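(* Let $q=e^{-r}$, $r>0$, and let $\pi$ be a random plane partition with $\mathrm{Prob}(\pi)\propto q^{|\pi|}$. Let $U=\{(t_i,h_i)\}_{i=1}^n\subset\mathbb{Z}\times\tfrac12\mathbb{Z}$ (depending on $r$) and suppose that as $r\to+0$, $$r t_i\to\tau\ge0,\qquad r h_i\to\chi,\qquad i=1,\dots,n,$$ in such a way that the differences $\Delta t_{ij}=t_i-t_j$ and $\Delta h_{ij}=h_i-h_j$ remain fixed. Then, as $r\to+0$, $$\mathrm{Prob}\{U\subset\widetilde{\mathfrak{S}}(\pi)\}\to\det\Big[\mathsf{B}_\pm\Big(\Delta t_{ij},\ \Delta h_{ij}+\frac{\Delta t_{ij}}{2};\ z_*\Big)\Big]_{i,j=1}^n,$$ where $z_*=z_*(\tau,\chi)$ is as in the context and the plus sign is chosen when $\Delta t_{ij}\ge0$ (minus sign otherwise).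
   Context: A plane partition is an array $\pi=(\pi_{ij})_{i,j\ge1}$ of nonnegative integers, nonincreasing in both $i$ and $j$, with finite volume $|\pi|=\sum\pi_{ij}$. Set $\widetilde{\mathfrak{S}}(\pi)=\{(j-i,\ \pi_{ij}-(i+j-1)/2):\ i,j\ge1\}$ (the centers of horizontal tiles of the associated rhombus tiling). The incomplete beta kernel is $$\mathsf{B}_\pm(k,l;z)=\frac1{2\pi i}\int_{\bar z}^{z}(1-w)^k\,w^{-l-1}\,dw,$$ where the path of integration crosses $(0,1)$ for the plus sign and $(-\infty,0)$ for the minus sign. The point $z_*$ is defined by: if the circles $\{|z|=e^{-\tau/2}\}$ and $\{|z-1|=e^{-\tau/4-\chi/2}\}$ intersect, $\{z_*,\bar z_*\}$ is their intersection with $\mathrm{Im}\,z_*\ge 0$; otherwise $z_*=e^{-\tau/2}$ if $e^{-\chi/2}<e^{\tau/4}-e^{-\tau/4}$ and $z_*=-e^{-\tau/2}$ if $e^{-\chi/2}>e^{\tau/4}+e^{-\tau/4}$.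
   Formalization: The points (t_i,h_i) are assumed to satisfy h_i + t_i/2 + 1/2 ∈ ℤ, as all tile centers do; for other points of ℤ×½ℤ the probability is identically 0 while the determinant need not vanish (n=1: arg(z_* )/π), or the kernel is multivalued. *)

theory Defs
  imports "HOL-Complex_Analysis.Complex_Analysis"
begin

text \<open>Rows and columns are numbered from 0: the entry \<open>p i j\<close> is $\pi_{i+1,j+1}$.\<close>

definition plane_partition :: "(nat \<Rightarrow> nat \<Rightarrow> nat) \<Rightarrow> bool" where
  "plane_partition p \<longleftrightarrow>
     (\<forall>i j. p (Suc i) j \<le> p i j) \<and> (\<forall>i j. p i (Suc j) \<le> p i j) \<and>
     finite {(i, j). p i j \<noteq> 0}"

definition volume :: "(nat \<Rightarrow> nat \<Rightarrow> nat) \<Rightarrow> nat" where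
  "volume p = (\<Sum>(i, j) | p i j \<noteq> 0. p i j)"

text \<open>With numbering from 0, the term $(i+j-1)/2$ becomes $(i+j+1)/2$.\<close>

definition tile_centers :: "(nat \<Rightarrow> nat \<Rightarrow> nat) \<Rightarrow> (int \<times> real) set" where
  "tile_centers p =
     {(int j - int i, real (p i j) - (real i + real j + 1) / 2) | i j. True}"

text \<open>
  The points of $\mathbb{Z}\times\frac12\mathbb{Z}$ that can be tile centers. For differences of
  such points the second argument of the kernel is an integer, so that its integrand is
  single-valued.
\<close>

definition tile_lattice :: "(int \<times> real) set" where
  "tile_lattice = {(t, h). h + of_int t / 2 + 1 / 2 \<in> \<int>}"

lemma tile_lattice_half_integer:
  assumes "(t, h) \<in> tile_lattice"
  shows "2 * h \<in> \<int>"
proof -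
  have "2 * (h + of_int t / 2 + 1 / 2) - of_int t - 1 \<in> \<int>"
    using assms unfolding tile_lattice_def by (intro Ints_diff Ints_mult) auto
  then show ?thesis by (simp add: algebra_simps)
qed

lemma tile_lattice_diff:
  assumes "(t, h) \<in> tile_lattice" "(t', h') \<in> tile_lattice"
  shows "(h - h') + of_int (t - t') / 2 \<in> \<int>"
proof -
  have "(h + of_int t / 2 + 1 / 2) - (h' + of_int t' / 2 + 1 / 2) \<in> \<int>"
    using assms unfolding tile_lattice_def by (intro Ints_diff) auto
  then show ?thesis by (simp add: algebra_simps diff_divide_distrib)
qed

lemma tile_centers_subset_lattice: "tile_centers p \<subseteq> tile_lattice"
proof -
  have "real (p i j) - (real i + real j + 1) / 2 + of_int (int j - int i) / 2 + 1 / 2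
      = of_int (int (p i j) - int i)" for i j
    by (simp add: field_simps)
  then show ?thesis
    unfolding tile_centers_def tile_lattice_def by (auto simp del: of_int_diff)
qed

text \<open>Probability of the event \<open>E\<close>; the denominator is finite for \<open>0 < q < 1\<close> (MacMahon).\<close>

definition pp_prob :: "real \<Rightarrow> ((nat \<Rightarrow> nat \<Rightarrow> nat) \<Rightarrow> bool) \<Rightarrow> real" where
  "pp_prob q E =
     (\<Sum>\<^sub>\<infinity>p | plane_partition p \<and> E p. q ^ volume p) /
     (\<Sum>\<^sub>\<infinity>p | plane_partition p. q ^ volume p)"

text \<open>
  A path from \<open>cnj z\<close> to \<open>z\<close> (where \<open>Im z \<ge> 0\<close>) that crosses the real axis once, upwards,
  at a point of \<open>I\<close>. If \<open>z\<close> is real this is a closed path based at \<open>z\<close>, which first runs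
  through the lower and then through the upper half-plane; this is the limit of the paths
  for nonreal \<open>z\<close>.
\<close>

definition crossing_path :: "real set \<Rightarrow> complex \<Rightarrow> (real \<Rightarrow> complex) \<Rightarrow> bool" where
  "crossing_path I z g \<longleftrightarrow>
     valid_path g \<and> pathstart g = cnj z \<and> pathfinish g = z \<and>
     (\<exists>s\<in>{0<..<1}. g s \<in> complex_of_real ` I \<and>
        (\<forall>u\<in>{0<..<s}. Im (g u) < 0) \<and> (\<forall>u\<in>{s<..<1}. Im (g u) > 0))"

definition inc_beta :: "real set \<Rightarrow> int \<Rightarrow> int \<Rightarrow> complex \<Rightarrow> complex" where
  "inc_beta I k l z =
     1 / (2 * of_real pi * \<i>) *
     contour_integral (SOME g. crossing_path I z g) (\<lambda>w. (1 - w) powi k * w powi (- l - 1))"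

text \<open>Such paths exist, and by Cauchy's theorem the choice of the path is immaterial.\<close>

lemma crossing_path_exists:
  assumes "Im z \<ge> 0" "c \<in> I"
  shows "\<exists>g. crossing_path I z g"
proof -
  let ?c = "complex_of_real c"
  define g1 where "g1 = linepath (cnj z) (?c - \<i>) +++ linepath (?c - \<i>) ?c"
  define g2 where "g2 = linepath ?c (?c + \<i>) +++ linepath (?c + \<i>) z"
  have v: "valid_path (g1 +++ g2)"
    unfolding g1_def g2_def by (intro valid_path_join) auto
  have lo: "Im (g1 u) < 0" if "0 < u" "u < 1" for u
  proof (cases "u \<le> 1/2")
    case True
    then have "Im (g1 u) = - ((1 - 2 * u) * Im z) - 2 * u"
      by (simp add: g1_def joinpaths_def linepath_def algebra_simps)
    moreover have "(1 - 2 * u) * Im z \<ge> 0" using True assms by simp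
    ultimately show ?thesis using that by linarith
  qed (use that in \<open>simp add: g1_def joinpaths_def linepath_def\<close>)
  have hi: "Im (g2 u) > 0" if "0 < u" "u < 1" for u
  proof (cases "u \<le> 1/2")
    case False
    then have "Im (g2 u) = (2 - 2 * u) + (2 * u - 1) * Im z"
      by (simp add: g2_def joinpaths_def linepath_def algebra_simps)
    moreover have "(2 * u - 1) * Im z \<ge> 0" using False assms by simp
    ultimately show ?thesis using that by linarith
  qed (use that in \<open>simp add: g2_def joinpaths_def linepath_def\<close>)
  have "crossing_path I z (g1 +++ g2)"
    unfolding crossing_path_def
  proof (intro conjI bexI[of _ "1/2"])
    show "(g1 +++ g2) (1/2) \<in> complex_of_real ` I"
      using assms by (simp add: joinpaths_def g1_def linepath_def)
    show "pathstart (g1 +++ g2) = cnj z" "pathfinish (g1 +++ g2) = z"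
      by (simp_all add: g1_def g2_def)
    show "\<forall>u\<in>{0<..<1/2}. Im ((g1 +++ g2) u) < 0"
      using lo by (simp add: joinpaths_def)
    show "\<forall>u\<in>{1/2<..<1}. Im ((g1 +++ g2) u) > 0"
      using hi by (simp add: joinpaths_def)
  qed (use v in auto)
  then show ?thesis by blast
qed

lemma primitive_lower_half_plane:
  "\<exists>F. \<forall>w. Im w \<le> 0 \<longrightarrow> w \<noteq> 0 \<longrightarrow> w \<noteq> 1 \<longrightarrow>
     (F has_field_derivative (1 - w) powi k * w powi m) (at w)"
proof -
  define R :: "complex \<Rightarrow> complex set"
    where "R = (\<lambda>d. {w. Im (w * cnj d) = 0 \<and> Re (w * cnj d) \<ge> 0})"
  define b :: complex where "b = Complex (1/2) (-1)"
  define D where "D = {w. w \<notin> R (- b) \<and> w - 1 \<notin> R (1 - b)}"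
  have "closed {w. w \<in> R (- b)}" "closed {w. w - 1 \<in> R (1 - b)}"
    unfolding R_def mem_Collect_eq
    by (intro closed_Collect_conj closed_Collect_eq closed_Collect_le continuous_intros)+
  then have "open (- {w. w \<in> R (- b)} \<inter> - {w. w - 1 \<in> R (1 - b)})"
    by (intro open_Int) (auto simp: open_Compl)
  moreover have "- {w. w \<in> R (- b)} \<inter> - {w. w - 1 \<in> R (1 - b)} = D"
    by (auto simp: D_def)
  ultimately have "open D" by simp
  have ray: "w \<in> R d" if "(1 - u) *\<^sub>R (- d) + u *\<^sub>R w \<in> R d" "0 \<le> u" "u \<le> 1" "d \<noteq> 0" for u w d
  proof -
    have e: "((1 - u) *\<^sub>R (- d) + u *\<^sub>R w) * cnj d =
        of_real u * (w * cnj d) - of_real ((1 - u) * (cmod d)\<^sup>2)"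
    proof -
      have "((1 - u) *\<^sub>R (- d) + u *\<^sub>R w) * cnj d =
          of_real u * (w * cnj d) - of_real (1 - u) * (d * cnj d)"
        by (simp add: algebra_simps scaleR_conv_of_real)
      also have "d * cnj d = of_real ((cmod d)\<^sup>2)"
        by (rule complex_norm_square[symmetric])
      finally show ?thesis by simp
    qed
    have d: "(cmod d)\<^sup>2 > 0" using that by simp
    have 1: "u * Im (w * cnj d) = 0" and 2: "u * Re (w * cnj d) \<ge> (1 - u) * (cmod d)\<^sup>2"
      using that(1) unfolding R_def mem_Collect_eq e by simp_all
    have "u \<noteq> 0" using 2 d by auto
    moreover have "u * Re (w * cnj d) \<ge> 0"
      using 2 d that by (meson diff_ge_0_iff_ge less_imp_le mult_nonneg_nonneg order_trans)
    ultimately show ?thesis using 1 that unfolding R_def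
      by (auto simp: zero_le_mult_iff)
  qed
  have bD: "b \<noteq> 0" "1 - b \<noteq> 0" by (auto simp: b_def complex_eq_iff)
  have "starlike D"
    unfolding starlike_def
  proof (intro bexI[of _ b] ballI subsetI)
    show "b \<in> D" by (auto simp: D_def R_def b_def)
  next
    fix w x assume w: "w \<in> D" and "x \<in> closed_segment b w"
    then obtain u where u: "x = (1 - u) *\<^sub>R b + u *\<^sub>R w" "0 \<le> u" "u \<le> 1"
      by (auto simp: closed_segment_def)
    have x1: "x - 1 = (1 - u) *\<^sub>R (- (1 - b)) + u *\<^sub>R (w - 1)"
      by (simp add: u(1) algebra_simps scaleR_conv_of_real)
    show "x \<in> D"
      using ray[of u "- b" w] ray[of u "1 - b" "w - 1"] u w bD x1 by (auto simp: D_def)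
  qed
  have nz: "w \<noteq> 0" "w \<noteq> 1" if "w \<in> D" for w
    using that by (auto simp: D_def R_def)
  have hol: "(\<lambda>w. (1 - w) powi k * w powi m) holomorphic_on D"
    by (intro holomorphic_intros) (use nz in auto)
  have "\<exists>F. \<forall>w\<in>D. (F has_field_derivative (1 - w) powi k * w powi m) (at w)"
    by (rule holomorphic_starlike_primitive[OF holomorphic_on_imp_continuous_on[OF hol]
          \<open>starlike D\<close> \<open>open D\<close> finite.emptyI])
      (simp add: holomorphic_on_imp_differentiable_at[OF hol \<open>open D\<close>])
  then obtain F where
    F: "\<And>w. w \<in> D \<Longrightarrow> (F has_field_derivative (1 - w) powi k * w powi m) (at w)"
    by blast
  have "w \<in> D" if "Im w \<le> 0" "w \<noteq> 0" "w \<noteq> 1" for w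
    using that by (auto simp: D_def R_def b_def complex_eq_iff field_simps)
  then show ?thesis using F by blast
qed

lemma inc_beta_eq:
  assumes I: "I = {0<..<1} \<or> I = {..<0}" and z: "Im z \<ge> 0" "z \<noteq> 0" "z \<noteq> 1"
    and g: "crossing_path I z g"
  shows "inc_beta I k l z =
    1 / (2 * of_real pi * \<i>) * contour_integral g (\<lambda>w. (1 - w) powi k * w powi (- l - 1))"
proof -
  let ?f = "\<lambda>w :: complex. (1 - w) powi k * w powi (- l - 1)"
  obtain F where F: "\<And>w. Im w \<le> 0 \<Longrightarrow> w \<noteq> 0 \<Longrightarrow> w \<noteq> 1 \<Longrightarrow>
      (F has_field_derivative ?f w) (at w)"
    using primitive_lower_half_plane[of k "- l - 1"] by blast
  define G where "G = cnj \<circ> F \<circ> cnj"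
  have G: "(G has_field_derivative ?f w) (at w)" if "Im w \<ge> 0" "w \<noteq> 0" "w \<noteq> 1" for w
  proof -
    have "(F has_field_derivative ?f (cnj w)) (at (cnj w))"
      using that by (intro F) (auto simp: complex_eq_iff)
    then show ?thesis
      using has_field_derivative_cnj_cnj[of F "?f (cnj w)" w]
      by (simp add: G_def)
  qed
  have cv: "convex (complex_of_real ` I)"
    using I by (intro convex_linear_image) (auto intro: linear_of_real)
  have I01: "c \<noteq> 0 \<and> c \<noteq> 1" if "c \<in> I" for c using that I by auto
  have "\<exists>C. \<forall>w\<in>complex_of_real ` I. F w - G w = C"
  proof (rule has_field_derivative_zero_constant[OF cv])
    fix w assume "w \<in> complex_of_real ` I"
    then have "Im w = 0" "w \<noteq> 0" "w \<noteq> 1" using I01 by auto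
    then show "((\<lambda>w. F w - G w) has_field_derivative 0) (at w within complex_of_real ` I)"
      using DERIV_diff[OF F[of w] G[of w]] by (auto intro: has_field_derivative_at_within)
  qed
  then obtain C where C: "\<And>w. w \<in> complex_of_real ` I \<Longrightarrow> F w - G w = C" by blast
  have *: "contour_integral g ?f = C + G z - F (cnj z)" if cg: "crossing_path I z g" for g
  proof -
    obtain s where s: "0 < s" "s < 1" "g s \<in> complex_of_real ` I"
      "\<And>u. 0 < u \<Longrightarrow> u < s \<Longrightarrow> Im (g u) < 0" "\<And>u. s < u \<Longrightarrow> u < 1 \<Longrightarrow> Im (g u) > 0"
      and vg: "valid_path g" and ends: "g 0 = cnj z" "g 1 = z"
      using cg by (auto simp: crossing_path_def pathstart_def pathfinish_def)
    have gs: "Im (g s) = 0" "g s \<noteq> 0" "g s \<noteq> 1" using s(3) I01 by auto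
    have cz: "cnj z \<noteq> 0" "cnj z \<noteq> 1" using z by (auto simp: complex_eq_iff)
    have lo: "Im (g u) \<le> 0 \<and> g u \<noteq> 0 \<and> g u \<noteq> 1" if "0 \<le> u" "u \<le> s" for u
      using that s(4)[of u] gs ends z cz
      by (cases "u = 0"; cases "u = s") (auto simp: less_le)
    have hi: "Im (g u) \<ge> 0 \<and> g u \<noteq> 0 \<and> g u \<noteq> 1" if "s \<le> u" "u \<le> 1" for u
      using that s(5)[of u] gs ends z
      by (cases "u = 1"; cases "u = s") (auto simp: less_le)
    have v1: "valid_path (subpath 0 s g)" and v2: "valid_path (subpath s 1 g)"
      using vg s by (auto intro!: valid_path_subpath)
    have "(?f has_contour_integral F (pathfinish (subpath 0 s g)) - F (pathstart (subpath 0 s g)))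
        (subpath 0 s g)"
    proof (rule contour_integral_primitive[where S = "g ` {0..s}"])
      show "(F has_field_derivative ?f w) (at w within g ` {0..s})" if w: "w \<in> g ` {0..s}" for w
      proof -
        obtain u where "u \<in> {0..s}" "w = g u" using w by blast
        then show ?thesis using F[of w] lo[of u] by (simp add: has_field_derivative_at_within)
      qed
    qed (use v1 s in \<open>simp_all add: path_image_subpath\<close>)
    then have i1: "contour_integral (subpath 0 s g) ?f = F (g s) - F (cnj z)"
      using ends by (simp add: contour_integral_unique)
    have "(?f has_contour_integral G (pathfinish (subpath s 1 g)) - G (pathstart (subpath s 1 g)))
        (subpath s 1 g)"
    proof (rule contour_integral_primitive[where S = "g ` {s..1}"])
      show "(G has_field_derivative ?f w) (at w within g ` {s..1})" if w: "w \<in> g ` {s..1}" for w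
      proof -
        obtain u where "u \<in> {s..1}" "w = g u" using w by blast
        then show ?thesis using G[of w] hi[of u] by (simp add: has_field_derivative_at_within)
      qed
    qed (use v2 s in \<open>simp_all add: path_image_subpath\<close>)
    then have i2: "contour_integral (subpath s 1 g) ?f = G z - G (g s)"
      using ends by (simp add: contour_integral_unique)
    have nz: "g u \<noteq> 0 \<and> g u \<noteq> 1" if "0 \<le> u" "u \<le> 1" for u
      using lo[of u] hi[of u] that by linarith
    have "?f holomorphic_on - {0, 1}"
      by (intro holomorphic_intros) auto
    then have "?f contour_integrable_on g"
      using nz vg by (intro contour_integrable_holomorphic_simple[where S = "- {0, 1}"])
        (auto simp: path_image_def open_Compl)
    then have "contour_integral g ?f
        = contour_integral (subpath 0 s g) ?f + contour_integral (subpath s 1 g) ?f"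
      using contour_integral_subpath_combine[of ?f g 0 s 1] vg s by simp
    then show ?thesis using i1 i2 C[OF s(3)] by (simp add: algebra_simps)
  qed
  have "crossing_path I z (SOME g. crossing_path I z g)"
    using someI[of "crossing_path I z" g] g by blast
  then show ?thesis unfolding inc_beta_def using *[OF g] by (simp add: *)
qed

definition beta_plus :: "int \<Rightarrow> int \<Rightarrow> complex \<Rightarrow> complex" where
  "beta_plus = inc_beta {0<..<1}"

definition beta_minus :: "int \<Rightarrow> int \<Rightarrow> complex \<Rightarrow> complex" where
  "beta_minus = inc_beta {..<0}"

definition z_star :: "real \<Rightarrow> real \<Rightarrow> complex" where
  "z_star tau chi =
     (let C = sphere 0 (exp (- tau / 2)) \<inter> sphere 1 (exp (- tau / 4 - chi / 2)) in
      if C \<noteq> {} then (THE z. C = {z, cnj z} \<and> Im z \<ge> 0)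
      else if exp (- chi / 2) < exp (tau / 4) - exp (- tau / 4) then of_real (exp (- tau / 2))
      else if exp (- chi / 2) > exp (tau / 4) + exp (- tau / 4) then - of_real (exp (- tau / 2))
      else undefined)"

end

theory Submission
  imports Defs "Jordan_Normal_Form.Determinant"
begin

text \<open>
  A plane partition confined to an \<open>A \<times> B\<close> base is a sequence of interlacing diagonal slices, so
  its tile centers form a determinantal process (Cauchy-Binet and a Sylvester-type identity, as in
  the Eynard-Mehta theorem). The kernel is half of a pairing of the Laurent coefficients of \<open>1/J\<close>
  at one slice with those of \<open>J\<close> at the other, and letting the base grow gives the probability.

  On the circle of radius \<open>q^(t/2)\<close> the symbol \<open>J\<close> is, up to a gauge that cancels in the determinant,
  a unimodular function whose phase derivative is even, monotone on \<open>[0, pi]\<close> and of order \<open>1/r\<close>; it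
  changes sign at the angle of \<open>z_star\<close>. Integration by parts and Bessel's inequality show that the half
  of the spectrum which the pairing keeps only sees the arc on one side of this angle, and there the
  oscillating factors cancel. What remains is the integral of the incomplete beta kernel.
\<close>

text \<open>The event that all prescribed sites are occupied is isolated by giving each of them the
  weight \<open>1 + f\<close>: all sums stay nonnegative, \<open>f = 0\<close> yields the partition
  function, and after division by \<open>f ^ m\<close> the limit of large \<open>f\<close> leaves
  the event alone. The base is \<open>A\<close> by \<open>A + d\<close> with \<open>d\<close> close
  to the slice index, so that \<open>J\<close> has almost as many numerator as denominator factors;
  paired, they form Blaschke factors, and the surplus factors tend to 1. The phase rate of a
  Blaschke factor with node \<open>exp (- y)\<close> is the \<open>y\<close>-derivative of
  \<open>ln (poisson_den (exp (- y)) th)\<close>, so the total rate is a Riemann sum that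
  telescopes, and stationarity reads |1 - c e^(i th)|^2 = exp (- chi - \<tau>/2) with c = exp (-
  \<tau>/2): this is the second circle in the definition of \<open>z_star\<close>. Near the critical
  angle Bessel's inequality bounds a short arc by the square root of its length. The obstacle is
  \<tau> = 0 with a negative time difference: the limiting amplitude then has a pole at the point 1
  of the circle.\<close>

hide_const (open) Determinant.det

section \<open>Determinants of matrices given by functions on the natural numbers\<close>

text \<open>The size is a term, so it may depend on the base and on the number of particles;
  \<open>detn_eq_det\<close> translates to determinants over a finite type at the very end.\<close>

definition detn :: "nat => (nat => nat => 'a) => 'a :: comm_ring_1" where
 "detn n A=Determinant.det (Matrix.mat n n (%(i,j). A i j))"

lemma detn_sum_permutations:
 "detn n A=(\<Sum>p | p permutes {0..<n}. of_int (sign p)*(\<Prod>i=0..<n. A i (p i)))"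
proof -
 have "detn n A=(\<Sum>p | p permutes {0..<n}. of_int (sign p) *
 (\<Prod>i=0..<n. Matrix.mat n n (%(i,j). A i j) $$ (i,p i)))"
 unfolding detn_def by (subst det_def') auto
 also have "... = (\<Sum>p | p permutes {0..<n}. of_int (sign p)*(\<Prod>i=0..<n. A i (p i)))"
 proof (rule sum.cong[OF refl],rule arg_cong[of _ _ "%x. _ * x"],rule prod.cong[OF refl])
 fix p i assume "p \<in> {p. p permutes {0..<n}}" "i \<in> {0..<n}"
 thus "Matrix.mat n n (%(i,j). A i j) $$ (i,p i)=A i (p i)"
 using permutes_in_image[of p "{0..<n}" i] by auto
 qed
 finally show ?thesis .
qed

lemma detn_cong:
 assumes "\<And>i j. i < n ==> j < n ==> A i j=B i j"
 shows "detn n A=detn n B"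
proof -
 have "Matrix.mat n n (%(i,j). A i j)=Matrix.mat n n (%(i,j). B i j)"
 by (rule eq_matI) (simp_all add: assms)
 thus ?thesis by (simp add: detn_def)
qed

lemma detn_transpose: "detn n (%i j. A j i)=detn n A"
proof -
 have "Matrix.mat n n (%(i,j). A j i)=transpose_mat (Matrix.mat n n (%(i,j). A i j))"
 by auto
 thus ?thesis unfolding detn_def by (metis det_transpose mat_carrier)
qed

lemma detn_mult:
 "detn n (%i j. \<Sum>k<n. A i k * B k j)=detn n A * detn n B"
proof -
 have "Matrix.mat n n (%(i,j). \<Sum>k<n. A i k * B k j)
 = Matrix.mat n n (%(i,j). A i j) * Matrix.mat n n (%(i,j). B i j)"
 by (auto simp: scalar_prod_def atLeast0LessThan)
 thus ?thesis unfolding detn_def by (simp add: det_mult[where n=n])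
qed

lemma detn_permute_rows:
 assumes "p permutes {0..<n}"
 shows "detn n (%i j. A (p i) j) = of_int (sign p) * detn n A"
proof -
 have "Matrix.mat n n (%(i,j). A (p i) j)
 = Matrix.mat n n (%(i,j). Matrix.mat n n (%(i,j). A i j) $$ (p i,j))"
 proof (rule eq_matI)
 fix i j assume "i < dim_row (Matrix.mat n n (%(i,j). Matrix.mat n n (%(i,j). A i j) $$ (p i,j)))"
 "j < dim_col (Matrix.mat n n (%(i,j). Matrix.mat n n (%(i,j). A i j) $$ (p i,j)))"
 hence ij: "i < n" "j < n" by simp_all
 hence "p i < n" using permutes_in_image[OF assms,of i] by simp
 thus "Matrix.mat n n (%(i,j). A (p i) j) $$ (i,j)
 = Matrix.mat n n (%(i,j). Matrix.mat n n (%(i,j). A i j) $$ (p i,j)) $$ (i,j)"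
 using ij by simp
 qed simp_all
 also have "Determinant.det ... = of_int (sign p) * Determinant.det (Matrix.mat n n (%(i,j). A i j))"
 by (rule det_permute_rows[OF mat_carrier assms])
 finally show ?thesis by (simp only: detn_def)
qed

lemma detn_identical_rows:
 assumes "i ~= j" "i < n" "j < n" "\<And>k. k < n ==> A i k=A j k"
 shows "detn n A=0"
proof -
 have "row (Matrix.mat n n (%(i,j). A i j)) i=row (Matrix.mat n n (%(i,j). A i j)) j"
 by (rule eq_vecI) (simp_all add: assms(2-4))
 thus ?thesis
 unfolding detn_def by (rule det_identical_rows[OF mat_carrier assms(1-3)])
qed

lemma detn_upper_unitriangular:
 assumes "\<And>i j. j < i ==> i < n ==> A i j=0" "\<And>i. i < n ==> A i i=1"
 shows "detn n A=1"
proof -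
 have "upper_triangular (Matrix.mat n n (%(i,j). A i j))" using assms by auto
 hence "detn n A=prod_list (diag_mat (Matrix.mat n n (%(i,j). A i j)))"
 unfolding detn_def by (rule det_upper_triangular) auto
 also have "diag_mat (Matrix.mat n n (%(i,j). A i j))=map (%_. 1) [0..<n]"
 unfolding diag_mat_def using assms by (intro map_cong) auto
 also have "prod_list (map (%_. 1 :: 'a) [0..<n])=1" by (induction n) auto
 finally show ?thesis .
qed

text \<open>A permutation preserves the sum of \<open>lev\<close>, whereas every index moved by a
  nonzero term raises it, so only the identity contributes. This is unitriangularity for an order
  that may have ties, as needed for several points on one slice.\<close>

lemma detn_strictly_increasing_perturbation:
 fixes lev :: "nat => int"
 assumes "\<And>i j. i < n ==> j < n ==> i ~= j ==> A i j ~= 0 ==> lev i < lev j"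
 and "\<And>i. i < n ==> A i i=1"
 shows "detn n A=1"
proof -
 have z: "(\<Prod>i=0..<n. A i (p i))=0" if p: "p permutes {0..<n}" and "p ~= id" for p
 proof (rule ccontr)
 assume nz: "(\<Prod>i=0..<n. A i (p i)) ~= 0"
 have A: "A i (p i) ~= 0" if "i < n" for i
 proof
 assume "A i (p i)=0"
 hence "(\<Prod>i=0..<n. A i (p i))=0"
 using that by (intro prod_zero) auto
 thus False using nz by simp
 qed
 have le: "lev i < lev (p i)" if "i < n" "p i ~= i" for i
 using assms(1)[of i "p i"] A[of i] that permutes_in_image[OF p,of i] by auto
 obtain i where i: "p i ~= i" using \<open>p ~= id\<close> by (auto simp: fun_eq_iff)
 hence "i < n" using permutes_not_in[OF p,of i] by auto
 hence "(\<Sum>i=0..<n. lev i) < (\<Sum>i=0..<n. lev (p i))"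
 proof (intro sum_strict_mono_ex1)
 show "\<forall>x\<in>{0..<n}. lev x<=lev (p x)"
 proof
 fix x assume "x \<in> {0..<n}"
 thus "lev x<=lev (p x)" using le[of x] by (cases "p x=x") auto
 qed
 show "\<exists>a\<in>{0..<n}. lev a < lev (p a)"
 using le[of i] i \<open>i < n\<close> by (intro bexI[of _ i]) auto
 qed simp
 also have "... = (\<Sum>i=0..<n. lev i)"
 using sum.permute[OF p,of lev] by (simp add: o_def)
 finally show False by simp
 qed
 have "detn n A=(\<Sum>p\<in>{id}. of_int (sign p)*(\<Prod>i=0..<n. A i (p i)))"
 unfolding detn_sum_permutations
 by (rule sum.mono_neutral_right) (use z in \<open>auto simp: finite_permutations permutes_id\<close>)
 thus ?thesis using assms(2) by (simp add: sign_id)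
qed

text \<open>The block matrix with rows (1, -X) and (Y, 1) becomes block triangular when multiplied
  by the unipotent matrix with rows (1, X) and (0, 1), from the left as well as from the right; the
  two products have the two determinants in question.\<close>

lemma detn_sylvester:
 fixes X Y :: "nat => nat => 'a :: idom"
 shows "detn n (%i j. (if i=j then 1 else 0)+(\<Sum>u<m. X i u * Y u j)) =
 detn m (%u v. (if u=v then 1 else 0)+(\<Sum>i<n. Y u i * X i v))"
proof -
 define XM where "XM=Matrix.mat n m (%(i,j). X i j)"
 define YM where "YM=Matrix.mat m n (%(i,j). Y i j)"
 have [simp]: "XM \<in> carrier_mat n m" "YM \<in> carrier_mat m n" by (auto simp: XM_def YM_def)
 have dims [simp]: "dim_row XM=n" "dim_col XM=m" "dim_row YM=m" "dim_col YM=n"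
 by (auto simp: XM_def YM_def)
 let ?M = "four_block_mat (1\<^sub>m n) (- XM) YM (1\<^sub>m m)"
 let ?P = "four_block_mat (1\<^sub>m n) XM (0\<^sub>m m n) (1\<^sub>m m)"
 have [simp]: "?M \<in> carrier_mat (n+m) (n+m)" "?P \<in> carrier_mat (n+m) (n+m)" by auto
 have P: "Determinant.det ?P=1"
 by (subst det_four_block_mat_lower_left_zero[of _ n _ m]) auto
 have 1: "?P * ?M=four_block_mat (1\<^sub>m n+XM * YM) (0\<^sub>m n m) YM (1\<^sub>m m)"
 proof -
 have "1\<^sub>m n*1\<^sub>m n+XM * YM=1\<^sub>m n+XM * YM" "1\<^sub>m n * - XM+XM*1\<^sub>m m=0\<^sub>m n m"
 "0\<^sub>m m n*1\<^sub>m n+1\<^sub>m m * YM=YM" "0\<^sub>m m n * - XM+1\<^sub>m m*1\<^sub>m m=1\<^sub>m m"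
 by (rule eq_matI; simp)+
 thus ?thesis
 by (subst mult_four_block_mat[of _ n n _ m _ m _ _ n _ m]) auto
 qed
 have 2: "?M * ?P=four_block_mat (1\<^sub>m n) (0\<^sub>m n m) YM (YM * XM+1\<^sub>m m)"
 proof -
 have "1\<^sub>m n*1\<^sub>m n + - XM*0\<^sub>m m n=1\<^sub>m n" "1\<^sub>m n * XM + - XM*1\<^sub>m m=0\<^sub>m n m"
 "YM*1\<^sub>m n+1\<^sub>m m*0\<^sub>m m n=YM" "YM * XM+1\<^sub>m m*1\<^sub>m m=YM * XM+1\<^sub>m m"
 by (rule eq_matI; simp)+
 thus ?thesis
 by (subst mult_four_block_mat[of _ n n _ m _ m _ _ n _ m]) auto
 qed
 have "Determinant.det (1\<^sub>m n+XM * YM)=Determinant.det (?P * ?M)"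
 unfolding 1 by (subst det_four_block_mat_upper_right_zero[of _ n _ m]) auto
 also have "... = Determinant.det ?M"
 by (subst det_mult[of _ "n+m"]) (auto simp: P)
 also have "... = Determinant.det (?M * ?P)"
 by (subst det_mult[of _ "n+m"]) (auto simp: P)
 also have "... = Determinant.det (YM * XM+1\<^sub>m m)"
 unfolding 2 by (subst det_four_block_mat_upper_right_zero[of _ n _ m]) auto
 finally have "Determinant.det (1\<^sub>m n+XM * YM)=Determinant.det (YM * XM+1\<^sub>m m)" .
 moreover have "1\<^sub>m n+XM * YM
 = Matrix.mat n n (%(i,j). (if i=j then 1 else 0)+(\<Sum>u<m. X i u * Y u j))"
 by (auto simp: XM_def YM_def scalar_prod_def atLeast0LessThan)
 moreover have "YM * XM+1\<^sub>m m
 = Matrix.mat m m (%(u,v). (if u=v then 1 else 0)+(\<Sum>i<n. Y u i * X i v))"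
 by (auto simp: XM_def YM_def scalar_prod_def atLeast0LessThan)
 ultimately show ?thesis by (simp add: detn_def)
qed

lemma tendsto_detn:
 fixes A :: "'b => nat => nat => 'a :: {real_normed_field}"
 assumes "\<And>i j. i < n ==> j < n ==> ((%x. A x i j) \<longlongrightarrow> B i j) F"
 shows "((%x. detn n (A x)) \<longlongrightarrow> detn n B) F"
 unfolding detn_sum_permutations
proof (intro tendsto_sum tendsto_mult tendsto_const tendsto_prod)
 fix p i assume "p \<in> {p. p permutes {0..<n}}" "i \<in> {0..<n}"
 thus "((%x. A x i (p i)) \<longlongrightarrow> B i (p i)) F"
 using permutes_in_image[of p "{0..<n}" i] by (intro assms) auto
qed

text \<open>Transport along \<open>e\<close> identifies the permutations of the index type with
  those of an initial segment and preserves signs.\<close>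

lemma detn_eq_det:
 fixes M :: "'n::finite => 'n => 'a :: comm_ring_1"
 assumes e: "bij_betw e {0..<m} (UNIV :: 'n set)"
 shows "detn m (%i j. M (e i) (e j))=Determinants.det (\<chi> i j. M i j)"
proof -
 have inj: "inj_on e {0..<m}" and im: "e ` {0..<m}=UNIV" using e by (auto simp: bij_betw_def)
 let ?mp = "map_permutation {0..<m} e"
 have bij: "bij_betw ?mp {p. p permutes {0..<m}} {p. p permutes (UNIV :: 'n set)}"
 proof (rule bij_betw_byWitness[where f' = "map_permutation UNIV (inv_into {0..<m} e)"])
 show "\<forall>p\<in>{p. p permutes {0..<m}}. map_permutation UNIV (inv_into {0..<m} e) (?mp p)=p"
 proof safe
 fix p assume "p permutes {0..<m}"
 thus "map_permutation UNIV (inv_into {0..<m} e) (?mp p)=p"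
 by (intro map_permutation_compose_inv) (use e inj in auto)
 qed
 show "\<forall>p\<in>{p. p permutes UNIV}. ?mp (map_permutation UNIV (inv_into {0..<m} e) p)=p"
 proof safe
 fix p :: "'n => 'n" assume "p permutes UNIV"
 thus "?mp (map_permutation UNIV (inv_into {0..<m} e) p)=p"
 by (intro map_permutation_compose_inv)
 (use e im in \<open>auto intro: bij_betw_inv_into f_inv_into_f\<close>)
 qed
 show "?mp ` {p. p permutes {0..<m}} \<subseteq> {p. p permutes UNIV}"
 using e by (auto intro!: map_permutation_permutes)
 show "map_permutation UNIV (inv_into {0..<m} e) ` {p. p permutes UNIV} \<subseteq> {p. p permutes {0..<m}}"
 using e by (auto intro!: map_permutation_permutes bij_betw_inv_into)
 qed
 have "Determinants.det (\<chi> i j. M i j)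
 = (\<Sum>p | p permutes UNIV. of_int (sign p)*(\<Prod>i\<in>UNIV. M i (p i)))"
 by (simp add: Determinants.det_def)
 also have "... = (\<Sum>p | p permutes {0..<m}. of_int (sign (?mp p))*(\<Prod>i\<in>UNIV. M i (?mp p i)))"
 by (rule sum.reindex_bij_betw[OF bij,symmetric])
 also have "... = (\<Sum>p | p permutes {0..<m}. of_int (sign p)*(\<Prod>i=0..<m. M (e i) (e (p i))))"
 proof (rule sum.cong[OF refl])
 fix p assume "p \<in> {p. p permutes {0..<m}}"
 hence p: "p permutes {0..<m}" by simp
 have "(\<Prod>i\<in>UNIV. M i (?mp p i))=(\<Prod>i=0..<m. M (e i) (?mp p (e i)))"
 by (rule prod.reindex_bij_betw[OF e,symmetric])
 also have "... = (\<Prod>i=0..<m. M (e i) (e (p i)))"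
 by (intro prod.cong refl) (simp add: map_permutation_apply[OF inj])
 finally show "of_int (sign (?mp p))*(\<Prod>i\<in>UNIV. M i (?mp p i))
 = of_int (sign p)*(\<Prod>i=0..<m. M (e i) (e (p i)))"
 using sign_map_permutation[OF inj p] by simp
 qed
 finally show ?thesis by (simp add: detn_sum_permutations)
qed

text \<open>Pigeonhole: the \<open>n - k\<close> rows from \<open>k\<close> on have only
  \<open>n - k - 1\<close> columns for nonzero entries, so every permutation meets a zero.\<close>

lemma detn_zero_block:
 assumes k: "k < n" and z: "\<And>i j. k<=i ==> i < n ==> j<=k ==> A i j=0"
 shows "detn n A=0"
 unfolding detn_sum_permutations
proof (rule sum.neutral,rule ballI)
 fix p assume "p \<in> {p. p permutes {0..<n}}"
 hence p: "p permutes {0..<n}" by simp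
 have "\<exists>i\<in>{k..<n}. p i<=k"
 proof (rule ccontr)
 assume "~ ?thesis"
 hence "p ` {k..<n} \<subseteq> {Suc k..<n}"
 using permutes_in_image[OF p] by (auto simp: not_le Suc_le_eq)
 hence "card (p ` {k..<n})<=card {Suc k..<n}" by (intro card_mono) auto
 moreover have "card (p ` {k..<n})=card {k..<n}"
 by (rule card_image) (use permutes_inj[OF p] in \<open>auto intro: inj_on_subset\<close>)
 ultimately show False using k by simp
 qed
 then obtain i where "k<=i" "i < n" "p i<=k" by auto
 hence "(\<Prod>i=0..<n. A i (p i))=0" by (intro prod_zero bexI[of _ i]) (auto intro: z)
 thus "of_int (sign p)*(\<Prod>i=0..<n. A i (p i))=0" by simp
qed

text \<open>Interlacing means x 0 >= y 0 > x 1 >= y 1 > ..., and then the matrix is upper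
  unitriangular. A failure \<open>x k < y k\<close> produces a zero block; if only strict
  inequalities fail, the first failure makes two neighbouring rows equal.\<close>

lemma detn_interlacing:
 fixes x y :: "nat => 'b :: linorder"
 assumes x: "\<And>i j. i < j ==> j < n ==> x j < x i" and y: "\<And>i j. i < j ==> j < n ==> y j < y i"
 shows "detn n (%i j. if y j<=x i then 1 else 0 :: 'a :: comm_ring_1) =
 (if (\<forall>i<n. y i<=x i) & (\<forall>i. Suc i < n --> x (Suc i) < y i) then 1 else 0)"
proof -
 let ?A = "%i j. if y j<=x i then 1 else 0 :: 'a"
 have xm: "x j<=x i" if "i<=j" "j < n" for i j
 using x[of i j] that by (cases "i=j") auto
 have ym: "y j<=y i" if "i<=j" "j < n" for i j
 using y[of i j] that by (cases "i=j") auto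
 consider (ok) "\<forall>i<n. y i<=x i" "\<forall>i. Suc i < n --> x (Suc i) < y i"
 | (a) k where "k < n" "x k < y k"
 | (b) "\<forall>i<n. y i<=x i" "\<exists>i. Suc i < n & y i<=x (Suc i)"
 by (meson linorder_not_le)
 thus ?thesis
 proof cases
 case ok
 have "detn n ?A=1"
 proof (rule detn_upper_unitriangular)
 fix i j assume ij: "j < i" "i < n"
 hence "x (Suc j) < y j" using ok(2) by simp
 moreover have "x i<=x (Suc j)" using ij by (intro xm) auto
 ultimately show "?A i j=0" by auto
 qed (use ok in auto)
 thus ?thesis using ok by simp
 next
 case (a k)
 have "detn n ?A=0"
 proof (rule detn_zero_block[OF a(1)])
 fix i j assume "k<=i" "i < n" "j<=k"
 hence "x i<=x k" "y k<=y j" using a by (auto intro: xm ym)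
 thus "?A i j=0" using a by auto
 qed
 moreover have "~ (\<forall>i<n. y i<=x i)" using a by auto
 ultimately show ?thesis by simp
 next
 case b
 define k where "k=(LEAST i. Suc i < n & y i<=x (Suc i))"
 have k: "Suc k < n" "y k<=x (Suc k)"
 using LeastI_ex[OF b(2)] by (auto simp: k_def)
 have kl: "x (Suc j) < y j" if "j < k" for j
 proof -
 have "~ (Suc j < n & y j<=x (Suc j))" using not_less_Least that unfolding k_def by blast
 thus ?thesis using that k by auto
 qed
 have "detn n ?A=0"
 proof (rule detn_identical_rows[of k "Suc k"])
 fix j assume j: "j < n"
 show "?A k j = ?A (Suc k) j"
 proof (cases "j < k")
 case True
 hence "x k<=x (Suc j)" "x (Suc k)<=x (Suc j)" using k by (auto intro!: xm)
 thus ?thesis using kl[OF True] by auto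
 next
 case False
 hence "y j<=y k" using j by (auto intro: ym)
 moreover have "y k<=x k" using b k by auto
 ultimately show ?thesis using k by auto
 qed
 qed (use k in auto)
 moreover have "~ (\<forall>i. Suc i < n --> x (Suc i) < y i)" using b(2) by (auto simp: not_less)
 ultimately show ?thesis by simp
 qed
qed

section \<open>Decreasing tuples and the Cauchy-Binet formula\<close>

text \<open>These tuples encode the \<open>n\<close>-element subsets of \<open>{..<L}\<close>; the
  value 0 beyond \<open>n\<close> makes the encoding unique as a function.\<close>

definition dec_tuples :: "nat => nat => (nat => nat) set" where
 "dec_tuples n L = {g. (\<forall>i j. i < j --> j < n --> g j < g i) & (\<forall>i<n. g i < L) & (\<forall>i\<ge>n. g i=0)}"

lemma finite_dec_tuples: "finite (dec_tuples n L)"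
proof -
 have "dec_tuples n L \<subseteq> {g. \<forall>i. (i \<in> {..<n} --> g i \<in> {..<L}) & (i \<notin> {..<n} --> g i=0)}"
 by (auto simp: dec_tuples_def)
 thus ?thesis by (rule finite_subset) (rule finite_set_of_finite_funs; simp)
qed

lemma dec_tuples_sorted_list:
 assumes "g \<in> dec_tuples n L"
 shows "map g [0..<n]=rev (sorted_list_of_set (g ` {0..<n}))"
proof -
 have "sorted_wrt (%a b. b < a) (map g [0..<n])"
 using assms by (auto simp: sorted_wrt_iff_nth_less dec_tuples_def)
 hence "sorted_wrt (<) (rev (map g [0..<n]))" by (simp add: sorted_wrt_rev)
 hence "rev (map g [0..<n])=sorted_list_of_set (set (rev (map g [0..<n])))"
 by (intro sorted_distinct_set_unique) (auto simp: strict_sorted_iff)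
 hence "rev (map g [0..<n])=sorted_list_of_set (g ` {0..<n})" by simp
 thus ?thesis by (metis rev_rev_ident)
qed

lemma dec_tuples_eqI:
 assumes g: "g \<in> dec_tuples n L" "g' \<in> dec_tuples n L" and im: "g ` {0..<n}=g' ` {0..<n}"
 shows "g=g'"
proof
 fix i
 have "map g [0..<n]=map g' [0..<n]"
 using dec_tuples_sorted_list[OF g(1)] dec_tuples_sorted_list[OF g(2)] im by simp
 thus "g i=g' i"
 using g by (cases "i < n") (auto simp: dec_tuples_def)
qed

lemma dec_tuples_inj_on: "g \<in> dec_tuples n L ==> inj_on g {0..<n}"
proof (rule inj_onI)
 fix i j assume g: "g \<in> dec_tuples n L" and ij: "i \<in> {0..<n}" "j \<in> {0..<n}" "g i=g j"
 have lt: "g l < g k" if "k < l" "l < n" for k l using g that by (simp add: dec_tuples_def)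
 show "i=j" using lt[of i j] lt[of j i] ij by (cases i j rule: linorder_cases) auto
qed

text \<open>Sorting: an injective tuple is determined by its range, listed in decreasing order, and
  by the permutation that restores the original order.\<close>

lemma bij_betw_dec_tuples_permutations:
 "bij_betw (%(g,p). restrict (g \<circ> p) {0..<n}) (dec_tuples n L \<times> {p. p permutes {0..<n}})
 {f \<in> {0..<n} \<rightarrow>\<^sub>E {..<L}. inj_on f {0..<n}}"
 (is "bij_betw ?h ?A ?B")
 unfolding bij_betw_def
proof (intro conjI subset_antisym)
 show "inj_on ?h ?A"
 proof (rule inj_onI,clarify)
 fix g p g' p'
 assume g: "g \<in> dec_tuples n L" "g' \<in> dec_tuples n L"
 and p: "p permutes {0..<n}" "p' permutes {0..<n}"
 and eq: "restrict (g \<circ> p) {0..<n}=restrict (g' \<circ> p') {0..<n}"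
 have e: "g (p i)=g' (p' i)" if "i < n" for i
 using fun_cong[OF eq,of i] that by simp
 have "g ` {0..<n}=g ` p ` {0..<n}" using permutes_image[OF p(1)] by simp
 also have "... = g' ` p' ` {0..<n}" using e by (force simp: image_image)
 also have "... = g' ` {0..<n}" using permutes_image[OF p(2)] by simp
 finally have gg: "g=g'" using g by (rule dec_tuples_eqI[rotated 2])
 have "p i=p' i" for i
 proof (cases "i < n")
 case True
 thus ?thesis
 using e[OF True] gg dec_tuples_inj_on[OF g(1)] permutes_in_image[OF p(1),of i]
 permutes_in_image[OF p(2),of i] by (auto dest: inj_onD)
 qed (use permutes_not_in[OF p(1)] permutes_not_in[OF p(2)] in auto)
 thus "g=g' & p=p'" using gg by auto
 qed
 show "?h ` ?A \<subseteq> ?B"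
 proof (rule image_subsetI)
 fix z assume "z \<in> ?A"
 then obtain g p where z: "z=(g,p)" and g: "g \<in> dec_tuples n L" and p: "p permutes {0..<n}"
 by auto
 have pi: "p i < n" if "i < n" for i using permutes_in_image[OF p,of i] that by simp
 have "inj_on (g \<circ> p) {0..<n}"
 by (rule comp_inj_on) (use permutes_inj[OF p] permutes_image[OF p] dec_tuples_inj_on[OF g] in
 \<open>auto intro: inj_on_subset\<close>)
 hence "inj_on (restrict (g \<circ> p) {0..<n}) {0..<n}" by (simp add: inj_on_def)
 thus "?h z \<in> ?B"
 using g pi by (auto simp: dec_tuples_def z)
 qed
 show "?B \<subseteq> ?h ` ?A"
 proof (rule subsetI)
 fix f assume "f \<in> ?B"
 hence f: "f \<in> {0..<n} \<rightarrow>\<^sub>E {..<L}" and inj: "inj_on f {0..<n}" by auto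
 define S where "S=f ` {0..<n}"
 have S: "finite S" "card S=n" "S \<subseteq> {..<L}"
 using f inj by (auto simp: S_def card_image)
 define xs where "xs=rev (sorted_list_of_set S)"
 have xs: "length xs=n" "set xs=S" "distinct xs" "sorted_wrt (%a b. b < a) xs"
 using S by (auto simp: xs_def sorted_wrt_rev)
 define g where "g=(%i. if i < n then xs ! i else 0)"
 have g: "g \<in> dec_tuples n L"
 proof -
 have "xs ! i < L" if "i < n" for i using xs S nth_mem[of i xs] that by auto
 thus ?thesis
 using xs(1) sorted_wrt_nth_less[OF xs(4)] by (auto simp: dec_tuples_def g_def)
 qed
 have "g ` {0..<n}=(!) xs ` {0..<n}" by (rule image_cong) (auto simp: g_def)
 also have "... = S" using nth_image[of n xs] xs by (simp add: lessThan_atLeast0)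
 finally have gS: "g ` {0..<n}=S" .
 have gb: "bij_betw g {0..<n} S" using gS dec_tuples_inj_on[OF g] by (simp add: bij_betw_def)
 define p where "p=(%i. if i < n then inv_into {0..<n} g (f i) else i)"
 have "bij_betw (inv_into {0..<n} g \<circ> f) {0..<n} {0..<n}"
 by (rule bij_betw_trans[of _ _ S]) (use inj bij_betw_inv_into[OF gb] in \<open>auto simp: S_def bij_betw_def\<close>)
 hence "bij_betw p {0..<n} {0..<n}"
 by (subst (asm) bij_betw_cong[where g=p]) (auto simp: p_def)
 hence p: "p permutes {0..<n}"
 by (rule bij_imp_permutes) (auto simp: p_def)
 have "restrict (g \<circ> p) {0..<n}=f"
 proof (rule PiE_ext[OF _ f])
 show "restrict (g \<circ> p) {0..<n} \<in> {0..<n} \<rightarrow>\<^sub>E {..<L}"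
 using g permutes_in_image[OF p] by (auto simp: dec_tuples_def)
 fix i assume "i \<in> {0..<n}"
 thus "restrict (g \<circ> p) {0..<n} i=f i"
 using gS by (auto simp: p_def S_def intro!: f_inv_into_f)
 qed
 thus "f \<in> ?h ` ?A" using g p by (intro image_eqI[of _ _ "(g,p)"]) auto
 qed
qed

text \<open>Multilinearity expands the determinant over all tuples of intermediate indices. A
  repeated index gives equal rows; the remaining tuples are grouped by their decreasing
  rearrangement, and the permutation supplies the sign.\<close>

lemma detn_cauchy_binet:
 fixes X Y :: "nat => nat => 'a :: comm_ring_1"
 shows "detn n (%i j. \<Sum>x<L. X i x * Y x j) =
 (\<Sum>g\<in>dec_tuples n L. detn n (%i j. X i (g j)) * detn n (%i j. Y (g i) j))"
proof -
 let ?P = "{p. p permutes {0..<n}}"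
 let ?I = "{f \<in> {0..<n} \<rightarrow>\<^sub>E {..<L}. inj_on f {0..<n}}"
 let ?S = "%f. (\<Prod>i=0..<n. X i (f i)) * detn n (%i j. Y (f i) j)"
 have fin: "finite ({0..<n} \<rightarrow>\<^sub>E {..<L})" by (intro finite_PiE) auto
 have "detn n (%i j. \<Sum>x<L. X i x * Y x j)
 = (\<Sum>p\<in>?P. of_int (sign p)*(\<Sum>f\<in>{0..<n} \<rightarrow>\<^sub>E {..<L}. \<Prod>i=0..<n. X i (f i) * Y (f i) (p i)))"
 unfolding detn_sum_permutations by (subst prod_sum_PiE) auto
 also have "... = (\<Sum>f\<in>{0..<n} \<rightarrow>\<^sub>E {..<L}. \<Sum>p\<in>?P.
 (\<Prod>i=0..<n. X i (f i))*(of_int (sign p)*(\<Prod>i=0..<n. Y (f i) (p i))))"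
 by (subst sum.swap) (simp add: sum_distrib_left prod.distrib mult_ac)
 also have "... = (\<Sum>f\<in>{0..<n} \<rightarrow>\<^sub>E {..<L}. ?S f)"
 by (simp add: detn_sum_permutations sum_distrib_left)
 also have "... = (\<Sum>f\<in>?I. ?S f)"
 proof (rule sum.mono_neutral_right[OF fin])
 show "\<forall>f\<in>({0..<n} \<rightarrow>\<^sub>E {..<L}) - ?I. ?S f=0"
 proof
 fix f assume "f \<in> ({0..<n} \<rightarrow>\<^sub>E {..<L}) - ?I"
 then obtain i j where "i < n" "j < n" "i ~= j" "f i=f j" by (auto simp: inj_on_def)
 hence "detn n (%i j. Y (f i) j)=0" by (intro detn_identical_rows[of i j]) auto
 thus "?S f=0" by simp
 qed
 qed auto
 also have "... = (\<Sum>(g,p)\<in>dec_tuples n L \<times> ?P. ?S (restrict (g \<circ> p) {0..<n}))"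
 by (subst sum.reindex_bij_betw[OF bij_betw_dec_tuples_permutations,symmetric])
 (auto intro: sum.cong)
 also have "... = (\<Sum>g\<in>dec_tuples n L. \<Sum>p\<in>?P. ?S (restrict (g \<circ> p) {0..<n}))"
 by (rule sum.cartesian_product[symmetric])
 also have "... = (\<Sum>g\<in>dec_tuples n L. detn n (%i j. X i (g j)) * detn n (%i j. Y (g i) j))"
 proof (rule sum.cong[OF refl])
 fix g
 have "?S (restrict (g \<circ> p) {0..<n})
 = (of_int (sign p)*(\<Prod>i=0..<n. X i (g (p i)))) * detn n (%i j. Y (g i) j)"
 if "p \<in> ?P" for p
 proof -
 have "detn n (%i j. Y (restrict (g \<circ> p) {0..<n} i) j)=detn n (%i j. Y (g (p i)) j)"
 by (rule detn_cong) auto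
 also have "... = of_int (sign p) * detn n (%i j. Y (g i) j)"
 using detn_permute_rows[of p n "%i j. Y (g i) j"] that by simp
 finally show ?thesis by (simp add: mult_ac)
 qed
 hence "(\<Sum>p\<in>?P. ?S (restrict (g \<circ> p) {0..<n}))
 = (\<Sum>p\<in>?P. (of_int (sign p)*(\<Prod>i=0..<n. X i (g (p i)))) * detn n (%i j. Y (g i) j))"
 by (rule sum.cong[OF refl])
 also have "... = detn n (%i j. X i (g j)) * detn n (%i j. Y (g i) j)"
 unfolding detn_sum_permutations[of n "%i j. X i (g j)"] by (rule sum_distrib_right[symmetric])
 finally show "(\<Sum>p\<in>?P. ?S (restrict (g \<circ> p) {0..<n}))
 = detn n (%i j. X i (g j)) * detn n (%i j. Y (g i) j)" .
 qed
 finally show ?thesis .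
qed

lemma detn_scale:
 "detn n (%i j. a i * b j * M i j)=(\<Prod>i=0..<n. a i)*(\<Prod>i=0..<n. b i) * detn n M"
 unfolding detn_sum_permutations sum_distrib_left
proof (rule sum.cong[OF refl])
 fix p assume "p \<in> {p. p permutes {0..<n}}"
 hence "(\<Prod>i=0..<n. b (p i))=(\<Prod>i=0..<n. b i)"
 using prod.permute[of p "{0..<n}" b] by (simp add: o_def)
 thus "of_int (sign p)*(\<Prod>i=0..<n. a i * b (p i) * M i (p i))
 = (\<Prod>i=0..<n. a i)*(\<Prod>i=0..<n. b i)*(of_int (sign p)*(\<Prod>i=0..<n. M i (p i)))"
 by (simp add: prod.distrib mult_ac)
qed

section \<open>Slices as particle configurations and their transfer weights\<close>

text \<open>Particle positions of the empty partition. Adding them to the parts of a partition turns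
  weakly into strictly decreasing sequences.\<close>

definition vacuum :: "nat => nat => nat" where
 "vacuum n i=(if i < n then n-1-i else 0)"

lemma dec_tuples_ge_vacuum:
 assumes "g \<in> dec_tuples n L" "i < n"
 shows "vacuum n i<=g i"
proof -
 have "k < n ==> k<=g (n-1-k)" for k
 proof (induction k)
 case (Suc k)
 hence "g (n-1-k) < g (n-1-Suc k)"
 using assms(1) by (auto simp: dec_tuples_def)
 thus ?case using Suc by auto
 qed simp
 from this[of "n-1-i"] assms(2) show ?thesis by (simp add: vacuum_def)
qed

lemma vacuum_dec_tuples: "n<=L ==> vacuum n \<in> dec_tuples n L"
 by (auto simp: dec_tuples_def vacuum_def)

text \<open>The vacuum is the lowest configuration; any other one exceeds it at some index, and this
  opens a zero block.\<close>

lemma detn_vacuum: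
 assumes g: "g \<in> dec_tuples n L"
 shows "detn n (%i j. if g j=vacuum n i then 1 else 0 :: 'a :: comm_ring_1)
 = (if g=vacuum n then 1 else 0)"
proof (cases "g=vacuum n")
 case True
 have "vacuum n j=vacuum n i \<longleftrightarrow> i=j" if "i < n" "j < n" for i j
 using that by (auto simp: vacuum_def)
 hence "detn n (%i j. if g j=vacuum n i then 1 else 0 :: 'a)=1"
 unfolding True by (intro detn_upper_unitriangular) auto
 thus ?thesis using True by simp
next
 case False
 have "\<exists>i<n. vacuum n i < g i"
 proof (rule ccontr)
 assume "~ ?thesis"
 hence "g i=vacuum n i" for i
 using dec_tuples_ge_vacuum[OF g,of i] g
 by (cases "i < n") (force simp: dec_tuples_def vacuum_def)+
 thus False using False by auto
 qed
 then obtain k where k: "k < n" "vacuum n k < g k" by auto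
 have "detn n (%i j. if g j=vacuum n i then 1 else 0 :: 'a)=0"
 proof (rule detn_zero_block[OF k(1)])
 fix i j assume ij: "k<=i" "i < n" "j<=k"
 have "g k<=g j" using g ij k by (cases "j=k") (auto simp: dec_tuples_def less_imp_le)
 moreover have "vacuum n i<=vacuum n k" using ij by (auto simp: vacuum_def)
 ultimately show "(if g j=vacuum n i then 1 else 0 :: 'a)=0" using k by auto
 qed
 thus ?thesis using False by simp
qed

text \<open>
  Time \<open>k\<close> is the diagonal \<open>t = k - A\<close>; the parts grow up to time \<open>A\<close> and shrink afterwards.
\<close>

definition step_rate :: "real => nat => nat => real" where
 "step_rate r A k=r*(real k-real A+1/2)"

text \<open>The one-particle weight depends on the displacement only. Hence the kernel is Toeplitz,
  and in a determinant the exponentials combine to the total displacement.\<close>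

definition step_kernel :: "real => nat => nat => nat => nat => real" where
 "step_kernel r A k x y =
 (if (if k < A then x<=y else y<=x) then exp (step_rate r A k*(real y-real x)) else 0)"

definition interlaced :: "nat => nat => nat => (nat => nat) => (nat => nat) => bool" where
 "interlaced n A k g g' \<longleftrightarrow>
 (if k < A then (\<forall>i<n. g i<=g' i) & (\<forall>i. Suc i < n --> g' (Suc i) < g i)
 else (\<forall>i<n. g' i<=g i) & (\<forall>i. Suc i < n --> g (Suc i) < g' i))"

text \<open>Rows and columns give up their exponentials, and what remains is the 0-1 matrix of
  \<open>detn_interlacing\<close>, transposed for growing slices.\<close>

lemma detn_step_kernel:
 assumes "g \<in> dec_tuples n L" "g' \<in> dec_tuples n L"
 shows "detn n (%i j. step_kernel r A k (g i) (g' j)) =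
 (if interlaced n A k g g'
 then exp (step_rate r A k*((\<Sum>i=0..<n. real (g' i))-(\<Sum>i=0..<n. real (g i)))) else 0)"
proof -
 let ?c = "step_rate r A k"
 have "detn n (%i j. step_kernel r A k (g i) (g' j))=detn n (%i j. exp (- ?c * real (g i)) *
 exp (?c * real (g' j))*(if (if k < A then g i<=g' j else g' j<=g i) then 1 else 0))"
 by (rule detn_cong) (auto simp: step_kernel_def exp_add[symmetric] algebra_simps)
 also have "... = (\<Prod>i=0..<n. exp (- ?c * real (g i)))*(\<Prod>i=0..<n. exp (?c * real (g' i))) *
 detn n (%i j. if (if k < A then g i<=g' j else g' j<=g i) then 1 else 0)"
 by (rule detn_scale)
 also have "(\<Prod>i=0..<n. exp (- ?c * real (g i)))*(\<Prod>i=0..<n. exp (?c * real (g' i)))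
 = exp (?c*((\<Sum>i=0..<n. real (g' i))-(\<Sum>i=0..<n. real (g i))))"
 by (simp add: exp_sum[symmetric] exp_add[symmetric] sum_distrib_left sum_negf right_diff_distrib)
 also have "detn n (%i j. if (if k < A then g i<=g' j else g' j<=g i) then 1 else 0 :: real)
 = (if interlaced n A k g g' then 1 else 0)"
 proof (cases "k < A")
 case True
 have "detn n (%i j. if g i<=g' j then 1 else 0 :: real)
 = detn n (%i j. if g j<=g' i then 1 else 0 :: real)"
 by (rule detn_transpose[symmetric])
 also have "... = (if interlaced n A k g g' then 1 else 0)"
 using assms True by (subst detn_interlacing) (auto simp: dec_tuples_def interlaced_def)
 finally show ?thesis using True by simp
 next
 case False
 have "detn n (%i j. if g' j<=g i then 1 else 0 :: real)=(if interlaced n A k g g' then 1 else 0)"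
 using assms False by (subst detn_interlacing) (auto simp: dec_tuples_def interlaced_def)
 thus ?thesis using False by simp
 qed
 finally show ?thesis by simp
qed

text \<open>Sites are truncated at \<open>L\<close> to keep the sums finite. The site weight
  \<open>D k\<close> acts before the step at time \<open>k\<close>, so it rewards the particles
  present at time \<open>k\<close>.\<close>

fun evolve :: "nat => (nat => nat => real) => (nat => nat => nat => real) => nat => nat => nat => real" where
 "evolve L D T 0 x y=(if y=x then 1 else 0)"
| "evolve L D T (Suc k) x y=(\<Sum>z<L. evolve L D T k x z * D k z * T k z y)"

definition path_weight ::
 "nat => (nat => nat => real) => (nat => nat => nat => real) => nat => (nat => nat) => (nat => nat) => real" where
 "path_weight n D T k g g'=(\<Prod>i=0..<n. D k (g i)) * detn n (%i j. T k (g i) (g' j))"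

lemma detn_evolve_Suc:
 "detn n (%i j. evolve L D T (Suc k) (v i) (g' j)) =
 (\<Sum>g\<in>dec_tuples n L. detn n (%i j. evolve L D T k (v i) (g j)) * path_weight n D T k g g')"
proof -
 have "detn n (%i j. evolve L D T (Suc k) (v i) (g' j)) =
 (\<Sum>g\<in>dec_tuples n L. detn n (%i j. evolve L D T k (v i) (g j) * D k (g j)) *
 detn n (%i j. T k (g i) (g' j)))"
 using detn_cauchy_binet[where n=n and L=L and X = "%i z. evolve L D T k (v i) z * D k z" and Y = "%z j. T k z (g' j)"]
 by simp
 moreover have "detn n (%i j. evolve L D T k (v i) (g j) * D k (g j))
 = detn n (%i j. evolve L D T k (v i) (g j))*(\<Prod>i=0..<n. D k (g i))" for g
 using detn_scale[of n "%_. 1" "%j. D k (g j)" "%i j. evolve L D T k (v i) (g j)"]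
 by (simp add: mult_ac)
 ultimately show ?thesis by (simp add: path_weight_def mult_ac)
qed

definition paths :: "nat => nat => nat => (nat => nat) => (nat => nat => nat) set" where
 "paths n L k g = {s \<in> {0..k} \<rightarrow>\<^sub>E dec_tuples n L. s 0=vacuum n & s k=g}"

lemma finite_paths: "finite (paths n L k g)"
 unfolding paths_def by (rule finite_subset[OF _ finite_PiE[of "{0..k}" "%_. dec_tuples n L"]]) (auto simp: finite_dec_tuples)

text \<open>Applying Cauchy-Binet at every step turns the determinant of one-particle evolutions
  into a sum over \<open>n\<close>-particle configurations at all intermediate times, a transfer
  matrix form of the Lindstrom-Gessel-Viennot formula.\<close>

lemma detn_evolve_paths:
 assumes "g \<in> dec_tuples n L"
 shows "detn n (%i j. evolve L D T k (vacuum n i) (g j)) =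
 (\<Sum>s\<in>paths n L k g. \<Prod>j<k. path_weight n D T j (s j) (s (Suc j)))"
 using assms
proof (induction k arbitrary: g)
 case 0
 have "paths n L 0 g=(if g=vacuum n then {restrict (%_. g) {0..0}} else {})"
 proof -
 have "s=restrict (%_. g) {0..0}" if "s \<in> paths n L 0 g" for s
 using that by (intro ext) (auto simp: paths_def PiE_iff extensional_def)
 moreover have "restrict (%_. g) {0..0} \<in> paths n L 0 g" if "g=vacuum n"
 using that 0 by (auto simp: paths_def)
 moreover have "paths n L 0 g = {}" if "g ~= vacuum n"
 using that by (auto simp: paths_def)
 ultimately show ?thesis by (auto split: if_splits)
 qed
 thus ?case using detn_vacuum[OF 0,where 'a=real] by simp
next
 case (Suc k)
 let ?w = "%k (s :: nat => nat => nat). \<Prod>j<k. path_weight n D T j (s j) (s (Suc j))"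
 have "detn n (%i j. evolve L D T (Suc k) (vacuum n i) (g j)) =
 (\<Sum>h\<in>dec_tuples n L. \<Sum>s\<in>paths n L k h. ?w k s * path_weight n D T k h g)"
 unfolding detn_evolve_Suc by (rule sum.cong[OF refl]) (simp add: Suc.IH sum_distrib_right)
 also have "... = (\<Sum>(h,s)\<in>Sigma (dec_tuples n L) (paths n L k). ?w k s * path_weight n D T k h g)"
 by (rule sum.Sigma) (auto simp: finite_dec_tuples finite_paths)
 also have "... = (\<Sum>s\<in>paths n L (Suc k) g. ?w (Suc k) s)"
 proof (rule sum.reindex_bij_witness[where
 j = "%(h,s). s(Suc k := g)" and i = "%s. (s k,restrict s {0..k})"])
 fix a assume "a \<in> Sigma (dec_tuples n L) (paths n L k)"
 then obtain h s where a: "a=(h,s)" "h \<in> dec_tuples n L" "s \<in> {0..k} \<rightarrow>\<^sub>E dec_tuples n L"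
 "s 0=vacuum n" "s k=h" by (auto simp: paths_def)
 show "(((case a of (h,s) => s(Suc k := g)) k),restrict (case a of (h,s) => s(Suc k := g)) {0..k})=a"
 using a by (auto simp: fun_eq_iff PiE_iff extensional_def)
 show "(case a of (h,s) => s(Suc k := g)) \<in> paths n L (Suc k) g"
 using a Suc.prems by (auto simp: paths_def PiE_iff extensional_def)
 show "?w (Suc k) (case a of (h,s) => s(Suc k := g))
 = (case a of (h,s) => ?w k s * path_weight n D T k h g)"
 using a by (auto intro!: arg_cong2[of _ _ _ _ "(*)"] prod.cong)
 next
 fix s assume s: "s \<in> paths n L (Suc k) g"
 hence "s k \<in> dec_tuples n L" by (auto simp: paths_def)
 thus "(s k,restrict s {0..k}) \<in> Sigma (dec_tuples n L) (paths n L k)"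
 using s by (auto simp: paths_def PiE_iff extensional_def)
 show "(case (s k,restrict s {0..k}) of (h,s) => s(Suc k := g))=s"
 using s by (auto simp: paths_def PiE_iff extensional_def fun_eq_iff)
 qed
 finally show ?case .
qed

section \<open>Plane partitions in a box correspond to interlacing paths\<close>

definition box_pps :: "nat => nat => nat => (nat => nat => nat) set" where
 "box_pps A B M =
 {p. plane_partition p & (\<forall>i\<ge>A. p i 0=0) & (\<forall>j\<ge>B. p 0 j=0) & p 0 0<=M}"

lemma plane_partition_mono:
 assumes "plane_partition p" "i<=i'" "j<=j'"
 shows "p i' j'<=p i j"
proof -
 have "p i' j'<=p i' j"
 using assms lift_Suc_antimono_le[of "p i'" j j'] by (auto simp: plane_partition_def)
 also have "p i' j<=p i j"
 using assms lift_Suc_antimono_le[of "%i. p i j" i i'] by (auto simp: plane_partition_def)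
 finally show ?thesis .
qed

lemma box_pps_zero:
 assumes "p \<in> box_pps A B M" "A<=i \<or> B<=j"
 shows "p i j=0"
 using assms plane_partition_mono[of p i i 0 j] plane_partition_mono[of p 0 i j j]
 by (auto simp: box_pps_def)

lemma box_pps_le: "p \<in> box_pps A B M ==> p i j<=M"
 using plane_partition_mono[of p 0 i 0 j] by (auto simp: box_pps_def)

text \<open>Truncated subtraction makes one of the two offsets 0, so that one formula serves the
  diagonals on both sides of the main one.\<close>

definition diag_part :: "nat => (nat => nat => nat) => nat => nat => nat" where
 "diag_part A p k i=p (i+(A-k)) (i+(k-A))"

definition pp_path :: "nat => nat => nat => (nat => nat => nat) => nat => nat => nat" where
 "pp_path n A B p=restrict (%k i. if i < n then diag_part A p k i+vacuum n i else 0) {0..A+B}"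

definition path_part :: "nat => nat => nat => (nat => nat => nat) => int => nat => nat" where
 "path_part n A B s t i =
 (if-int A<=t & t<=int B & i < n then s (nat (t+int A)) i-vacuum n i else 0)"

definition path_pp :: "nat => nat => nat => (nat => nat => nat) => nat => nat => nat" where
 "path_pp n A B s i j=path_part n A B s (int j-int i) (min i j)"

definition interlaced_paths :: "nat => nat => nat => nat => (nat => nat => nat) set" where
 "interlaced_paths n A B L =
 {s \<in> paths n L (A+B) (vacuum n). \<forall>k<A+B. interlaced n A k (s k) (s (Suc k))}"

lemma diag_part_interlaced:
 assumes p: "plane_partition p"
 shows "k < A ==> diag_part A p k i<=diag_part A p (Suc k) i"
 and "k < A ==> diag_part A p (Suc k) (Suc i)<=diag_part A p k i"
 and "A<=k ==> diag_part A p (Suc k) i<=diag_part A p k i"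
 and "A<=k ==> diag_part A p k (Suc i)<=diag_part A p (Suc k) i"
 unfolding diag_part_def by (rule plane_partition_mono[OF p]; simp)+

lemma vacuum_Suc: "Suc i < n ==> vacuum n i=Suc (vacuum n (Suc i))"
 by (auto simp: vacuum_def)

lemma pp_path_interlaced:
 assumes p: "p \<in> box_pps A B M" and n: "A<=n" "B<=n"
 shows "pp_path n A B p \<in> interlaced_paths n A B (M+n)"
proof -
 have pp: "plane_partition p" using p by (auto simp: box_pps_def)
 let ?s = "pp_path n A B p"
 have s: "?s k=(%i. if i < n then diag_part A p k i+vacuum n i else 0)" if "k<=A+B" for k
 using that by (simp add: pp_path_def)
 have dec: "?s k \<in> dec_tuples n (M+n)" if "k<=A+B" for k
 proof -
 have "diag_part A p k j<=diag_part A p k i" if "i<=j" for i j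
 unfolding diag_part_def using that by (intro plane_partition_mono[OF pp]) auto
 moreover have "vacuum n j < vacuum n i" if "i < j" "j < n" for i j
 using that by (auto simp: vacuum_def)
 moreover have "diag_part A p k i<=M" for i unfolding diag_part_def by (rule box_pps_le[OF p])
 moreover have "vacuum n i < n" if "i < n" for i using that by (auto simp: vacuum_def)
 ultimately show ?thesis unfolding s[OF that] dec_tuples_def
 by (auto intro: add_le_less_mono)
 qed
 have "?s 0=vacuum n" "?s (A+B)=vacuum n"
 using box_pps_zero[OF p] by (auto simp: s diag_part_def vacuum_def fun_eq_iff)
 hence "?s \<in> paths n (M+n) (A+B) (vacuum n)"
 using dec by (auto simp: paths_def pp_path_def)
 moreover have "interlaced n A k (?s k) (?s (Suc k))" if "k < A+B" for k
 proof (cases "k < A")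
 case True
 have "?s (Suc k) (Suc i) < ?s k i" if "Suc i < n" for i
 using diag_part_interlaced(2)[OF pp True,of i] vacuum_Suc[OF that] that \<open>k < A+B\<close>
 by (simp add: s)
 thus ?thesis
 using True diag_part_interlaced(1)[OF pp True] \<open>k < A+B\<close> by (simp add: interlaced_def s)
 next
 case False
 have "?s k (Suc i) < ?s (Suc k) i" if "Suc i < n" for i
 using diag_part_interlaced(4)[OF pp,of A k i] vacuum_Suc[OF that] that \<open>k < A+B\<close> False
 by (simp add: s)
 thus ?thesis
 using False diag_part_interlaced(3)[OF pp,of A k] \<open>k < A+B\<close> by (simp add: interlaced_def s)
 qed
 ultimately show ?thesis by (simp add: interlaced_paths_def)
qed

text \<open>Within the time range this is the interlacing of the path, where the vacuum shift
  absorbs the strict inequalities. At the ends and beyond them all parts vanish, because the path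
  starts and ends in the vacuum.\<close>

lemma path_part_interlaced:
 assumes s: "s \<in> interlaced_paths n A B L"
 shows "t < 0 ==> path_part n A B s t i<=path_part n A B s (t+1) i"
 and "t < 0 ==> path_part n A B s (t+1) (Suc i)<=path_part n A B s t i"
 and "0<=t ==> path_part n A B s (t+1) i<=path_part n A B s t i"
 and "0<=t ==> path_part n A B s t (Suc i)<=path_part n A B s (t+1) i"
proof -
 have ends: "s 0=vacuum n" "s (A+B)=vacuum n"
 using s by (auto simp: interlaced_paths_def paths_def)
 have e0: "path_part n A B s t i=0" if "t <= - int A \<or> int B<=t" for t i
 proof -
 note range=that
 consider "t = - int A" | "t=int B" | "t < - int A \<or> int B < t"
 using range by linarith
 thus ?thesis
 proof cases
 case 2
 hence "nat (t+int A)=A+B" by simp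
 thus ?thesis using ends by (simp add: path_part_def)
 qed (use ends in \<open>auto simp: path_part_def\<close>)
 qed
 {
 assume t: "- int A<=t" "t < int B"
 define k where "k=nat (t+int A)"
 have k: "k < A+B" "nat (t+1+int A)=Suc k" using t by (auto simp: k_def)
 have il: "interlaced n A k (s k) (s (Suc k))"
 using s k by (auto simp: interlaced_paths_def)
 have e: "path_part n A B s t i=(if i < n then s k i-vacuum n i else 0)"
 "path_part n A B s (t+1) i=(if i < n then s (Suc k) i-vacuum n i else 0)" for i
 using t k by (auto simp: path_part_def k_def)
 have "t < 0 ==> path_part n A B s t i<=path_part n A B s (t+1) i"
 "t < 0 ==> path_part n A B s (t+1) (Suc i)<=path_part n A B s t i"
 "0<=t ==> path_part n A B s (t+1) i<=path_part n A B s t i"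
 "0<=t ==> path_part n A B s t (Suc i)<=path_part n A B s (t+1) i"
 proof -
 assume "t < 0"
 hence "k < A" using t by (auto simp: k_def)
 hence c: "\<And>i. i < n ==> s k i<=s (Suc k) i" "\<And>i. Suc i < n ==> s (Suc k) (Suc i) < s k i"
 using il by (auto simp: interlaced_def)
 show "path_part n A B s t i<=path_part n A B s (t+1) i" using c(1)[of i] by (simp add: e diff_le_mono)
 show "path_part n A B s (t+1) (Suc i)<=path_part n A B s t i"
 using c(2)[of i] vacuum_Suc[of i n] by (cases "Suc i < n") (simp_all add: e)
 next
 assume "0<=t"
 hence "~ k < A" using t by (auto simp: k_def)
 hence c: "\<And>i. i < n ==> s (Suc k) i<=s k i" "\<And>i. Suc i < n ==> s k (Suc i) < s (Suc k) i"
 using il by (auto simp: interlaced_def)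
 show "path_part n A B s (t+1) i<=path_part n A B s t i" using c(1)[of i] by (simp add: e diff_le_mono)
 show "path_part n A B s t (Suc i)<=path_part n A B s (t+1) i"
 using c(2)[of i] vacuum_Suc[of i n] by (cases "Suc i < n") (simp_all add: e)
 qed
 } note in_range=this
 show "t < 0 ==> path_part n A B s t i<=path_part n A B s (t+1) i"
 using in_range(1) e0[of t i] by (cases "- int A<=t & t < int B") auto
 show "t < 0 ==> path_part n A B s (t+1) (Suc i)<=path_part n A B s t i"
 using in_range(2) e0[of "t+1" "Suc i"] by (cases "- int A<=t & t < int B") auto
 show "0<=t ==> path_part n A B s (t+1) i<=path_part n A B s t i"
 using in_range(3) e0[of "t+1" i] by (cases "- int A<=t & t < int B") auto
 show "0<=t ==> path_part n A B s t (Suc i)<=path_part n A B s (t+1) i"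
 using in_range(4) e0[of t "Suc i"] by (cases "- int A<=t & t < int B") auto
qed

text \<open>Monotonicity along rows and columns of the array amounts to the four interlacing
  inequalities, selected by the side of the main diagonal.\<close>

lemma path_pp_in_box:
 assumes s: "s \<in> interlaced_paths n A B (M+n)" and n: "0 < n"
 shows "path_pp n A B s \<in> box_pps A B M"
proof -
 let ?p = "path_pp n A B s"
 have sp: "s \<in> paths n (M+n) (A+B) (vacuum n)" using s by (simp add: interlaced_paths_def)
 have dec: "s k \<in> dec_tuples n (M+n)" if "k<=A+B" for k
 using sp that by (auto simp: paths_def)
 have ends: "s 0=vacuum n" "s (A+B)=vacuum n" using sp by (auto simp: paths_def)
 have m1: "?p (Suc i) j <= ?p i j" for i j
 proof (cases "i < j")
 case True
 hence "?p (Suc i) j=path_part n A B s (int j-int i-1) (Suc i)"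
 "?p i j=path_part n A B s (int j-int i-1+1) i" by (auto simp: path_pp_def min_def algebra_simps)
 thus ?thesis using path_part_interlaced(4)[OF s,of "int j-int i-1" i] True by simp
 next
 case False
 hence "?p (Suc i) j=path_part n A B s (int j-int i-1) j"
 "?p i j=path_part n A B s (int j-int i-1+1) j" by (auto simp: path_pp_def min_def algebra_simps)
 thus ?thesis using path_part_interlaced(1)[OF s,of "int j-int i-1" j] False by simp
 qed
 have m2: "?p i (Suc j) <= ?p i j" for i j
 proof (cases "i<=j")
 case True
 hence "?p i (Suc j)=path_part n A B s (int j-int i+1) i"
 "?p i j=path_part n A B s (int j-int i) i" by (auto simp: path_pp_def min_def algebra_simps)
 thus ?thesis using path_part_interlaced(3)[OF s,of "int j-int i" i] True by simp
 next
 case False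
 hence "min i (Suc j)=Suc j" "min i j=j" by auto
 hence "?p i (Suc j)=path_part n A B s (int j-int i+1) (Suc j)"
 "?p i j=path_part n A B s (int j-int i) j" by (auto simp: path_pp_def algebra_simps)
 thus ?thesis using path_part_interlaced(2)[OF s,of "int j-int i" j] False by simp
 qed
 have z1: "?p i 0=0" if "A<=i" for i
 proof (cases "i=A")
 case True
 thus ?thesis using ends by (simp add: path_pp_def path_part_def)
 qed (use that in \<open>auto simp: path_pp_def path_part_def\<close>)
 have z2: "?p 0 j=0" if "B<=j" for j
 proof (cases "j=B")
 case True
 hence "nat (int j+int A)=A+B" by simp
 thus ?thesis using ends True by (simp add: path_pp_def path_part_def)
 qed (use that in \<open>auto simp: path_pp_def path_part_def\<close>)
 have "s A 0 < M+n" using dec[of A] n by (auto simp: dec_tuples_def)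
 hence M: "?p 0 0<=M" using n by (auto simp: path_pp_def path_part_def vacuum_def)
 have mono1: "?p i' j <= ?p i j" if "i<=i'" for i i' j
 using lift_Suc_antimono_le[of "%i. ?p i j" i i'] m1 that by auto
 have mono2: "?p i j' <= ?p i j" if "j<=j'" for i j j'
 using lift_Suc_antimono_le[of "?p i" j j'] m2 that by auto
 have "{(i,j). ?p i j ~= 0} \<subseteq> {..<A} \<times> {..<B}"
 proof (rule subsetI)
 fix z assume "z \<in> {(i,j). ?p i j ~= 0}"
 then obtain i j where z: "z=(i,j)" and nz: "?p i j ~= 0" by auto
 show "z \<in> {..<A} \<times> {..<B}"
 using z nz mono2[of 0 j i] mono1[of 0 i j] z1[of i] z2[of j] by (cases "A<=i"; cases "B<=j") auto
 qed
 hence "finite {(i,j). ?p i j ~= 0}" by (rule finite_subset) auto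
 thus ?thesis using m1 m2 z1 z2 M by (auto simp: box_pps_def plane_partition_def)
qed

lemma path_pp_pp_path:
 assumes p: "p \<in> box_pps A B M" and n: "A<=n" "B<=n"
 shows "path_pp n A B (pp_path n A B p)=p"
proof (intro ext)
 fix i j
 show "path_pp n A B (pp_path n A B p) i j=p i j"
 proof (cases "- int A<=int j-int i & int j-int i<=int B & min i j < n")
 case True
 let ?k = "nat (int j-int i+int A)"
 have k: "?k<=A+B" using True by auto
 have "diag_part A p ?k (min i j)=p i j"
 proof (cases "i<=j")
 case True
 hence "?k=A+(j-i)" by auto
 thus ?thesis using True by (simp add: diag_part_def)
 next
 case False
 hence "A - ?k=i-j" "?k-A=0" using True by auto
 thus ?thesis using False by (simp add: diag_part_def)
 qed
 thus ?thesis using True k by (simp add: path_pp_def path_part_def pp_path_def)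
 next
 case False
 hence "p i j=0" using n by (intro box_pps_zero[OF p]) auto
 thus ?thesis using False by (auto simp: path_pp_def path_part_def)
 qed
qed

lemma pp_path_path_pp:
 assumes s: "s \<in> interlaced_paths n A B L"
 shows "pp_path n A B (path_pp n A B s)=s"
proof
 fix k
 have sp: "s \<in> {0..A+B} \<rightarrow>\<^sub>E dec_tuples n L" using s by (simp add: interlaced_paths_def paths_def)
 show "pp_path n A B (path_pp n A B s) k=s k"
 proof (cases "k<=A+B")
 case True
 hence d: "s k \<in> dec_tuples n L" using sp by auto
 have "diag_part A (path_pp n A B s) k i=s k i-vacuum n i" if "i < n" for i
 proof -
 have "int (i+(k-A))-int (i+(A-k))=int k-int A" "min (i+(A-k)) (i+(k-A))=i"
 by auto
 thus ?thesis using True that by (simp add: diag_part_def path_pp_def path_part_def)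
 qed
 thus ?thesis
 using True d dec_tuples_ge_vacuum[OF d] by (auto simp: pp_path_def dec_tuples_def fun_eq_iff)
 next
 case False
 thus ?thesis using sp by (simp add: pp_path_def PiE_iff extensional_def)
 qed
qed

lemma bij_betw_pp_path:
 assumes "0 < n" "A<=n" "B<=n"
 shows "bij_betw (pp_path n A B) (box_pps A B M) (interlaced_paths n A B (M+n))"
 by (rule bij_betw_byWitness[where f' = "path_pp n A B"])
 (use assms in \<open>auto simp: path_pp_pp_path pp_path_path_pp intro!: pp_path_interlaced path_pp_in_box\<close>)

lemma finite_box_pps: "finite (box_pps A B M)"
proof -
 have "finite (interlaced_paths (Suc (A+B)) A B (M+Suc (A+B)))"
 unfolding interlaced_paths_def using finite_paths by auto
 thus ?thesis using bij_betw_finite[OF bij_betw_pp_path[of "Suc (A+B)" A B M]] by simp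
qed

lemma volume_diag_parts:
 assumes p: "p \<in> box_pps A B M" and n: "A<=n" "B<=n"
 shows "volume p=(\<Sum>k=0..A+B. \<Sum>i=0..<n. diag_part A p k i)"
proof -
 let ?h = "%(k,i). (i+(A-k),i+(k-A))"
 \<comment> \<open>A cell \<open>(a, b)\<close> lies on diagonal \<open>A + b - a\<close> at depth
   \<open>min a b\<close>.\<close>
 have inj: "inj_on ?h ({0..A+B} \<times> {0..<n})"
 proof (rule inj_on_inverseI[where g = "%(a,b). (A+b-a,min a b)"])
 fix z assume "z \<in> {0..A+B} \<times> {0..<n}"
 obtain k i where z: "z=(k,i)" by (cases z)
 show "(case ?h z of (a,b) => (A+b-a,min a b))=z"
 unfolding z by (cases "k<=A") auto
 qed
 have sub: "{(i,j). p i j ~= 0} \<subseteq> ?h ` ({0..A+B} \<times> {0..<n})"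
 proof (rule subsetI)
 fix z assume "z \<in> {(i,j). p i j ~= 0}"
 then obtain i j where z: "z=(i,j)" and "p i j ~= 0" by auto
 hence "i < A" "j < B" using box_pps_zero[OF p,of i j] by (meson linorder_not_le)+
 thus "z \<in> ?h ` ({0..A+B} \<times> {0..<n})"
 unfolding z
 proof (intro image_eqI)
 show "(i,j) = ?h (A+j-i,min i j)"
 proof (cases "i<=j")
 case True
 then obtain d where "j=i+d" using le_Suc_ex by blast
 thus ?thesis by simp
 next
 case False
 then obtain d where d: "i=j+d" using le_Suc_ex[of j i] by auto
 hence "A+j-i=A-d" "d < A" using \<open>i < A\<close> by auto
 thus ?thesis using d by simp
 qed
 show "(A+j-i,min i j) \<in> {0..A+B} \<times> {0..<n}" using \<open>i < A\<close> \<open>j < B\<close> n by auto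
 qed
 qed
 have "volume p=(\<Sum>(i,j)\<in>?h ` ({0..A+B} \<times> {0..<n}). p i j)"
 unfolding volume_def
 proof (rule sum.mono_neutral_left[OF _ sub])
 show "\<forall>z\<in>?h ` ({0..A+B} \<times> {0..<n}) - {(i,j). p i j ~= 0}. (case z of (i,j) => p i j)=0"
 by (rule ballI,erule DiffE) (simp split: prod.splits)
 qed (intro finite_imageI; simp)
 also have "... = (\<Sum>(k,i)\<in>{0..A+B} \<times> {0..<n}. diag_part A p k i)"
 by (subst sum.reindex[OF inj]) (simp add: diag_part_def o_def case_prod_unfold)
 also have "... = (\<Sum>k=0..A+B. \<Sum>i=0..<n. diag_part A p k i)"
 by (rule sum.cartesian_product[symmetric])
 finally show ?thesis .
qed

lemma abel_summation:
 fixes D :: "nat => real"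
 shows "(\<Sum>k<K. (real k+c)*(D (Suc k)-D k))=(real K+c) * D K-c * D 0-(\<Sum>k<K. D (Suc k))"
 by (induction K) (auto simp: algebra_simps)

text \<open>By Abel summation the rates \<open>r * (k - A + 1/2)\<close> turn increments of slice
  sizes into \<open>- r\<close> times the sum of all slice sizes, the volume. A constant offset of
  the rates cancels since the first and the last slice are empty; the value 1/2 keeps every rate
  nonzero, with the sign that makes each step decay.\<close>

lemma prod_step_weights:
 assumes p: "p \<in> box_pps A B M" and n: "0 < n" "A<=n" "B<=n"
 shows "(\<Prod>k<A+B. detn n (%i j. step_kernel r A k (pp_path n A B p k i) (pp_path n A B p (Suc k) j)))
 = exp (- r * real (volume p))"
proof -
 let ?s = "pp_path n A B p"
 define D where "D=(%k. \<Sum>i=0..<n. real (diag_part A p k i))"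
 have sp: "?s \<in> interlaced_paths n A B (M+n)" using pp_path_interlaced[OF p] n by simp
 hence dec: "?s k \<in> dec_tuples n (M+n)" if "k<=A+B" for k
 using that by (auto simp: interlaced_paths_def paths_def)
 have sum: "(\<Sum>i=0..<n. real (?s k i))=D k+(\<Sum>i=0..<n. real (vacuum n i))" if "k<=A+B" for k
 using that by (simp add: pp_path_def D_def sum.distrib)
 have "(\<Prod>k<A+B. detn n (%i j. step_kernel r A k (?s k i) (?s (Suc k) j)))
 = (\<Prod>k<A+B. exp (step_rate r A k*(D (Suc k)-D k)))"
 proof (rule prod.cong[OF refl])
 fix k assume k: "k \<in> {..<A+B}"
 hence "interlaced n A k (?s k) (?s (Suc k))" using sp by (auto simp: interlaced_paths_def)
 thus "detn n (%i j. step_kernel r A k (?s k i) (?s (Suc k) j))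
 = exp (step_rate r A k*(D (Suc k)-D k))"
 using k by (subst detn_step_kernel[OF dec dec]) (auto simp: sum)
 qed
 also have "... = exp (\<Sum>k<A+B. step_rate r A k*(D (Suc k)-D k))" by (simp add: exp_sum)
 also have "(\<Sum>k<A+B. step_rate r A k*(D (Suc k)-D k))
 = r*(\<Sum>k<A+B. (real k+(1/2-real A))*(D (Suc k)-D k))"
 by (simp add: step_rate_def sum_distrib_left algebra_simps)
 also have "... = r*(- (\<Sum>k<A+B. D (Suc k)))"
 proof -
 have "D 0=0" "D (A+B)=0" using box_pps_zero[OF p] by (auto simp: D_def diag_part_def)
 thus ?thesis by (simp add: abel_summation)
 qed
 also have "(\<Sum>k<A+B. D (Suc k))=(\<Sum>k=0..A+B. D k)"
 proof -
 have "D 0=0" using box_pps_zero[OF p] by (auto simp: D_def diag_part_def)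
 thus ?thesis by (simp add: atLeast0AtMost sum.atMost_shift)
 qed
 also have "... = real (volume p)" using volume_diag_parts[OF p] n by (simp add: D_def)
 finally show ?thesis by simp
qed

text \<open>Paths that violate interlacing have weight 0, so the path sum reduces to plane
  partitions.\<close>

lemma box_sum_eq_detn:
 assumes n: "0 < n" "A<=n" "B<=n"
 shows "(\<Sum>p\<in>box_pps A B M. exp (- r * real (volume p)) *
 (\<Prod>k<A+B. \<Prod>i=0..<n. D k (pp_path n A B p k i))) =
 detn n (%i j. evolve (M+n) D (step_kernel r A) (A+B) (vacuum n i) (vacuum n j))"
proof -
 let ?w = "%s. \<Prod>j<A+B. path_weight n D (step_kernel r A) j (s j) (s (Suc j))"
 have "detn n (%i j. evolve (M+n) D (step_kernel r A) (A+B) (vacuum n i) (vacuum n j))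
 = (\<Sum>s\<in>paths n (M+n) (A+B) (vacuum n). ?w s)"
 by (rule detn_evolve_paths) (simp add: vacuum_dec_tuples)
 also have "... = (\<Sum>s\<in>interlaced_paths n A B (M+n). ?w s)"
 proof (rule sum.mono_neutral_right[OF finite_paths])
 show "\<forall>s\<in>paths n (M+n) (A+B) (vacuum n)-interlaced_paths n A B (M+n). ?w s=0"
 proof
 fix s assume s: "s \<in> paths n (M+n) (A+B) (vacuum n)-interlaced_paths n A B (M+n)"
 then obtain k where k: "k < A+B" "~ interlaced n A k (s k) (s (Suc k))"
 by (auto simp: interlaced_paths_def)
 have "s k \<in> dec_tuples n (M+n)" "s (Suc k) \<in> dec_tuples n (M+n)"
 using s k by (auto simp: paths_def)
 hence "path_weight n D (step_kernel r A) k (s k) (s (Suc k))=0"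
 using k by (simp add: path_weight_def detn_step_kernel)
 thus "?w s=0" using k by (intro prod_zero) auto
 qed
 qed (auto simp: interlaced_paths_def)
 also have "... = (\<Sum>p\<in>box_pps A B M. ?w (pp_path n A B p))"
 by (rule sum.reindex_bij_betw[OF bij_betw_pp_path[OF n],symmetric])
 also have "... = (\<Sum>p\<in>box_pps A B M. exp (- r * real (volume p)) *
 (\<Prod>k<A+B. \<Prod>i=0..<n. D k (pp_path n A B p k i)))"
 proof (rule sum.cong[OF refl])
 fix p assume p: "p \<in> box_pps A B M"
 show "?w (pp_path n A B p)=exp (- r * real (volume p)) *
 (\<Prod>k<A+B. \<Prod>i=0..<n. D k (pp_path n A B p k i))"
 using prod_step_weights[OF p n,of r] by (simp add: path_weight_def prod.distrib mult.commute)
 qed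
 finally show ?thesis by simp
qed

section \<open>Marked sites\<close>

text \<open>An occupied mark contributes \<open>1 + f\<close>. The parameter is a generating
  variable: its limit at infinity will detect that all marks are occupied.\<close>

definition site_weight :: "nat => (nat => nat) => (nat => nat) => real => nat => nat => real" where
 "site_weight m uk ux f k x=(\<Prod>u<m. if uk u=k & ux u=x then 1+f else 1)"

definition occupied :: "nat => nat => nat => nat => (nat => nat => nat) => bool" where
 "occupied n A k x p \<longleftrightarrow> (\<exists>i<n. diag_part A p k i+vacuum n i=x)"

lemma prod_site_weight:
 assumes p: "p \<in> box_pps A B M" and n: "A<=n" "B<=n" and uk: "\<And>u. u < m ==> uk u < A+B"
 shows "(\<Prod>k<A+B. \<Prod>i=0..<n. site_weight m uk ux f k (pp_path n A B p k i)) =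
 (\<Prod>u<m. if occupied n A (uk u) (ux u) p then 1+f else 1)"
proof -
 let ?s = "pp_path n A B p"
 have "(\<Prod>k<A+B. \<Prod>i=0..<n. site_weight m uk ux f k (?s k i)) =
 (\<Prod>u<m. \<Prod>k<A+B. \<Prod>i=0..<n. if uk u=k & ux u = ?s k i then 1+f else 1)"
 proof -
 have "(\<Prod>k<A+B. \<Prod>i=0..<n. \<Prod>u<m. if uk u=k & ux u = ?s k i then 1+f else 1) =
 (\<Prod>k<A+B. \<Prod>u<m. \<Prod>i=0..<n. if uk u=k & ux u = ?s k i then 1+f else 1)"
 by (rule prod.cong[OF refl],rule prod.swap)
 also have "... = (\<Prod>u<m. \<Prod>k<A+B. \<Prod>i=0..<n. if uk u=k & ux u = ?s k i then 1+f else 1)"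
 by (rule prod.swap)
 finally show ?thesis by (simp only: site_weight_def)
 qed
 also have "... = (\<Prod>u<m. if occupied n A (uk u) (ux u) p then 1+f else 1)"
 proof (rule prod.cong[OF refl])
 fix u assume "u \<in> {..<m}"
 hence u: "uk u < A+B" using uk by simp
 have s: "?s (uk u) i=diag_part A p (uk u) i+vacuum n i" if "i < n" for i
 using u that by (simp add: pp_path_def)
 have "?s \<in> interlaced_paths n A B (M+n)" by (rule pp_path_interlaced[OF p n])
 hence "?s (uk u) \<in> dec_tuples n (M+n)"
 using u by (auto simp: interlaced_paths_def paths_def)
 hence inj: "inj_on (?s (uk u)) {0..<n}" by (rule dec_tuples_inj_on)
 have "(\<Prod>k<A+B. \<Prod>i=0..<n. if uk u=k & ux u = ?s k i then 1+f else 1)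
 = (\<Prod>k<A+B. if k=uk u then (\<Prod>i=0..<n. if ux u = ?s (uk u) i then 1+f else 1) else 1)"
 by (rule prod.cong[OF refl]) auto
 also have "... = (\<Prod>i=0..<n. if ux u = ?s (uk u) i then 1+f else 1)"
 using u by simp
 also have "... = (if occupied n A (uk u) (ux u) p then 1+f else 1)"
 proof (cases "occupied n A (uk u) (ux u) p")
 case True
 then obtain i where i: "i < n" "?s (uk u) i=ux u" using s by (auto simp: occupied_def)
 have "(\<Prod>j=0..<n. if ux u = ?s (uk u) j then 1+f else 1)
 = (\<Prod>j=0..<n. if j=i then 1+f else 1)"
 proof (rule prod.cong[OF refl])
 fix j assume "j \<in> {0..<n}"
 hence "ux u = ?s (uk u) j \<longleftrightarrow> j=i" using i inj_on_eq_iff[OF inj,of i j] by auto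
 thus "(if ux u = ?s (uk u) j then 1+f else 1)=(if j=i then 1+f else 1)" by simp
 qed
 thus ?thesis using True i by simp
 next
 case False
 hence "\<forall>i\<in>{0..<n}. ux u ~= ?s (uk u) i" using s by (force simp: occupied_def)
 thus ?thesis using False by simp
 qed
 finally show "(\<Prod>k<A+B. \<Prod>i=0..<n. if uk u=k & ux u = ?s k i then 1+f else 1)
 = (if occupied n A (uk u) (ux u) p then 1+f else 1)" .
 qed
 finally show ?thesis .
qed

text \<open>Distinct marks meet a given site at most once, so the product is affine in
  \<open>f\<close>. The perturbation expansion uses the weight in this form.\<close>

lemma site_weight_linear:
 assumes "inj_on (%u. (uk u,ux u)) {..<m}"
 shows "site_weight m uk ux f k x=1+f*(\<Sum>u<m. if uk u=k & ux u=x then 1 else 0)"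
proof (cases "\<exists>u<m. uk u=k & ux u=x")
 case True
 then obtain u where u: "u < m" "uk u=k" "ux u=x" by auto
 have e: "uk v = k & ux v = x \<longleftrightarrow> v = u" if "v < m" for v
 using inj_onD[OF assms,of v u] u that by auto
 have "site_weight m uk ux f k x=(\<Prod>v<m. if v = u then 1+f else 1)"
 unfolding site_weight_def by (rule prod.cong[OF refl]) (use e in auto)
 moreover have "(\<Sum>v<m. if uk v = k & ux v = x then 1 else 0)=(\<Sum>v<m. if v = u then 1 else 0 :: real)"
 by (rule sum.cong[OF refl]) (use e in auto)
 ultimately show ?thesis using u(1) by simp
next
 case False
 hence "\<And>u. u < m ==> ~ (uk u=k & ux u=x)" by auto
 hence "site_weight m uk ux f k x=(\<Prod>u<m. 1)"
 "(\<Sum>u<m. if uk u=k & ux u=x then 1 else 0)=(\<Sum>u<m. 0 :: real)"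
 unfolding site_weight_def by (intro prod.cong sum.cong; auto)+
 thus ?thesis by simp
qed

lemma weighted_box_sum:
 assumes n: "0 < n" "A<=n" "B<=n" and uk: "\<And>u. u < m ==> uk u < A+B"
 shows "(\<Sum>p\<in>box_pps A B M. exp (- r * real (volume p)) *
 (\<Prod>u<m. if occupied n A (uk u) (ux u) p then 1+f else 1)) =
 detn n (%i j. evolve (M+n) (site_weight m uk ux f) (step_kernel r A) (A+B) (vacuum n i) (vacuum n j))"
 unfolding box_sum_eq_detn[OF n,symmetric]
 by (rule sum.cong[OF refl]) (simp add: prod_site_weight[OF _ n(2,3) uk])

section \<open>Absolutely convergent Laurent series on a circle\<close>

definition cv :: "(int => real) => (int => real) => int => real" where
 "cv c d n=(\<Sum>\<^sub>\<infinity>k. c k * d (n-k))"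

text \<open>Absolute summability at radius \<open>rho\<close> is built in, so that products of
  symbols are convolutions of coefficients and coefficients are Fourier coefficients on that
  circle.\<close>

definition laurent_on :: "(int => real) => real => (complex => complex) => bool" where
 "laurent_on c rho f \<longleftrightarrow> rho > 0 & (%n. \<bar>c n\<bar> * rho powi n) summable_on UNIV \<and>
 (\<forall>w. cmod w = rho --> ((%n. of_real (c n) * w powi n) has_sum f w) UNIV)"

text \<open>Fubini for the double series after the change of variables from \<open>(n, k)\<close> to
  \<open>(k, n - k)\<close>.\<close>

lemma has_sum_product_UNIV:
 fixes f g :: "int => 'a :: {banach,real_normed_field,second_countable_topology}"
 assumes "(%k. norm (f k)) summable_on UNIV" "(%k. norm (g k)) summable_on UNIV"
 and "(f has_sum F) UNIV" "(g has_sum G) UNIV"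
 shows "((%n. \<Sum>\<^sub>\<infinity>k. f k * g (n-k)) has_sum F * G) UNIV"
 and "(%k. norm (f k * g (n-k))) summable_on UNIV"
proof -
 have ab: "(%x. norm (case x of (k,l) => f k * g l)) summable_on UNIV \<times> UNIV"
 by (rule iffD2[OF Infinite_Sum.abs_summable_on_Sigma_iff],use assms(1,2) in simp)
 (simp add: norm_mult infsum_cmult_right' summable_on_cmult_right summable_on_cmult_left
 infsum_nonneg abs_mult)
 hence sm: "(%(k,l). f k * g l) summable_on UNIV \<times> UNIV" by (rule abs_summable_summable)
 have s: "((%(k,l). f k * g l) has_sum F * G) (UNIV \<times> UNIV)"
 by (rule has_sum_SigmaI[OF _ _ sm]) (use assms in \<open>auto intro: has_sum_cmult_right has_sum_cmult_left\<close>)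
 have bij: "bij_betw (%(n,k). (k,n-k)) (UNIV \<times> UNIV) (UNIV \<times> (UNIV :: int set))"
 by (rule bij_betw_byWitness[where f' = "%(k,l). (k+l,k)"]) auto
 have s2: "((%(n,k). f k * g (n-k)) has_sum F * G) (UNIV \<times> UNIV)"
 using has_sum_reindex_bij_betw[OF bij,of "%(k,l). f k * g l" "F * G"] s
 by (simp add: case_prod_unfold)
 have ab2: "(%x. norm (case x of (n,k) => f k * g (n-k))) summable_on UNIV \<times> UNIV"
 using summable_on_reindex_bij_betw[OF bij,of "%x. norm (case x of (k,l) => f k * g l)"] ab
 by (simp add: case_prod_unfold)
 show ab3: "(%k. norm (f k * g (n-k))) summable_on UNIV" for n
 using summable_on_SigmaD1[of "%n k. norm (f k * g (n-k))" UNIV "%_. UNIV" n] ab2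
 by (simp add: case_prod_unfold)
 show "((%n. \<Sum>\<^sub>\<infinity>k. f k * g (n-k)) has_sum F * G) UNIV"
 by (rule has_sum_SigmaD[OF s2]) (use abs_summable_summable[OF ab3] in \<open>auto intro: has_sum_infsum\<close>)
qed

lemma powi_sub_mult:
 fixes w :: "'a :: field"
 assumes "w ~= 0"
 shows "w powi k * w powi (n-k)=w powi n"
 using assms by (simp add: power_int_diff)

lemma laurent_on_cv:
 assumes c: "laurent_on c rho f" and d: "laurent_on d rho g"
 shows "laurent_on (cv c d) rho (%w. f w * g w)"
 and "(%k. norm (c k * d (n-k))) summable_on UNIV"
proof -
 have rho: "rho > 0" using c by (simp add: laurent_on_def)
 have sc: "(%n. \<bar>c n\<bar> * rho powi n) summable_on UNIV" and sd: "(%n. \<bar>d n\<bar> * rho powi n) summable_on UNIV"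
 using c d by (auto simp: laurent_on_def)
 have nn: "norm (\<bar>c n\<bar> * rho powi n) = \<bar>c n\<bar> * rho powi n" "norm (\<bar>d n\<bar> * rho powi n) = \<bar>d n\<bar> * rho powi n" for n
 using rho by (simp_all add: abs_mult)
 note R=has_sum_product_UNIV[of "%n. \<bar>c n\<bar> * rho powi n" "%n. \<bar>d n\<bar> * rho powi n",
 unfolded nn,OF sc sd has_sum_infsum[OF sc] has_sum_infsum[OF sd]]
 have p: "\<bar>c k\<bar> * rho powi k*(\<bar>d (n-k)\<bar> * rho powi (n-k)) = \<bar>c k * d (n-k)\<bar> * rho powi n" for k n
 using powi_sub_mult[of rho k n] rho by (simp add: abs_mult mult_ac)
 have ab: "(%k. norm (c k * d (n-k))) summable_on UNIV" for n
 using R(2)[of n] rho unfolding p by (simp add: summable_on_cmult_left' abs_mult)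
 thus "(%k. norm (c k * d (n-k))) summable_on UNIV" .
 have 1: "(%n. \<bar>cv c d n\<bar> * rho powi n) summable_on UNIV"
 proof (rule summable_on_comparison_test[OF has_sum_imp_summable[OF R(1)]])
 fix n :: int
 have "\<bar>cv c d n\<bar> * rho powi n<=(\<Sum>\<^sub>\<infinity>k. \<bar>c k * d (n-k)\<bar>) * rho powi n"
 unfolding cv_def using norm_infsum_bound[OF ab[of n]] rho by (intro mult_right_mono) auto
 also have "... = (\<Sum>\<^sub>\<infinity>k. \<bar>c k\<bar> * rho powi k*(\<bar>d (n-k)\<bar> * rho powi (n-k)))"
 unfolding p by (rule infsum_cmult_left'[symmetric])
 finally show "\<bar>cv c d n\<bar> * rho powi n <= ..." .
 qed (use rho in auto)
 have 2: "((%n. of_real (cv c d n) * w powi n) has_sum f w * g w) UNIV" if w: "cmod w = rho" for w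
 proof -
 have w0: "w ~= 0" using w rho by auto
 have "((%n. \<Sum>\<^sub>\<infinity>k. of_real (c k) * w powi k*(of_real (d (n-k)) * w powi (n-k))) has_sum f w * g w) UNIV"
 by (rule has_sum_product_UNIV(1)) (use c d w in \<open>auto simp: laurent_on_def norm_mult norm_power_int\<close>)
 moreover have "(\<Sum>\<^sub>\<infinity>k. of_real (c k) * w powi k*(of_real (d (n-k)) * w powi (n-k)))
 = of_real (cv c d n) * w powi n" for n
 proof -
 have "(\<Sum>\<^sub>\<infinity>k. of_real (c k) * w powi k*(of_real (d (n-k)) * w powi (n-k)))
 = (\<Sum>\<^sub>\<infinity>k. complex_of_real (c k * d (n-k)) * w powi n)"
 by (rule infsum_cong) (use powi_sub_mult[OF w0,of _ n] in \<open>simp add: mult_ac\<close>)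
 also have "... = (\<Sum>\<^sub>\<infinity>k. complex_of_real (c k * d (n-k))) * w powi n"
 by (rule infsum_cmult_left')
 also have "(\<Sum>\<^sub>\<infinity>k. complex_of_real (c k * d (n-k))) = of_real (cv c d n)"
 unfolding cv_def using abs_summable_summable[OF ab[of n]]
 by (intro infsumI has_sum_of_real has_sum_infsum)
 finally show ?thesis .
 qed
 ultimately show ?thesis by simp
 qed
 show "laurent_on (cv c d) rho (%w. f w * g w)" using rho 1 2 by (auto simp: laurent_on_def)
qed

lemma laurent_on_finite_support:
 assumes "rho > 0" "finite S" "\<And>n. n \<notin> S ==> c n=0"
 and "\<And>w. cmod w = rho ==> f w=(\<Sum>n\<in>S. of_real (c n) * w powi n)"
 shows "laurent_on c rho f"
proof -
 have "(%n. \<bar>c n\<bar> * rho powi n) summable_on UNIV"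
 using assms(2,3) by (intro finite_nonzero_values_imp_summable_on) (auto intro: finite_subset[of _ S])
 moreover have "((%n. of_real (c n) * w powi n) has_sum f w) UNIV" if "cmod w = rho" for w
 using assms(2,3) assms(4)[OF that] by (intro has_sum_finite_neutralI[of S]) auto
 ultimately show ?thesis using assms(1) by (auto simp: laurent_on_def)
qed

definition delta_seq :: "int => real" where
 "delta_seq n=(if n=0 then 1 else 0)"

definition geom_up :: "real => int => real" where
 "geom_up a n=(if n >= 0 then a powi n else 0)"

definition geom_down :: "real => int => real" where
 "geom_down b n=(if n<=0 then b powi (- n) else 0)"

definition lin_up :: "real => int => real" where
 "lin_up a n=(if n=0 then 1 else if n=1 then-a else 0)"

definition lin_down :: "real => int => real" where
 "lin_down b n=(if n=0 then 1 else if n = - 1 then-b else 0)"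

lemma laurent_on_delta: "rho > 0 ==> laurent_on delta_seq rho (%_. 1)"
 by (rule laurent_on_finite_support[of _ "{0}"]) (auto simp: delta_seq_def)

lemma laurent_on_lin_up: "rho > 0 ==> laurent_on (lin_up a) rho (%w. 1-of_real a * w)"
 by (rule laurent_on_finite_support[of _ "{0,1}"]) (auto simp: lin_up_def)

lemma laurent_on_lin_down: "rho > 0 ==> laurent_on (lin_down b) rho (%w. 1-of_real b/w)"
 by (rule laurent_on_finite_support[of _ "{0,- 1}"]) (auto simp: lin_down_def power_int_minus divide_inverse)

lemma has_sum_geometric_int:
 fixes x :: "'a :: {real_normed_field,banach}"
 assumes "norm x < 1"
 shows "((%n. if n >= 0 then x powi n else 0) has_sum 1/(1-x)) (UNIV :: int set)"
 and "((%n. if n<=0 then x powi (- n) else 0) has_sum 1/(1-x)) (UNIV :: int set)"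
proof -
 have "(%n. x^n) sums (1/(1-x))" using assms by (rule geometric_sums)
 moreover have "summable (%n. norm (x^n))" using assms by (simp add: norm_power summable_geometric)
 ultimately have h: "((%n. x^n) has_sum 1/(1-x)) UNIV"
 using norm_summable_imp_has_sum[of "%n. x^n" "1/(1-x)"] by simp
 have "((%n. x powi n) has_sum 1/(1-x)) {0 :: int..}"
 by (rule iffD1[OF has_sum_reindex_bij_witness[where S=UNIV and j=int and i=nat and g = "%n. x^n"] h])
 (auto simp: power_int_def)
 thus "((%n. if n >= 0 then x powi n else 0) has_sum 1/(1-x)) (UNIV :: int set)"
 by (rule iffD1[OF has_sum_cong_neutral,rotated -1]) auto
 have "((%n. x powi (- n)) has_sum 1/(1-x)) {..0 :: int}"
 by (rule iffD1[OF has_sum_reindex_bij_witness[where S=UNIV and i = "%n. nat (- n)" and j = "%n. - int n" and g = "%n. x^n"] h])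
 (auto simp: power_int_def)
 thus "((%n. if n<=0 then x powi (- n) else 0) has_sum 1/(1-x)) (UNIV :: int set)"
 by (rule iffD1[OF has_sum_cong_neutral,rotated -1]) auto
qed

lemma laurent_on_geom_up:
 assumes "0<=a" "rho > 0" "a * rho < 1"
 shows "laurent_on (geom_up a) rho (%w. 1/(1-of_real a * w))"
proof -
 have "(%n. \<bar>geom_up a n\<bar> * rho powi n)=(%n. if n >= 0 then (a * rho) powi n else 0)"
 using assms by (auto simp: geom_up_def fun_eq_iff power_int_mult_distrib abs_mult)
 moreover have "((%n. of_real (geom_up a n) * w powi n) has_sum 1/(1-of_real a * w)) UNIV"
 if "cmod w = rho" for w
 proof -
 have "(%n. complex_of_real (geom_up a n) * w powi n)=(%n. if n >= 0 then (of_real a * w) powi n else 0)"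
 by (auto simp: geom_up_def fun_eq_iff power_int_mult_distrib of_real_power_int)
 thus ?thesis
 using has_sum_geometric_int(1)[of "of_real a * w"] that assms by (simp add: norm_mult)
 qed
 ultimately show ?thesis
 using has_sum_geometric_int(1)[of "a * rho"] assms by (auto simp: laurent_on_def dest: has_sum_imp_summable)
qed

lemma laurent_on_geom_down:
 assumes "0<=b" "b < rho"
 shows "laurent_on (geom_down b) rho (%w. 1/(1-of_real b/w))"
proof -
 have rho: "rho > 0" using assms by simp
 have "(%n. \<bar>geom_down b n\<bar> * rho powi n)=(%n. if n<=0 then (b / rho) powi (- n) else 0)"
 using assms rho by (auto simp: geom_down_def fun_eq_iff power_int_divide_distrib power_int_minus field_simps)
 moreover have "((%n. of_real (geom_down b n) * w powi n) has_sum 1/(1-of_real b/w)) UNIV"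
 if "cmod w = rho" for w
 proof -
 have "w ~= 0" using that rho by auto
 hence "(%n. complex_of_real (geom_down b n) * w powi n)
 = (%n. if n<=0 then (of_real b/w) powi (- n) else 0)"
 by (auto simp: geom_down_def fun_eq_iff power_int_divide_distrib power_int_minus of_real_power_int field_simps)
 thus ?thesis
 using has_sum_geometric_int(2)[of "of_real b/w"] that assms by (simp add: norm_divide)
 qed
 ultimately show ?thesis
 using has_sum_geometric_int(2)[of "b / rho"] assms rho by (auto simp: laurent_on_def dest: has_sum_imp_summable)
qed

lemma integral_cis_period:
 "integral {- pi..pi} (%th. cis (of_int n * th))=(if n=0 then of_real (2 * pi) else 0)"
proof (cases "n=0")
 case True
 have "integral {- pi..pi} (%th. 1 :: complex) = of_real (2 * pi)"
 using integral_const_real[of "- pi" pi "1 :: complex"] by (simp add: scaleR_conv_of_real)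
 thus ?thesis using True by simp
next
 case False
 let ?P = "%th. cis (of_int n * th)/(\<i> * of_int n)"
 have "((%th. cis (of_int n * th)) has_integral (?P pi - ?P (- pi))) {- pi..pi}"
 proof (rule fundamental_theorem_of_calculus)
 fix x
 show "(?P has_vector_derivative cis (of_int n * x)) (at x within {- pi..pi})"
 unfolding cis_conv_exp using False
 by (auto intro!: derivative_eq_intros has_vector_derivative_real_field simp: field_simps)
 qed simp
 moreover have "cis (of_int n * pi)=cis (of_int n*(- pi))"
 by (auto simp: cis.code sin_zero_iff_int2)
 ultimately show ?thesis using False by (simp add: integral_unique)
qed

text \<open>For an interval inside one period this is the coefficient of the function extended by 0,
  so the spectrum is indexed by the integers even for a short arc.\<close>

definition fourier_coeff :: "real => real => (real => complex) => int => complex" where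
 "fourier_coeff a b f n=1/(2 * pi) * integral {a..b} (%th. f th * cis (- (of_int n * th)))"

text \<open>Absolute summability allows integrating the series of \<open>g\<close> against
  \<open>f\<close> term by term.\<close>

lemma fourier_pairing:
 fixes f g :: "real => complex"
 assumes sum: "(%n. norm (c n)) summable_on UNIV"
 and g: "\<And>th. th \<in> {a..b} ==> ((%n. c n * cis (of_int n * th)) has_sum g th) UNIV"
 and f: "continuous_on {a..b} f"
 shows "((%n. c n * fourier_coeff a b f (- n)) has_sum 1/(2 * pi) * integral {a..b} (%th. f th * g th)) UNIV"
proof -
 obtain C where C: "\<And>th. th \<in> {a..b} ==> norm (f th)<=C"
 using compact_imp_bounded[OF compact_continuous_image[OF f compact_Icc]]
 unfolding bounded_iff by blast
 have "uniform_limit {a..b} (%X th. \<Sum>n\<in>X. f th*(c n * cis (of_int n * th))) (%th. f th * g th)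
 (finite_subsets_at_top UNIV)"
 proof (rule Weierstrass_m_test_general'[where M = "%n. C * norm (c n)"])
 fix n :: int and th assume "th \<in> {a..b}"
 thus "norm (f th*(c n * cis (of_int n * th)))<=C * norm (c n)"
 using C by (simp add: norm_mult mult_right_mono)
 qed (use g sum in \<open>auto intro: has_sum_cmult_right summable_on_cmult_right\<close>)
 then obtain I J where IJ:
 "\<And>X. ((%th. \<Sum>n\<in>X. f th*(c n * cis (of_int n * th))) has_integral I X) {a..b}"
 "((%th. f th * g th) has_integral J) {a..b}" "(I \<longlongrightarrow> J) (finite_subsets_at_top UNIV)"
 by (rule uniform_limit_integral) (auto intro!: continuous_intros f)
 let ?h = "%n. integral {a..b} (%th. f th*(c n * cis (of_int n * th)))"
 have hn: "?h n=2 * pi*(c n * fourier_coeff a b f (- n))" for n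
 proof -
 have "?h n=integral {a..b} (%th. c n*(f th * cis (of_int n * th)))"
 by (rule integral_cong) simp
 thus ?thesis by (simp add: fourier_coeff_def integral_mult_right)
 qed
 have "I X=(\<Sum>n\<in>X. ?h n)" if "finite X" for X
 proof -
 have "((%th. \<Sum>n\<in>X. f th*(c n * cis (of_int n * th))) has_integral (\<Sum>n\<in>X. ?h n)) {a..b}"
 by (intro has_integral_sum that integrable_integral integrable_continuous_interval continuous_intros f)
 thus ?thesis using IJ(1) has_integral_unique by blast
 qed
 hence "((%X. \<Sum>n\<in>X. ?h n) \<longlongrightarrow> J) (finite_subsets_at_top UNIV)"
 using IJ(3) by (subst (asm) tendsto_cong[of _ "%X. \<Sum>n\<in>X. ?h n"])
 (auto intro!: eventually_finite_subsets_at_top_weakI)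
 hence "(?h has_sum J) UNIV" by (simp add: has_sum_def)
 hence "((%n. 1/(2 * pi) * ?h n) has_sum 1/(2 * pi) * J) UNIV" by (rule has_sum_cmult_right)
 thus ?thesis unfolding hn using IJ(2) by (simp add: integral_unique)
qed

lemma laurent_on_fourier_coeff:
 assumes c: "laurent_on c rho f"
 shows "fourier_coeff (- pi) pi (%th. f (of_real rho * cis th)) n = of_real (c n * rho powi n)"
proof -
 have rho: "rho > 0" using c by (simp add: laurent_on_def)
 have 1: "(%n. norm (complex_of_real (c n * rho powi n))) summable_on UNIV"
 using c rho unfolding norm_of_real laurent_on_def by (simp add: abs_mult)
 have 2: "((%n. of_real (c n * rho powi n) * cis (of_int n * th)) has_sum f (of_real rho * cis th)) UNIV" for th
 proof -
 have "((%n. of_real (c n)*(of_real rho * cis th) powi n) has_sum f (of_real rho * cis th)) UNIV"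
 using c rho by (simp add: laurent_on_def norm_mult)
 thus ?thesis
 by (simp add: power_int_mult_distrib cis_power_int of_real_power_int mult_ac)
 qed
 have e: "fourier_coeff (- pi) pi (%th. cis (- (of_int n * th))) (- k)=(if k=n then 1 else 0)" for k
 proof -
 have "(%th. cis (- (of_int n * th)) * cis (- (of_int (- k) * th)))=(%th. cis (of_int (k-n) * th))"
 by (simp add: cis_mult algebra_simps)
 thus ?thesis
 unfolding fourier_coeff_def by (simp only: integral_cis_period) simp
 qed
 have "((%k. of_real (c k * rho powi k)*(if k=n then 1 else 0)) has_sum
 1/(2 * pi) * integral {- pi..pi} (%th. cis (- (of_int n * th)) * f (of_real rho * cis th))) UNIV"
 proof -
 have "continuous_on {- pi..pi} (%th. cis (- (of_int n * th)))" by (intro continuous_intros)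
 from fourier_pairing[OF 1 2 this] show ?thesis unfolding e by simp
 qed
 moreover have "((%k. of_real (c k * rho powi k)*(if k=n then 1 else 0)) has_sum
 of_real (c n * rho powi n)) (UNIV :: int set)"
 by (rule has_sum_finite_neutralI[of "{n}"]) auto
 ultimately show ?thesis
 unfolding fourier_coeff_def by (simp only: mult.commute[of _ "cis _"]) (rule has_sum_unique)
qed

text \<open>Identities between coefficient sequences are proved below by comparing symbols on a
  single circle.\<close>

lemma laurent_on_unique:
 assumes "laurent_on c rho f" "laurent_on d rho g" "\<And>w. cmod w = rho ==> f w=g w"
 shows "c=d"
proof
 fix n
 have rho: "rho > 0" using assms by (simp add: laurent_on_def)
 have "(%th. f (of_real rho * cis th))=(%th. g (of_real rho * cis th))"
 using assms(3) rho by (intro ext) (simp add: norm_mult)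
 hence "of_real (c n * rho powi n)=complex_of_real (d n * rho powi n)"
 using laurent_on_fourier_coeff[OF assms(1),of n] laurent_on_fourier_coeff[OF assms(2),of n] by metis
 thus "c n=d n" using rho by (simp del: of_real_mult)
qed

section \<open>Symbols of the steps and of their products\<close>

definition step_seq :: "real => nat => nat => int => real" where
 "step_seq r A k =
 (if k < A then geom_up (exp (step_rate r A k)) else geom_down (exp (- step_rate r A k)))"

definition step_inv :: "real => nat => nat => int => real" where
 "step_inv r A k =
 (if k < A then lin_up (exp (step_rate r A k)) else lin_down (exp (- step_rate r A k)))"

text \<open>This is the symbol of \<open>step_inv\<close>; the geometric sequence
  \<open>step_seq\<close> has the reciprocal symbol. Hence the exponent 1 of a step means the power
  -1 of \<open>step_sym\<close>.\<close>

definition step_sym :: "real => nat => nat => complex => complex" where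
 "step_sym r A k w=(if k < A then 1-of_real (exp (step_rate r A k)) * w
 else 1-of_real (exp (- step_rate r A k))/w)"

lemma step_kernel_eq: "step_kernel r A k x y=step_seq r A k (int y-int x)"
 by (auto simp: step_kernel_def step_seq_def geom_up_def geom_down_def exp_power_int algebra_simps)

lemma step_rate_neg: "r > 0 ==> k < A ==> step_rate r A k < 0"
 unfolding step_rate_def by (intro mult_pos_neg) auto

lemma step_rate_pos: "r > 0 ==> A<=k ==> 0 < step_rate r A k"
 unfolding step_rate_def by (intro mult_pos_pos) auto

text \<open>The circles on which the geometric series of the step converges: growing steps bound the
  radius from above, shrinking steps from below.\<close>

definition step_radius :: "real => nat => nat => real => bool" where
 "step_radius r A k rho \<longleftrightarrow>
 (if k < A then exp (step_rate r A k) * rho < 1 else exp (- step_rate r A k) < rho)"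

lemma step_radius_1: "r > 0 ==> step_radius r A k 1"
 using step_rate_neg[of r k A] step_rate_pos[of r A k] by (auto simp: step_radius_def)

lemma laurent_on_step_seq:
 "rho > 0 ==> step_radius r A k rho ==> laurent_on (step_seq r A k) rho (%w. 1/step_sym r A k w)"
 using laurent_on_geom_up[of "exp (step_rate r A k)" rho] laurent_on_geom_down[of "exp (- step_rate r A k)" rho]
 by (auto simp: step_seq_def step_sym_def step_radius_def)

lemma laurent_on_step_inv: "rho > 0 ==> laurent_on (step_inv r A k) rho (step_sym r A k)"
 using laurent_on_lin_up[of rho "exp (step_rate r A k)"] laurent_on_lin_down[of rho "exp (- step_rate r A k)"]
 unfolding step_inv_def step_sym_def[abs_def] by auto

lemma step_sym_nz:
 assumes "rho > 0" "step_radius r A k rho" "cmod w = rho"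
 shows "step_sym r A k w ~= 0"
proof
 assume z: "step_sym r A k w=0"
 show False
 proof (cases "k < A")
 case True
 hence "of_real (exp (step_rate r A k)) * w=1" using z by (simp add: step_sym_def)
 hence "cmod (of_real (exp (step_rate r A k)) * w)=1" by simp
 thus False using True assms by (simp add: step_radius_def norm_mult)
 next
 case False
 hence "of_real (exp (- step_rate r A k))/w=1" using z by (simp add: step_sym_def)
 hence "cmod (of_real (exp (- step_rate r A k))/w)=1" by simp
 thus False using False assms by (simp add: step_radius_def norm_divide)
 qed
qed

fun prodseq :: "(nat => int => real) => nat => int => real" where
 "prodseq F 0=delta_seq"
| "prodseq F (Suc k)=cv (prodseq F k) (F k)"

lemma laurent_on_prodseq:
 assumes "rho > 0" "\<And>j. j < K ==> laurent_on (F j) rho (g j)"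
 shows "laurent_on (prodseq F K) rho (%w. \<Prod>j<K. g j w)"
 using assms(2)
proof (induction K)
 case 0
 thus ?case using laurent_on_delta[OF assms(1)] by simp
next
 case (Suc K)
 thus ?case using laurent_on_cv(1)[of "prodseq F K" rho "%w. \<Prod>j<K. g j w" "F K" "g K"] by simp
qed

text \<open>Laurent coefficients of the product of the step symbols to the powers \<open>e j\<close>, where \<open>e j \<in> {-1, 0, 1}\<close>.\<close>

definition seqf :: "real => nat => nat => (nat => int) => int => real" where
 "seqf r A K e =
 prodseq (%j. if e j=1 then step_seq r A j else if e j = - 1 then step_inv r A j else delta_seq) K"

definition symf :: "real => nat => nat => (nat => int) => complex => complex" where
 "symf r A K e w=(\<Prod>j<K. step_sym r A j w powi (- e j))"

definition unit_exps :: "nat => (nat => int) => bool" where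
 "unit_exps K e \<longleftrightarrow> (\<forall>j<K. e j \<in> {- 1,0,1})"

lemma laurent_on_seqf:
 assumes "rho > 0" "unit_exps K e" "\<And>j. j < K ==> e j=1 ==> step_radius r A j rho"
 shows "laurent_on (seqf r A K e) rho (symf r A K e)"
 unfolding seqf_def symf_def[abs_def]
proof (rule laurent_on_prodseq[OF assms(1)])
 fix j assume j: "j < K"
 then consider "e j=1" | "e j = - 1" | "e j=0" using assms(2) by (auto simp: unit_exps_def)
 thus "laurent_on (if e j=1 then step_seq r A j else if e j = - 1 then step_inv r A j else delta_seq) rho
 (%w. step_sym r A j w powi (- e j))"
 proof cases
 case 1
 thus ?thesis
 using laurent_on_step_seq[OF assms(1) assms(3)[OF j 1]] by (simp add: power_int_minus divide_inverse)
 next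
 case 2
 thus ?thesis using laurent_on_step_inv[OF assms(1),of r A j] by simp
 next
 case 3
 thus ?thesis using laurent_on_delta[OF assms(1)] by simp
 qed
qed

lemma laurent_on_seqf_1:
 "r > 0 ==> unit_exps K e ==> laurent_on (seqf r A K e) 1 (symf r A K e)"
 by (rule laurent_on_seqf) (auto simp: step_radius_1)

lemma symf_mult:
 assumes "r > 0" "cmod w=1" "\<And>j. j < K ==> e j+e' j=e'' j"
 shows "symf r A K e w * symf r A K e' w=symf r A K e'' w"
 unfolding symf_def prod.distrib[symmetric]
proof (rule prod.cong[OF refl])
 fix j assume "j \<in> {..<K}"
 hence "- e'' j = - e j + - e' j" using assms(3)[of j] by simp
 moreover have "step_sym r A j w ~= 0" by (rule step_sym_nz[of 1]) (use assms step_radius_1 in auto)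
 ultimately show "step_sym r A j w powi (- e j) * step_sym r A j w powi (- e' j)=step_sym r A j w powi (- e'' j)"
 using power_int_add[of "step_sym r A j w" "- e j" "- e' j"] by simp
qed

text \<open>The unit circle lies in the domain of convergence of every step, so exponents can be
  added there, as long as all three vectors have entries in {-1, 0, 1}.\<close>

lemma seqf_cv:
 assumes "r > 0" "unit_exps K e" "unit_exps K e'" "unit_exps K e''" "\<And>j. j < K ==> e j+e' j=e'' j"
 shows "cv (seqf r A K e) (seqf r A K e')=seqf r A K e''"
 by (rule laurent_on_unique[OF laurent_on_cv(1)[OF laurent_on_seqf_1[OF assms(1,2)]
 laurent_on_seqf_1[OF assms(1,3)]] laurent_on_seqf_1[OF assms(1,4)]])
 (rule symf_mult[OF assms(1) _ assms(5)])

lemma seqf_single: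
 assumes "r > 0" "k < K"
 shows "seqf r A K (%j. if j=k then 1 else 0)=step_seq r A k"
proof (rule laurent_on_unique)
 show "laurent_on (seqf r A K (%j. if j=k then 1 else 0)) 1 (symf r A K (%j. if j=k then 1 else 0))"
 by (rule laurent_on_seqf_1) (use assms in \<open>auto simp: unit_exps_def\<close>)
 show "laurent_on (step_seq r A k) 1 (%w. 1/step_sym r A k w)"
 by (rule laurent_on_step_seq) (use assms step_radius_1 in auto)
 fix w
 have "symf r A K (%j. if j=k then 1 else 0) w=(\<Prod>j<K. if j=k then 1/step_sym r A k w else 1)"
 unfolding symf_def by (rule prod.cong[OF refl]) (auto simp: power_int_minus divide_inverse)
 thus "symf r A K (%j. if j=k then 1 else 0) w=1/step_sym r A k w" using assms by simp
qed

lemma seqf_zero: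
 assumes "r > 0" "\<And>j. j < K ==> e j=0"
 shows "seqf r A K e=delta_seq"
proof (rule laurent_on_unique)
 show "laurent_on (seqf r A K e) 1 (symf r A K e)"
 by (rule laurent_on_seqf_1) (use assms in \<open>auto simp: unit_exps_def\<close>)
 show "laurent_on delta_seq 1 (%w. 1)" by (rule laurent_on_delta) simp
qed (use assms in \<open>simp add: symf_def\<close>)

lemma cv_support_lower:
 assumes "\<And>n. n < a ==> c n=0" "\<And>n. n < b ==> d n=0" "n < a+b"
 shows "cv c d n=0"
proof -
 have "c k * d (n-k)=0" for k using assms(1)[of k] assms(2)[of "n-k"] assms(3) by (cases "k < a") auto
 thus ?thesis unfolding cv_def by (intro infsum_0)
qed

lemma cv_support_upper:
 assumes "\<And>n. a < n ==> c n=0" "\<And>n. b < n ==> d n=0" "a+b < n"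
 shows "cv c d n=0"
proof -
 have "c k * d (n-k)=0" for k using assms(1)[of k] assms(2)[of "n-k"] assms(3) by (cases "a < k") auto
 thus ?thesis unfolding cv_def by (intro infsum_0)
qed

text \<open>Only shrinking times reach downwards, and without their geometric series each of the
  \<open>K - A\<close> of them reaches down by at most one site.\<close>

lemma seqf_support_lower:
 assumes "\<And>j. j < K ==> A<=j ==> e j ~= 1" "n < - int (K-A)"
 shows "seqf r A K e n=0"
 using assms unfolding seqf_def
proof (induction K arbitrary: n)
 case 0
 thus ?case by (simp add: delta_seq_def)
next
 case (Suc K)
 let ?F = "%j. if e j=1 then step_seq r A j else if e j = - 1 then step_inv r A j else delta_seq"
 have F: "?F K i=0" if "i < - (if A<=K then 1 else 0)" for i
 using that Suc.prems(1)[of K]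
 by (auto simp: step_seq_def step_inv_def delta_seq_def geom_up_def lin_up_def lin_down_def split: if_splits)
 have P: "prodseq ?F K i=0" if "i < - int (K-A)" for i by (rule Suc.IH) (use Suc.prems(1) that in auto)
 show ?case
 unfolding prodseq.simps
 by (rule cv_support_lower[OF P F]) (use Suc.prems(2) in \<open>auto split: if_splits simp: Suc_diff_le\<close>)
qed

lemma seqf_support_upper:
 assumes "\<And>j. j < K ==> j < A ==> e j=0" "0 < n"
 shows "seqf r A K e n=0"
 using assms unfolding seqf_def
proof (induction K arbitrary: n)
 case 0
 thus ?case by (simp add: delta_seq_def)
next
 case (Suc K)
 let ?F = "%j. if e j=1 then step_seq r A j else if e j = - 1 then step_inv r A j else delta_seq"
 have F: "?F K i=0" if "0 < i" for i
 using that Suc.prems(1)[of K]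
 by (auto simp: step_seq_def step_inv_def delta_seq_def geom_down_def lin_down_def split: if_splits)
 have P: "prodseq ?F K i=0" if "0 < i" for i by (rule Suc.IH) (use Suc.prems(1) that in auto)
 show ?case
 unfolding prodseq.simps by (rule cv_support_upper[OF P F]) (use Suc.prems(2) in auto)
qed

lemma laurent_on_l1:
 assumes "(%n. \<bar>c n\<bar>) summable_on UNIV"
 shows "laurent_on c 1 (%w. \<Sum>\<^sub>\<infinity>n. of_real (c n) * w powi n)"
proof -
 have "((%n. of_real (c n) * w powi n) has_sum (\<Sum>\<^sub>\<infinity>n. of_real (c n) * w powi n)) UNIV"
 if "cmod w=1" for w :: complex
 proof -
 have "norm (of_real (c n) * w powi n) = \<bar>c n\<bar>" for n
 using that by (simp add: norm_mult norm_power_int)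
 hence "(%n. norm (of_real (c n) * w powi n)) summable_on UNIV" using assms by simp
 thus ?thesis by (rule has_sum_infsum[OF abs_summable_summable])
 qed
 thus ?thesis using assms by (auto simp: laurent_on_def)
qed

lemma laurent_on_abs_summable: "laurent_on c 1 f ==> (%n. \<bar>c n\<bar>) summable_on UNIV"
 by (simp add: laurent_on_def)

section \<open>The evolution without truncation\<close>

text \<open>Sites range over all integers, which makes a step a plain convolution;
  \<open>evo_Suc_has_sum_nat\<close> shows that negative sites do not contribute between nonnegative
  endpoints.\<close>

fun evo :: "real => nat => (nat => int => real) => nat => int => int => real" where
 "evo r A D 0 x y=(if y=x then 1 else 0)"
| "evo r A D (Suc k) x y=cv (%z. evo r A D k x z * D k z) (step_seq r A k) y"

lemma evo_l1:
 assumes r: "r > 0" and D: "\<And>k z. \<bar>D k z\<bar> <= C"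
 shows "(%z. \<bar>evo r A D k x z\<bar>) summable_on UNIV" "(%z. \<bar>evo r A D k x z * D k z\<bar>) summable_on UNIV"
proof -
 have wt: "(%z. \<bar>evo r A D k x z * D k z\<bar>) summable_on UNIV" if "(%z. \<bar>evo r A D k x z\<bar>) summable_on UNIV" for k
 by (rule summable_on_comparison_test[OF summable_on_cmult_left[OF that,of C]])
 (auto simp: abs_mult intro!: mult_left_mono D)
 have "(%z. \<bar>evo r A D k x z\<bar>) summable_on UNIV" for k
 proof (induction k)
 case 0
 have "(%z. \<bar>evo r A D 0 x z\<bar>) summable_on UNIV"
 by (rule finite_nonzero_values_imp_summable_on) (auto intro: finite_subset[of _ "{x}"])
 thus ?case .
 next
 case (Suc k)
 have "laurent_on (cv (%z. evo r A D k x z * D k z) (step_seq r A k)) 1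
 (%w. (\<Sum>\<^sub>\<infinity>n. of_real (evo r A D k x n * D k n) * w powi n)*(1/step_sym r A k w))"
 by (rule laurent_on_cv(1)[OF laurent_on_l1[OF wt[OF Suc]] laurent_on_step_seq])
 (use r step_radius_1 in auto)
 thus ?case by (simp add: laurent_on_def)
 qed
 thus "(%z. \<bar>evo r A D k x z\<bar>) summable_on UNIV" "(%z. \<bar>evo r A D k x z * D k z\<bar>) summable_on UNIV"
 using wt by auto
qed

lemma evo_Suc_has_sum:
 assumes r: "r > 0" and D: "\<And>k z. \<bar>D k z\<bar> <= C"
 shows "((%z. evo r A D k x z * D k z * step_seq r A k (y-z)) has_sum evo r A D (Suc k) x y) UNIV"
proof -
 have "(%z. norm (evo r A D k x z * D k z * step_seq r A k (y-z))) summable_on UNIV"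
 by (rule laurent_on_cv(2)[OF laurent_on_l1[OF evo_l1(2)[OF r D]] laurent_on_step_seq])
 (use r step_radius_1 in auto)
 thus ?thesis unfolding evo.simps cv_def by (rule has_sum_infsum[OF abs_summable_summable])
qed

lemma step_seq_nonneg: "step_seq r A k n >= 0"
 by (auto simp: step_seq_def geom_up_def geom_down_def)

lemma evo_nonneg: "(\<And>k z. D k z >= 0) ==> evo r A D k x y >= 0"
 by (induction k arbitrary: y) (auto simp: cv_def intro!: infsum_nonneg mult_nonneg_nonneg step_seq_nonneg)

lemma evo_support: "k<=A ==> y < x ==> evo r A D k x y=0"
proof (induction k arbitrary: y)
 case (Suc k)
 have "evo r A D k x z * D k z * step_seq r A k (y-z)=0" for z
 using Suc.IH[of z] Suc.prems by (cases "z < x") (auto simp: step_seq_def geom_up_def)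
 thus ?case unfolding evo.simps cv_def by (intro infsum_0)
qed simp

text \<open>Up to time \<open>A\<close> particles only move up from a nonnegative start, afterwards
  a step only moves down to a nonnegative end; either way the intermediate site is
  nonnegative.\<close>

lemma evo_Suc_has_sum_nat:
 assumes r: "r > 0" and D: "\<And>k z. \<bar>D k z\<bar> <= C"
 shows "((%z. evo r A D k (int x) (int z) * D k (int z) * step_kernel r A k z y) has_sum
 evo r A D (Suc k) (int x) (int y)) UNIV"
proof -
 let ?g = "%z. evo r A D k (int x) z * D k z * step_seq r A k (int y-z)"
 have "?g z=0" if "z < 0" for z
 proof (cases "k < A")
 case True
 thus ?thesis using that evo_support[of k A z "int x"] by simp
 qed (use that in \<open>auto simp: step_seq_def geom_down_def\<close>)
 hence "(?g has_sum evo r A D (Suc k) (int x) (int y)) {0..}"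
 using evo_Suc_has_sum[where r=r and A=A and D=D and C=C and k=k and x = "int x" and y = "int y"] r D
 by (subst has_sum_cong_neutral[where T=UNIV and g = ?g]) auto
 moreover have "((%z. evo r A D k (int x) (int z) * D k (int z) * step_kernel r A k z y) has_sum
 evo r A D (Suc k) (int x) (int y)) UNIV \<longleftrightarrow> (?g has_sum evo r A D (Suc k) (int x) (int y)) {0..}"
 by (rule has_sum_reindex_bij_witness[where j=int and i=nat]) (auto simp: step_kernel_eq)
 ultimately show ?thesis by blast
qed

text \<open>Everything is nonnegative, so the full evolution dominates the truncated one, and
  Tannery's theorem passes to the limit step by step.\<close>

lemma evolve_tendsto_evo:
 assumes r: "r > 0" and D: "\<And>k z. 0<=D k z" "\<And>k z. D k z<=C"
 and D': "\<And>k z. D' k z=D k (int z)"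
 shows "0<=evolve L D' (step_kernel r A) k x y"
 and "evolve L D' (step_kernel r A) k x y<=evo r A D k (int x) (int y)"
 and "(%L. evolve L D' (step_kernel r A) k x y) \<longlonglongrightarrow> evo r A D k (int x) (int y)"
proof -
 have Da: "\<bar>D k z\<bar> <= C" for k z using D by simp
 have T: "step_kernel r A k x y >= 0" for k x y by (simp add: step_kernel_def)
 let ?E = "%L. evolve L D' (step_kernel r A)"
 have nn: "0 <= ?E L k x y" for L k x y
 by (induction k arbitrary: y) (auto intro!: sum_nonneg mult_nonneg_nonneg T simp: D' D)
 thus "0 <= ?E L k x y" .
 have le: "?E L k x y<=evo r A D k (int x) (int y)" for L k x y
 proof (induction k arbitrary: y)
 case (Suc k)
 have "?E L (Suc k) x y<=(\<Sum>z<L. evo r A D k (int x) (int z) * D k (int z) * step_kernel r A k z y)"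
 by (auto intro!: sum_mono mult_right_mono T Suc D simp: D')
 also have "... <= evo r A D (Suc k) (int x) (int y)"
 by (rule finite_sum_le_has_sum[OF evo_Suc_has_sum_nat[OF r Da]])
 (auto intro!: mult_nonneg_nonneg T D evo_nonneg)
 finally show ?case .
 qed simp
 thus "?E L k x y<=evo r A D k (int x) (int y)" .
 show "(%L. ?E L k x y) \<longlonglongrightarrow> evo r A D k (int x) (int y)"
 proof (induction k arbitrary: y)
 case (Suc k)
 let ?a = "%z L. if z < L then ?E L k x z * D' k z * step_kernel r A k z y else 0"
 let ?b = "%z. evo r A D k (int x) (int z) * D k (int z) * step_kernel r A k z y"
 have hs: "(?b has_sum evo r A D (Suc k) (int x) (int y)) UNIV" by (rule evo_Suc_has_sum_nat[OF r Da])
 have "(%L. ?a z L) \<longlonglongrightarrow> ?b z" for z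
 proof (rule Lim_transform_eventually)
 show "(%L. ?E L k x z * D' k z * step_kernel r A k z y) \<longlonglongrightarrow> ?b z"
 using Suc[of z] by (simp only: D'[of k z]) (intro tendsto_mult tendsto_const)
 show "\<forall>\<^sub>F L in sequentially. ?E L k x z * D' k z * step_kernel r A k z y = ?a z L"
 using eventually_gt_at_top[of z] by eventually_elim auto
 qed
 moreover have "norm (?a z L) <= ?b z" for z L
 proof -
 have "0 <= ?b z" by (intro mult_nonneg_nonneg evo_nonneg D T)
 moreover have "?E L k x z * D k (int z) * step_kernel r A k z y <= ?b z"
 by (intro mult_right_mono le D T)
 moreover have "0 <= ?E L k x z * D k (int z) * step_kernel r A k z y"
 by (intro mult_nonneg_nonneg nn D T)
 ultimately show ?thesis by (simp add: D')
 qed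
 hence "\<forall>\<^sub>F (z,L) in at_top \<times>\<^sub>F sequentially. norm (?a z L) <= ?b z" by (intro always_eventually) auto
 moreover have "summable ?b" using hs by (intro summable_on_imp_summable has_sum_imp_summable)
 ultimately have "(%L. \<Sum>z. ?a z L) \<longlonglongrightarrow> (\<Sum>z. ?b z)"
 using tannerys_theorem[of ?a ?b sequentially ?b] by auto
 moreover have "(\<Sum>z. ?a z L) = ?E L (Suc k) x y" for L
 using suminf_finite[of "{..<L}" "%z. ?a z L"] by simp
 moreover have "(\<Sum>z. ?b z)=evo r A D (Suc k) (int x) (int y)"
 using has_sum_imp_sums[OF hs] by (simp add: sums_iff)
 ultimately show ?case by simp
 qed simp
qed

lemma has_sum_finite_sum:
 fixes f :: "nat => 'a => real"
 assumes "\<And>u. u < m ==> (f u has_sum s u) X"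
 shows "((%z. \<Sum>u<m. f u z) has_sum (\<Sum>u<m. s u)) X"
 using assms by (induction m) (auto intro!: has_sum_add)

section \<open>Free transitions and reduction to the marked points\<close>

text \<open>Exponents whose \<open>seqf\<close> is the free transition kernel between the two
  times.\<close>

definition trx :: "nat => nat => nat => int" where
 "trx s e j=(if s<=j & j < e then 1 else 0)"

lemma unit_exps_trx: "unit_exps K (trx s e)"
 by (auto simp: unit_exps_def trx_def)

lemma seqf_trx_Suc:
 assumes "r > 0" "s<=k" "k < K"
 shows "cv (seqf r A K (trx s k)) (step_seq r A k)=seqf r A K (trx s (Suc k))"
 unfolding seqf_single[OF assms(1,3),symmetric]
 by (rule seqf_cv) (use assms in \<open>auto simp: unit_exps_def trx_def\<close>)

lemma seqf_trx_shift_has_sum: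
 assumes "r > 0" "s<=k" "k < K"
 shows "((%z. seqf r A K (trx s k) (z-a) * step_seq r A k (y-z)) has_sum
 seqf r A K (trx s (Suc k)) (y-a)) UNIV"
proof -
 let ?c = "seqf r A K (trx s k)" and ?d = "step_seq r A k"
 have "(%z. norm (?c z * ?d (y-a-z))) summable_on UNIV"
 by (rule laurent_on_cv(2)[OF laurent_on_seqf_1 laurent_on_step_seq])
 (use assms step_radius_1 unit_exps_trx in auto)
 hence "((%z. ?c z * ?d (y-a-z)) has_sum cv ?c ?d (y-a)) UNIV"
 unfolding cv_def by (rule has_sum_infsum[OF abs_summable_summable])
 hence "((%z. ?c z * ?d (y-a-z)) has_sum seqf r A K (trx s (Suc k)) (y-a)) UNIV"
 using seqf_trx_Suc[OF assms] by simp
 moreover have "((%z. ?c z * ?d (y-a-z)) has_sum seqf r A K (trx s (Suc k)) (y-a)) UNIV \<longleftrightarrow>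
 ((%z. ?c (z-a) * ?d (y-z)) has_sum seqf r A K (trx s (Suc k)) (y-a)) UNIV"
 by (rule has_sum_reindex_bij_witness[where j = "%z. z+a" and i = "%z. z-a"])
 (auto simp: algebra_simps)
 ultimately show ?thesis by blast
qed

definition site_weight_int :: "nat => (nat => nat) => (nat => nat) => real => nat => int => real" where
 "site_weight_int m uk ux f k z=1+f*(\<Sum>u<m. if uk u=k & int (ux u)=z then 1 else 0)"

lemma site_weight_int_bounds:
 assumes "f >= 0"
 shows "0<=site_weight_int m uk ux f k z" "site_weight_int m uk ux f k z<=1+f * real m"
 "\<bar>site_weight_int m uk ux f k z\<bar> <= 1+f * real m"
proof -
 let ?S = "\<Sum>u<m. if uk u=k & int (ux u)=z then 1 else 0 :: real"
 have "?S<=(\<Sum>u<m. 1)" "0 <= ?S" by (intro sum_mono sum_nonneg; auto)+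
 hence "0<=f * ?S" "f * ?S<=f * real m" using assms by (auto intro: mult_left_mono)
 thus "0<=site_weight_int m uk ux f k z" "site_weight_int m uk ux f k z<=1+f * real m"
 "\<bar>site_weight_int m uk ux f k z\<bar> <= 1+f * real m"
 unfolding site_weight_int_def by linarith+
qed

text \<open>A Duhamel formula: a path is cut at the last mark whose \<open>f\<close>-term is chosen,
  with marked evolution before it and free evolution after it. The marked evolution reappears only
  at the marked sites, so a finite linear system results.\<close>

lemma evo_expansion:
 fixes m :: nat and uk ux :: "nat => nat"
 assumes r: "r > 0" and f: "f >= 0" and k: "k<=K"
 defines "D \<equiv> site_weight_int m uk ux f"
 shows "evo r A D k x y=seqf r A K (trx 0 k) (y-x) +
 f*(\<Sum>u<m. if uk u < k
 then evo r A D (uk u) x (int (ux u)) * seqf r A K (trx (uk u) k) (y-int (ux u)) else 0)"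
 using k
proof (induction k arbitrary: y)
 case 0
 have "seqf r A K (trx 0 0)=delta_seq" by (rule seqf_zero[OF r]) (simp add: trx_def)
 thus ?case by (simp add: delta_seq_def)
next
 case (Suc k)
 hence k: "k < K" "k<=K" by auto
 let ?c = "%u k y. evo r A D (uk u) x (int (ux u)) * seqf r A K (trx (uk u) k) (y-int (ux u))"
 have D: "\<bar>D k z\<bar> <= 1+f * real m" for k z unfolding D_def by (rule site_weight_int_bounds(3)[OF f])
 have 1: "((%z. evo r A D k x z * D k z * step_seq r A k (y-z)) has_sum evo r A D (Suc k) x y) UNIV"
 by (rule evo_Suc_has_sum[OF r D])
 have s1: "((%z. seqf r A K (trx 0 k) (z-x) * step_seq r A k (y-z)) has_sum
 seqf r A K (trx 0 (Suc k)) (y-x)) UNIV"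
 by (rule seqf_trx_shift_has_sum[OF r _ k(1)]) simp
 have s2: "((%z. if uk u < k then ?c u k z * step_seq r A k (y-z) else 0) has_sum
 (if uk u < k then ?c u (Suc k) y else 0)) UNIV" for u
 using has_sum_cmult_right[OF seqf_trx_shift_has_sum[OF r _ k(1),of "uk u" A "int (ux u)" y],
 of "evo r A D (uk u) x (int (ux u))"] by (auto simp: mult.assoc)
 have s3: "((%z. (if uk u=k & int (ux u)=z then 1 else 0) * evo r A D k x z * step_seq r A k (y-z)) has_sum
 (if uk u=k then ?c u (Suc k) y else 0)) UNIV" for u
 proof -
 have "seqf r A K (trx k (Suc k))=step_seq r A k"
 proof -
 have "trx k (Suc k)=(%j. if j=k then 1 else 0)" by (auto simp: trx_def fun_eq_iff)
 thus ?thesis using seqf_single[OF r k(1)] by simp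
 qed
 thus ?thesis by (intro has_sum_finite_neutralI[of "{int (ux u)}"]) auto
 qed
 have "((%z. seqf r A K (trx 0 k) (z-x) * step_seq r A k (y-z) +
 f*(\<Sum>u<m. if uk u < k then ?c u k z * step_seq r A k (y-z) else 0) +
 f*(\<Sum>u<m. (if uk u=k & int (ux u)=z then 1 else 0) * evo r A D k x z * step_seq r A k (y-z))) has_sum
 (seqf r A K (trx 0 (Suc k)) (y-x)+f*(\<Sum>u<m. if uk u < k then ?c u (Suc k) y else 0) +
 f*(\<Sum>u<m. if uk u=k then ?c u (Suc k) y else 0))) UNIV"
 by (intro has_sum_add has_sum_cmult_right has_sum_finite_sum s1 s2 s3)
 moreover have "seqf r A K (trx 0 k) (z-x) * step_seq r A k (y-z) +
 f*(\<Sum>u<m. if uk u < k then ?c u k z * step_seq r A k (y-z) else 0) +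
 f*(\<Sum>u<m. (if uk u=k & int (ux u)=z then 1 else 0) * evo r A D k x z * step_seq r A k (y-z))
 = evo r A D k x z * D k z * step_seq r A k (y-z)" for z
 proof -
 let ?st = "step_seq r A k (y-z)"
 have "(\<Sum>u<m. if uk u < k then ?c u k z * ?st else 0)=(\<Sum>u<m. if uk u < k then ?c u k z else 0) * ?st"
 unfolding sum_distrib_right by (rule sum.cong) auto
 moreover have "(\<Sum>u<m. (if uk u=k & int (ux u)=z then 1 else 0) * evo r A D k x z * ?st)
 = (\<Sum>u<m. if uk u=k & int (ux u)=z then 1 else 0) * evo r A D k x z * ?st"
 unfolding sum_distrib_right by simp
 moreover have "D k z=1+f*(\<Sum>u<m. if uk u=k & int (ux u)=z then 1 else 0)"
 by (simp add: D_def site_weight_int_def)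
 ultimately show ?thesis
 using Suc.IH[OF k(2),of z] by (simp add: algebra_simps)
 qed
 ultimately have "evo r A D (Suc k) x y=seqf r A K (trx 0 (Suc k)) (y-x) +
 f*(\<Sum>u<m. if uk u < k then ?c u (Suc k) y else 0)+f*(\<Sum>u<m. if uk u=k then ?c u (Suc k) y else 0)"
 using has_sum_unique[OF 1] by simp
 also have "... = seqf r A K (trx 0 (Suc k)) (y-x)+f*(\<Sum>u<m. if uk u < Suc k then ?c u (Suc k) y else 0)"
 unfolding add.assoc distrib_left[symmetric] sum.distrib[symmetric]
 by (intro arg_cong2[of _ _ _ _ "(+)"] arg_cong2[of _ _ _ _ "(*)"] sum.cong refl) auto
 finally show ?case .
qed

text \<open>
  The determinantal formula of Eynard and Mehta. Since \<open>Q\<close> solves \<open>Q G = R\<close>, no inverse of \<open>G\<close> is needed.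
\<close>

lemma detn_eynard_mehta:
 fixes G Gf L Lf R S Q :: "nat => nat => real" and lev :: "nat => int"
 assumes Gf: "\<And>i j. i < n ==> j < n ==> Gf i j=G i j+f*(\<Sum>u<m. Lf i u * R u j)"
 and Lf: "\<And>i v. i < n ==> v < m ==> Lf i v = L i v + f*(\<Sum>u<m. Lf i u * S u v)"
 and Q: "\<And>u j. u < m ==> j < n ==> (\<Sum>i<n. Q u i * G i j)=R u j"
 and S: "\<And>u v. u < m ==> v < m ==> S u v ~= 0 ==> lev u < lev v"
 shows "detn n Gf=detn n G *
 detn m (%u v. (if u=v then 1 else 0)+f*((\<Sum>i<n. Q u i * L i v)-S u v))"
proof -
 have "detn n Gf=detn n (%i j. \<Sum>k<n. ((if i=k then 1 else 0)+(\<Sum>u<m. Lf i u*(f * Q u k))) * G k j)"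
 proof (rule detn_cong)
 fix i j assume ij: "i < n" "j < n"
 have "(\<Sum>k<n. ((if i=k then 1 else 0)+(\<Sum>u<m. Lf i u*(f * Q u k))) * G k j)
 = G i j+(\<Sum>k<n. (\<Sum>u<m. Lf i u*(f * Q u k)) * G k j)"
 using ij by (simp add: distrib_right sum.distrib if_distrib[of "%x. x * _"] cong: if_cong)
 also have "(\<Sum>k<n. (\<Sum>u<m. Lf i u*(f * Q u k)) * G k j)=(\<Sum>u<m. \<Sum>k<n. Lf i u * f*(Q u k * G k j))"
 unfolding sum_distrib_right by (subst sum.swap) (simp add: mult_ac)
 also have "... = (\<Sum>u<m. Lf i u * f * R u j)"
 by (rule sum.cong[OF refl]) (simp add: sum_distrib_left[symmetric] Q ij)
 finally show "Gf i j=(\<Sum>k<n. ((if i=k then 1 else 0)+(\<Sum>u<m. Lf i u*(f * Q u k))) * G k j)"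
 using Gf[OF ij] by (simp add: sum_distrib_left mult_ac)
 qed
 also have "... = detn n (%i j. (if i=j then 1 else 0)+(\<Sum>u<m. Lf i u*(f * Q u j))) * detn n G"
 by (rule detn_mult)
 also have "detn n (%i j. (if i=j then 1 else 0)+(\<Sum>u<m. Lf i u*(f * Q u j)))
 = detn m (%u v. (if u=v then 1 else 0)+(\<Sum>i<n. f * Q u i * Lf i v))"
 by (rule detn_sylvester)
 \<comment> \<open>Multiplication by \<open>1 - f * S\<close>, of determinant 1, replaces the marked
   \<open>Lf\<close> by the free \<open>L\<close>, because \<open>Lf * (1 - f * S) = L\<close> as
   matrices.\<close>
 also have "... = detn m (%u v. (if u=v then 1 else 0)+(\<Sum>i<n. f * Q u i * Lf i v)) *
 detn m (%u v. (if u=v then 1 else 0)-f * S u v)"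
 proof -
 have "S u u=0" if "u < m" for u using S[of u u] that by auto
 hence "detn m (%u v. (if u=v then 1 else 0)-f * S u v)=1"
 by (intro detn_strictly_increasing_perturbation[where lev=lev]) (use S in auto)
 thus ?thesis by simp
 qed
 also have "... = detn m (%u v. \<Sum>w<m. ((if u=w then 1 else 0)+(\<Sum>i<n. f * Q u i * Lf i w)) *
 ((if w=v then 1 else 0)-f * S w v))"
 by (rule detn_mult[symmetric])
 also have "... = detn m (%u v. (if u=v then 1 else 0)+f*((\<Sum>i<n. Q u i * L i v)-S u v))"
 proof (rule detn_cong)
 fix u v assume uv: "u < m" "v < m"
 let ?M = "%w. \<Sum>i<n. f * Q u i * Lf i w"
 have "(\<Sum>w<m. ((if u=w then 1 else 0) + ?M w)*((if w=v then 1 else 0)-f * S w v))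
 = (\<Sum>w<m. (if w=u then (if w=v then 1 else 0)-f * S w v else 0) +
 (if w=v then ?M w else 0)-f*(?M w * S w v))"
 by (rule sum.cong[OF refl]) (auto simp: algebra_simps)
 also have "... = ((if u=v then 1 else 0)-f * S u v) + ?M v - f*(\<Sum>w<m. ?M w * S w v)"
 using uv by (simp add: sum.distrib sum_subtractf sum_distrib_left)
 finally have 1: "(\<Sum>w<m. ((if u=w then 1 else 0) + ?M w)*((if w=v then 1 else 0)-f * S w v))
 = ((if u=v then 1 else 0)-f * S u v) + ?M v - f*(\<Sum>w<m. ?M w * S w v)" .
 have "(\<Sum>w<m. ?M w * S w v)=(\<Sum>i<n. f * Q u i*(\<Sum>w<m. Lf i w * S w v))"
 unfolding sum_distrib_right sum_distrib_left by (subst sum.swap) (simp add: mult_ac)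
 hence "?M v - f*(\<Sum>w<m. ?M w * S w v)
 = (\<Sum>i<n. f * Q u i * Lf i v - f*(f * Q u i*(\<Sum>w<m. Lf i w * S w v)))"
 by (simp only: sum_subtractf sum_distrib_left)
 also have "... = (\<Sum>i<n. f * Q u i * L i v)"
 proof (rule sum.cong[OF refl])
 fix i assume "i \<in> {..<n}"
 hence e: "Lf i v = L i v + f*(\<Sum>w<m. Lf i w * S w v)" using Lf[of i v] uv by simp
 show "f * Q u i * Lf i v - f*(f * Q u i*(\<Sum>w<m. Lf i w * S w v))=f * Q u i * L i v"
 by (subst e) (simp add: algebra_simps)
 qed
 finally have "(\<Sum>w<m. ((if u=w then 1 else 0) + ?M w)*((if w=v then 1 else 0)-f * S w v))
 = ((if u=v then 1 else 0)-f * S u v)+(\<Sum>i<n. f * Q u i * L i v)"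
 using 1 by linarith
 thus "(\<Sum>w<m. ((if u=w then 1 else 0) + ?M w)*((if w=v then 1 else 0)-f * S w v))
 = (if u=v then 1 else 0)+f*((\<Sum>i<n. Q u i * L i v)-S u v)"
 by (simp add: sum_distrib_left algebra_simps)
 qed
 finally show ?thesis by simp
qed

text \<open>Exponents of \<open>J\<^sub>t\<close>, the growth steps before time \<open>k\<close> over the shrinking steps after it.\<close>

definition jx :: "nat => nat => nat => int" where
 "jx A k j=(if j < A then (if j < k then 1 else 0) else (if k<=j then-1 else 0))"

section \<open>The correlation kernel\<close>

text \<open>The factors are coefficients of \<open>1/J\<close> at time \<open>k\<close> and of
  \<open>J\<close> at time \<open>k'\<close>. For \<open>k < k'\<close>, summation over all
  \<open>l\<close> gives the free transition kernel from \<open>k\<close> to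
  \<open>k'\<close>.\<close>

definition kernel_term :: "real => nat => nat => nat => int => nat => int => int => real" where
 "kernel_term r A K k x k' x' l =
 seqf r A K (%j. - jx A k j) (l-x) * seqf r A K (jx A k') (x'-l)"

text \<open>For \<open>k < k'\<close> the lower half minus the free transition kernel, which is the
  full sum, leaves minus the upper half.\<close>

definition corr_kernel :: "real => nat => nat => nat => int => nat => int => real" where
 "corr_kernel r A K k x k' x' =
 (if k'<=k then (\<Sum>\<^sub>\<infinity>l\<in>{..0}. kernel_term r A K k x k' x' l)
 else-(\<Sum>\<^sub>\<infinity>l\<in>{0<..}. kernel_term r A K k x k' x' l))"

lemma unit_exps_jx: "unit_exps K (jx A k)" "unit_exps K (%j. - jx A k j)"
 by (auto simp: unit_exps_def jx_def)

lemma kernel_term_abs_summable: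
 assumes r: "r > 0"
 shows "(%l. \<bar>kernel_term r A K k x k' x' l\<bar>) summable_on X"
proof -
 let ?a = "seqf r A K (%j. - jx A k j)" and ?b = "seqf r A K (jx A k')"
 have "(%l. norm (?a l * ?b (x'-x-l))) summable_on UNIV"
 by (rule laurent_on_cv(2)[OF laurent_on_seqf_1[OF r unit_exps_jx(2)] laurent_on_seqf_1[OF r unit_exps_jx(1)]])
 moreover have "(%l. norm (?a l * ?b (x'-x-l))) summable_on UNIV \<longleftrightarrow>
 (%l. \<bar>kernel_term r A K k x k' x' l\<bar>) summable_on UNIV"
 by (rule summable_on_reindex_bij_witness[where j = "%l. l+x" and i = "%l. l-x"])
 (auto simp: kernel_term_def algebra_simps)
 ultimately show ?thesis using summable_on_subset_banach[OF _ subset_UNIV] by blast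
qed

lemma cv_finite_support:
 assumes "\<And>l. 0 < l \<or> l <= - int n ==> q l=0"
 shows "cv q g y=(\<Sum>i<n. q (- int i) * g (y+int i))"
proof -
 have "cv q g y=(\<Sum>l\<in>(%i. - int i) ` {..<n}. q l * g (y-l))"
 unfolding cv_def
 proof (rule infsumI,rule has_sum_finite_neutralI)
 fix l assume l: "l \<in> UNIV-(%i. - int i) ` {..<n}"
 have "0 < l \<or> l <= - int n"
 proof (rule ccontr)
 assume "~ ?thesis"
 hence "l = - int (nat (- l))" "nat (- l) < n" by auto
 thus False using l by blast
 qed
 thus "q l * g (y-l)=0" using assms by simp
 qed auto
 also have "... = (\<Sum>i<n. q (- int i) * g (y+int i))"
 by (subst sum.reindex) (auto simp: inj_on_def)
 finally show ?thesis .
qed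

text \<open>A Wiener-Hopf argument. The coefficients of the linear system form a section of a
  Toeplitz matrix whose symbol is an upward factor times a downward factor. Undoing the downward
  factor (\<open>eb\<close>) on a sequence cut to the nonpositive half line gives a row
  \<open>q\<close> that lives on \<open>n\<close> sites and solves the system exactly; pairing it
  with the free evolution up to \<open>k'\<close> produces the kernel.\<close>

lemma corr_kernel_solution:
 assumes r: "r > 0" and K: "A+B=K" "B<=n" and k: "k < K" and x: "int B < x+int n"
 obtains q where
 "\<And>j. (\<Sum>i<n. q i * seqf r A K (trx 0 K) (int i-int j))=seqf r A K (trx k K) (- int j-x)"
 "\<And>k' x'. k' < K ==> (\<Sum>i<n. q i * seqf r A K (trx 0 k') (x'+int i)) -
 (if k < k' then seqf r A K (trx k k') (x'-x) else 0)=corr_kernel r A K k x k' x'"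
proof -
 let ?s = "seqf r A K"
 define eb where "eb=(%j. if A<=j then-1 else 0 :: int)"
 define al where "al=(%j. if j < A then 1 else 0 :: int)"
 define ji where "ji = ?s (%j. - jx A k j)"
 \<comment> \<open>The cut at 0 is invisible in the first claim: the upward factor
   \<open>al\<close>, evaluated at \<open>- int j - l\<close>, vanishes unless \<open>l\<close> is
   at most 0.\<close>
 define s where "s=(%l. if l<=0 then ji (l-x) else 0)"
 define q where "q=cv (?s eb) s"
 have ue: "unit_exps K eb" "unit_exps K al" by (auto simp: unit_exps_def eb_def al_def)
 have ji1: "(%l. \<bar>ji l\<bar>) summable_on UNIV"
 unfolding ji_def by (rule laurent_on_abs_summable[OF laurent_on_seqf_1[OF r unit_exps_jx(2)]])
 have "(%l. \<bar>ji l\<bar>) summable_on UNIV \<longleftrightarrow> (%l. \<bar>ji (l-x)\<bar>) summable_on UNIV"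
 by (rule summable_on_reindex_bij_witness[where j = "%l. l+x" and i = "%l. l-x"]) auto
 hence "(%l. \<bar>ji (l-x)\<bar>) summable_on UNIV" using ji1 by blast
 hence "(%l. \<bar>s l\<bar>) summable_on UNIV"
 by (rule summable_on_comparison_test) (auto simp: s_def)
 note s1=laurent_on_l1[OF this]
 note q1=laurent_on_cv(1)[OF laurent_on_seqf_1[OF r ue(1),of A] s1,folded q_def]
 have q_sub: "cv q (?s e)=cv s (?s e')" if "unit_exps K e" "unit_exps K e'" "\<And>j. j < K ==> eb j+e j=e' j" for e e'
 proof (rule laurent_on_unique[OF laurent_on_cv(1)[OF q1 laurent_on_seqf_1[OF r that(1)]]
 laurent_on_cv(1)[OF s1 laurent_on_seqf_1[OF r that(2)]]])
 fix w :: complex assume "cmod w=1"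
 thus "symf r A K eb w*(\<Sum>\<^sub>\<infinity>n. of_real (s n) * w powi n) * symf r A K e w =
 (\<Sum>\<^sub>\<infinity>n. of_real (s n) * w powi n) * symf r A K e' w"
 using symf_mult[OF r _ that(3),where w=w and A=A] by (simp add: mult_ac)
 qed
 have q0: "q l=0" if "0 < l \<or> l <= - int n" for l
 proof (cases "0 < l")
 case True
 show ?thesis unfolding q_def
 by (rule cv_support_upper[where a=0 and b=0])
 (use True in \<open>auto simp: s_def eb_def intro!: seqf_support_upper\<close>)
 next
 case False
 hence l: "l <= - int n" using that by simp
 \<comment> \<open>The cut is invisible here as well, since \<open>eb\<close> reaches down by at
   most \<open>B <= n\<close> sites. What remains consists of inverse steps before time
   \<open>k\<close>; its support starts at \<open>- int B\<close>, and \<open>l - x\<close> lies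
   below that by the assumption on \<open>x\<close>.\<close>
 have "q l=(\<Sum>\<^sub>\<infinity>i. ?s eb i * ji (l-x-i))"
 unfolding q_def cv_def
 proof (rule infsum_cong)
 fix i
 show "?s eb i * s (l-i) = ?s eb i * ji (l-x-i)"
 proof (cases "i < - int B")
 case True
 hence "?s eb i=0" using K by (intro seqf_support_lower) (auto simp: eb_def)
 thus ?thesis by simp
 next
 case False
 hence "l-i<=0" using l K by linarith
 thus ?thesis by (simp add: s_def algebra_simps)
 qed
 qed
 also have "... = cv (?s eb) ji (l-x)" by (simp add: cv_def)
 also have "cv (?s eb) ji = ?s (%j. if j < k then-1 else 0)"
 unfolding ji_def by (rule seqf_cv[OF r ue(1) unit_exps_jx(2)]) (auto simp: eb_def jx_def unit_exps_def)
 also have "... (l-x)=0"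
 by (rule seqf_support_lower) (use K l x in auto)
 finally show ?thesis .
 qed
 show thesis
 proof (rule that[of "%i. q (- int i)"])
 fix j :: nat
 have "(\<Sum>i<n. q (- int i) * ?s (trx 0 K) (int i-int j))=cv q (?s (trx 0 K)) (- int j)"
 by (subst cv_finite_support[OF q0]) (auto simp: algebra_simps)
 also have "cv q (?s (trx 0 K))=cv s (?s al)"
 by (rule q_sub) (use ue unit_exps_trx in \<open>auto simp: eb_def al_def trx_def\<close>)
 also have "cv s (?s al) (- int j)=(\<Sum>\<^sub>\<infinity>l. ji (l-x) * ?s al (- int j-l))"
 unfolding cv_def
 proof (rule infsum_cong)
 fix l
 have al0: "?s al i=0" if "i < 0" for i
 proof -
 have "prodseq (%j. if al j=1 then step_seq r A j else if al j = - 1 then step_inv r A j else delta_seq) K' i'=0"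
 if "i' < 0" for K' i'
 using that
 proof (induction K' arbitrary: i')
 case (Suc K')
 show ?case unfolding prodseq.simps
 by (rule cv_support_lower[where a=0 and b=0])
 (use Suc in \<open>auto simp: al_def step_seq_def geom_up_def delta_seq_def split: if_splits\<close>)
 qed (simp add: delta_seq_def)
 thus ?thesis using that unfolding seqf_def by blast
 qed
 show "s l * ?s al (- int j-l)=ji (l-x) * ?s al (- int j-l)"
 using al0[of "- int j-l"] by (cases "l<=0") (auto simp: s_def)
 qed
 also have "... = (\<Sum>\<^sub>\<infinity>l. ji l * ?s al (- int j-x-l))"
 by (rule infsum_reindex_bij_witness[where i = "%l. l+x" and j = "%l. l-x"])
 (auto simp: algebra_simps)
 also have "... = cv ji (?s al) (- int j-x)" by (simp add: cv_def)
 also have "cv ji (?s al) = ?s (trx k K)"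
 unfolding ji_def by (rule seqf_cv[OF r unit_exps_jx(2) ue(2) unit_exps_trx]) (auto simp: al_def jx_def trx_def)
 finally show "(\<Sum>i<n. q (- int i) * ?s (trx 0 K) (int i-int j)) = ?s (trx k K) (- int j-x)" .
 next
 fix k' x' assume k': "k' < K"
 let ?t = "kernel_term r A K k x k' x'"
 have sm: "?t summable_on X" for X
 by (rule abs_summable_summable) (use kernel_term_abs_summable[OF r,of A K k x k' x' X] in simp)
 have "(\<Sum>i<n. q (- int i) * ?s (trx 0 k') (x'+int i))=cv q (?s (trx 0 k')) x'"
 by (rule cv_finite_support[OF q0,symmetric])
 also have "cv q (?s (trx 0 k'))=cv s (?s (jx A k'))"
 by (rule q_sub) (use unit_exps_jx unit_exps_trx in \<open>auto simp: eb_def jx_def trx_def\<close>)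
 also have "cv s (?s (jx A k')) x'=(\<Sum>\<^sub>\<infinity>l\<in>{..0}. ?t l)"
 unfolding cv_def by (rule infsum_cong_neutral) (auto simp: s_def kernel_term_def ji_def)
 finally have 1: "(\<Sum>i<n. q (- int i) * ?s (trx 0 k') (x'+int i))=(\<Sum>\<^sub>\<infinity>l\<in>{..0}. ?t l)" .
 show "(\<Sum>i<n. q (- int i) * ?s (trx 0 k') (x'+int i)) -
 (if k < k' then ?s (trx k k') (x'-x) else 0)=corr_kernel r A K k x k' x'"
 proof (cases "k < k'")
 case True
 have "?s (trx k k')=cv ji (?s (jx A k'))"
 unfolding ji_def by (rule seqf_cv[symmetric,OF r unit_exps_jx(2) unit_exps_jx(1) unit_exps_trx])
 (use True in \<open>auto simp: jx_def trx_def\<close>)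
 hence "?s (trx k k') (x'-x)=(\<Sum>\<^sub>\<infinity>l. ji l * ?s (jx A k') (x'-x-l))" by (simp add: cv_def)
 also have "... = (\<Sum>\<^sub>\<infinity>l. ?t l)"
 by (rule infsum_reindex_bij_witness[where i = "%l. l-x" and j = "%l. l+x"])
 (auto simp: kernel_term_def ji_def algebra_simps)
 also have "(UNIV :: int set) = {..0} \<union> {0<..}" by auto
 also have "(\<Sum>\<^sub>\<infinity>l\<in>{..0} \<union> {0<..}. ?t l)=(\<Sum>\<^sub>\<infinity>l\<in>{..0}. ?t l)+(\<Sum>\<^sub>\<infinity>l\<in>{0<..}. ?t l)"
 by (rule infsum_Un_disjoint) (auto intro: sm)
 finally show ?thesis using 1 True by (simp add: corr_kernel_def)
 qed (use 1 in \<open>simp add: corr_kernel_def\<close>)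
 qed
qed

text \<open>The height bound is removed while the base stays fixed. Recentring positions by
  \<open>n - 1\<close> puts the vacuum at 0, -1, -2, ..., so that the kernel no longer contains
  \<open>n\<close>.\<close>

lemma weighted_box_sum_tendsto:
 assumes r: "r > 0" and f: "f >= 0" and n: "0 < n" "A<=n" "B<=n"
 and uk: "\<And>u. u < m ==> uk u < A+B" and ux: "\<And>u. u < m ==> B<=ux u"
 and inj: "inj_on (%u. (uk u,ux u)) {..<m}"
 defines "X \<equiv> %u. int (ux u)-int (n-1)"
 shows "(%M. \<Sum>p\<in>box_pps A B M. exp (- r * real (volume p)) *
 (\<Prod>u<m. if occupied n A (uk u) (ux u) p then 1+f else 1)) \<longlonglongrightarrow>
 detn n (%i j. seqf r A (A+B) (trx 0 (A+B)) (int i-int j)) *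
 detn m (%u v. (if u=v then 1 else 0)+f * corr_kernel r A (A+B) (uk u) (X u) (uk v) (X v))"
proof -
 let ?K = "A+B" and ?D = "site_weight_int m uk ux f"
 let ?s = "seqf r A (A+B)"
 have lim: "(%M. evolve (M+n) (site_weight m uk ux f) (step_kernel r A) ?K x y) \<longlonglongrightarrow>
 evo r A ?D ?K (int x) (int y)" for x y
 proof -
 have "(%L. evolve L (site_weight m uk ux f) (step_kernel r A) ?K x y) \<longlonglongrightarrow>
 evo r A ?D ?K (int x) (int y)"
 by (rule evolve_tendsto_evo(3)[OF r site_weight_int_bounds(1,2)[OF f]])
 (simp add: site_weight_linear[OF inj] site_weight_int_def)
 thus ?thesis by (rule LIMSEQ_ignore_initial_segment)
 qed
 have "(%M. \<Sum>p\<in>box_pps A B M. exp (- r * real (volume p)) *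
 (\<Prod>u<m. if occupied n A (uk u) (ux u) p then 1+f else 1)) \<longlonglongrightarrow>
 detn n (%i j. evo r A ?D ?K (int (vacuum n i)) (int (vacuum n j)))"
 proof -
 have e: "(\<Sum>p\<in>box_pps A B M. exp (- r * real (volume p)) *
 (\<Prod>u<m. if occupied n A (uk u) (ux u) p then 1+f else 1)) =
 detn n (%i j. evolve (M+n) (site_weight m uk ux f) (step_kernel r A) (A+B) (vacuum n i) (vacuum n j))" for M
 by (rule weighted_box_sum[OF n uk])
 show ?thesis unfolding e by (rule tendsto_detn) (rule lim)
 qed
 also have "detn n (%i j. evo r A ?D ?K (int (vacuum n i)) (int (vacuum n j))) =
 detn n (%i j. ?s (trx 0 ?K) (int i-int j)) *
 detn m (%u v. (if u=v then 1 else 0)+f * corr_kernel r A ?K (uk u) (X u) (uk v) (X v))"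
 proof -
 have ex: "\<exists>q. (\<forall>j. (\<Sum>i<n. q i * ?s (trx 0 ?K) (int i-int j)) = ?s (trx (uk u) ?K) (- int j-X u)) \<and>
 (\<forall>k' x'. k' < ?K --> (\<Sum>i<n. q i * ?s (trx 0 k') (x'+int i)) -
 (if uk u < k' then ?s (trx (uk u) k') (x'-X u) else 0)=corr_kernel r A ?K (uk u) (X u) k' x')"
 if u: "u < m" for u
 proof -
 have h: "int B < X u+int n" using ux[OF u] n by (simp add: X_def)
 obtain q where
 "\<And>j. (\<Sum>i<n. q i * ?s (trx 0 ?K) (int i-int j)) = ?s (trx (uk u) ?K) (- int j-X u)"
 "\<And>k' x'. k' < ?K ==> (\<Sum>i<n. q i * ?s (trx 0 k') (x'+int i)) -
 (if uk u < k' then ?s (trx (uk u) k') (x'-X u) else 0)=corr_kernel r A ?K (uk u) (X u) k' x'"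
 using corr_kernel_solution[OF r refl n(3) uk[OF u] h] by blast
 thus ?thesis by (intro exI[of _ q]) blast
 qed
 define Q where "Q=(%u. SOME q. (\<forall>j. (\<Sum>i<n. q i * ?s (trx 0 ?K) (int i-int j)) = ?s (trx (uk u) ?K) (- int j-X u)) \<and>
 (\<forall>k' x'. k' < ?K --> (\<Sum>i<n. q i * ?s (trx 0 k') (x'+int i)) -
 (if uk u < k' then ?s (trx (uk u) k') (x'-X u) else 0)=corr_kernel r A ?K (uk u) (X u) k' x'))"
 have Q: "(\<forall>j. (\<Sum>i<n. Q u i * ?s (trx 0 ?K) (int i-int j)) = ?s (trx (uk u) ?K) (- int j-X u)) \<and>
 (\<forall>k' x'. k' < ?K --> (\<Sum>i<n. Q u i * ?s (trx 0 k') (x'+int i)) -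
 (if uk u < k' then ?s (trx (uk u) k') (x'-X u) else 0)=corr_kernel r A ?K (uk u) (X u) k' x')"
 if "u < m" for u
 unfolding Q_def by (rule someI_ex[OF ex[OF that]])
 have Q1: "\<And>u j. u < m ==> (\<Sum>i<n. Q u i * ?s (trx 0 ?K) (int i-int j)) = ?s (trx (uk u) ?K) (- int j-X u)"
 and Q2: "\<And>u k' x'. u < m ==> k' < ?K ==> (\<Sum>i<n. Q u i * ?s (trx 0 k') (x'+int i)) -
 (if uk u < k' then ?s (trx (uk u) k') (x'-X u) else 0)=corr_kernel r A ?K (uk u) (X u) k' x'"
 using Q by blast+
 have vac: "int (vacuum n i)=int (n-1)-int i" if "i < n" for i using that by (auto simp: vacuum_def)
 let ?S = "%u v. if uk u < uk v then ?s (trx (uk u) (uk v)) (X v - X u) else 0"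
 let ?L = "%i v. ?s (trx 0 (uk v)) (X v + int i)"
 have "detn n (%i j. evo r A ?D ?K (int (vacuum n i)) (int (vacuum n j))) =
 detn n (%i j. ?s (trx 0 ?K) (int i-int j)) *
 detn m (%u v. (if u=v then 1 else 0)+f*((\<Sum>i<n. Q u i * ?L i v) - ?S u v))"
 proof (rule detn_eynard_mehta[where lev = "%u. int (uk u)" and
 Lf = "%i u. evo r A ?D (uk u) (int (vacuum n i)) (int (ux u))" and
 R = "%u j. ?s (trx (uk u) ?K) (- int j-X u)"])
 fix i j assume ij: "i < n" "j < n"
 have e: "int (vacuum n j)-int (vacuum n i)=int i-int j"
 "int (vacuum n j)-int (ux u) = - int j-X u" for u using ij by (auto simp: vac X_def)
 show "evo r A ?D ?K (int (vacuum n i)) (int (vacuum n j)) = ?s (trx 0 ?K) (int i-int j) +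
 f*(\<Sum>u<m. evo r A ?D (uk u) (int (vacuum n i)) (int (ux u)) * ?s (trx (uk u) ?K) (- int j-X u))"
 by (subst evo_expansion[OF r f order_refl]) (simp add: e uk)
 next
 fix i v assume iv: "i < n" "v < m"
 have e: "int (ux v)-int (vacuum n i)=X v + int i" "int (ux v)-int (ux u)=X v - X u" for u
 using iv by (auto simp: vac X_def)
 show "evo r A ?D (uk v) (int (vacuum n i)) (int (ux v)) = ?L i v +
 f*(\<Sum>u<m. evo r A ?D (uk u) (int (vacuum n i)) (int (ux u)) * ?S u v)"
 using uk[OF iv(2)]
 by (subst evo_expansion[OF r f,where K = ?K])
 (auto simp: e intro!: arg_cong2[of _ _ _ _ "(*)"] sum.cong)
 qed (auto simp: Q1 split: if_splits)
 also have "detn m (%u v. (if u=v then 1 else 0)+f*((\<Sum>i<n. Q u i * ?L i v) - ?S u v)) =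
 detn m (%u v. (if u=v then 1 else 0)+f * corr_kernel r A ?K (uk u) (X u) (uk v) (X v))"
 by (rule detn_cong) (simp only: Q2 uk)
 finally show ?thesis .
 qed
 finally show ?thesis .
qed

section \<open>Summability over plane partitions and removal of the bounds\<close>

lemma sum_tendsto_infsum_exhaustion:
 fixes f :: "'a => real"
 assumes f: "f summable_on S" and F: "\<And>M. finite (F M)" "\<And>M. F M \<subseteq> S"
 and ev: "\<And>x. x \<in> S ==> eventually (%M. x \<in> F M) sequentially"
 shows "(%M. \<Sum>x\<in>F M. f x) \<longlonglongrightarrow> infsum f S"
proof -
 have "filterlim F (finite_subsets_at_top S) sequentially"
 unfolding filterlim_finite_subsets_at_top
 proof safe
 fix Y assume Y: "finite Y" "Y \<subseteq> S"
 hence "\<forall>\<^sub>F M in sequentially. \<forall>x\<in>Y. x \<in> F M" by (intro eventually_ball_finite) (auto intro: ev)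
 thus "\<forall>\<^sub>F M in sequentially. finite (F M) & Y \<subseteq> F M & F M \<subseteq> S"
 by eventually_elim (use F in auto)
 qed
 moreover have "(sum f \<longlongrightarrow> infsum f S) (finite_subsets_at_top S)"
 using has_sum_infsum[OF f] by (simp add: has_sum_def)
 ultimately show ?thesis by (rule filterlim_compose[rotated])
qed

lemma infsum_tendsto_infsum_exhaustion:
 fixes f :: "'a => real"
 assumes f: "f summable_on S" "\<And>x. x \<in> S ==> 0<=f x" and T: "\<And>M. T M \<subseteq> S"
 and ev: "\<And>x. x \<in> S ==> eventually (%M. x \<in> T M) sequentially"
 shows "(%M. infsum f (T M)) \<longlonglongrightarrow> infsum f S"
proof (rule order_tendstoI)
 have sT: "f summable_on T M" for M using f(1) T by (rule summable_on_subset_banach)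
 fix a assume "a < infsum f S"
 moreover have "(sum f \<longlongrightarrow> infsum f S) (finite_subsets_at_top S)"
 using has_sum_infsum[OF f(1)] by (simp add: has_sum_def)
 ultimately have "\<forall>\<^sub>F Y in finite_subsets_at_top S. a < sum f Y" by (rule order_tendstoD(1)[rotated])
 then obtain Y where Y: "finite Y" "Y \<subseteq> S" "a < sum f Y"
 unfolding eventually_finite_subsets_at_top by blast
 hence "\<forall>\<^sub>F M in sequentially. \<forall>x\<in>Y. x \<in> T M" by (intro eventually_ball_finite) (auto intro: ev)
 thus "\<forall>\<^sub>F M in sequentially. a < infsum f (T M)"
 proof eventually_elim
 case (elim M)
 have "sum f Y<=infsum f (T M)"
 by (rule finite_sum_le_infsum[OF sT]) (use elim Y f(2) T[of M] in blast)+
 thus ?case using Y by simp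
 qed
next
 have sT: "f summable_on T M" for M using f(1) T by (rule summable_on_subset_banach)
 fix a assume "infsum f S < a"
 moreover have "infsum f (T M)<=infsum f S" for M
 by (rule infsum_mono2[OF sT f(1) T]) (use f in auto)
 ultimately show "\<forall>\<^sub>F M in sequentially. infsum f (T M) < a"
 by (intro always_eventually) (meson le_less_trans)
qed

text \<open>The drop \<open>d i\<close> is contained in each of the \<open>i + 1\<close> values
  \<open>f 0\<close>, ..., \<open>f i\<close>.\<close>

lemma weighted_sum_le_sum:
 fixes f d :: "nat => nat"
 assumes "\<And>k. d k+f (Suc k)<=f k"
 shows "(\<Sum>i<N. (i+1) * d i)+N * f N<=(\<Sum>i<N. f i)"
proof (induction N)
 case (Suc N)
 have "(N+1) * d N+(N+1) * f (Suc N)<=(N+1) * f N"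
 using assms[of N] by (metis distrib_left mult_le_mono2)
 thus ?case using Suc by simp
qed simp

text \<open>Excess of an entry over its successors in row and column. The excesses determine the
  partition and bound its volume from below, so the generating function is dominated by a product of
  geometric series.\<close>

definition corner_part :: "(nat => nat => nat) => nat \<times> nat => nat" where
 "corner_part p=(%(i,j). p i j-max (p (Suc i) j) (p i (Suc j)))"

text \<open>Induction from the far corner of the box: an entry is its excess plus the larger of two
  entries with a higher index sum.\<close>

lemma corner_part_injective:
 assumes p: "p \<in> box_pps N N M" "p' \<in> box_pps N N M"
 and e: "\<And>i j. i < N ==> j < N ==> corner_part p (i,j)=corner_part p' (i,j)"
 shows "p=p'"
proof -
 have "p i j=p' i j" if "i+j+k=2 * N" for i j k
 using that
 proof (induction k arbitrary: i j)
 case 0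
 hence "N<=i \<or> N<=j" by linarith
 thus ?case using box_pps_zero[OF p(1),of i j] box_pps_zero[OF p(2),of i j] by simp
 next
 case (Suc k)
 show ?case
 proof (cases "i < N & j < N")
 case True
 have pp: "plane_partition p" "plane_partition p'" using p by (auto simp: box_pps_def)
 have "p (Suc i) j=p' (Suc i) j" "p i (Suc j)=p' i (Suc j)" using Suc by auto
 moreover have "max (p (Suc i) j) (p i (Suc j))<=p i j" "max (p' (Suc i) j) (p' i (Suc j))<=p' i j"
 using pp by (auto simp: plane_partition_def)
 ultimately show ?thesis
 using e[of i j] True by (metis (no_types,lifting) case_prod_conv corner_part_def eq_diff_iff)
 next
 case False
 hence "N<=i \<or> N<=j" by linarith
 thus ?thesis using box_pps_zero[OF p(1),of i j] box_pps_zero[OF p(2),of i j] by simp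
 qed
 qed
 hence "p i j=p' i j" for i j
 proof (cases "i+j<=2 * N")
 case True
 thus ?thesis using \<open>\<And>k j i. i+j+k=2 * N ==> p i j=p' i j\<close>[of i j "2 * N-(i+j)"] by simp
 next
 case False
 hence "N<=i \<or> N<=j" by linarith
 thus ?thesis using box_pps_zero[OF p(1),of i j] box_pps_zero[OF p(2),of i j] by simp
 qed
 thus ?thesis by (intro ext)
qed

lemma volume_box: "p \<in> box_pps A B M ==> volume p=(\<Sum>i<A. \<Sum>j<B. p i j)"
proof -
 assume p: "p \<in> box_pps A B M"
 have sub: "{(i,j). p i j ~= 0} \<subseteq> {..<A} \<times> {..<B}"
 proof (rule subsetI)
 fix z assume "z \<in> {(i,j). p i j ~= 0}"
 then obtain i j where z: "z=(i,j)" "p i j ~= 0" by auto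
 hence "i < A" "j < B" using box_pps_zero[OF p,of i j] by (meson linorder_not_le)+
 thus "z \<in> {..<A} \<times> {..<B}" using z by simp
 qed
 have "volume p=(\<Sum>(i,j)\<in>{..<A} \<times> {..<B}. p i j)"
 unfolding volume_def by (rule sum.mono_neutral_left[OF _ sub]) auto
 thus ?thesis by (simp add: sum.cartesian_product)
qed

text \<open>Summation along rows and along columns counts the volume twice and attaches the weights
  \<open>j + 1\<close> and \<open>i + 1\<close> to the same excess.\<close>

lemma volume_ge_corner_parts:
 assumes p: "p \<in> box_pps N N M"
 shows "(\<Sum>i<N. \<Sum>j<N. (i+j+2) * corner_part p (i,j))<=2 * volume p"
proof -
 let ?d = "%i j. corner_part p (i,j)"
 have pp: "plane_partition p" using p by (simp add: box_pps_def)
 have m: "max (p (Suc i) j) (p i (Suc j))<=p i j" for i j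
 using pp by (auto simp: plane_partition_def)
 have d1: "?d i j+p (Suc i) j<=p i j" "?d i j+p i (Suc j)<=p i j" for i j
 using m[of i j] by (auto simp: corner_part_def)
 have 1: "(\<Sum>j<N. (j+1) * ?d i j)<=(\<Sum>j<N. p i j)" for i
 using weighted_sum_le_sum[of "?d i" "p i" N] d1(2) by (simp add: add_leD1)
 have 2: "(\<Sum>i<N. (i+1) * ?d i j)<=(\<Sum>i<N. p i j)" for j
 using weighted_sum_le_sum[of "%i. ?d i j" "%i. p i j" N] d1(1) by (simp add: add_leD1)
 have "(\<Sum>i<N. \<Sum>j<N. (i+j+2) * ?d i j)=(\<Sum>i<N. \<Sum>j<N. (j+1) * ?d i j)+(\<Sum>j<N. \<Sum>i<N. (i+1) * ?d i j)"
 by (subst (3) sum.swap) (simp add: sum.distrib[symmetric] algebra_simps)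
 also have "... <= (\<Sum>i<N. \<Sum>j<N. p i j)+(\<Sum>j<N. \<Sum>i<N. p i j)"
 by (intro add_mono sum_mono 1 2)
 also have "(\<Sum>j<N. \<Sum>i<N. p i j)=(\<Sum>i<N. \<Sum>j<N. p i j)" by (rule sum.swap)
 finally show ?thesis using volume_box[OF p] by simp
qed

text \<open>The volume bound carries a factor 2, hence the base \<open>exp (- r/2)\<close>.
  Injectivity of the excesses gives a product of geometric series, estimated by the exponential of a
  double geometric sum; the result depends on neither \<open>N\<close> nor \<open>M\<close>.\<close>

lemma box_sum_bounded:
 assumes r: "r > 0"
 defines "b \<equiv> exp (- r/2)"
 shows "(\<Sum>p\<in>box_pps N N M. exp (- r * real (volume p)))<=exp (1/(1-b)*(1/(1-b))\<^sup>2)"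
proof -
 have b: "0 < b" "b < 1" using r by (auto simp: b_def)
 let ?I = "{..<N} \<times> {..<N}"
 define y where "y=(%(i,j). b^(i+j+2))"
 let ?h = "%p. restrict (corner_part p) ?I"
 have y: "0 < y z" "y z<=b" for z
 using b power_decreasing[of 1 "fst z+snd z+2" b] by (auto simp: y_def case_prod_unfold)
 have inj: "inj_on ?h (box_pps N N M)"
 proof (rule inj_onI)
 fix p p' assume p: "p \<in> box_pps N N M" "p' \<in> box_pps N N M" and e: "?h p = ?h p'"
 show "p=p'"
 proof (rule corner_part_injective[OF p])
 fix i j assume "i < N" "j < N"
 thus "corner_part p (i,j)=corner_part p' (i,j)" using fun_cong[OF e,of "(i,j)"] by simp
 qed
 qed
 have "(\<Sum>p\<in>box_pps N N M. exp (- r * real (volume p)))<=(\<Sum>p\<in>box_pps N N M. \<Prod>z\<in>?I. y z ^ ?h p z)"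
 proof (rule sum_mono)
 fix p assume p: "p \<in> box_pps N N M"
 have "(\<Prod>z\<in>?I. y z ^ ?h p z)=(\<Prod>z\<in>?I. b^((fst z+snd z+2) * corner_part p z))"
 proof (rule prod.cong[OF refl])
 fix z assume "z \<in> ?I"
 moreover have "y z=b^(fst z+snd z+2)" by (simp add: y_def case_prod_unfold)
 ultimately show "y z ^ ?h p z=b^((fst z+snd z+2) * corner_part p z)"
 by (simp only: restrict_apply' power_mult)
 qed
 also have "... = b^(\<Sum>z\<in>?I. (fst z+snd z+2) * corner_part p z)" by (simp add: power_sum)
 also have "(\<Sum>z\<in>?I. (fst z+snd z+2) * corner_part p z)=(\<Sum>i<N. \<Sum>j<N. (i+j+2) * corner_part p (i,j))"
 by (simp add: sum.cartesian_product case_prod_unfold)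
 also have "b ^ ... >= b^(2 * volume p)"
 using b volume_ge_corner_parts[OF p] by (intro power_decreasing) auto
 also have "b^(2 * volume p)=exp (- r * real (volume p))"
 by (simp add: b_def exp_of_nat_mult[symmetric])
 finally show "exp (- r * real (volume p))<=(\<Prod>z\<in>?I. y z ^ ?h p z)" .
 qed
 also have "... = (\<Sum>d\<in>?h ` box_pps N N M. \<Prod>z\<in>?I. y z^d z)"
 by (simp add: sum.reindex[OF inj])
 also have "... <= (\<Sum>d\<in>?I \<rightarrow>\<^sub>E {..M}. \<Prod>z\<in>?I. y z^d z)"
 proof (rule sum_mono2)
 show "?h ` box_pps N N M \<subseteq> ?I \<rightarrow>\<^sub>E {..M}"
 proof (rule image_subsetI)
 fix p assume p: "p \<in> box_pps N N M"
 have "corner_part p z<=M" for z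
 using box_pps_le[OF p,of "fst z" "snd z"] by (simp add: corner_part_def case_prod_unfold)
 thus "?h p \<in> ?I \<rightarrow>\<^sub>E {..M}" by (simp add: restrict_PiE_iff)
 qed
 qed (use y in \<open>auto intro!: finite_PiE prod_nonneg simp: less_imp_le\<close>)
 also have "... = (\<Prod>z\<in>?I. \<Sum>k\<le>M. y z^k)"
 by (rule prod_sum_PiE[symmetric]) auto
 also have "... <= (\<Prod>z\<in>?I. exp (y z/(1-b)))"
 proof (rule prod_mono,safe)
 fix i j
 let ?y = "y (i,j)"
 have yb: "0 < ?y" "?y<=b" using y by auto
 show "0<=(\<Sum>k\<le>M. ?y^k)" using yb by (intro sum_nonneg) auto
 have "(\<Sum>k\<le>M. ?y^k)<=(\<Sum>k. ?y^k)"
 using yb b by (intro sum_le_suminf summable_geometric) auto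
 also have "... = 1/(1 - ?y)" using yb b by (intro suminf_geometric) auto
 also have "... = 1 + ?y/(1 - ?y)" using yb b by (simp add: field_simps)
 also have "... <= 1 + ?y/(1-b)" using yb b by (intro add_left_mono divide_left_mono mult_pos_pos) auto
 also have "... <= exp (?y/(1-b))" by (rule exp_ge_add_one_self)
 finally show "(\<Sum>k\<le>M. ?y^k)<=exp (?y/(1-b))" .
 qed
 also have "... = exp (1/(1-b)*(\<Sum>z\<in>?I. y z))"
 unfolding exp_sum[OF finite_cartesian_product[OF finite_lessThan finite_lessThan],symmetric]
 sum_divide_distrib[symmetric] by simp
 also have "... <= exp (1/(1-b)*(1/(1-b))\<^sup>2)"
 proof -
 have g: "(\<Sum>i<N. b^i)<=1/(1-b)"
 using b sum_le_suminf[of "%i. b^i" "{..<N}"] by (simp add: suminf_geometric summable_geometric)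
 have "(\<Sum>z\<in>?I. y z)=b\<^sup>2*((\<Sum>i<N. b^i)*(\<Sum>j<N. b^j))"
 proof -
 have "(\<Sum>z\<in>?I. y z)=(\<Sum>i<N. \<Sum>j<N. b^(i+j+2))"
 unfolding y_def by (rule sum.cartesian_product[symmetric])
 also have "... = (\<Sum>i<N. \<Sum>j<N. b\<^sup>2*(b^i * b^j))"
 by (intro sum.cong refl) (simp add: power_add power2_eq_square)
 also have "... = b\<^sup>2*((\<Sum>i<N. b^i)*(\<Sum>j<N. b^j))"
 proof -
 have "(\<Sum>i<N. b^i)*(\<Sum>j<N. b^j)=(\<Sum>i<N. \<Sum>j<N. b^i * b^j)" by (rule sum_product)
 thus ?thesis by (simp only: sum_distrib_left)
 qed
 finally show ?thesis .
 qed
 also have "... <= 1*((1/(1-b))*(1/(1-b)))"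
 using b by (intro mult_mono g power_le_one sum_nonneg mult_nonneg_nonneg) auto
 finally have "(\<Sum>z\<in>?I. y z)<=(1/(1-b))\<^sup>2" by (simp add: power2_eq_square)
 hence "1/(1-b)*(\<Sum>z\<in>?I. y z)<=1/(1-b)*(1/(1-b))\<^sup>2"
 using b by (intro mult_left_mono) auto
 thus ?thesis by simp
 qed
 finally show ?thesis .
qed

lemma plane_partition_in_box:
 assumes "plane_partition p"
 obtains N where "\<And>N'. N<=N' ==> p \<in> box_pps N' N' N'"
 "\<And>A B. N<=A ==> N<=B ==> (\<forall>i\<ge>A. p i 0=0) & (\<forall>j\<ge>B. p 0 j=0)"
proof -
 have fin: "finite {(i,j). p i j ~= 0}" using assms by (simp add: plane_partition_def)
 obtain N1 where N1: "\<And>i j. p i j ~= 0 ==> i < N1"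
 using finite_imageI[OF fin,of fst] by (auto simp: finite_nat_iff_bounded image_iff subset_iff)
 obtain N2 where N2: "\<And>i j. p i j ~= 0 ==> j < N2"
 using finite_imageI[OF fin,of snd] by (auto simp: finite_nat_iff_bounded image_iff subset_iff)
 show thesis
 proof (rule that[of "N1+N2+p 0 0"])
 show *: "(\<forall>i\<ge>A. p i 0=0) & (\<forall>j\<ge>B. p 0 j=0)" if "N1+N2+p 0 0<=A" "N1+N2+p 0 0<=B" for A B
 proof (intro conjI allI impI)
 fix i assume "A<=i"
 hence "~ i < N1" using that by linarith
 thus "p i 0=0" using N1[of i 0] by blast
 next
 fix j assume "B<=j"
 hence "~ j < N2" using that by linarith
 thus "p 0 j=0" using N2[of 0 j] by blast
 qed
 show "p \<in> box_pps N' N' N'" if "N1+N2+p 0 0<=N'" for N'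
 using assms *[OF that that] that by (auto simp: box_pps_def)
 qed
qed

lemma summable_plane_partitions:
 assumes "r > 0"
 shows "(%p. exp (- r * real (volume p))) summable_on {p. plane_partition p}"
proof (rule nonneg_bounded_partial_sums_imp_summable_on[where
 C = "exp (1/(1-exp (- r/2))*(1/(1-exp (- r/2)))\<^sup>2)"])
 show "\<forall>\<^sub>F F in finite_subsets_at_top {p. plane_partition p}.
 (\<Sum>p\<in>F. exp (- r * real (volume p)))<=exp (1/(1-exp (- r/2))*(1/(1-exp (- r/2)))\<^sup>2)"
 proof (rule eventually_finite_subsets_at_top_weakI)
 fix F assume F: "finite F" "F \<subseteq> {p. plane_partition p}"
 have "\<forall>\<^sub>F N in sequentially. \<forall>p\<in>F. p \<in> box_pps N N N"
 proof (intro eventually_ball_finite F ballI)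
 fix p assume "p \<in> F"
 hence "plane_partition p" using F by auto
 then obtain N where "\<And>N'. N<=N' ==> p \<in> box_pps N' N' N'" by (rule plane_partition_in_box) blast
 thus "\<forall>\<^sub>F N in sequentially. p \<in> box_pps N N N" by (auto simp: eventually_sequentially)
 qed
 then obtain N where "F \<subseteq> box_pps N N N" by (auto simp: eventually_sequentially)
 hence "(\<Sum>p\<in>F. exp (- r * real (volume p)))<=(\<Sum>p\<in>box_pps N N N. exp (- r * real (volume p)))"
 by (intro sum_mono2 finite_box_pps) auto
 also have "... <= exp (1/(1-exp (- r/2))*(1/(1-exp (- r/2)))\<^sup>2)"
 by (rule box_sum_bounded[OF assms])
 finally show "(\<Sum>p\<in>F. exp (- r * real (volume p))) <= ..." .
 qed
qed auto

definition base_pps :: "nat => nat => (nat => nat => nat) set" where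
 "base_pps A B = {p. plane_partition p & (\<forall>i\<ge>A. p i 0=0) & (\<forall>j\<ge>B. p 0 j=0)}"

text \<open>The generating function is known for all \<open>f >= 0\<close>. Partitions with all
  marks occupied have the factor \<open>(1 + f) ^ m\<close>, all others at most
  \<open>(1 + f) ^ (m - 1)\<close>, so division by \<open>f ^ m\<close> and large \<open>f\<close>
  isolate the event.\<close>

lemma base_pps_prob:
 assumes r: "r > 0" and n: "0 < n" "A<=n" "B<=n"
 and uk: "\<And>u. u < m ==> uk u < A+B" and ux: "\<And>u. u < m ==> B<=ux u"
 and inj: "inj_on (%u. (uk u,ux u)) {..<m}"
 defines "X \<equiv> %u. int (ux u)-int (n-1)"
 shows "(\<Sum>\<^sub>\<infinity>p\<in>{p \<in> base_pps A B. \<forall>u<m. occupied n A (uk u) (ux u) p}. exp (- r * real (volume p))) =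
 (\<Sum>\<^sub>\<infinity>p\<in>base_pps A B. exp (- r * real (volume p))) *
 detn m (%u v. corr_kernel r A (A+B) (uk u) (X u) (uk v) (X v))"
proof -
 let ?w = "%p. exp (- r * real (volume p))" and ?S = "base_pps A B"
 let ?occ = "%u p. occupied n A (uk u) (ux u) p"
 let ?all = "{p \<in> ?S. \<forall>u<m. ?occ u p}"
 let ?g = "%f p. \<Prod>u<m. if ?occ u p then 1+f else 1 :: real"
 let ?K = "%u v. corr_kernel r A (A+B) (uk u) (X u) (uk v) (X v)"
 define Z where "Z=infsum ?w ?S"
 define W where "W=infsum ?w ?all"
 have sw: "?w summable_on T" if "T \<subseteq> ?S" for T
 by (rule summable_on_subset_banach[OF summable_plane_partitions[OF r]]) (use that in \<open>auto simp: base_pps_def\<close>)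
 have ex: "(%M. \<Sum>p\<in>box_pps A B M. h p) \<longlonglongrightarrow> infsum h ?S" if "h summable_on ?S" for h :: "_ => real"
 proof (rule sum_tendsto_infsum_exhaustion[OF that finite_box_pps])
 fix p assume p: "p \<in> ?S"
 show "\<forall>\<^sub>F M in sequentially. p \<in> box_pps A B M"
 using eventually_ge_at_top[of "p 0 0"]
 by eventually_elim (use p in \<open>auto simp: box_pps_def base_pps_def\<close>)
 qed (auto simp: box_pps_def base_pps_def)
 have g_le: "?g f p<=(1+f)^m" "0 <= ?g f p" if "f >= 0" for f p
 proof -
 have "?g f p<=(\<Prod>u<m. 1+f)" using that by (intro prod_mono) auto
 thus "?g f p<=(1+f)^m" by simp
 show "0 <= ?g f p" using that by (intro prod_nonneg) auto
 qed
 have sg: "(%p. ?w p * ?g f p) summable_on T" if "f >= 0" "T \<subseteq> ?S" for f T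
 by (rule summable_on_comparison_test[OF summable_on_cmult_left[OF sw[OF that(2)],of "(1+f)^m"]])
 (use g_le[OF that(1)] in \<open>auto intro!: mult_left_mono mult_nonneg_nonneg\<close>)
 let ?G = "%i j. seqf r A (A+B) (trx 0 (A+B)) (int i-int j)"
 have eqf: "infsum (%p. ?w p * ?g f p) ?S=detn n ?G * detn m (%u v. (if u=v then 1 else 0)+f * ?K u v)"
 if "f >= 0" for f
 using LIMSEQ_unique[OF ex[OF sg[OF that order_refl]]
 weighted_box_sum_tendsto[OF r that n uk ux inj,folded X_def]] by (simp add: X_def)
 \<comment> \<open>At \<open>f = 0\<close> the weighted sum is the partition function and the second
   determinant is 1.\<close>
 have ZG: "Z=detn n ?G"
 proof -
 have "detn m (%u v. (if u=v then 1 else 0)+0 * ?K u v)=1"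
 by (rule detn_upper_unitriangular) auto
 moreover have "?g 0 p=1" for p by (rule prod.neutral) auto
 ultimately show ?thesis using eqf[of 0] by (simp add: Z_def)
 qed
 have scaled: "infsum (%p. ?w p * ?g f p) ?S/f^m=Z * detn m (%u v. (if u=v then 1/f else 0) + ?K u v)"
 if "f > 0" for f
 proof -
 have "detn m (%u v. (if u=v then 1 else 0)+f * ?K u v)
 = detn m (%u v. f*1*((if u=v then 1/f else 0) + ?K u v))"
 by (rule detn_cong) (use that in \<open>auto simp: field_simps\<close>)
 also have "... = f^m * detn m (%u v. (if u=v then 1/f else 0) + ?K u v)"
 by (subst detn_scale) simp
 finally show ?thesis using eqf[of f] that ZG by simp
 qed
 have lower: "W<=infsum (%p. ?w p * ?g f p) ?S/f^m" if f: "f > 0" for f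
 proof -
 have "f^m * W=infsum (%p. f^m * ?w p) ?all" unfolding W_def by (rule infsum_cmult_right'[symmetric])
 also have "... <= infsum (%p. ?w p * ?g f p) ?S"
 proof (rule infsum_mono_neutral)
 show "(%p. f^m * ?w p) summable_on ?all" by (intro summable_on_cmult_right sw) auto
 show "(%p. ?w p * ?g f p) summable_on ?S" using f by (intro sg) auto
 fix p assume "p \<in> ?all \<inter> ?S"
 hence "?g f p=(\<Prod>u<m. 1+f)" by (intro prod.cong) auto
 hence "f^m <= ?g f p" using f by (simp add: power_mono)
 thus "f^m * ?w p <= ?w p * ?g f p" by (simp add: mult.commute)
 qed (use g_le f in \<open>auto intro!: mult_nonneg_nonneg simp: less_imp_le\<close>)
 finally show ?thesis using f by (simp add: field_simps)
 qed
 \<comment> \<open>A partition that misses a mark loses at least one factor \<open>1 + f\<close>;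
   this accounts for the term with \<open>Z\<close>.\<close>
 have upper: "infsum (%p. ?w p * ?g f p) ?S/f^m<=(1+1/f)^m*(W+Z*(1/(1+f)))" if f: "f > 0" for f
 proof -
 have "infsum (%p. ?w p * ?g f p) ?S \<le>
 infsum (%p. (1+f)^m*((if p \<in> ?all then ?w p else 0) + ?w p*(1/(1+f)))) ?S"
 proof (rule infsum_mono)
 show "(%p. ?w p * ?g f p) summable_on ?S" using f by (intro sg) auto
 have "(%p. if p \<in> ?all then ?w p else 0) summable_on ?S"
 using sw[of ?all] by (subst summable_on_cong_neutral[where T = ?all and g = ?w]) auto
 thus "(%p. (1+f)^m*((if p \<in> ?all then ?w p else 0) + ?w p*(1/(1+f)))) summable_on ?S"
 by (intro summable_on_cmult_right summable_on_add summable_on_cmult_left sw) auto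
 fix p assume p: "p \<in> ?S"
 show "?w p * ?g f p<=(1+f)^m*((if p \<in> ?all then ?w p else 0) + ?w p*(1/(1+f)))"
 proof (cases "p \<in> ?all")
 case True
 have "?w p * ?g f p <= ?w p*(1+f)^m" using g_le[of f p] f by (intro mult_left_mono) auto
 also have "... <= (1+f)^m*(?w p + ?w p*(1/(1+f)))" using f by (simp add: algebra_simps)
 finally show ?thesis using True by simp
 next
 case False
 then obtain u where u: "u < m" "~ ?occ u p" using p by auto
 have "?g f p=(if ?occ u p then 1+f else 1)*(\<Prod>u'\<in>{..<m} - {u}. if ?occ u' p then 1+f else 1)"
 using u by (intro prod.remove) auto
 also have "... = (\<Prod>u'\<in>{..<m} - {u}. if ?occ u' p then 1+f else 1)" using u by simp
 also have "... <= (\<Prod>u'\<in>{..<m} - {u}. 1+f)" by (intro prod_mono) (use f in auto)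
 also have "... = (1+f)^m*(1/(1+f))"
 proof -
 obtain m' where "m=Suc m'" using u by (cases m) auto
 thus ?thesis using u f by simp
 qed
 finally have "?w p * ?g f p <= ?w p*((1+f)^m*(1/(1+f)))" by (intro mult_left_mono) auto
 thus ?thesis unfolding if_not_P[OF False] by (simp only: add_0_left mult_ac)
 qed
 qed
 also have "... = (1+f)^m*(W+Z*(1/(1+f)))"
 proof -
 have "infsum (%p. (if p \<in> ?all then ?w p else 0) + ?w p*(1/(1+f))) ?S=W+Z*(1/(1+f))"
 proof (subst infsum_add)
 show "(%p. if p \<in> ?all then ?w p else 0) summable_on ?S"
 using sw[of ?all] by (subst summable_on_cong_neutral[where T = ?all and g = ?w]) auto
 have "infsum (%p. if p \<in> ?all then ?w p else 0) ?S=W"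
 unfolding W_def by (rule infsum_cong_neutral) auto
 moreover have "infsum (%p. ?w p*(1/(1+f))) ?S=Z*(1/(1+f))"
 unfolding Z_def by (rule infsum_cmult_left')
 ultimately show "infsum (%p. if p \<in> ?all then ?w p else 0) ?S+infsum (%p. ?w p*(1/(1+f))) ?S
 = W+Z*(1/(1+f))" by simp
 qed (intro summable_on_cmult_left sw order_refl)
 thus ?thesis by (simp only: infsum_cmult_right')
 qed
 finally have "infsum (%p. ?w p * ?g f p) ?S/f^m<=((1+f)^m*(W+Z*(1/(1+f))))/f^m"
 using f by (intro divide_right_mono) auto
 also have "... = (1+1/f)^m*(W+Z*(1/(1+f)))"
 proof -
 have "(1+f)^m/f^m=(1+1/f)^m"
 using f by (subst power_divide[symmetric]) (simp add: add_divide_distrib add.commute)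
 thus ?thesis by (metis times_divide_eq_left)
 qed
 finally show ?thesis .
 qed
 have inv: "(%j. 1/real (Suc j)) \<longlonglongrightarrow> 0" using LIMSEQ_Suc[OF lim_1_over_n] by simp
 have "(%j. Z * detn m (%u v. (if u=v then 1/real (Suc j) else 0) + ?K u v)) \<longlonglongrightarrow>
 Z * detn m (%u v. (if u=v then 0 else 0) + ?K u v)"
 proof (intro tendsto_mult tendsto_const tendsto_detn tendsto_add)
 fix u v :: nat
 show "(%j. if u=v then 1/real (Suc j) else 0) \<longlonglongrightarrow> (if u=v then 0 else 0)"
 by (cases "u=v") (simp_all only: if_True if_False simp_thms inv tendsto_const)
 qed
 moreover have "(%j. Z * detn m (%u v. (if u=v then 1/real (Suc j) else 0) + ?K u v)) \<longlonglongrightarrow> W"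
 proof (rule tendsto_sandwich[OF always_eventually always_eventually])
 show "\<forall>j. W<=Z * detn m (%u v. (if u=v then 1/real (Suc j) else 0) + ?K u v)"
 proof
 fix j
 have j: "0 < real (Suc j)" by simp
 show "W<=Z * detn m (%u v. (if u=v then 1/real (Suc j) else 0) + ?K u v)"
 using lower[OF j] unfolding scaled[OF j] .
 qed
 show "\<forall>j. Z * detn m (%u v. (if u=v then 1/real (Suc j) else 0) + ?K u v) \<le>
 (1+1/real (Suc j))^m*(W+Z*(1/(1+real (Suc j))))"
 proof
 fix j
 have j: "0 < real (Suc j)" by simp
 show "Z * detn m (%u v. (if u=v then 1/real (Suc j) else 0) + ?K u v) \<le>
 (1+1/real (Suc j))^m*(W+Z*(1/(1+real (Suc j))))"
 using upper[OF j] unfolding scaled[OF j] .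
 qed
 have "(%j. 1/(1+real (Suc j))) \<longlonglongrightarrow> 0"
 using LIMSEQ_Suc[OF inv] by (simp add: algebra_simps)
 from tendsto_mult[OF tendsto_power[OF tendsto_add[OF tendsto_const[of 1] inv],of m]
 tendsto_add[OF tendsto_const[of W] tendsto_mult[OF tendsto_const[of Z] this]]]
 show "(%j. (1+1/real (Suc j))^m*(W+Z*(1/(1+real (Suc j))))) \<longlonglongrightarrow> W" by simp
 qed simp
 ultimately have "W=Z * detn m (%u v. (if u=v then 0 else 0) + ?K u v)" using LIMSEQ_unique by blast
 thus ?thesis by (simp add: W_def Z_def)
qed

section \<open>From tile centers to particles\<close>

text \<open>For a lattice point the argument of the floor is already an integer. It is part minus
  index on the slice, because \<open>min i j\<close> equals half of
  \<open>i + j - |t|\<close>.\<close>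

definition tile_pos :: "int => real => int" where
 "tile_pos t h = \<lfloor>h + of_int \<bar>t\<bar> / 2+1/2\<rfloor>"

lemma tile_pos:
 assumes "(t,h) \<in> tile_lattice"
 shows "of_int (tile_pos t h)=h + of_int \<bar>t\<bar> / 2+1/2"
proof -
 have "h + of_int \<bar>t\<bar> / 2+1/2 \<in> \<int>"
 proof (cases "t >= 0")
 case False
 have "h + of_int t/2+1/2-of_int t \<in> \<int>"
 using assms by (intro Ints_diff) (auto simp: tile_lattice_def)
 thus ?thesis using False by (simp add: field_simps)
 qed (use assms in \<open>simp add: tile_lattice_def\<close>)
 then obtain k where "h + of_int \<bar>t\<bar> / 2+1/2 = of_int k" by (rule Ints_cases)
 thus ?thesis unfolding tile_pos_def by simp
qed

lemma tile_centers_iff: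
 assumes lat: "(t,h) \<in> tile_lattice" and t: "- int A<=t"
 shows "(t,h) \<in> tile_centers p \<longleftrightarrow> (\<exists>l. int (diag_part A p (nat (t+int A)) l)-int l=tile_pos t h)"
proof -
 have d: "diag_part A p (nat (t+int A)) l=p (l+nat (- t)) (l+nat t)" for l
 proof -
 have "A-nat (t+int A)=nat (- t)" "nat (t+int A)-A=nat t" using t by auto
 thus ?thesis by (simp add: diag_part_def)
 qed
 have pos: "of_int (int a-int l)=h + of_int \<bar>t\<bar> / 2+1/2 \<longleftrightarrow> int a-int l=tile_pos t h" for a l
 by (simp only: tile_pos[OF lat,symmetric] of_int_eq_iff)
 show ?thesis
 proof
 assume "(t,h) \<in> tile_centers p"
 then obtain i j where ij: "t=int j-int i" "h=real (p i j)-(real i+real j+1)/2"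
 by (auto simp: tile_centers_def)
 have e: "min i j+nat (- t)=i" "min i j+nat t=j" using ij(1) by auto
 have "of_int (int (p i j)-int (min i j))=h + of_int \<bar>t\<bar> / 2+1/2"
 proof (cases "i<=j")
 case True
 hence "of_int \<bar>t\<bar> = real j-real i" "min i j=i" using ij(1) by auto
 thus ?thesis using ij(2) by (simp add: field_simps)
 next
 case False
 hence "of_int \<bar>t\<bar> = real i-real j" "min i j=j" using ij(1) by auto
 thus ?thesis using ij(2) by (simp add: field_simps)
 qed
 hence "int (p i j)-int (min i j)=tile_pos t h" using pos by blast
 thus "\<exists>l. int (diag_part A p (nat (t+int A)) l)-int l=tile_pos t h"
 unfolding d by (intro exI[of _ "min i j"]) (simp only: e)
 next
 assume "\<exists>l. int (diag_part A p (nat (t+int A)) l)-int l=tile_pos t h"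
 then obtain l where l: "int (p (l+nat (- t)) (l+nat t))-int l=tile_pos t h" unfolding d by blast
 define i j where "i=l+nat (- t)" and "j=l+nat t"
 have ij: "t=int j-int i" by (simp add: i_def j_def)
 have "of_int (int (p i j)-int l)=h + of_int \<bar>t\<bar> / 2+1/2"
 using l pos unfolding i_def j_def by blast
 moreover have "real i+real j=2 * real l + of_int \<bar>t\<bar>" by (simp add: i_def j_def)
 ultimately have "h=real (p i j)-(real i+real j+1)/2" by (simp add: field_simps)
 thus "(t,h) \<in> tile_centers p" using ij by (auto simp: tile_centers_def)
 qed
qed

lemma occupied_iff:
 assumes "- int n < x"
 shows "occupied n A k (nat (x+int (n-1))) p \<longleftrightarrow> (\<exists>l<n. int (diag_part A p k l)-int l=x)"
proof -
 have "diag_part A p k l+vacuum n l=nat (x+int (n-1)) \<longleftrightarrow> int (diag_part A p k l)-int l=x"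
 if "l < n" for l
 proof -
 have "int (vacuum n l)=int (n-1)-int l" using that by (auto simp: vacuum_def)
 moreover have "int (nat (x+int (n-1)))=x+int (n-1)" using assms that by auto
 moreover have "diag_part A p k l+vacuum n l=nat (x+int (n-1)) \<longleftrightarrow>
 int (diag_part A p k l)+int (vacuum n l)=int (nat (x+int (n-1)))"
 by (simp only: of_nat_add[symmetric] of_nat_eq_iff)
 ultimately show ?thesis by (simp only:) (rule iffI; linarith)
 qed
 thus ?thesis unfolding occupied_def by blast
qed

text \<open>The base has sides \<open>A\<close> and \<open>A + d\<close>. Any \<open>d\<close> gives
  the same limit in \<open>A\<close>; later it is chosen to balance the growing and the shrinking
  steps around the slices.\<close>

definition box_kernel :: "real => int => nat => int => real => int => real => real" where
 "box_kernel r d A t h t' h' =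
 corr_kernel r A (A+nat (int A+d)) (nat (t+int A)) (tile_pos t h) (nat (t'+int A)) (tile_pos t' h')"

text \<open>The bases exhaust all plane partitions, so numerator and denominator converge
  separately; the empty partition keeps the denominators at least 1.\<close>

theorem pp_prob_limit:
 fixes t :: "nat => int" and h :: "nat => real"
 assumes r: "r > 0" and lat: "\<And>u. u < m ==> (t u,h u) \<in> tile_lattice"
 and inj: "inj_on (%u. (t u,h u)) {..<m}"
 shows "(%A. detn m (%u v. box_kernel r d A (t u) (h u) (t v) (h v))) \<longlonglongrightarrow>
 pp_prob (exp (- r)) (%p. (%u. (t u,h u)) ` {..<m} \<subseteq> tile_centers p)"
proof -
 let ?w = "%p. exp (- r * real (volume p))"
 let ?E = "%p. (%u. (t u,h u)) ` {..<m} \<subseteq> tile_centers p"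
 let ?S = "{p. plane_partition p}" and ?SE = "{p. plane_partition p & ?E p}"
 define B where "B=(%A. nat (int A+d))"
 define Z W where "Z=(%A. infsum ?w (base_pps A (B A)))" and "W=(%A. infsum ?w {p \<in> base_pps A (B A). ?E p})"
 note sw=summable_plane_partitions[OF r]
 have sT: "?w summable_on T" if "T \<subseteq> ?S" for T using sw that by (rule summable_on_subset_banach)
 have ev: "\<forall>\<^sub>F A in sequentially. p \<in> base_pps A (B A)" if "plane_partition p" for p
 proof -
 from that obtain N where N: "\<And>A B. N<=A ==> N<=B ==> (\<forall>i\<ge>A. p i 0=0) & (\<forall>j\<ge>B. p 0 j=0)"
 by (rule plane_partition_in_box) blast
 show ?thesis
 using eventually_ge_at_top[of "N+nat \<bar>d\<bar>"]
 proof eventually_elim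
 case (elim A)
 hence "N<=A" "N<=B A" unfolding B_def by linarith+
 thus ?case using N that by (simp add: base_pps_def)
 qed
 qed
 have Zlim: "Z \<longlonglongrightarrow> infsum ?w ?S"
 unfolding Z_def
 proof (rule infsum_tendsto_infsum_exhaustion[OF sw])
 show "\<forall>\<^sub>F A in sequentially. p \<in> base_pps A (B A)" if "p \<in> ?S" for p using ev that by simp
 qed (auto simp: base_pps_def)
 have Wlim: "W \<longlonglongrightarrow> infsum ?w ?SE"
 unfolding W_def
 proof (rule infsum_tendsto_infsum_exhaustion[OF sT])
 fix p assume p: "p \<in> ?SE"
 hence "\<forall>\<^sub>F A in sequentially. p \<in> base_pps A (B A)" by (intro ev) auto
 thus "\<forall>\<^sub>F A in sequentially. p \<in> {p \<in> base_pps A (B A). ?E p}"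
 by eventually_elim (use p in auto)
 qed (auto simp: base_pps_def)
 have Zpos: "1<=infsum ?w T" if "(%_ _. 0) \<in> T" "T \<subseteq> ?S" for T
 proof -
 have "sum ?w {%_ _. 0}<=infsum ?w T"
 by (rule finite_sum_le_infsum[OF sT[OF that(2)]]) (use that in auto)
 moreover have "volume (%_ _. 0)=0" by (simp add: volume_def)
 ultimately show ?thesis by simp
 qed
 have zero: "(%_ _. 0) \<in> base_pps A B" for A B by (auto simp: base_pps_def plane_partition_def)
 have Z1: "1<=Z A" for A
 unfolding Z_def by (rule Zpos[OF zero]) (auto simp: base_pps_def)
 have Z2: "1<=infsum ?w ?S" by (rule Zpos) (auto simp: plane_partition_def)
 have "\<forall>\<^sub>F A in sequentially. W A/Z A=detn m (%u v. box_kernel r d A (t u) (h u) (t v) (h v))"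
 using eventually_ge_at_top[of "1+nat \<bar>d\<bar> + (\<Sum>u<m. nat \<bar>t u\<bar>)"]
 proof eventually_elim
 case (elim A)
 let ?B = "B A"
 have tb: "nat \<bar>t u\<bar> <= (\<Sum>u<m. nat \<bar>t u\<bar>)" if "u < m" for u
 using that by (intro member_le_sum) auto
 have tA: "\<bar>t u\<bar> < int A" if "u < m" for u
 using tb[OF that] elim by linarith
 define s where "s=(\<Sum>u<m. nat \<bar>tile_pos (t u) (h u)\<bar>)"
 \<comment> \<open>Large enough to exceed both sides of the base and to move every tile to a
   position at least \<open>B\<close>, as \<open>base_pps_prob\<close> requires.\<close>
 define n where "n=1+A+2 * ?B+s"
 define uk ux where "uk=(%u. nat (t u+int A))" and "ux=(%u. nat (tile_pos (t u) (h u)+int (n-1)))"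
 have xb: "int ?B<=tile_pos (t u) (h u)+int (n-1)" if "u < m" for u
 proof -
 have "nat \<bar>tile_pos (t u) (h u)\<bar> <= s"
 unfolding s_def using that by (intro member_le_sum) auto
 thus ?thesis unfolding n_def by linarith
 qed
 have X: "int (ux u)-int (n-1)=tile_pos (t u) (h u)" if "u < m" for u
 using xb[OF that] unfolding ux_def by linarith
 have B1: "0 < ?B" using elim unfolding B_def by linarith
 have uk: "uk u < A + ?B" if "u < m" for u
 proof -
 have "\<bar>t u\<bar> < int A+d" using tb[OF that] elim by linarith
 thus ?thesis using tA[OF that] unfolding uk_def B_def by linarith
 qed
 have inj': "inj_on (%u. (uk u,ux u)) {..<m}"
 proof (rule inj_onI)
 fix u v assume uv: "u \<in> {..<m}" "v \<in> {..<m}" and e: "(uk u,ux u)=(uk v,ux v)"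
 have "0<=t u+int A" "0<=t v + int A" using tA[of u] tA[of v] uv by auto
 hence "t u=t v" using e by (simp add: uk_def eq_nat_nat_iff)
 have "tile_pos (t u) (h u)=tile_pos (t v) (h v)" using e X[of u] X[of v] uv by simp
 hence "real_of_int (tile_pos (t u) (h u))=real_of_int (tile_pos (t v) (h v))" by (rule arg_cong)
 moreover have "real_of_int (tile_pos (t u) (h u))=h u+real_of_int \<bar>t u\<bar> / 2+1/2"
 "real_of_int (tile_pos (t v) (h v))=h v + real_of_int \<bar>t v\<bar> / 2+1/2"
 using tile_pos[OF lat] uv by auto
 moreover have "real_of_int \<bar>t u\<bar> = real_of_int \<bar>t v\<bar>" using \<open>t u=t v\<close> by (simp only:)
 ultimately have "h u=h v" by linarith
 thus "u=v" using \<open>t u=t v\<close> inj_onD[OF inj,of u v] uv by simp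
 qed
 have occ: "occupied n A (uk u) (ux u) p \<longleftrightarrow> (t u,h u) \<in> tile_centers p" if u: "u < m" and p: "p \<in> base_pps A ?B" for u p
 proof -
 have xn: "- int n < tile_pos (t u) (h u)" using xb[OF u] B1 by linarith
 have "occupied n A (uk u) (ux u) p \<longleftrightarrow> (\<exists>l<n. int (diag_part A p (uk u) l)-int l=tile_pos (t u) (h u))"
 unfolding ux_def by (rule occupied_iff[OF xn])
 also have "... \<longleftrightarrow> (\<exists>l. int (diag_part A p (uk u) l)-int l=tile_pos (t u) (h u))"
 proof -
 have "l < n" if "int (diag_part A p (uk u) l)-int l=tile_pos (t u) (h u)" for l
 proof (rule ccontr)
 assume "~ l < n"
 hence "A<=l" unfolding n_def by linarith
 have "p \<in> box_pps A ?B (p 0 0)" using p by (auto simp: base_pps_def box_pps_def)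
 from box_pps_zero[OF this,of "l+(A-uk u)" "l+(uk u-A)"] have "diag_part A p (uk u) l=0"
 using \<open>A<=l\<close> by (simp add: diag_part_def)
 thus False using that \<open>~ l < n\<close> xn by linarith
 qed
 thus ?thesis by blast
 qed
 also have "... \<longleftrightarrow> (t u,h u) \<in> tile_centers p"
 unfolding uk_def by (rule tile_centers_iff[symmetric,OF lat[OF u]]) (use tA[OF u] in linarith)
 finally show ?thesis .
 qed
 have "{p \<in> base_pps A ?B. ?E p} = {p \<in> base_pps A ?B. \<forall>u<m. occupied n A (uk u) (ux u) p}"
 proof (rule Collect_cong,rule conj_cong[OF refl])
 fix p assume p: "p \<in> base_pps A ?B"
 have "?E p \<longleftrightarrow> (\<forall>u<m. (t u,h u) \<in> tile_centers p)" by blast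
 also have "... \<longleftrightarrow> (\<forall>u<m. occupied n A (uk u) (ux u) p)" using occ[OF _ p] by blast
 finally show "?E p \<longleftrightarrow> (\<forall>u<m. occupied n A (uk u) (ux u) p)" .
 qed
 hence WE: "W A=infsum ?w {p \<in> base_pps A ?B. \<forall>u<m. occupied n A (uk u) (ux u) p}"
 unfolding W_def by (rule arg_cong)
 have uxB: "?B<=ux u" if "u < m" for u using xb[OF that] unfolding ux_def by linarith
 have n: "0 < n" "A<=n" "?B<=n" unfolding n_def by linarith+
 have "W A=Z A * detn m (%u v. corr_kernel r A (A + ?B) (uk u) (int (ux u)-int (n-1)) (uk v) (int (ux v)-int (n-1)))"
 unfolding WE Z_def by (rule base_pps_prob[OF r n uk uxB inj'])
 also have "detn m (%u v. corr_kernel r A (A + ?B) (uk u) (int (ux u)-int (n-1)) (uk v) (int (ux v)-int (n-1)))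
 = detn m (%u v. box_kernel r d A (t u) (h u) (t v) (h v))"
 by (rule detn_cong) (simp only: X box_kernel_def uk_def B_def)
 finally have "W A=Z A * detn m (%u v. box_kernel r d A (t u) (h u) (t v) (h v))" .
 moreover have "Z A ~= 0" using Z1[of A] by linarith
 ultimately show ?case by (metis nonzero_mult_div_cancel_left)
 qed
 moreover have "(%A. W A/Z A) \<longlonglongrightarrow> infsum ?w ?SE/infsum ?w ?S"
 using Z2 by (intro tendsto_divide Wlim Zlim) auto
 ultimately have "(%A. detn m (%u v. box_kernel r d A (t u) (h u) (t v) (h v))) \<longlonglongrightarrow> infsum ?w ?SE/infsum ?w ?S"
 by (rule Lim_transform_eventually[rotated])
 moreover have pw: "exp (- r)^k=exp (- r * real k)" for k
 using exp_of_nat_mult[of k "- r"] by (simp only: mult.commute[of "real k"])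
 have "pp_prob (exp (- r)) ?E=infsum ?w ?SE/infsum ?w ?S"
 unfolding pp_prob_def by (simp only: pw)
 ultimately show ?thesis by (simp only:)
qed

section \<open>Fourier coefficients on arcs: Bessel's inequality and integration by parts\<close>

lemma continuous_on_vector_derivative:
 assumes "\<And>x. x \<in> S ==> (f has_vector_derivative f' x) (at x within S)"
 shows "continuous_on S f"
 unfolding continuous_on_eq_continuous_within using assms has_vector_derivative_continuous by blast

lemma integral_norm_sq_nonneg:
 fixes f :: "real => complex"
 assumes "continuous_on {a..b} f"
 shows "0<=integral {a..b} (%th. (norm (f th))\<^sup>2)"
 by (rule integral_nonneg) (auto intro!: integrable_continuous_interval continuous_intros assms)

text \<open>Exponentials are orthogonal on the full period only; enlarging the integral of the
  squared modulus of \<open>P\<close> from the arc to the period goes in the favourable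
  direction.\<close>

lemma bessel_finite:
 fixes f :: "real => complex"
 assumes f: "continuous_on {a..b} f" and ab: "- pi<=a" "b<=pi" and X: "finite X"
 shows "(\<Sum>n\<in>X. (norm (fourier_coeff a b f n))\<^sup>2)<=1/(2 * pi) * integral {a..b} (%th. (norm (f th))\<^sup>2)"
proof -
 define c where "c=fourier_coeff a b f"
 define P where "P=(%th. \<Sum>n\<in>X. c n * cis (of_int n * th))"
 have cP: "continuous_on T P" for T unfolding P_def by (intro continuous_intros)
 have ints: "g integrable_on {a..b}" if "continuous_on {a..b} g" for g :: "real => complex"
 using that by (rule integrable_continuous_interval)
 have fP: "integral {a..b} (%th. f th * cnj (P th)) = of_real (2 * pi*(\<Sum>n\<in>X. (norm (c n))\<^sup>2))"
 proof -
 have "integral {a..b} (%th. f th * cnj (P th))=integral {a..b} (%th. \<Sum>n\<in>X. cnj (c n)*(f th * cis (- (of_int n * th))))"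
 by (rule integral_cong) (simp add: P_def sum_distrib_left cis_cnj mult_ac)
 also have "... = (\<Sum>n\<in>X. integral {a..b} (%th. cnj (c n)*(f th * cis (- (of_int n * th)))))"
 by (rule integral_sum[OF X]) (intro ints continuous_intros f)
 also have "... = (\<Sum>n\<in>X. cnj (c n)*(2 * pi * c n))"
 by (rule sum.cong[OF refl]) (simp add: c_def fourier_coeff_def integral_mult_right)
 also have "... = (\<Sum>n\<in>X. of_real (2 * pi*(norm (c n))\<^sup>2))"
 by (rule sum.cong[OF refl]) (simp only: of_real_mult complex_norm_square,simp add: mult_ac)
 finally show ?thesis by (simp add: sum_distrib_left)
 qed
 have PP: "integral {- pi..pi} (%th. P th * cnj (P th)) = of_real (2 * pi*(\<Sum>n\<in>X. (norm (c n))\<^sup>2))"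
 proof -
 have "integral {- pi..pi} (%th. P th * cnj (P th))
 = integral {- pi..pi} (%th. \<Sum>n\<in>X. \<Sum>k\<in>X. c n * cnj (c k) * cis (of_int (n-k) * th))"
 by (rule integral_cong) (simp add: P_def sum_product cis_cnj cis_mult algebra_simps)
 also have "... = (\<Sum>n\<in>X. \<Sum>k\<in>X. integral {- pi..pi} (%th. c n * cnj (c k) * cis (of_int (n-k) * th)))"
 by (subst integral_sum[OF X],intro integrable_continuous_interval continuous_intros)
 (intro sum.cong refl integral_sum[OF X] integrable_continuous_interval continuous_intros)
 also have "... = (\<Sum>n\<in>X. \<Sum>k\<in>X. c n * cnj (c k)*(if n=k then of_real (2 * pi) else 0))"
 by (intro sum.cong refl) (simp only: integral_mult_right integral_cis_period,simp)
 also have "... = (\<Sum>n\<in>X. of_real (2 * pi*(norm (c n))\<^sup>2))"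
 proof (rule sum.cong[OF refl])
 fix n assume "n \<in> X"
 hence "(\<Sum>k\<in>X. c n * cnj (c k)*(if n=k then of_real (2 * pi) else 0))=c n * cnj (c n) * of_real (2 * pi)"
 using X by (simp add: if_distrib[of "%x. _ * x"] cong: if_cong)
 also have "... = of_real (2 * pi*(norm (c n))\<^sup>2)"
 by (simp only: of_real_mult complex_norm_square,simp add: mult_ac)
 finally show "(\<Sum>k\<in>X. c n * cnj (c k)*(if n=k then of_real (2 * pi) else 0)) = of_real (2 * pi*(norm (c n))\<^sup>2)" .
 qed
 finally show ?thesis by (simp add: sum_distrib_left)
 qed
 let ?S = "2 * pi*(\<Sum>n\<in>X. (norm (c n))\<^sup>2)"
 have sqi: "(%th. (norm (g th))\<^sup>2) integrable_on {l..u}" if "continuous_on {l..u} g" for g :: "real => complex" and l u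
 using that by (intro integrable_continuous_interval continuous_intros)
 have PPr: "integral {- pi..pi} (%th. (norm (P th))\<^sup>2) = ?S"
 proof -
 have "(norm (P th))\<^sup>2=Re (P th * cnj (P th))" for th
 unfolding cmod_power2 by (simp add: power2_eq_square)
 hence "integral {- pi..pi} (%th. (norm (P th))\<^sup>2)=integral {- pi..pi} (%th. Re (P th * cnj (P th)))"
 by (simp only:)
 also have "... = Re (integral {- pi..pi} (%th. P th * cnj (P th)))"
 using integral_linear[OF integrable_continuous_interval bounded_linear_Re,of "- pi" pi "%th. P th * cnj (P th)"] cP
 by (simp add: o_def continuous_intros)
 finally show ?thesis using PP by simp
 qed
 have fPr: "integral {a..b} (%th. Re (f th * cnj (P th))) = ?S"
 proof -
 have "integral {a..b} (%th. Re (f th * cnj (P th)))=Re (integral {a..b} (%th. f th * cnj (P th)))"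
 using integral_linear[OF ints bounded_linear_Re,of "%th. f th * cnj (P th)"] f cP
 by (simp add: o_def continuous_intros)
 thus ?thesis using fP by simp
 qed
 have "0<=integral {a..b} (%th. (norm (f th-P th))\<^sup>2)"
 by (rule integral_norm_sq_nonneg) (intro continuous_intros f cP)
 also have "... = integral {a..b} (%th. (norm (f th))\<^sup>2-2 * Re (f th * cnj (P th))+(norm (P th))\<^sup>2)"
 by (rule integral_cong) (unfold cmod_power2,simp add: power2_eq_square algebra_simps)
 also have "... = integral {a..b} (%th. (norm (f th))\<^sup>2)-2 * ?S+integral {a..b} (%th. (norm (P th))\<^sup>2)"
 proof -
 have 1: "(%th. 2 * Re (f th * cnj (P th))) integrable_on {a..b}"
 by (intro integrable_continuous_interval continuous_intros f cP)
 have "integral {a..b} (%th. (norm (f th))\<^sup>2-2 * Re (f th * cnj (P th))+(norm (P th))\<^sup>2) =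
 integral {a..b} (%th. (norm (f th))\<^sup>2-2 * Re (f th * cnj (P th)))+integral {a..b} (%th. (norm (P th))\<^sup>2)"
 by (intro integral_add integrable_diff sqi 1 f cP)
 also have "integral {a..b} (%th. (norm (f th))\<^sup>2-2 * Re (f th * cnj (P th))) =
 integral {a..b} (%th. (norm (f th))\<^sup>2)-integral {a..b} (%th. 2 * Re (f th * cnj (P th)))"
 by (intro integral_diff sqi 1 f)
 finally show ?thesis using fPr by (simp del: times_complex.sel)
 qed
 also have "integral {a..b} (%th. (norm (P th))\<^sup>2) <= ?S"
 unfolding PPr[symmetric] using ab by (intro integral_subset_le sqi cP) auto
 finally have "?S<=integral {a..b} (%th. (norm (f th))\<^sup>2)" by simp
 thus ?thesis by (simp add: c_def field_simps)
qed

lemma norm_infsum_mult_le: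
 fixes c d :: "'a => complex"
 assumes s: "(%n. c n * d n) summable_on X"
 and c: "\<And>F. finite F ==> F \<subseteq> X ==> (\<Sum>n\<in>F. (norm (c n))\<^sup>2)<=P"
 and d: "\<And>F. finite F ==> F \<subseteq> X ==> (\<Sum>n\<in>F. (norm (d n))\<^sup>2)<=Q"
 shows "norm (\<Sum>\<^sub>\<infinity>n\<in>X. c n * d n)<=sqrt P * sqrt Q"
proof -
 have "norm (\<Sum>n\<in>F. c n * d n)<=sqrt P * sqrt Q" if F: "finite F" "F \<subseteq> X" for F
 proof -
 have PQ: "0<=P" "0<=Q" using c[of "{}"] d[of "{}"] by auto
 have "norm (\<Sum>n\<in>F. c n * d n)<=(\<Sum>n\<in>F. norm (c n) * norm (d n))"
 by (rule order_trans[OF norm_sum]) (simp add: norm_mult)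
 also have "... = sqrt ((\<Sum>n\<in>F. norm (c n) * norm (d n))\<^sup>2)" by (simp add: sum_nonneg)
 also have "... <= sqrt ((\<Sum>n\<in>F. (norm (c n))\<^sup>2)*(\<Sum>n\<in>F. (norm (d n))\<^sup>2))"
 by (intro real_sqrt_le_mono Cauchy_Schwarz_ineq_sum)
 also have "... <= sqrt (P * Q)"
 using PQ by (intro real_sqrt_le_mono mult_mono c d F sum_nonneg) auto
 finally show ?thesis by (simp add: real_sqrt_mult)
 qed
 moreover have "((%F. norm (\<Sum>n\<in>F. c n * d n)) \<longlongrightarrow> norm (\<Sum>\<^sub>\<infinity>n\<in>X. c n * d n)) (finite_subsets_at_top X)"
 using has_sum_infsum[OF s] unfolding has_sum_def by (rule tendsto_norm)
 ultimately show ?thesis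
 by (intro tendsto_upperbound[of _ _ "finite_subsets_at_top X"]) (auto intro!: eventually_finite_subsets_at_top_weakI)
qed

text \<open>Integration by parts; monotonicity of \<open>\<Psi>\<close> bounds the total variation of \<open>1 / (\<Psi> + n)\<close>.\<close>

lemma nonstationary_fourier_coeff:
 fixes F phi phi' :: "real => complex" and \<Psi> \<Psi>' :: "real => real"
 assumes ab: "a<=b" "b-a<=2 * pi"
 and F: "\<And>x. x \<in> {a..b} ==> (F has_vector_derivative \<i> * of_real (\<Psi> x) * F x) (at x within {a..b})"
 and F1: "\<And>x. x \<in> {a..b} ==> norm (F x)=1"
 and \<Psi>: "\<And>x. x \<in> {a..b} ==> (\<Psi> has_real_derivative \<Psi>' x) (at x within {a..b})"
 and \<Psi>'c: "continuous_on {a..b} \<Psi>'"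
 and \<Psi>'s: "(\<forall>x\<in>{a..b}. 0 <= \<Psi>' x) \<or> (\<forall>x\<in>{a..b}. \<Psi>' x<=0)"
 and phi: "\<And>x. x \<in> {a..b} ==> (phi has_vector_derivative phi' x) (at x within {a..b})"
 and phi'c: "continuous_on {a..b} phi'"
 and M: "\<And>x. x \<in> {a..b} ==> norm (phi x)<=M" "\<And>x. x \<in> {a..b} ==> norm (phi' x)<=M"
 and mu: "0 < mu" "(\<forall>x\<in>{a..b}. mu <= \<Psi> x + of_int n) \<or> (\<forall>x\<in>{a..b}. \<Psi> x + of_int n <= - mu)"
 shows "norm (fourier_coeff a b (%x. cnj (F x) * phi x) n)<=2 * M / mu"
proof -
 \<comment> \<open>Up to sign the phase rate of the full integrand, oscillation and frequency
   together; it keeps the distance \<open>mu\<close> from 0.\<close>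
 define X where "X=(%x. \<Psi> x + of_int n)"
 have Xn: "mu <= \<bar>X x\<bar>" "X x ~= 0" if "x \<in> {a..b}" for x using mu that by (fastforce simp: X_def)+
 have Xd: "(X has_real_derivative \<Psi>' x) (at x within {a..b})" if "x \<in> {a..b}" for x
 unfolding X_def using \<Psi>[OF that] by (auto intro!: derivative_eq_intros)
 have Xc: "continuous_on {a..b} X" using Xd by (intro DERIV_continuous_on)
 have phic: "continuous_on {a..b} phi" using phi by (intro continuous_on_vector_derivative)
 have M0: "0<=M" using M(1)[of a] ab by (auto intro: order_trans[OF norm_ge_zero])
 define E where "E=(%x. cnj (F x) * cis (- (of_int n * x)))"
 have Ed: "(E has_vector_derivative - \<i> * of_real (X x) * E x) (at x within {a..b})" if "x \<in> {a..b}" for x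
 proof -
 have "((%x. cis (- (of_int n * x))) has_vector_derivative - \<i> * of_int n * cis (- (of_int n * x))) (at x within {a..b})"
 unfolding cis_conv_exp
 by (auto intro!: derivative_eq_intros has_vector_derivative_real_field simp: algebra_simps)
 from has_vector_derivative_mult[OF has_vector_derivative_cnj[OF F[OF that]] this]
 show ?thesis unfolding E_def by (rule has_vector_derivative_eq_rhs) (simp add: X_def algebra_simps)
 qed
 have Ec: "continuous_on {a..b} E" using Ed by (intro continuous_on_vector_derivative)
 have E1: "norm (E x)=1" if "x \<in> {a..b}" for x using F1[OF that] by (simp add: E_def norm_mult)
 define u where "u=(%x. phi x/of_real (X x))"
 define u' where "u'=(%x. phi' x/of_real (X x) - phi x * of_real (\<Psi>' x/(X x)\<^sup>2))"
 have ud: "(u has_vector_derivative u' x) (at x within {a..b})" if x: "x \<in> {a..b}" for x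
 proof -
 have "((%x. inverse (X x)) has_real_derivative-(\<Psi>' x/(X x)\<^sup>2)) (at x within {a..b})"
 using Xd[OF x] Xn(2)[OF x] by (auto intro!: derivative_eq_intros simp: power2_eq_square field_simps)
 hence "((%x. complex_of_real (inverse (X x))) has_vector_derivative of_real (- (\<Psi>' x/(X x)\<^sup>2))) (at x within {a..b})"
 by (rule has_vector_derivative_of_real)
 from has_vector_derivative_mult[OF phi[OF x] this] show ?thesis
 unfolding u_def u'_def divide_inverse of_real_inverse[symmetric]
 by (rule has_vector_derivative_eq_rhs) (simp add: divide_inverse)
 qed
 have uc: "continuous_on {a..b} u" using ud by (intro continuous_on_vector_derivative)
 have u'c: "continuous_on {a..b} u'"
 unfolding u'_def using Xn(2) by (intro continuous_intros phic phi'c Xc \<Psi>'c) auto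
 have i1: "((%x. u x*(- \<i> * of_real (X x) * E x)+u' x * E x) has_integral u b * E b-u a * E a) {a..b}"
 by (rule fundamental_theorem_of_calculus[OF ab(1)])
 (rule has_vector_derivative_mult[OF ud Ed])
 have i2: "(%x. u' x * E x) integrable_on {a..b}" by (intro integrable_continuous_interval continuous_intros u'c Ec)
 have "((%x. u x*(- \<i> * of_real (X x) * E x)) has_integral (u b * E b-u a * E a)-integral {a..b} (%x. u' x * E x)) {a..b}"
 using has_integral_diff[OF i1 integrable_integral[OF i2]] by simp
 hence "((%x. \<i> * (u x*(- \<i> * of_real (X x) * E x))) has_integral
 \<i> * ((u b * E b-u a * E a)-integral {a..b} (%x. u' x * E x))) {a..b}"
 by (rule has_integral_mult_right)
 moreover have "\<i> * (u x*(- \<i> * of_real (X x) * E x))=cnj (F x) * phi x * cis (- (of_int n * x))" if "x \<in> {a..b}" for x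
 using Xn(2)[OF that] by (simp add: u_def E_def field_simps)
 ultimately have "((%x. cnj (F x) * phi x * cis (- (of_int n * x))) has_integral
 \<i> * ((u b * E b-u a * E a)-integral {a..b} (%x. u' x * E x))) {a..b}"
 by (rule has_integral_eq[rotated])
 hence I: "integral {a..b} (%x. cnj (F x) * phi x * cis (- (of_int n * x)))
 = \<i> * ((u b * E b-u a * E a)-integral {a..b} (%x. u' x * E x))" by (rule integral_unique)
 have un: "norm (u x * E x)<=M / mu" if x: "x \<in> {a..b}" for x
 using M(1)[OF x] Xn[OF x] E1[OF x] mu(1) M0
 by (simp add: u_def norm_mult norm_divide) (rule frac_le; simp)
 have bd: "norm (integral {a..b} (%x. u' x * E x))<=integral {a..b} (%x. M / mu + M*(\<bar>\<Psi>' x\<bar> / (X x)\<^sup>2))"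
 proof (rule integral_norm_bound_integral[OF i2])
 show "(%x. M / mu + M*(\<bar>\<Psi>' x\<bar> / (X x)\<^sup>2)) integrable_on {a..b}"
 using Xn(2) by (intro integrable_continuous_interval continuous_intros Xc \<Psi>'c) auto
 fix x assume x: "x \<in> {a..b}"
 have "norm (u' x * E x)=norm (u' x)" using E1[OF x] by (simp add: norm_mult)
 also have "... <= norm (phi' x/of_real (X x))+norm (phi x * of_real (\<Psi>' x/(X x)\<^sup>2))"
 unfolding u'_def by (rule norm_triangle_ineq4)
 also have "... <= M / mu + M*(\<bar>\<Psi>' x\<bar> / (X x)\<^sup>2)"
 proof (rule add_mono)
 show "norm (phi' x/of_real (X x))<=M / mu"
 using M(2)[OF x] Xn[OF x] mu(1) M0 by (simp add: norm_divide) (rule frac_le; simp)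
 show "norm (phi x * of_real (\<Psi>' x/(X x)\<^sup>2))<=M*(\<bar>\<Psi>' x\<bar> / (X x)\<^sup>2)"
 unfolding norm_mult norm_of_real using M(1)[OF x] M0 by (intro mult_mono) (auto simp: abs_divide)
 qed
 finally show "norm (u' x * E x)<=M / mu + M*(\<bar>\<Psi>' x\<bar> / (X x)\<^sup>2)" .
 qed
 have tv: "integral {a..b} (%x. \<bar>\<Psi>' x\<bar> / (X x)\<^sup>2)<=1 / mu"
 proof -
 have d: "((%x. inverse (X x)) has_vector_derivative-(\<Psi>' x/(X x)\<^sup>2)) (at x within {a..b})" if x: "x \<in> {a..b}" for x
 unfolding has_real_derivative_iff_has_vector_derivative[symmetric]
 using Xd[OF x] Xn(2)[OF x] by (auto intro!: derivative_eq_intros simp: power2_eq_square field_simps)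
 have h: "((%x. - (\<Psi>' x/(X x)\<^sup>2)) has_integral inverse (X b)-inverse (X a)) {a..b}"
 by (rule fundamental_theorem_of_calculus[OF ab(1) d])
 have ib: "\<bar>inverse (X b)-inverse (X a)\<bar> <= 1 / mu"
 proof -
 have aux: "0 < inverse p & inverse p<=1 / mu" if "mu <= p" for p
 using that mu(1) by (auto simp: field_simps)
 from mu(2) show ?thesis
 proof
 assume "\<forall>x\<in>{a..b}. mu <= \<Psi> x + of_int n"
 hence "mu <= X a" "mu <= X b" using ab by (auto simp: X_def)
 thus ?thesis using aux[of "X a"] aux[of "X b"] by linarith
 next
 assume "\<forall>x\<in>{a..b}. \<Psi> x + of_int n <= - mu"
 hence "\<Psi> a + of_int n <= - mu" "\<Psi> b + of_int n <= - mu" using ab by auto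
 hence "mu <= - X a" "mu <= - X b" unfolding X_def by linarith+
 thus ?thesis using aux[of "- X a"] aux[of "- X b"] unfolding inverse_minus_eq by linarith
 qed
 qed
 from \<Psi>'s show ?thesis
 proof
 assume s: "\<forall>x\<in>{a..b}. 0 <= \<Psi>' x"
 have "integral {a..b} (%x. \<bar>\<Psi>' x\<bar> / (X x)\<^sup>2)=integral {a..b} (%x. - (- (\<Psi>' x/(X x)\<^sup>2)))"
 by (rule integral_cong) (use s in auto)
 also have "... = - (inverse (X b)-inverse (X a))"
 using has_integral_neg[OF h] by (rule integral_unique)
 finally show ?thesis using ib by linarith
 next
 assume s: "\<forall>x\<in>{a..b}. \<Psi>' x<=0"
 have "integral {a..b} (%x. \<bar>\<Psi>' x\<bar> / (X x)\<^sup>2)=integral {a..b} (%x. - (\<Psi>' x/(X x)\<^sup>2))"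
 by (rule integral_cong) (use s in auto)
 also have "... = inverse (X b)-inverse (X a)" using h by (rule integral_unique)
 finally show ?thesis using ib by linarith
 qed
 qed
 have "integral {a..b} (%x. M / mu + M*(\<bar>\<Psi>' x\<bar> / (X x)\<^sup>2))=(b-a)*(M / mu)+M * integral {a..b} (%x. \<bar>\<Psi>' x\<bar> / (X x)\<^sup>2)"
 proof -
 have "(%x. M*(\<bar>\<Psi>' x\<bar> / (X x)\<^sup>2)) integrable_on {a..b}"
 using Xn(2) by (intro integrable_continuous_interval continuous_intros Xc \<Psi>'c) auto
 hence "integral {a..b} (%x. M / mu + M*(\<bar>\<Psi>' x\<bar> / (X x)\<^sup>2)) =
 integral {a..b} (%x. M / mu)+integral {a..b} (%x. M*(\<bar>\<Psi>' x\<bar> / (X x)\<^sup>2))"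
 by (intro integral_add integrable_const_ivl)
 moreover have "integral {a..b} (%x. M / mu)=(b-a)*(M / mu)" using ab by simp
 ultimately show ?thesis by (simp only: integral_mult_right)
 qed
 also have "... <= (2 * pi)*(M / mu)+M*(1 / mu)"
 using ab M0 mu(1) tv by (intro add_mono mult_right_mono mult_left_mono) auto
 finally have bd2: "norm (integral {a..b} (%x. u' x * E x))<=(2 * pi+1)*(M / mu)"
 using bd by (simp add: algebra_simps)
 have "norm (integral {a..b} (%x. cnj (F x) * phi x * cis (- (of_int n * x))))
 <= norm (u b * E b)+norm (u a * E a)+norm (integral {a..b} (%x. u' x * E x))"
 unfolding I norm_mult by (simp add: norm_mult[symmetric]) (meson add_right_mono norm_triangle_ineq4 order_trans)
 also have "... <= (2 * pi+3)*(M / mu)"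
 proof -
 have "norm (u b * E b)+norm (u a * E a)+norm (integral {a..b} (%x. u' x * E x))<=M / mu + M / mu + (2 * pi+1)*(M / mu)"
 using ab by (intro add_mono un bd2) auto
 also have "... = (2 * pi+3)*(M / mu)" by (simp only: ring_distribs)
 finally show ?thesis .
 qed
 \<comment> \<open>The constant collects two boundary terms, \<open>2 * pi\<close> from
   \<open>phi'\<close> and 1 from the variation of \<open>1 / X\<close>. Rounding
   \<open>2 * pi + 3\<close> up to \<open>4 * pi\<close> leaves 2 after division by
   \<open>2 * pi\<close>.\<close>
 also have "... <= (4 * pi)*(M / mu)"
 using pi_gt3 M0 mu(1) by (intro mult_right_mono) auto
 finally have "norm (integral {a..b} (%x. cnj (F x) * phi x * cis (- (of_int n * x))))<=(4 * pi)*(M / mu)" .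
 thus ?thesis by (simp add: fourier_coeff_def norm_mult norm_divide field_simps)
qed

text \<open>On a half line the absolute value is injective, and each term after the first is at most
  a difference of consecutive values \<open>1 / (l + k)\<close>, so the sum telescopes.\<close>

lemma sum_inverse_squares_le:
 fixes l :: real
 assumes l: "l > 0" and F: "finite F" "F \<subseteq> {0<..} \<or> F \<subseteq> {..0}"
 shows "(\<Sum>n\<in>F. 1/(l + of_int \<bar>n\<bar>)\<^sup>2)<=1/l\<^sup>2+1/l"
proof -
 have inj: "inj_on (%n :: int. nat \<bar>n\<bar>) F"
 proof (rule inj_onI)
 fix x y assume *: "x \<in> F" "y \<in> F" "nat \<bar>x\<bar> = nat \<bar>y\<bar>"
 have "(0 < x & 0 < y) \<or> (x<=0 & y<=0)" using F(2) *(1,2) by auto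
 thus "x=y" using *(3) by linarith
 qed
 obtain K where K: "(%n. nat \<bar>n\<bar>) ` F \<subseteq> {..<K}" using finite_imageI[OF F(1)] finite_nat_iff_bounded by blast
 have tel: "(\<Sum>k<Suc K. 1/(l+real k)\<^sup>2)<=1/l\<^sup>2+1/l-1/(l+real K)" for K
 proof (induction K)
 case (Suc K)
 have p: "0 < l+real K" using l by simp
 have "1/(l+real (Suc K))\<^sup>2<=1/((l+real K)*(l+real (Suc K)))"
 using p by (intro divide_left_mono) (auto simp: power2_eq_square intro!: mult_right_mono)
 also have "... = 1/(l+real K)-1/(l+real (Suc K))" using p by (simp add: field_simps)
 finally show ?case using Suc by simp
 qed simp
 have "(\<Sum>n\<in>F. 1/(l + of_int \<bar>n\<bar>)\<^sup>2)=(\<Sum>k\<in>(%n. nat \<bar>n\<bar>) ` F. 1/(l+real k)\<^sup>2)"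
 by (subst sum.reindex[OF inj]) simp
 also have "... <= (\<Sum>k<Suc K. 1/(l+real k)\<^sup>2)" using K by (intro sum_mono2) auto
 also have "... <= 1/l\<^sup>2+1/l-1/(l+real K)" by (rule tel)
 also have "... <= 1/l\<^sup>2+1/l" using l by simp
 finally show ?thesis .
qed

section \<open>Blaschke factors and their phase\<close>

text \<open>The Blaschke factor \<open>(z - a) / (1 - a * z)\<close> at \<open>z = cis th\<close>,
  divided by \<open>z\<close>: numerator and denominator become complex conjugates.\<close>

definition blaschke :: "real => real => complex" where
 "blaschke a th=(1-of_real a * cis (- th))/(1-of_real a * cis th)"

definition poisson_den :: "real => real => real" where
 "poisson_den a th=1-2 * a * cos th+a\<^sup>2"

text \<open>Derivative of the argument of \<open>blaschke a\<close>. It is the Poisson kernel minus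
  1, and with \<open>a = exp (- y)\<close> it is also the derivative of
  \<open>ln (poisson_den (exp (- y)) th)\<close> in \<open>y\<close>.\<close>

definition phase_rate :: "real => real => real" where
 "phase_rate a th=(2 * a * cos th-2 * a\<^sup>2)/poisson_den a th"

lemma cmod_one_minus_cis: "(cmod (1-of_real a * cis th))\<^sup>2=poisson_den a th"
proof -
 have "(cmod (1-of_real a * cis th))\<^sup>2=(1-a * cos th)\<^sup>2+(a * sin th)\<^sup>2"
 by (simp add: cmod_power2)
 also have "... = 1-2 * a * cos th+a\<^sup>2*((sin th)\<^sup>2+(cos th)\<^sup>2)"
 by (simp only: power2_eq_square ring_distribs) (simp add: algebra_simps)
 finally show ?thesis by (simp add: poisson_den_def)
qed

lemma poisson_den_pos:
 assumes "0<=a" "a < 1"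
 shows "(1-a)\<^sup>2<=poisson_den a th" "0 < poisson_den a th"
proof -
 have "2 * a * cos th<=2 * a*1" using assms cos_le_one by (intro mult_left_mono) auto
 thus 1: "(1-a)\<^sup>2<=poisson_den a th" by (simp add: poisson_den_def power2_eq_square algebra_simps)
 have "0 < (1-a)\<^sup>2" using assms by simp
 thus "0 < poisson_den a th" using 1 by linarith
qed

lemma one_minus_cis_nz: "0<=a ==> a < 1 ==> 1-of_real a * cis th ~= 0"
 using poisson_den_pos(2)[of a th] cmod_one_minus_cis[of a th] by auto

lemma norm_blaschke:
 assumes "0<=a" "a < 1"
 shows "norm (blaschke a th)=1"
proof -
 have "1-of_real a * cis (- th)=cnj (1-of_real a * cis th)" by (simp add: cis_cnj)
 thus ?thesis using one_minus_cis_nz[OF assms,of th]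
 unfolding blaschke_def norm_divide by (metis complex_mod_cnj divide_self norm_eq_zero)
qed

lemma blaschke_derivative:
 assumes a: "0<=a" "a < 1"
 shows "(blaschke a has_vector_derivative \<i> * of_real (phase_rate a th) * blaschke a th) (at th within S)"
proof -
 let ?D = "1-of_real a * cis th" and ?C = "1-of_real a * cis (- th)"
 have nz: "?D ~= 0" "?C ~= 0" using one_minus_cis_nz[OF a] by auto
 have d1: "((%th. 1-of_real a * cis (- th)) has_vector_derivative \<i> * of_real a * cis (- th)) (at th within S)"
 unfolding cis_conv_exp by (auto intro!: derivative_eq_intros has_vector_derivative_real_field simp: algebra_simps)
 have d2: "((%th. 1-of_real a * cis th) has_vector_derivative - \<i> * of_real a * cis th) (at th within S)"
 unfolding cis_conv_exp by (auto intro!: derivative_eq_intros has_vector_derivative_real_field simp: algebra_simps)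
 have quot: "C * - (inverse D * q * inverse D)+p * inverse D=(p * D-C * q) * inverse (D * D)"
 if "D ~= 0" for C D p q :: complex
 using that by (simp add: field_simps)
 have d: "(blaschke a has_vector_derivative
 (\<i> * of_real a * cis (- th) * ?D - ?C*(- \<i> * of_real a * cis th))/(?D * ?D)) (at th within S)"
 proof -
 have "((%th. inverse (1-of_real a * cis th)) has_vector_derivative
 - (inverse ?D*(- \<i> * of_real a * cis th) * inverse ?D)) (at th within S)"
 unfolding has_vector_derivative_def
 by (rule has_derivative_eq_rhs[OF Deriv.has_derivative_inverse[OF nz(1) d2[unfolded has_vector_derivative_def]]])
 (simp add: fun_eq_iff)
 from has_vector_derivative_mult[OF d1 this] show ?thesis
 unfolding blaschke_def[abs_def] divide_inverse
 by (rule has_vector_derivative_eq_rhs) (rule quot[OF nz(1)])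
 qed
 have CD: "?C * ?D = of_real (poisson_den a th)"
 unfolding cmod_one_minus_cis[symmetric] complex_norm_square by (simp add: cis_cnj mult.commute)
 have pn: "of_real (poisson_den a th) ~= (0 :: complex)" using CD nz by (metis mult_eq_0_iff)
 have num: "cis (- th) * ?D + ?C * cis th = of_real (2 * cos th-2 * a)"
 proof -
 have "cis (- th) * ?D + ?C * cis th=cis th+cis (- th)-2 * of_real a*(cis th * cis (- th))"
 by (simp add: algebra_simps)
 also have "cis th * cis (- th)=1" by (simp add: cis_mult)
 also have "cis th+cis (- th) = of_real (2 * cos th)" by (simp add: complex_eq_iff)
 finally show ?thesis by simp
 qed
 have "(\<i> * of_real a * cis (- th) * ?D - ?C*(- \<i> * of_real a * cis th))/(?D * ?D)
 = \<i> * of_real a*(cis (- th) * ?D + ?C * cis th)/(?D * ?D)"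
 by (simp add: algebra_simps)
 also have "... = \<i> * of_real (a*(2 * cos th-2 * a))/(?C * ?D)*(?C / ?D)"
 unfolding num using nz by simp
 also have "... = \<i> * of_real (phase_rate a th) * blaschke a th"
 unfolding CD phase_rate_def blaschke_def by (simp add: power2_eq_square algebra_simps)
 finally show ?thesis using d by simp
qed

definition phase_rate' :: "real => real => real" where
 "phase_rate' a th = - (2 * a * sin th*(1-a\<^sup>2))/(poisson_den a th)\<^sup>2"

lemma phase_rate_derivative:
 assumes a: "0<=a" "a < 1"
 shows "(phase_rate a has_real_derivative phase_rate' a th) (at th within S)"
proof -
 have nz: "poisson_den a th ~= 0" using poisson_den_pos(2)[OF a,of th] by simp
 have "((%th. (2 * a * cos th-2 * a\<^sup>2)/(1-2 * a * cos th+a\<^sup>2)) has_real_derivative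
 ((- (2 * a * sin th)) * poisson_den a th-(2 * a * cos th-2 * a\<^sup>2)*(2 * a * sin th))/(poisson_den a th * poisson_den a th)) (at th within S)"
 using nz by (auto intro!: derivative_eq_intros simp: poisson_den_def)
 moreover have "((- (2 * a * sin th)) * poisson_den a th-(2 * a * cos th-2 * a\<^sup>2)*(2 * a * sin th))
 = - (2 * a * sin th*(1-a\<^sup>2))"
 by (simp add: poisson_den_def power2_eq_square algebra_simps)
 ultimately show ?thesis
 unfolding phase_rate_def[abs_def] phase_rate'_def poisson_den_def[symmetric] by (simp add: power2_eq_square)
qed

text \<open>The unimodular part of the symbol on its reference circle; the particle position
  \<open>x\<close> enters as a linear phase.\<close>

definition osc :: "real list => int => real => complex" where
 "osc as x th=(\<Prod>a\<leftarrow>as. blaschke a th) * cis (- (of_int x * th))"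

definition osc_rate :: "real list => int => real => real" where
 "osc_rate as x th=(\<Sum>a\<leftarrow>as. phase_rate a th)-of_int x"

definition osc_rate' :: "real list => real => real" where
 "osc_rate' as th=(\<Sum>a\<leftarrow>as. phase_rate' a th)"

context
 fixes as :: "real list"
 assumes as: "\<And>a. a \<in> set as ==> 0<=a & a < 1"
begin

lemma norm_osc: "norm (osc as x th)=1"
proof -
 have "norm (\<Prod>a\<leftarrow>as. blaschke a th)=1"
 using as by (induction as) (auto simp: norm_mult norm_blaschke)
 thus ?thesis by (simp add: osc_def norm_mult)
qed

lemma osc_derivative:
 "(osc as x has_vector_derivative \<i> * of_real (osc_rate as x th) * osc as x th) (at th within S)"
proof -
 have 1: "((%th. \<Prod>a\<leftarrow>as. blaschke a th) has_vector_derivative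
 \<i> * of_real (\<Sum>a\<leftarrow>as. phase_rate a th)*(\<Prod>a\<leftarrow>as. blaschke a th)) (at th within S)"
 using as
 proof (induction as)
 case (Cons b bs)
 have b: "(blaschke b has_vector_derivative \<i> * of_real (phase_rate b th) * blaschke b th) (at th within S)"
 by (rule blaschke_derivative) (use Cons.prems in auto)
 from has_vector_derivative_mult[OF b Cons.IH] Cons.prems show ?case
 by (auto simp: algebra_simps elim!: has_vector_derivative_eq_rhs)
 qed simp
 have 2: "((%th. cis (- (of_int x * th))) has_vector_derivative - \<i> * of_int x * cis (- (of_int x * th))) (at th within S)"
 unfolding cis_conv_exp
 by (auto intro!: derivative_eq_intros has_vector_derivative_real_field simp: algebra_simps)
 from has_vector_derivative_mult[OF 1 2] show ?thesis
 unfolding osc_def[abs_def] osc_rate_def by (rule has_vector_derivative_eq_rhs) (simp add: osc_def algebra_simps)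
qed

lemma osc_rate_derivative: "(osc_rate as x has_real_derivative osc_rate' as th) (at th within S)"
proof -
 have "((%th. \<Sum>a\<leftarrow>as. phase_rate a th) has_real_derivative osc_rate' as th) (at th within S)"
 using as unfolding osc_rate'_def
 by (induction as) (auto intro!: derivative_eq_intros phase_rate_derivative)
 thus ?thesis unfolding osc_rate_def[abs_def] by (auto intro!: derivative_eq_intros)
qed

lemma continuous_osc: "continuous_on S (osc as x)"
 by (rule continuous_on_vector_derivative) (rule osc_derivative)

lemma continuous_osc_rate': "continuous_on S (osc_rate' as)"
proof -
 have "continuous_on S (phase_rate' a)" if "a \<in> set as" for a
 proof -
 have "poisson_den a th ~= 0" for th using poisson_den_pos(2)[of a th] as[OF that] by auto
 thus ?thesis unfolding phase_rate'_def[abs_def] poisson_den_def by (intro continuous_intros) auto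
 qed
 thus ?thesis unfolding osc_rate'_def[abs_def] by (induction as) (auto intro!: continuous_intros)
qed

text \<open>The sign of each summand is opposite to that of \<open>sin th\<close> for every node, so
  the total rate inherits the monotonicity of a single one.\<close>

lemma osc_rate'_sign: "th \<in> {0..pi} ==> osc_rate' as th<=0" "th \<in> {- pi..0} ==> 0 <= osc_rate' as th"
proof -
 have q: "0<=1-a\<^sup>2" if "a \<in> set as" for a using as[OF that] by (simp add: power_le_one)
 {
 assume "th \<in> {0..pi}"
 hence s: "0<=sin th" by (auto intro: sin_ge_zero)
 have "phase_rate' a th<=0" if "a \<in> set as" for a
 unfolding phase_rate'_def using q[OF that] as[OF that] s by (intro divide_nonpos_nonneg) auto
 thus "osc_rate' as th<=0" unfolding osc_rate'_def by (intro sum_list_nonpos) auto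
 next
 assume "th \<in> {- pi..0}"
 hence s: "sin th<=0" using sin_ge_zero[of "- th"] by auto
 have "0<=phase_rate' a th" if "a \<in> set as" for a
 proof -
 have "0<=2 * a*(- sin th)*(1-a\<^sup>2)" using q[OF that] as[OF that] s by (intro mult_nonneg_nonneg) auto
 thus ?thesis unfolding phase_rate'_def by (intro divide_nonneg_nonneg) auto
 qed
 thus "0 <= osc_rate' as th" unfolding osc_rate'_def by (intro sum_list_nonneg) auto
 }
qed

lemma osc_rate_even: "osc_rate as x (- th) = osc_rate as x th"
 by (simp add: osc_rate_def phase_rate_def poisson_den_def)

lemma osc_rate_antimono:
 assumes "0<=th" "th<=th'" "th'<=pi"
 shows "osc_rate as x th' <= osc_rate as x th"
 by (rule DERIV_nonpos_imp_nonincreasing[OF assms(2)])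
 (use assms osc_rate_derivative[of x _ UNIV] osc_rate'_sign(1) in \<open>auto intro!: exI\<close>)

text \<open>On a piece where the phase is not stationary, one half of the Fourier spectrum carries almost nothing.\<close>

lemma osc_piece:
 fixes phi phi' :: "real => complex" and d :: "int => complex"
 assumes ab: "a<=b" "{a..b} \<subseteq> {0..pi} \<or> {a..b} \<subseteq> {- pi..0}" "- pi<=a" "b<=pi"
 and phi: "\<And>x. x \<in> {a..b} ==> (phi has_vector_derivative phi' x) (at x within {a..b})"
 and phi'c: "continuous_on {a..b} phi'"
 and M: "\<And>x. x \<in> {a..b} ==> norm (phi x)<=M" "\<And>x. x \<in> {a..b} ==> norm (phi' x)<=M"
 and d: "(%n. norm (d n)) summable_on UNIV" "\<And>F. finite F ==> (\<Sum>n\<in>F. (norm (d n))\<^sup>2)<=Q"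
 and l: "l > 0" "(X = {0<..} & (\<forall>th\<in>{a..b}. l <= osc_rate as x th)) \<or>
 (X = {..0} & (\<forall>th\<in>{a..b}. osc_rate as x th <= - l))"
 shows "norm (\<Sum>\<^sub>\<infinity>n\<in>X. fourier_coeff a b (%th. cnj (osc as x th) * phi th) n * d (- n))
 <= 2 * M * sqrt (1/l\<^sup>2+1/l) * sqrt Q"
proof -
 let ?f = "%th. cnj (osc as x th) * phi th"
 have M0: "0<=M" using M(1)[of a] ab by (auto intro: order_trans[OF norm_ge_zero])
 have phic: "continuous_on {a..b} phi" using phi by (rule continuous_on_vector_derivative)
 have fc: "continuous_on {a..b} ?f" by (intro continuous_intros continuous_osc phic)
 \<comment> \<open>The half \<open>X\<close> is the one on which rate and frequency have compatible
   signs. Their sum is then at least \<open>l + |n|\<close> in absolute value, which makes the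
   coefficients square summable with a bound that vanishes for large \<open>l\<close>.\<close>
 have co: "norm (fourier_coeff a b ?f n)<=2 * M/(l + of_int \<bar>n\<bar>)" if n: "n \<in> X" for n
 proof (rule nonstationary_fourier_coeff[where \<Psi> = "osc_rate as x" and \<Psi>' = "osc_rate' as" and phi' = phi'])
 show "(\<forall>x\<in>{a..b}. 0 <= osc_rate' as x) \<or> (\<forall>x\<in>{a..b}. osc_rate' as x<=0)"
 using ab(2) osc_rate'_sign by blast
 show "(\<forall>th\<in>{a..b}. l + of_int \<bar>n\<bar> <= osc_rate as x th + of_int n) \<or>
 (\<forall>th\<in>{a..b}. osc_rate as x th + of_int n <= - (l + of_int \<bar>n\<bar>))"
 using l(2) n by auto
 qed (use ab l phi phi'c M osc_derivative norm_osc osc_rate_derivative continuous_osc_rate' in auto)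
 have s1: "(\<Sum>n\<in>F. (norm (fourier_coeff a b ?f n))\<^sup>2)<=4 * M\<^sup>2*(1/l\<^sup>2+1/l)" if F: "finite F" "F \<subseteq> X" for F
 proof -
 have "(\<Sum>n\<in>F. (norm (fourier_coeff a b ?f n))\<^sup>2)<=(\<Sum>n\<in>F. (2 * M/(l + of_int \<bar>n\<bar>))\<^sup>2)"
 by (intro sum_mono power_mono co) (use F in auto)
 also have "... = 4 * M\<^sup>2*(\<Sum>n\<in>F. 1/(l + of_int \<bar>n\<bar>)\<^sup>2)"
 unfolding sum_distrib_left by (rule sum.cong) (auto simp: power_divide power_mult_distrib)
 also have "... <= 4 * M\<^sup>2*(1/l\<^sup>2+1/l)"
 by (intro mult_left_mono sum_inverse_squares_le) (use F l in auto)
 finally show ?thesis .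
 qed
 have s2: "(\<Sum>n\<in>F. (norm (d (- n)))\<^sup>2)<=Q" if "finite F" for F
 using d(2)[of "uminus ` F"] that by (simp add: sum.reindex inj_on_def)
 have sm: "(%n. fourier_coeff a b ?f n * d (- n)) summable_on X"
 proof -
 have "(%n. norm (d n)) summable_on UNIV \<longleftrightarrow> (%n. norm (d (- n))) summable_on UNIV"
 by (rule summable_on_reindex_bij_witness[where i=uminus and j=uminus]) auto
 hence "(%n. norm (d (- n))) summable_on X"
 using d(1) summable_on_subset_banach[OF _ subset_UNIV] by blast
 hence "(%n. 2 * M/l * norm (d (- n))) summable_on X" by (rule summable_on_cmult_right)
 hence "(%n. norm (fourier_coeff a b ?f n * d (- n))) summable_on X"
 proof (rule summable_on_comparison_test)
 fix n assume n: "n \<in> X"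
 have "norm (fourier_coeff a b ?f n)<=2 * M/l"
 using co[OF n] l M0 by (elim order_trans) (auto intro!: divide_left_mono mult_pos_pos)
 thus "norm (fourier_coeff a b ?f n * d (- n))<=2 * M/l * norm (d (- n))"
 unfolding norm_mult by (intro mult_right_mono) auto
 qed simp
 thus ?thesis by (rule abs_summable_summable)
 qed
 have "norm (\<Sum>\<^sub>\<infinity>n\<in>X. fourier_coeff a b ?f n * d (- n))<=sqrt (4 * M\<^sup>2*(1/l\<^sup>2+1/l)) * sqrt Q"
 by (rule norm_infsum_mult_le[OF sm s1 s2]) auto
 also have "sqrt (4 * M\<^sup>2*(1/l\<^sup>2+1/l))=2 * M * sqrt (1/l\<^sup>2+1/l)"
 using M0 by (simp add: real_sqrt_mult)
 finally show ?thesis .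
qed

end

section \<open>The phase rate as a Riemann sum\<close>

text \<open>Exponentials of the midpoints of a grid with mesh \<open>r\<close> and origin
  \<open>s\<close>; in the application \<open>s\<close> is \<open>r * |t| / 2\<close> for the slice
  \<open>t\<close>.\<close>

definition nodes :: "real => real => nat => real list" where
 "nodes r s N=map (%k. exp (- (s+r*(real k+1/2)))) [0..<N]"

lemma nodes_bounds: "r > 0 ==> s >= 0 ==> a \<in> set (nodes r s N) ==> 0<=a & a < 1"
proof -
 assume r: "r > 0" "s >= 0" and "a \<in> set (nodes r s N)"
 then obtain k where a: "a=exp (- (s+r*(real k+1/2)))" by (auto simp: nodes_def)
 have "0 < s+r*(real k+1/2)" using r by (intro add_nonneg_pos mult_pos_pos) auto
 thus "0<=a & a < 1" unfolding a by simp
qed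

text \<open>The summand is the derivative of \<open>L\<close>, so the sum telescopes up to the
  midpoint error of each cell. This error decays like \<open>exp (- y)\<close>, hence the bound is
  uniform in the number of nodes.\<close>

lemma riemann_sum_phase_rate:
 assumes r: "r > 0" and s: "s >= 0" and k: "0 < kappa" "\<And>a. 0<=a ==> a<=1 ==> kappa <= poisson_den a th"
 defines "L \<equiv> %y. ln (poisson_den (exp (- y)) th)"
 shows "\<bar>r*(\<Sum>a\<leftarrow>nodes r s N. phase_rate a th)-(L (s+r * real N)-L s)\<bar> <= 40 / kappa\<^sup>2*(r*(1+r))"
proof -
 let ?P = "%y. phase_rate (exp (- y)) th"
 define C where "C=40 / kappa\<^sup>2"
 have C0: "0<=C" by (simp add: C_def)
 have den: "kappa <= poisson_den (exp (- y)) th" if "0<=y" for y using that by (intro k(2)) auto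
 have Ld: "(L has_real_derivative ?P y) (at y)" if "0<=y" for y
 proof -
 have "0 < poisson_den (exp (- y)) th" using den[OF that] k(1) by linarith
 thus ?thesis unfolding L_def phase_rate_def poisson_den_def
 by (auto intro!: derivative_eq_intros simp: power2_eq_square field_simps)
 qed
 \<comment> \<open>Quotient rule for \<open>?P\<close>, whose numerator \<open>u\<close> is itself
   the \<open>y\<close>-derivative of its denominator \<open>Q\<close>.\<close>
 define W where "W=(%y. let a=exp (- y); Q=poisson_den a th; u=2 * a * cos th-2 * a\<^sup>2 in
 ((4 * a\<^sup>2-2 * a * cos th) * Q-u * u)/Q\<^sup>2)"
 have Pd: "(?P has_real_derivative W y) (at y)" if "0<=y" for y
 proof -
 let ?a = "exp (- y)" and ?Q = "poisson_den (exp (- y)) th"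
 have nz: "?Q ~= 0" using den[OF that] k(1) by linarith
 have d1: "((%y. 2 * exp (- y) * cos th-2*(exp (- y))\<^sup>2) has_real_derivative 4 * ?a\<^sup>2-2 * ?a * cos th) (at y)"
 by (auto intro!: derivative_eq_intros simp: power2_eq_square)
 have d2: "((%y. poisson_den (exp (- y)) th) has_real_derivative 2 * ?a * cos th-2 * ?a\<^sup>2) (at y)"
 unfolding poisson_den_def by (auto intro!: derivative_eq_intros simp: power2_eq_square)
 from DERIV_divide[OF d1 d2 nz] show ?thesis
 unfolding phase_rate_def W_def Let_def by (simp add: power2_eq_square)
 qed
 have Wb: "\<bar>W y\<bar> <= C * exp (- y)" if y: "0<=y" for y
 proof -
 define a where "a=exp (- y)"
 define Q where "Q=poisson_den a th"
 define u where "u=2 * a * cos th-2 * a\<^sup>2"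
 have a: "0 < a" "a<=1" using y by (auto simp: a_def)
 have a2: "a\<^sup>2<=a" using a by (simp add: power2_eq_square mult_left_le)
 have ac: "\<bar>2 * a * cos th\<bar> <= 2 * a" using a abs_cos_le_one[of th] by (simp add: abs_mult mult_left_le)
 have Q: "kappa <= Q" "Q<=4" using den[OF y] ac a a2 by (auto simp: Q_def a_def[symmetric] poisson_den_def)
 have u: "\<bar>u\<bar> <= 4 * a" unfolding u_def using ac a2 zero_le_power2[of a] by linarith
 have u': "\<bar>4 * a\<^sup>2-2 * a * cos th\<bar> <= 6 * a" using ac a2 zero_le_power2[of a] by linarith
 have "\<bar>(4 * a\<^sup>2-2 * a * cos th) * Q-u * u\<bar> <= \<bar>(4 * a\<^sup>2-2 * a * cos th) * Q\<bar> + \<bar>u * u\<bar>" by (rule abs_triangle_ineq4)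
 \<comment> \<open>Origin of the constant 40: \<open>Q\<close> is at most 4, and of the two factors
   \<open>u\<close> one is bounded by \<open>4 * a\<close> and the other by 4.\<close>
 also have "... <= (6 * a)*4+(4 * a)*4"
 unfolding abs_mult using u u' Q k(1) a by (intro add_mono mult_mono) auto
 finally have num: "\<bar>(4 * a\<^sup>2-2 * a * cos th) * Q-u * u\<bar> <= 40 * a" by simp
 have "\<bar>W y\<bar> = \<bar>(4 * a\<^sup>2-2 * a * cos th) * Q-u * u\<bar> / Q\<^sup>2"
 by (simp add: W_def Let_def a_def Q_def u_def abs_divide)
 also have "... <= 40 * a / kappa\<^sup>2"
 using num Q k(1) a by (intro frac_le power_mono) auto
 finally show ?thesis by (simp add: C_def a_def)
 qed
 have cell: "\<bar>r * ?P (s+r*(real k+1/2))-(L (s+r * real (Suc k))-L (s+r * real k))\<bar> <= r*(r*(C * exp (- (r * real k))))" for k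
 proof -
 define y where "y=s+r * real k"
 have y0: "r * real k<=y" "0<=y" using s r by (auto simp: y_def)
 have "\<exists>\<xi>>y. \<xi> < y+r & L (y+r)-L y=(y+r-y) * ?P \<xi>"
 by (rule MVT2) (use r y0 Ld in auto)
 then obtain \<xi> where \<xi>: "y < \<xi>" "\<xi> < y+r" "L (y+r)-L y=r * ?P \<xi>" by auto
 have "norm (?P (y+r/2) - ?P \<xi>)<=(C * exp (- y)) * norm (y+r/2 - \<xi>)"
 proof (rule field_differentiable_bound[of "{y..y+r}" ?P W])
 fix z assume z: "z \<in> {y..y+r}"
 thus "(?P has_field_derivative W z) (at z within {y..y+r})"
 using y0 by (auto intro!: has_field_derivative_at_within Pd)
 have "\<bar>W z\<bar> <= C * exp (- z)" using z y0 by (intro Wb) auto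
 also have "... <= C * exp (- y)" using z C0 by (intro mult_left_mono) auto
 finally show "norm (W z)<=C * exp (- y)" by simp
 qed (use \<xi> r in auto)
 also have "... <= (C * exp (- (r * real k))) * r"
 using \<xi> y0 C0 by (intro mult_mono) auto
 finally have "\<bar>?P (y+r/2) - ?P \<xi>\<bar> <= r*(C * exp (- (r * real k)))" by (simp add: mult.commute)
 hence "r * \<bar>?P (y+r/2) - ?P \<xi>\<bar> <= r*(r*(C * exp (- (r * real k))))" using r by (intro mult_left_mono) auto
 moreover have "r * \<bar>?P (y+r/2) - ?P \<xi>\<bar> = \<bar>r * ?P (y+r/2)-(L (y+r)-L y)\<bar>"
 unfolding \<xi>(3) right_diff_distrib[symmetric] abs_mult using r by simp
 ultimately have main: "\<bar>r * ?P (y+r/2)-(L (y+r)-L y)\<bar> <= r*(r*(C * exp (- (r * real k))))" by simp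
 have e: "y+r/2=s+r*(real k+1/2)" "y+r=s+r * real (Suc k)" by (simp_all add: y_def algebra_simps)
 show ?thesis using main unfolding e unfolding y_def .
 qed
 have "r*(\<Sum>a\<leftarrow>nodes r s N. phase_rate a th)=(\<Sum>k<N. r * ?P (s+r*(real k+1/2)))"
 unfolding nodes_def map_map o_def by (simp add: sum_list_sum_nth atLeast0LessThan sum_distrib_left)
 moreover have "L (s+r * real N)-L s=(\<Sum>k<N. L (s+r * real (Suc k))-L (s+r * real k))"
 by (simp only: sum_lessThan_telescope[where f = "%k. L (s+r * real k)"]) simp
 ultimately have "\<bar>r*(\<Sum>a\<leftarrow>nodes r s N. phase_rate a th)-(L (s+r * real N)-L s)\<bar>
 = \<bar>\<Sum>k<N. r * ?P (s+r*(real k+1/2))-(L (s+r * real (Suc k))-L (s+r * real k))\<bar>"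
 by (simp only: sum_subtractf)
 also have "... <= (\<Sum>k<N. r*(r*(C * exp (- (r * real k)))))"
 by (rule order_trans[OF sum_abs]) (intro sum_mono cell)
 also have "... = r*(r * C)*(\<Sum>k<N. exp (- r)^k)"
 unfolding sum_distrib_left by (intro sum.cong refl) (simp add: exp_of_nat_mult[symmetric] mult_ac)
 also have "... <= r*(r * C)*((1+r)/r)"
 proof (intro mult_left_mono)
 have "(\<Sum>k<N. exp (- r)^k)<=(\<Sum>k. exp (- r)^k)"
 using r by (intro sum_le_suminf summable_geometric) auto
 also have "... = 1/(1-exp (- r))" using r by (intro suminf_geometric) auto
 also have "... <= (1+r)/r"
 proof -
 have "(1+r) * exp (- r)<=exp r * exp (- r)" using exp_ge_add_one_self[of r] by (intro mult_right_mono) auto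
 hence "(1+r) * exp (- r)<=1" by (simp add: exp_add[symmetric])
 thus ?thesis using r by (simp add: field_simps)
 qed
 finally show "(\<Sum>k<N. exp (- r)^k)<=(1+r)/r" .
 qed (use r C0 in auto)
 also have "... = C*(r*(1+r))" using r by (simp add: field_simps)
 finally show ?thesis unfolding C_def .
qed

text \<open>The telescoped sum extends from \<open>s0\<close> to infinity, where
  \<open>poisson_den 0 th = 1\<close> has logarithm 0, so only the endpoint \<open>s0\<close>
  contributes.\<close>

lemma osc_rate_limit:
 fixes s :: "real => real" and N :: "real => nat" and x :: "real => int"
 assumes s: "\<And>r. r > 0 ==> s r >= 0" "(s \<longlongrightarrow> s0) (at_right 0)"
 and N: "filterlim (%r. r * real (N r)) at_top (at_right 0)"
 and x: "((%r. r * of_int (x r)) \<longlongrightarrow> mu) (at_right 0)"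
 and k: "0 < kappa" "\<And>a. 0<=a ==> a<=1 ==> kappa <= poisson_den a th"
 shows "((%r. r * osc_rate (nodes r (s r) (N r)) (x r) th) \<longlongrightarrow> - ln (poisson_den (exp (- s0)) th) - mu) (at_right 0)"
proof -
 define L where "L=(%y. ln (poisson_den (exp (- y)) th))"
 have ev: "\<forall>\<^sub>F r :: real in at_right 0. r > 0" by (rule eventually_at_right_less)
 have s00: "s0 >= 0"
 by (rule tendsto_lowerbound[OF s(2)]) (use ev s(1) in \<open>auto elim: eventually_mono\<close>)
 have den: "0 < poisson_den (exp (- y)) th" if "0<=y" for y
 using k(2)[of "exp (- y)"] k(1) that by fastforce
 have pc: "isCont (%a. poisson_den a th) a" for a unfolding poisson_den_def by (intro continuous_intros)
 have Ls: "((%r. L (s r)) \<longlongrightarrow> L s0) (at_right 0)"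
 unfolding L_def using den[OF s00]
 by (intro tendsto_ln isCont_tendsto_compose[OF pc] tendsto_intros s(2)) auto
 have far: "filterlim (%r. s r+r * real (N r)) at_top (at_right 0)"
 by (rule filterlim_at_top_mono[OF N]) (use ev s(1) in \<open>auto elim!: eventually_mono\<close>)
 have "((%r. exp (- (s r+r * real (N r)))) \<longlongrightarrow> 0) (at_right 0)"
 by (rule filterlim_compose[OF exp_at_bot]) (intro filterlim_compose[OF filterlim_uminus_at_bot_at_top far])
 hence "((%r. poisson_den (exp (- (s r+r * real (N r)))) th) \<longlongrightarrow> poisson_den 0 th) (at_right 0)"
 by (rule isCont_tendsto_compose[OF pc])
 hence LN: "((%r. L (s r+r * real (N r))) \<longlongrightarrow> ln (poisson_den 0 th)) (at_right 0)"
 unfolding L_def by (intro tendsto_ln) (auto simp: poisson_den_def)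
 have "((%r. r*(\<Sum>a\<leftarrow>nodes r (s r) (N r). phase_rate a th)-(L (s r+r * real (N r))-L (s r))) \<longlongrightarrow> 0) (at_right 0)"
 proof (rule Lim_null_comparison)
 show "\<forall>\<^sub>F r in at_right 0. norm (r*(\<Sum>a\<leftarrow>nodes r (s r) (N r). phase_rate a th)-(L (s r+r * real (N r))-L (s r)))
 <= 40 / kappa\<^sup>2*(r*(1+r))"
 using ev
 proof eventually_elim
 case (elim r)
 show ?case using riemann_sum_phase_rate[OF elim s(1)[OF elim] k,of "N r"] by (simp add: L_def)
 qed
 have "((%r :: real. 40 / kappa\<^sup>2*(r*(1+r))) \<longlongrightarrow> 40 / kappa\<^sup>2*(0*(1+0))) (at_right 0)"
 by (intro tendsto_intros)
 thus "((%r :: real. 40 / kappa\<^sup>2*(r*(1+r))) \<longlongrightarrow> 0) (at_right 0)" by simp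
 qed
 from tendsto_diff[OF tendsto_add[OF this tendsto_diff[OF LN Ls]] x]
 show ?thesis by (simp add: L_def osc_rate_def poisson_den_def[of 0] right_diff_distrib)
qed

section \<open>One-sided pairings on an arc and on its mirror image\<close>

text \<open>The flag selects the interval from \<open>a\<close> to \<open>b\<close> or its mirror
  image, so that the two halves of the circle, on each of which the rate is monotone, share one
  argument.\<close>

definition side_lo :: "bool => real => real => real" where
 "side_lo sg a b=(if sg then a else-b)"

definition side_hi :: "bool => real => real => real" where
 "side_hi sg a b=(if sg then b else-a)"

lemma integral_side_combine:
 fixes g :: "real => complex"
 assumes "a<=c" "c<=b" "g integrable_on {side_lo sg a b..side_hi sg a b}"
 shows "integral {side_lo sg a b..side_hi sg a b} g =
 integral {side_lo sg a c..side_hi sg a c} g+integral {side_lo sg c b..side_hi sg c b} g"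
proof (cases sg)
 case True
 thus ?thesis
 using assms Henstock_Kurzweil_Integration.integral_combine[of a c b g] by (simp add: side_lo_def side_hi_def)
next
 case False
 hence "integral {- b..- c} g+integral {- c..- a} g=integral {- b..- a} g"
 using assms by (intro Henstock_Kurzweil_Integration.integral_combine) (auto simp: side_lo_def side_hi_def)
 thus ?thesis using False by (simp add: side_lo_def side_hi_def add.commute)
qed

lemma fourier_coeff_side_combine:
 assumes "a<=c" "c<=b" "continuous_on {side_lo sg a b..side_hi sg a b} f"
 shows "fourier_coeff (side_lo sg a b) (side_hi sg a b) f n =
 fourier_coeff (side_lo sg a c) (side_hi sg a c) f n+fourier_coeff (side_lo sg c b) (side_hi sg c b) f n"
proof -
 have "(%th. f th * cis (- (of_int n * th))) integrable_on {side_lo sg a b..side_hi sg a b}"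
 by (intro integrable_continuous_interval continuous_intros assms)
 from integral_side_combine[OF assms(1,2) this] show ?thesis by (simp add: fourier_coeff_def distrib_left)
qed

lemma fourier_coeff_bound:
 assumes "continuous_on {a..b} f" "a<=b" "\<And>th. th \<in> {a..b} ==> norm (f th)<=M"
 shows "norm (fourier_coeff a b f n)<=1/(2 * pi)*(M*(b-a))"
proof -
 have "norm (integral {a..b} (%th. f th * cis (- (of_int n * th))))<=M*(b-a)"
 by (rule integral_bound) (use assms in \<open>auto intro!: continuous_intros simp: norm_mult\<close>)
 hence "1/(2 * pi) * norm (integral {a..b} (%th. f th * cis (- (of_int n * th))))<=1/(2 * pi)*(M*(b-a))"
 by (intro mult_left_mono) auto
 thus ?thesis by (simp add: fourier_coeff_def norm_mult norm_divide)
qed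

abbreviation side :: "bool => real => real => real set" where
 "side sg a b \<equiv> {side_lo sg a b..side_hi sg a b}"

lemma side_subset: "a'<=a ==> b<=b' ==> side sg a b \<subseteq> side sg a' b'"
 by (auto simp: side_lo_def side_hi_def)

lemma side_in_half: "0<=a ==> b<=pi ==> side sg a b \<subseteq> {0..pi} \<or> side sg a b \<subseteq> {- pi..0}"
 by (auto simp: side_lo_def side_hi_def)

lemma osc_rate_side_ge:
 assumes "\<And>a. a \<in> set as ==> 0<=a & a < 1" "0<=a" "b<=pi" "th \<in> side sg a b"
 shows "osc_rate as x b <= osc_rate as x th" "osc_rate as x th <= osc_rate as x a"
proof -
 have t: "osc_rate as x th = osc_rate as x \<bar>th\<bar>" using osc_rate_even[OF assms(1),where x=x and th=th] by (cases "th >= 0") auto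
 have "a <= \<bar>th\<bar>" "\<bar>th\<bar> <= b" using assms(2-4) by (auto simp: side_lo_def side_hi_def split: if_splits)
 thus "osc_rate as x b <= osc_rate as x th" "osc_rate as x th <= osc_rate as x a"
 unfolding t using assms by (auto intro!: osc_rate_antimono)
qed

lemma summable_fourier_pairing:
 assumes f: "continuous_on {a..b} f" and d: "(%n. norm (d n)) summable_on UNIV"
 shows "(%n. fourier_coeff a b f n * d (- n)) summable_on X"
proof (cases "a<=b")
 case True
 obtain C where C: "\<And>th. th \<in> {a..b} ==> norm (f th)<=C"
 using compact_imp_bounded[OF compact_continuous_image[OF f compact_Icc]] unfolding bounded_iff by blast
 have "(%n. norm (d n)) summable_on UNIV \<longleftrightarrow> (%n. norm (d (- n))) summable_on UNIV"
 by (rule summable_on_reindex_bij_witness[where i=uminus and j=uminus]) auto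
 hence "(%n. norm (d (- n))) summable_on X"
 using d summable_on_subset_banach[OF _ subset_UNIV] by blast
 hence "(%n. 1/(2 * pi)*(C*(b-a)) * norm (d (- n))) summable_on X" by (rule summable_on_cmult_right)
 hence "(%n. norm (fourier_coeff a b f n * d (- n))) summable_on X"
 proof (rule summable_on_comparison_test)
 fix n
 show "norm (fourier_coeff a b f n * d (- n))<=1/(2 * pi)*(C*(b-a)) * norm (d (- n))"
 unfolding norm_mult by (intro mult_right_mono fourier_coeff_bound f True C) auto
 qed simp
 thus ?thesis by (rule abs_summable_summable)
next
 case False
 hence "fourier_coeff a b f n=0" for n by (simp add: fourier_coeff_def)
 thus ?thesis by simp
qed

text \<open>A part of the Parseval sum for \<open>f\<close> and the function with coefficients
  \<open>d\<close>; the nonpositive and the positive half add up to the integral of the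
  product.\<close>

definition half_pairing :: "bool => real => real => (real => complex) => (int => complex) => int set => complex" where
 "half_pairing sg a b f d X=(\<Sum>\<^sub>\<infinity>n\<in>X. fourier_coeff (side_lo sg a b) (side_hi sg a b) f n * d (- n))"

lemma half_pairing_combine:
 assumes "a<=c" "c<=b" "continuous_on (side sg a b) f" "(%n. norm (d n)) summable_on UNIV"
 shows "half_pairing sg a b f d X=half_pairing sg a c f d X+half_pairing sg c b f d X"
proof -
 have "side sg a c \<subseteq> side sg a b" "side sg c b \<subseteq> side sg a b" by (rule side_subset; use assms in simp)+
 hence "continuous_on (side sg a c) f" "continuous_on (side sg c b) f"
 using continuous_on_subset[OF assms(3)] by blast+
 thus ?thesis
 unfolding half_pairing_def fourier_coeff_side_combine[OF assms(1-3)] distrib_right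
 by (intro infsum_add summable_fourier_pairing assms(4))
qed

lemma half_pairing_degenerate: "half_pairing sg a a f d X=0"
 by (simp add: half_pairing_def fourier_coeff_def side_lo_def side_hi_def)

lemma half_pairing_total:
 fixes f H :: "real => complex"
 assumes "continuous_on (side sg a b) f" "(%n. norm (d n)) summable_on UNIV"
 and "\<And>th. ((%n. d n * cis (of_int n * th)) has_sum H th) UNIV"
 shows "half_pairing sg a b f d {..0}+half_pairing sg a b f d {0<..} =
 1/(2 * pi) * integral (side sg a b) (%th. f th * H th)"
proof -
 let ?fc = "fourier_coeff (side_lo sg a b) (side_hi sg a b) f"
 have "((%n. d n * ?fc (- n)) has_sum 1/(2 * pi) * integral (side sg a b) (%th. f th * H th)) UNIV"
 by (rule fourier_pairing[OF assms(2,3,1)])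
 moreover have "((%n. d n * ?fc (- n)) has_sum 1/(2 * pi) * integral (side sg a b) (%th. f th * H th)) UNIV \<longleftrightarrow>
 ((%n. ?fc n * d (- n)) has_sum 1/(2 * pi) * integral (side sg a b) (%th. f th * H th)) UNIV"
 by (rule has_sum_reindex_bij_witness[where i=uminus and j=uminus]) (auto simp: mult.commute)
 ultimately have "infsum (%n. ?fc n * d (- n)) ({..0} \<union> {0<..})=1/(2 * pi) * integral (side sg a b) (%th. f th * H th)"
 proof -
 assume "((%n. d n * ?fc (- n)) has_sum 1/(2 * pi) * integral (side sg a b) (%th. f th * H th)) UNIV"
 and "((%n. d n * ?fc (- n)) has_sum 1/(2 * pi) * integral (side sg a b) (%th. f th * H th)) UNIV \<longleftrightarrow>
 ((%n. ?fc n * d (- n)) has_sum 1/(2 * pi) * integral (side sg a b) (%th. f th * H th)) UNIV"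
 hence "((%n. ?fc n * d (- n)) has_sum 1/(2 * pi) * integral (side sg a b) (%th. f th * H th)) UNIV" by blast
 moreover have e: "{..0} \<union> {0<..}=(UNIV :: int set)" by auto
 ultimately show ?thesis unfolding e by (intro infsumI)
 qed
 thus ?thesis
 unfolding half_pairing_def by (subst (asm) infsum_Un_disjoint) (auto intro!: summable_fourier_pairing assms)
qed

text \<open>Here \<open>d\<close> are the Fourier coefficients of \<open>H\<close>, and \<open>ths\<close> is the critical angle where the phase is stationary.\<close>

lemma half_pairing_limit:
 fixes G :: "real => bool" and as :: "real => real list" and x :: "real => int" and d :: "real => int => complex"
 and H :: "real => real => complex" and phi phi' :: "real => complex"
 assumes evp: "\<forall>\<^sub>F r in at_right 0. G r" and Gpos: "\<And>r. G r ==> r > 0"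
 and as: "\<And>r a. G r ==> a \<in> set (as r) ==> 0<=a & a < 1"
 and ths: "0<=ths" "ths<=pi"
 and inside: "\<And>th. 0 < th ==> th < ths ==> \<exists>e>0. \<forall>\<^sub>F r in at_right 0. e/r <= osc_rate (as r) (x r) th"
 and outside: "\<And>th. ths < th ==> th<=pi ==> \<exists>e>0. \<forall>\<^sub>F r in at_right 0. osc_rate (as r) (x r) th <= - e/r"
 and d: "\<And>r. G r ==> (%n. norm (d r n)) summable_on UNIV"
 "\<And>r th. G r ==> ((%n. d r n * cis (of_int n * th)) has_sum H r th) UNIV"
 and Hc: "\<And>r. G r ==> continuous_on {- pi..pi} (H r)"
 and Hm: "\<forall>\<^sub>F r in at_right 0. (\<forall>th\<in>{- pi..pi}. norm (H r th)<=Hm) & (\<forall>F. finite F --> (\<Sum>n\<in>F. (norm (d r n))\<^sup>2)<=Hm\<^sup>2)"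
 and eta: "0 <= eta" "eta <= pi"
 and phi: "\<And>th. th \<in> side sg eta pi ==> (phi has_vector_derivative phi' th) (at th within side sg eta pi)"
 and phi'c: "continuous_on (side sg eta pi) phi'"
 shows "((%r. half_pairing sg eta pi (%th. cnj (osc (as r) (x r) th) * phi th) (d r) {..0} -
 1/(2 * pi) * integral (side sg eta (max eta ths)) (%th. cnj (osc (as r) (x r) th) * phi th * H r th)) \<longlongrightarrow> 0) (at_right 0)"
proof -
 let ?f = "%r th. cnj (osc (as r) (x r) th) * phi th"
 let ?T = "%r a b. half_pairing sg a b (?f r) (d r) {..0}"
 let ?V = "%r a b. 1/(2 * pi) * integral (side sg a b) (%th. ?f r th * H r th)"
 let ?c = "max eta ths"
 have phic: "continuous_on (side sg eta pi) phi" using phi by (rule continuous_on_vector_derivative)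
 obtain M1 where M1: "\<And>th. th \<in> side sg eta pi ==> norm (phi th)<=M1"
 using compact_imp_bounded[OF compact_continuous_image[OF phic compact_Icc]] unfolding bounded_iff by blast
 obtain M2 where M2: "\<And>th. th \<in> side sg eta pi ==> norm (phi' th)<=M2"
 using compact_imp_bounded[OF compact_continuous_image[OF phi'c compact_Icc]] unfolding bounded_iff by blast
 define M where "M=max 1 (max M1 M2)"
 have M: "norm (phi th)<=M" "norm (phi' th)<=M" "0 < M" if "th \<in> side sg eta pi" for th
 using M1[OF that] M2[OF that] by (simp_all add: M_def le_max_iff_disj less_max_iff_disj)
 have M0: "0 < M" by (simp add: M_def)
 have Hm0: "0<=Hm"
 proof -
 have "\<forall>\<^sub>F r :: real in at_right 0. norm (H r 0)<=Hm" using Hm by eventually_elim auto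
 then obtain r where "norm (H r 0)<=Hm" using eventually_happens'[OF trivial_limit_at_right_real] by blast
 thus ?thesis using norm_ge_zero order_trans by blast
 qed
 have fc: "continuous_on (side sg eta pi) (?f r)" if "G r" for r
 by (intro continuous_intros continuous_osc phic as[OF that])
 have sub: "side sg a b \<subseteq> side sg eta pi" if "eta <= a" "b<=pi" for a b using that by (rule side_subset)
 have fn: "norm (?f r th)<=M" if "G r" "th \<in> side sg eta pi" for r th
 using M[OF that(2)] norm_osc[OF as[OF that(1)]] by (simp add: norm_mult)
 show ?thesis
 proof (rule tendstoI)
 fix \<epsilon> :: real assume \<epsilon>: "0 < \<epsilon>"
 define B where "B=M * Hm+1"
 have B: "0 < B" using M0 Hm0 by (simp add: B_def add_nonneg_pos)
 \<comment> \<open>Half the width of a window around the critical angle. The Bessel bound on the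
   window is at most \<open>B * sqrt (2 * \<delta>)\<close>, and the choice makes this at most
   \<open>\<epsilon> / 4\<close>.\<close>
 define \<delta> where "\<delta> = min 1 ((\<epsilon> / (8 * B))\<^sup>2)"
 have \<delta>: "0 < \<delta>" "\<delta> <= 1" "\<delta> <= (\<epsilon> / (8 * B))\<^sup>2" using \<epsilon> B by (auto simp: \<delta>_def)
 define p where "p=max eta (ths - \<delta>)"
 define q where "q=min pi (max eta (ths + \<delta>))"
 have pq: "eta <= p" "p <= ?c" "?c<=q" "q<=pi" "q-p<=2 * \<delta>" "?c-p <= \<delta>" "p<=q"
 using eta ths \<delta> by (auto simp: p_def q_def)
 have sqd: "sqrt (2 * \<delta>)<=2*(\<epsilon> / (8 * B))"
 proof -
 have "sqrt (2 * \<delta>)<=sqrt (4*(\<epsilon> / (8 * B))\<^sup>2)" using \<delta> by (intro real_sqrt_le_mono) auto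
 also have "... = 2*(\<epsilon> / (8 * B))" using \<epsilon> B by (intro real_sqrt_unique) (simp_all only: power_mult_distrib,simp_all)
 finally show ?thesis .
 qed
 define bd where "bd=(%e r :: real. 2 * M * sqrt (1/(e/r)\<^sup>2+1/(e/r)) * Hm)"
 have bd0: "(bd e \<longlongrightarrow> 0) (at_right 0)" if "0 < e" for e
 proof -
 have "((%r :: real. 2 * M * sqrt ((r/e)\<^sup>2+r/e) * Hm) \<longlongrightarrow> 2 * M * sqrt ((0/e)\<^sup>2+0/e) * Hm) (at_right 0)"
 by (intro tendsto_intros) (use that in auto)
 thus ?thesis unfolding bd_def by (simp add: power_divide)
 qed
 \<comment> \<open>Below the window the rate is large and positive: the positive half is negligible,
   so the nonpositive half carries the full integral.\<close>
 have I: "\<forall>\<^sub>F r in at_right 0. norm (?T r eta p - ?V r eta p) < \<epsilon> / 8"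
 proof (cases "p = eta")
 case True
 have "?T r eta p - ?V r eta p=0" for r
 unfolding True half_pairing_degenerate by (simp add: side_lo_def side_hi_def)
 thus ?thesis using \<epsilon> by simp
 next
 case False
 hence pe: "p=ths - \<delta>" "eta < p" by (auto simp: p_def split: if_splits)
 hence "0 < p" "p < ths" using eta \<delta> by auto
 then obtain e where e: "0 < e" "\<forall>\<^sub>F r in at_right 0. e/r <= osc_rate (as r) (x r) p" using inside by blast
 have "\<forall>\<^sub>F r in at_right 0. bd e r < \<epsilon> / 8" using order_tendstoD(2)[OF bd0[OF e(1)],of "\<epsilon> / 8"] \<epsilon> by simp
 thus ?thesis using e(2) Hm evp
 proof eventually_elim
 case (elim r)
 have "?T r eta p - ?V r eta p = - half_pairing sg eta p (?f r) (d r) {0<..}"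
 proof -
 have cfp: "continuous_on (side sg eta p) (?f r)"
 by (rule continuous_on_subset[OF fc[OF elim(4)] sub]) (use pq in auto)
 show ?thesis unfolding half_pairing_total[OF cfp d(1)[OF elim(4)] d(2)[OF elim(4)],symmetric] by simp
 qed
 hence "norm (?T r eta p - ?V r eta p)=norm (half_pairing sg eta p (?f r) (d r) {0<..})" by simp
 also have "... <= 2 * M * sqrt (1/(e/r)\<^sup>2+1/(e/r)) * sqrt (Hm\<^sup>2)"
 unfolding half_pairing_def
 proof (rule osc_piece[OF as[OF elim(4)],where phi' = phi'])
 have pp: "p<=pi" using pq by auto
 show "side_lo sg eta p<=side_hi sg eta p" using pq by (auto simp: side_lo_def side_hi_def)
 show "side sg eta p \<subseteq> {0..pi} \<or> side sg eta p \<subseteq> {- pi..0}" using eta pp by (intro side_in_half)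
 show "- pi<=side_lo sg eta p" "side_hi sg eta p<=pi" using eta pp pq by (auto simp: side_lo_def side_hi_def)
 fix th assume t: "th \<in> side sg eta p"
 hence t': "th \<in> side sg eta pi" using sub[of eta p] pp by auto
 show "(phi has_vector_derivative phi' th) (at th within side sg eta p)"
 by (rule has_vector_derivative_within_subset[OF phi[OF t'] sub]) (use pp in auto)
 show "norm (phi th)<=M" "norm (phi' th)<=M" using M[OF t'] by auto
 next
 show "continuous_on (side sg eta p) phi'" by (rule continuous_on_subset[OF phi'c sub]) (use pq in auto)
 show "({0<..} = {0<..} & (\<forall>th\<in>side sg eta p. e/r <= osc_rate (as r) (x r) th)) \<or>
 ({0<..} = {..0 :: int} & (\<forall>th\<in>side sg eta p. osc_rate (as r) (x r) th <= - (e/r)))"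
 proof (intro disjI1 conjI ballI refl)
 fix th assume t: "th \<in> side sg eta p"
 have "p<=pi" using pq by linarith
 with as[OF elim(4)] have "osc_rate (as r) (x r) p <= osc_rate (as r) (x r) th"
 by (rule osc_rate_side_ge(1)[OF _ eta(1) _ t])
 with elim(2) show "e/r <= osc_rate (as r) (x r) th" by (rule order_trans)
 qed
 show "(%n. norm (d r n)) summable_on UNIV" by (rule d(1)[OF elim(4)])
 show "(\<Sum>n\<in>F. (norm (d r n))\<^sup>2)<=Hm\<^sup>2" if "finite F" for F using elim(3)[THEN conjunct2] that by blast
 show "0 < e/r" using Gpos[OF elim(4)] e(1) by simp
 qed
 also have "... = bd e r" using Hm0 by (simp add: bd_def)
 finally show ?case using elim(1) by linarith
 qed
 qed
 \<comment> \<open>Above the window the rate is large and negative, and the nonpositive half is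
   itself negligible.\<close>
 have O: "\<forall>\<^sub>F r in at_right 0. norm (?T r q pi) < \<epsilon> / 8"
 proof (cases "q=pi")
 case True
 thus ?thesis using \<epsilon> by (simp add: half_pairing_degenerate)
 next
 case False
 hence qe: "q=max eta (ths + \<delta>)" "q < pi" by (auto simp: q_def min_def split: if_splits)
 hence "ths < q" using \<delta> by auto
 then obtain e where e: "0 < e" "\<forall>\<^sub>F r in at_right 0. osc_rate (as r) (x r) q <= - e/r" using outside[of q] qe by auto
 have "\<forall>\<^sub>F r in at_right 0. bd e r < \<epsilon> / 8" using order_tendstoD(2)[OF bd0[OF e(1)],of "\<epsilon> / 8"] \<epsilon> by simp
 thus ?thesis using e(2) Hm evp
 proof eventually_elim
 case (elim r)
 have "norm (?T r q pi)<=2 * M * sqrt (1/(e/r)\<^sup>2+1/(e/r)) * sqrt (Hm\<^sup>2)"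
 unfolding half_pairing_def
 proof (rule osc_piece[OF as[OF elim(4)],where phi' = phi'])
 have pp: "eta <= q" "0<=q" using pq eta by auto
 show "side_lo sg q pi<=side_hi sg q pi" using pq by (auto simp: side_lo_def side_hi_def)
 show "side sg q pi \<subseteq> {0..pi} \<or> side sg q pi \<subseteq> {- pi..0}" using pp by (intro side_in_half) auto
 have "- q<=pi" "- pi<=q" using pp(2) pi_gt_zero by linarith+
 thus "- pi<=side_lo sg q pi" "side_hi sg q pi<=pi" unfolding side_lo_def side_hi_def by (cases sg; simp)+
 fix th assume t: "th \<in> side sg q pi"
 hence t': "th \<in> side sg eta pi" using sub[of q pi] pp by auto
 show "(phi has_vector_derivative phi' th) (at th within side sg q pi)"
 by (rule has_vector_derivative_within_subset[OF phi[OF t'] sub]) (use pp in auto)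
 show "norm (phi th)<=M" "norm (phi' th)<=M" using M[OF t'] by auto
 next
 show "continuous_on (side sg q pi) phi'" by (rule continuous_on_subset[OF phi'c sub]) (use pq in auto)
 show "({..0} = {0 :: int<..} & (\<forall>th\<in>side sg q pi. e/r <= osc_rate (as r) (x r) th)) \<or>
 ({..0} = {..0 :: int} & (\<forall>th\<in>side sg q pi. osc_rate (as r) (x r) th <= - (e/r)))"
 proof (intro disjI2 conjI ballI refl)
 fix th assume t: "th \<in> side sg q pi"
 have "0<=q" using pq eta by linarith
 with as[OF elim(4)] have "osc_rate (as r) (x r) th <= osc_rate (as r) (x r) q"
 by (rule osc_rate_side_ge(2)[OF _ _ order_refl t])
 with elim(2) show "osc_rate (as r) (x r) th <= - (e/r)" by simp
 qed
 show "(%n. norm (d r n)) summable_on UNIV" by (rule d(1)[OF elim(4)])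
 show "(\<Sum>n\<in>F. (norm (d r n))\<^sup>2)<=Hm\<^sup>2" if "finite F" for F using elim(3)[THEN conjunct2] that by blast
 show "0 < e/r" using Gpos[OF elim(4)] e(1) by simp
 qed
 also have "... = bd e r" using Hm0 by (simp add: bd_def)
 finally show ?case using elim(1) by linarith
 qed
 qed
 have "\<forall>\<^sub>F r in at_right 0. norm (?T r eta pi - ?V r eta ?c) < \<epsilon>"
 using I O Hm evp
 proof eventually_elim
 case (elim r)
 have r: "G r" by fact
 have cs: "continuous_on (side sg a b) (?f r)" if "eta <= a" "b<=pi" for a b
 using continuous_on_subset[OF fc[OF r] sub[OF that]] .
 have cH: "continuous_on (side sg a b) (H r)" if "eta <= a" "b<=pi" for a b
 by (rule continuous_on_subset[OF Hc[OF r]]) (use that eta in \<open>auto simp: side_lo_def side_hi_def\<close>)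
 have T: "?T r eta pi = ?T r eta p+(?T r p q + ?T r q pi)"
 using half_pairing_combine[of eta p pi sg "?f r" "d r" "{..0}"] half_pairing_combine[of p q pi sg "?f r" "d r" "{..0}"]
 cs[of eta pi] cs[of p pi] pq d(1)[OF r] by simp
 have V: "?V r eta ?c = ?V r eta p + ?V r p ?c"
 proof -
 have "(%th. ?f r th * H r th) integrable_on side sg eta ?c"
 using pq by (intro integrable_continuous_interval continuous_on_mult cs cH) auto
 hence "integral (side sg eta ?c) (%th. ?f r th * H r th) =
 integral (side sg eta p) (%th. ?f r th * H r th)+integral (side sg p ?c) (%th. ?f r th * H r th)"
 by (rule integral_side_combine[OF pq(1,2)])
 thus ?thesis by (simp add: distrib_left)
 qed
 \<comment> \<open>On the window no cancellation is available; Cauchy-Schwarz and Bessel's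
   inequality give the square root of its length.\<close>
 have mid: "norm (?T r p q) <= \<epsilon> / 4"
 proof -
 have pw: "- pi<=side_lo sg p q" "side_hi sg p q<=pi" "side_lo sg p q<=side_hi sg p q"
 using pq eta by (auto simp: side_lo_def side_hi_def)
 have len: "side_hi sg p q-side_lo sg p q<=2 * \<delta>" using pq by (auto simp: side_lo_def side_hi_def)
 have "norm (?T r p q)<=sqrt (M\<^sup>2*(2 * \<delta>)) * sqrt (Hm\<^sup>2)"
 unfolding half_pairing_def
 proof (rule norm_infsum_mult_le)
 show "(%n. fourier_coeff (side_lo sg p q) (side_hi sg p q) (?f r) n * d r (- n)) summable_on {..0}"
 using pq by (intro summable_fourier_pairing cs d(1)[OF r]) auto
 fix F :: "int set" assume F: "finite F"
 have "(\<Sum>n\<in>F. (norm (fourier_coeff (side_lo sg p q) (side_hi sg p q) (?f r) n))\<^sup>2) \<le>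
 1/(2 * pi) * integral (side sg p q) (%th. (norm (?f r th))\<^sup>2)"
 using pq by (intro bessel_finite cs pw F) auto
 also have "... <= 1/(2 * pi)*(M\<^sup>2*(side_hi sg p q-side_lo sg p q))"
 proof (intro mult_left_mono)
 have "norm (integral (side sg p q) (%th. (norm (?f r th))\<^sup>2))<=M\<^sup>2*(side_hi sg p q-side_lo sg p q)"
 proof (rule integral_bound[OF pw(3)])
 show "continuous_on (side sg p q) (%th. (norm (?f r th))\<^sup>2)" using pq by (intro continuous_on_power continuous_on_norm cs) auto
 fix th assume "th \<in> side sg p q"
 hence "th \<in> side sg eta pi" using subsetD[OF sub[OF pq(1,4)]] by blast
 from power_mono[OF fn[OF r this] norm_ge_zero,of 2]
 show "norm ((norm (?f r th))\<^sup>2)<=M\<^sup>2" by (simp only: real_norm_def abs_power2)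
 qed
 thus "integral (side sg p q) (%th. (norm (?f r th))\<^sup>2)<=M\<^sup>2*(side_hi sg p q-side_lo sg p q)" by simp
 qed simp
 also have "... <= 1*(M\<^sup>2*(2 * \<delta>))"
 using len pw pi_gt3 by (intro mult_mono mult_left_mono) auto
 finally show "(\<Sum>n\<in>F. (norm (fourier_coeff (side_lo sg p q) (side_hi sg p q) (?f r) n))\<^sup>2)<=M\<^sup>2*(2 * \<delta>)" by simp
 have "(\<Sum>n\<in>F. (norm (d r (- n)))\<^sup>2)=(\<Sum>n\<in>uminus ` F. (norm (d r n))\<^sup>2)" by (simp add: sum.reindex inj_on_def)
 also have "... <= Hm\<^sup>2" using elim F by blast
 finally show "(\<Sum>n\<in>F. (norm (d r (- n)))\<^sup>2)<=Hm\<^sup>2" .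
 qed
 also have "... = (M * Hm) * sqrt (2 * \<delta>)" using M0 Hm0 by (simp add: real_sqrt_mult)
 also have "... <= B*(2*(\<epsilon> / (8 * B)))"
 using sqd M0 Hm0 B \<delta> by (intro mult_mono) (auto simp: B_def)
 also have "... = \<epsilon> / 4" using B by simp
 finally show ?thesis .
 qed
 have vv: "norm (?V r p ?c) <= \<epsilon> / 4"
 proof -
 have pw: "side_lo sg p ?c<=side_hi sg p ?c" using pq by (auto simp: side_lo_def side_hi_def)
 have len: "side_hi sg p ?c-side_lo sg p ?c <= \<delta>" using pq by (auto simp: side_lo_def side_hi_def)
 have "norm (integral (side sg p ?c) (%th. ?f r th * H r th))<=(M * Hm)*(side_hi sg p ?c-side_lo sg p ?c)"
 proof (rule integral_bound[OF pw])
 show "continuous_on (side sg p ?c) (%th. ?f r th * H r th)" using pq by (intro continuous_on_mult cs cH) auto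
 fix th assume t: "th \<in> side sg p ?c"
 moreover have "?c<=pi" using pq by linarith
 ultimately have "th \<in> side sg eta pi" using subsetD[OF sub[OF pq(1)]] by blast
 moreover have "th \<in> {- pi..pi}" using t pq eta by (auto simp: side_lo_def side_hi_def split: if_splits)
 ultimately show "norm (?f r th * H r th)<=M * Hm"
 unfolding norm_mult[of "?f r th"] using fn[OF r] elim M0 by (intro mult_mono) auto
 qed
 also have "... <= B * \<delta>" using len M0 Hm0 B pw by (intro mult_mono) (auto simp: B_def)
 also have "... <= B * sqrt (2 * \<delta>)"
 proof -
 have "\<delta> <= sqrt (2 * \<delta>)" using \<delta> by (intro real_le_rsqrt) (simp add: power2_eq_square mult_mono)
 thus ?thesis using B by (intro mult_left_mono) auto
 qed
 also have "... <= B*(2*(\<epsilon> / (8 * B)))" using sqd B by (intro mult_left_mono) auto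
 also have "... = \<epsilon> / 4" using B by simp
 finally have "1/(2 * pi) * norm (integral (side sg p ?c) (%th. ?f r th * H r th))<=1*(\<epsilon> / 4)"
 using pi_gt3 by (intro mult_mono) auto
 thus ?thesis by (simp add: norm_mult norm_divide)
 qed
 have tri: "norm (a+(b+c)-(e+f))<=norm (a-e)+(norm b+(norm c+norm f))" for a b c e f :: complex
 using norm_triangle_ineq[of "a-e" "b+(c-f)"] norm_triangle_ineq[of b "c-f"] norm_triangle_ineq4[of c f]
 by (simp add: algebra_simps)
 have "norm (?T r eta pi - ?V r eta ?c)<=norm (?T r eta p - ?V r eta p)+(norm (?T r p q)+(norm (?T r q pi)+norm (?V r p ?c)))"
 unfolding T V by (rule tri)
 also have "... < \<epsilon>" using elim(1,2) mid vv \<epsilon> by linarith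
 finally show ?case .
 qed
 thus "\<forall>\<^sub>F r in at_right 0. dist (?T r eta pi - ?V r eta ?c) 0 < \<epsilon>" by simp
 qed
qed

section \<open>The symbols of the slices on a reference circle\<close>

text \<open>Continuation of \<open>osc\<close> off the unit circle, with \<open>1/z\<close> in the
  place of the conjugate of \<open>z\<close>.\<close>

definition oscz :: "real list => int => complex => complex" where
 "oscz as x z=(\<Prod>a\<leftarrow>as. (1-of_real a/z)/(1-of_real a * z)) * z powi (- x)"

lemma osc_eq_oscz: "osc as x th = oscz as x (cis th)"
proof -
 have "(1-of_real a/cis th)/(1-of_real a * cis th)=blaschke a th" for a
 by (simp add: blaschke_def divide_inverse)
 moreover have "cis th powi (- x)=cis (- (of_int x * th))" by (simp add: cis_power_int)
 ultimately show ?thesis by (simp add: osc_def oscz_def)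
qed

text \<open>The numerator factors without a partner in the denominator, present when the base is not
  exactly balanced around the slice.\<close>

definition tailp :: "real => real => nat => nat => complex => complex" where
 "tailp r s N N' z=(\<Prod>i\<in>{N..<N'}. 1-of_real (exp (- (s+r*(real i+1/2))))/z)"

lemma prod_list_nodes: "(\<Prod>a\<leftarrow>nodes r s N. f a)=(\<Prod>i<N. f (exp (- (s+r*(real i+1/2)))))"
 unfolding nodes_def map_map o_def by (simp add: prod.list_conv_set_nth atLeast0LessThan)

definition gsym :: "real => nat => int => int => int => complex => complex" where
 "gsym r A d t x w=w powi (- x) * symf r A (A+nat (int A+d)) (jx A (nat (t+int A))) w"

text \<open>On the circle of radius \<open>exp (- (r * t/2))\<close> the growing steps, counted
  backwards from the slice, and the shrinking steps, counted forwards, have the same nodes. They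
  pair into Blaschke factors until the growing steps are used up.\<close>

lemma symf_jx:
 fixes t d :: int and r :: real
 assumes t: "\<bar>t\<bar> <= int A" and d: "t<=d" and z: "z ~= 0"
 defines "w \<equiv> of_real (exp (- (r * of_int t/2))) * z" and "s \<equiv> r * of_int \<bar>t\<bar> / 2"
 and "N \<equiv> A-nat (- t)" and "N' \<equiv> nat (int A+d)-nat t"
 shows "symf r A (A+nat (int A+d)) (jx A (nat (t+int A))) w =
 (\<Prod>a\<leftarrow>nodes r s N. (1-of_real a/z)/(1-of_real a * z)) * tailp r s N N' z"
proof -
 define k where "k=nat (t+int A)"
 define K where "K=A+nat (int A+d)"
 let ?g = "%j. step_sym r A j w powi (- jx A k j)"
 let ?s = "%i. complex_of_real (exp (- (s+r*(real i+1/2))))"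
 have NN: "N<=N'" "N=min A k" "A+nat t=max A k" "max A k+N'=K" "max A k<=K"
 using t d unfolding N_def N'_def k_def K_def by linarith+
 have kA: "N<=A" "real A-real N = of_int (nat (- t))" using NN(2) t by (auto simp: N_def of_nat_diff)
 have "(\<Prod>j<K. ?g j)=(\<Prod>j<A. ?g j)*(\<Prod>j\<in>{A..<K}. ?g j)"
 using prod.atLeastLessThan_concat[of 0 A K ?g] by (simp add: lessThan_atLeast0 K_def)
 also have "(\<Prod>j<A. ?g j)=(\<Prod>j<N. ?g j)"
 by (rule prod.mono_neutral_right) (auto simp: NN(2) jx_def)
 \<comment> \<open>Reversal gives the growing step nearest to the slice the index 0.\<close>
 also have "... = (\<Prod>i<N. ?g (N-Suc i))" by (rule prod.nat_diff_reindex[symmetric])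
 also have "... = (\<Prod>i<N. 1/(1 - ?s i * z))"
 proof (rule prod.cong[OF refl])
 fix i assume "i \<in> {..<N}"
 hence i: "N-Suc i < A" "N-Suc i < k" "real (N-Suc i)=real N-real i-1" using NN(2) by (auto simp: of_nat_diff)
 have "step_rate r A (N-Suc i)=r*(- real_of_int (nat (- t))-real i-1/2)"
 unfolding step_rate_def i(3) kA(2)[symmetric] by (simp add: algebra_simps)
 hence "step_rate r A (N-Suc i)-r * of_int t/2 = - (s+r*(real i+1/2))"
 unfolding s_def by (cases "t >= 0") (simp_all add: algebra_simps)
 hence "exp (step_rate r A (N-Suc i)) * exp (- (r * of_int t/2))=exp (- (s+r*(real i+1/2)))"
 by (simp add: exp_add[symmetric])
 hence "complex_of_real (exp (step_rate r A (N-Suc i))) * of_real (exp (- (r * of_int t/2))) = ?s i"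
 by (simp only: of_real_mult[symmetric])
 hence "step_sym r A (N-Suc i) w=1 - ?s i * z"
 using i by (simp only: step_sym_def w_def if_True mult.assoc[symmetric])
 moreover have "jx A k (N-Suc i)=1" using i(1,2) by (simp add: jx_def)
 ultimately show "?g (N-Suc i)=1/(1 - ?s i * z)" by (simp only: power_int_minus power_int_1_right inverse_eq_divide)
 qed
 also have "(\<Prod>j\<in>{A..<K}. ?g j)=(\<Prod>j\<in>{max A k..<K}. ?g j)"
 by (rule prod.mono_neutral_right) (auto simp: jx_def)
 also have "... = (\<Prod>i<N'. ?g (max A k+i))"
 using prod.shift_bounds_nat_ivl[of ?g 0 "max A k" N'] NN(4) by (simp add: add.commute atLeast0LessThan)
 also have "... = (\<Prod>i<N'. 1 - ?s i/z)"
 proof (rule prod.cong[OF refl])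
 fix i
 have i: "~ max A k+i < A" "k<=max A k+i" by auto
 have "step_rate r A (max A k+i)=r*(real (nat t)+real i+1/2)"
 unfolding step_rate_def NN(3)[symmetric] by simp
 hence "- step_rate r A (max A k+i)+r * of_int t/2 = - (s+r*(real i+1/2))"
 unfolding s_def by (cases "t >= 0") (simp_all add: algebra_simps)
 hence "exp (- step_rate r A (max A k+i))/exp (- (r * of_int t/2))=exp (- (s+r*(real i+1/2)))"
 by (simp add: exp_diff[symmetric])
 hence "complex_of_real (exp (- step_rate r A (max A k+i)))/of_real (exp (- (r * of_int t/2))) = ?s i"
 by (simp only: of_real_divide[symmetric])
 hence "step_sym r A (max A k+i) w=1 - ?s i/z"
 using i by (simp only: step_sym_def w_def if_False divide_divide_eq_left[symmetric])
 thus "?g (max A k+i)=1 - ?s i/z" using i by (simp add: jx_def)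
 qed
 also have "(\<Prod>i<N'. 1 - ?s i/z)=(\<Prod>i<N. 1 - ?s i/z) * tailp r s N N' z"
 unfolding tailp_def using prod.atLeastLessThan_concat[of 0 N N' "%i. 1 - ?s i/z"] NN(1) by (simp only: lessThan_atLeast0 le0 mult.commute)
 finally have "(\<Prod>j<K. ?g j)=((\<Prod>i<N. 1/(1 - ?s i * z))*(\<Prod>i<N. 1 - ?s i/z)) * tailp r s N N' z"
 by (simp only: mult.assoc)
 also have "(\<Prod>i<N. 1/(1 - ?s i * z))*(\<Prod>i<N. 1 - ?s i/z)=(\<Prod>i<N. (1 - ?s i/z)/(1 - ?s i * z))"
 unfolding prod.distrib[symmetric] by (intro prod.cong refl) simp
 finally show ?thesis unfolding symf_def prod_list_nodes k_def K_def .
qed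

lemma gsym_ref:
 fixes t d :: int and r :: real
 assumes t: "\<bar>t\<bar> <= int A" and d: "t<=d" and z: "z ~= 0"
 defines "s \<equiv> r * of_int \<bar>t\<bar> / 2" and "N \<equiv> A-nat (- t)" and "N' \<equiv> nat (int A+d)-nat t"
 shows "gsym r A d t x (of_real (exp (- (r * of_int t/2))) * z) =
 of_real (exp (- (r * of_int t/2))) powi (- x)*(oscz (nodes r s N) x z * tailp r s N N' z)"
 unfolding gsym_def oscz_def s_def N_def N'_def symf_jx[OF t d z] power_int_mult_distrib by (simp only: mult_ac)

text \<open>The ratio of the symbols of two slices up to a constant and a power of \<open>w\<close>;
  every intermediate step contributes one factor, written in \<open>1/w\<close> on both sides of the
  main diagonal.\<close>

definition quotp :: "real => int => int => complex => complex" where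
 "quotp r t t' w=(\<Prod>T\<in>{t..<t'}. 1-of_real (exp (- (r*(of_int T+1/2))))/w)"

text \<open>Constants from rewriting a growing factor \<open>1 - e * w\<close> as
  \<open>- e * w * (1 - inverse e / w)\<close>. They depend on one slice only, so in the kernel they
  form a gauge that cancels in determinants.\<close>

definition gam :: "real => int => complex" where
 "gam r t=(\<Prod>T\<in>{t..<0}. - of_real (exp (- (r*(of_int T+1/2)))))"

lemma gam_nz: "gam r t ~= 0"
 unfolding gam_def by simp

lemma prod_step_sym:
 assumes t: "t<=t'" and A: "- int A<=t" and w: "w ~= 0"
 shows "(\<Prod>j\<in>{nat (t+int A)..<nat (t'+int A)}. step_sym r A j w) * gam r t =
 gam r t' * w powi (int (nat (- t))-int (nat (- t'))) * quotp r t t' w"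
 using t
proof (induction t' rule: int_ge_induct)
 case base
 thus ?case by (simp add: quotp_def)
next
 case (step T)
 have e: "{nat (t+int A)..<nat (T+1+int A)}=insert (nat (T+int A)) {nat (t+int A)..<nat (T+int A)}"
 using step.hyps A by auto
 have e2: "{t..<T+1}=insert T {t..<T}" using step.hyps by auto
 have rate: "step_rate r A (nat (T+int A))=r*(of_int T+1/2)"
 using step.hyps A by (simp add: step_rate_def)
 let ?q = "complex_of_real (exp (- (r*(of_int T+1/2))))"
 have q: "quotp r t (T+1) w=(1 - ?q/w) * quotp r t T w" unfolding quotp_def e2 by simp
 have "step_sym r A (nat (T+int A)) w*(gam r T * w powi (int (nat (- t))-int (nat (- T)))) =
 gam r (T+1) * w powi (int (nat (- t))-int (nat (- (T+1))))*(1 - ?q/w)"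
 proof (cases "T < 0")
 case True
 have "{T..<0}=insert T {T+1..<0}" using True by auto
 hence g: "gam r T = - ?q * gam r (T+1)" unfolding gam_def by simp
 have "int (nat (- t))-int (nat (- (T+1)))=(int (nat (- t))-int (nat (- T)))+1" using True by simp
 hence p: "w powi (int (nat (- t))-int (nat (- (T+1))))=w powi (int (nat (- t))-int (nat (- T))) * w"
 by (simp only: power_int_add[OF disjI1[OF w]] power_int_1_right)
 have "exp (r*(of_int T+1/2)) * exp (- (r*(of_int T+1/2)))=1" by (simp add: exp_add[symmetric])
 hence inv: "complex_of_real (exp (r*(of_int T+1/2))) * ?q=1" by (simp only: of_real_mult[symmetric] of_real_1)
 have alg: "(1-e * w) * - q=(e * q) * w-q" for e q :: complex by (simp add: algebra_simps)
 have "nat (T+int A) < A" using True A step.hyps by linarith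
 hence "step_sym r A (nat (T+int A)) w=1-of_real (exp (r*(of_int T+1/2))) * w"
 by (simp add: step_sym_def rate)
 hence "step_sym r A (nat (T+int A)) w * - ?q=(of_real (exp (r*(of_int T+1/2))) * ?q) * w - ?q"
 using alg by simp
 also have "... = w - ?q" unfolding inv by simp
 also have "... = (1 - ?q/w) * w" using w by (simp add: field_simps)
 finally have sq: "step_sym r A (nat (T+int A)) w * - ?q=(1 - ?q/w) * w" .
 have "step_sym r A (nat (T+int A)) w*(gam r T * w powi (int (nat (- t))-int (nat (- T)))) =
 (step_sym r A (nat (T+int A)) w * - ?q)*(gam r (T+1) * w powi (int (nat (- t))-int (nat (- T))))"
 unfolding g by (simp only: mult_ac)
 also have "... = gam r (T+1) * w powi (int (nat (- t))-int (nat (- (T+1))))*(1 - ?q/w)"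
 unfolding sq p by (simp only: mult_ac)
 finally show ?thesis .
 next
 case False
 hence g: "gam r T=gam r (T+1)" "int (nat (- T))=int (nat (- (T+1)))" by (auto simp: gam_def)
 have "~ nat (T+int A) < A" using False A step.hyps by linarith
 hence "step_sym r A (nat (T+int A)) w=1 - ?q/w" by (simp add: step_sym_def rate)
 thus ?thesis unfolding g by (simp only: mult_ac)
 qed
 note main=this
 let ?S = "\<Prod>j\<in>{nat (t+int A)..<nat (T+int A)}. step_sym r A j w"
 have "(\<Prod>j\<in>{nat (t+int A)..<nat (T+1+int A)}. step_sym r A j w) * gam r t=step_sym r A (nat (T+int A)) w*(?S * gam r t)"
 unfolding e by (simp add: mult.assoc)
 also have "... = (step_sym r A (nat (T+int A)) w*(gam r T * w powi (int (nat (- t))-int (nat (- T))))) * quotp r t T w"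
 unfolding step.IH by (simp only: mult_ac)
 also have "... = gam r (T+1) * w powi (int (nat (- t))-int (nat (- (T+1)))) * quotp r t (T+1) w"
 unfolding main q by (simp only: mult_ac)
 finally show ?case .
qed

text \<open>Two slices differ by the intermediate steps. The power of \<open>w\<close> produced by
  rewriting the growing ones is absorbed by the summand \<open>nat (- t)\<close> of the
  position.\<close>

lemma gsym_step:
 assumes t: "t<=t'" "- int A<=t" "t'<=int A+d" and w: "w ~= 0" "quotp r t t' w ~= 0"
 and x: "x=y+int (nat (- t))" "x'=y'+int (nat (- t'))"
 shows "gsym r A d t' x' w * gam r t'=gsym r A d t x w * gam r t * w powi (y-y')/quotp r t t' w"
proof -
 define K where "K=A+nat (int A+d)"
 define k where "k=nat (t+int A)"
 define k' where "k'=nat (t'+int A)"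
 let ?P = "\<Prod>j\<in>{k..<k'}. step_sym r A j w"
 have kk: "k<=k'" "k'<=K" using t by (auto simp: k_def k'_def K_def)
 have P: "?P * gam r t=gam r t' * w powi (int (nat (- t))-int (nat (- t'))) * quotp r t t' w"
 unfolding k_def k'_def by (rule prod_step_sym[OF t(1,2) w(1)])
 have "gam r t' * w powi (int (nat (- t))-int (nat (- t'))) * quotp r t t' w ~= 0"
 using w gam_nz[of r t'] by simp
 hence nz: "?P ~= 0" using P by fastforce
 have "symf r A K (jx A k') w * ?P=symf r A K (jx A k) w"
 proof -
 have "?P=(\<Prod>j<K. if j \<in> {k..<k'} then step_sym r A j w else 1)"
 using kk by (intro prod.mono_neutral_cong_left) auto
 hence "symf r A K (jx A k') w * ?P =
 (\<Prod>j<K. step_sym r A j w powi (- jx A k' j)*(if j \<in> {k..<k'} then step_sym r A j w else 1))"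
 by (simp only: symf_def prod.distrib)
 also have "... = symf r A K (jx A k) w" unfolding symf_def
 proof (rule prod.cong[OF refl])
 fix j
 have "j \<in> {k..<k'} ==> step_sym r A j w ~= 0" using nz prod_zero_iff[of "{k..<k'}"] by blast
 thus "step_sym r A j w powi (- jx A k' j)*(if j \<in> {k..<k'} then step_sym r A j w else 1)=step_sym r A j w powi (- jx A k j)"
 using kk by (auto simp: jx_def power_int_minus)
 qed
 finally show ?thesis .
 qed
 note JP=this
 have J: "symf r A K (jx A k') w * gam r t' * w powi (int (nat (- t))-int (nat (- t'))) * quotp r t t' w=symf r A K (jx A k) w * gam r t"
 unfolding JP[symmetric] mult.assoc P[unfolded mult.assoc] by (simp only: mult_ac)
 have "- x' = - x+(y-y')+(int (nat (- t))-int (nat (- t')))" using x by simp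
 hence "w powi (- x')=w powi (- x) * w powi (y-y') * w powi (int (nat (- t))-int (nat (- t')))"
 by (simp only: power_int_add[OF disjI1[OF w(1)]])
 hence "w powi (- x') * symf r A K (jx A k') w * gam r t' * quotp r t t' w =
 w powi (- x) * w powi (y-y')*(symf r A K (jx A k') w * gam r t' * w powi (int (nat (- t))-int (nat (- t'))) * quotp r t t' w)"
 by (simp only: mult_ac)
 also have "... = w powi (- x) * symf r A K (jx A k) w * gam r t * w powi (y-y')"
 unfolding J by (simp only: mult_ac)
 finally show ?thesis unfolding gsym_def K_def[symmetric] k_def[symmetric] k'_def[symmetric]
 using w(2) by (simp add: eq_divide_eq)
qed

lemma laurent_on_shift:
 assumes "laurent_on c rho f"
 shows "laurent_on (%n. c (n-x)) rho (%w. w powi x * f w)"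
proof -
 have rho: "rho > 0" and s: "(%n. \<bar>c n\<bar> * rho powi n) summable_on UNIV"
 and h: "\<And>w. cmod w = rho ==> ((%n. of_real (c n) * w powi n) has_sum f w) UNIV"
 using assms by (auto simp: laurent_on_def)
 have "(%n. rho powi x*(\<bar>c n\<bar> * rho powi n)) summable_on UNIV" by (rule summable_on_cmult_right[OF s])
 moreover have "(%n. rho powi x*(\<bar>c n\<bar> * rho powi n)) summable_on UNIV \<longleftrightarrow> (%n. \<bar>c (n-x)\<bar> * rho powi n) summable_on UNIV"
 by (rule summable_on_reindex_bij_witness[where i = "%n. n-x" and j = "%n. n+x"]) (use rho in \<open>auto simp: power_int_add\<close>)
 ultimately have 1: "(%n. \<bar>c (n-x)\<bar> * rho powi n) summable_on UNIV" by blast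
 have 2: "((%n. of_real (c (n-x)) * w powi n) has_sum w powi x * f w) UNIV" if w: "cmod w = rho" for w
 proof -
 have "w ~= 0" using w rho by auto
 have "((%n. w powi x*(of_real (c n) * w powi n)) has_sum w powi x * f w) UNIV" by (rule has_sum_cmult_right[OF h[OF w]])
 moreover have "((%n. w powi x*(of_real (c n) * w powi n)) has_sum w powi x * f w) UNIV \<longleftrightarrow>
 ((%n. of_real (c (n-x)) * w powi n) has_sum w powi x * f w) UNIV"
 by (rule has_sum_reindex_bij_witness[where i = "%n. n-x" and j = "%n. n+x"]) (use \<open>w ~= 0\<close> in \<open>auto simp: power_int_add\<close>)
 ultimately show ?thesis by blast
 qed
 show ?thesis using rho 1 2 by (simp add: laurent_on_def)
qed

lemma symf_uminus: "symf r A K (%j. - e j) w=inverse (symf r A K e w)"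
 unfolding symf_def prod_inversef[symmetric] by (simp add: power_int_minus o_def)

definition coef_inv :: "real => nat => int => int => int => int => real" where
 "coef_inv r A d t x n=seqf r A (A+nat (int A+d)) (%j. - jx A (nat (t+int A)) j) (n-x)"

definition coef_sym :: "real => nat => int => int => int => int => real" where
 "coef_sym r A d t x n=seqf r A (A+nat (int A+d)) (jx A (nat (t+int A))) (n-(- x))"

text \<open>The poles of \<open>1/J\<close> come from the shrinking steps after the slice; the first
  of these fixes the inner radius of convergence.\<close>

lemma laurent_on_coef_inv:
 assumes r: "r > 0" and rho: "exp (- (r*(of_int (nat t)+1/2))) < rho"
 shows "laurent_on (coef_inv r A d t x) rho (%w. inverse (gsym r A d t x w))"
proof -
 let ?K = "A+nat (int A+d)" and ?k = "nat (t+int A)"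
 have 0: "0 < rho" using rho exp_gt_zero order.strict_trans by blast
 have "laurent_on (seqf r A ?K (%j. - jx A ?k j)) rho (symf r A ?K (%j. - jx A ?k j))"
 proof (rule laurent_on_seqf[OF 0 unit_exps_jx(2)])
 fix j assume "- jx A ?k j=1"
 hence j: "A<=j" "?k<=j" by (auto simp: jx_def split: if_splits)
 have "real_of_int (nat t)<=real j-real A" using j by linarith
 hence "r*(of_int (nat t)+1/2)<=step_rate r A j" using r unfolding step_rate_def by (intro mult_left_mono) auto
 hence "exp (- step_rate r A j)<=exp (- (r*(of_int (nat t)+1/2)))" by (simp only: exp_le_cancel_iff neg_le_iff_le)
 hence "exp (- step_rate r A j) < rho" using rho by linarith
 thus "step_radius r A j rho" using j(1) by (simp add: step_radius_def)
 qed
 from laurent_on_shift[OF this,of x] show ?thesis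
 unfolding coef_inv_def[abs_def] gsym_def symf_uminus by (simp add: power_int_minus inverse_mult_distrib)
qed

text \<open>The poles of \<open>J\<close> come from the growing steps before the slice, and the last
  of these fixes the outer radius. The reference circle lies between this radius and the inner one
  of \<open>1/J\<close>.\<close>

lemma laurent_on_coef_sym:
 assumes r: "r > 0" and rho: "0 < rho" "rho < exp (r*(of_int (nat (- t))+1/2))" and t: "- int A<=t"
 shows "laurent_on (coef_sym r A d t x) rho (gsym r A d t x)"
proof -
 let ?K = "A+nat (int A+d)" and ?k = "nat (t+int A)"
 have "laurent_on (seqf r A ?K (jx A ?k)) rho (symf r A ?K (jx A ?k))"
 proof (rule laurent_on_seqf[OF rho(1) unit_exps_jx(1)])
 fix j assume "jx A ?k j=1"
 hence j: "j < A" "j < ?k" by (auto simp: jx_def split: if_splits)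
 have "real j-real A+1/2 <= - (real_of_int (nat (- t))+1/2)" using j t by linarith
 hence "step_rate r A j<=r * - (of_int (nat (- t))+1/2)" using r unfolding step_rate_def by (intro mult_left_mono) auto
 hence "exp (step_rate r A j)<=exp (- (r*(of_int (nat (- t))+1/2)))" by (simp only: exp_le_cancel_iff mult_minus_right)
 hence "exp (step_rate r A j) * rho <= exp (- (r*(of_int (nat (- t))+1/2))) * rho" using rho(1) by (intro mult_right_mono) auto
 also have "... < exp (- (r*(of_int (nat (- t))+1/2))) * exp (r*(of_int (nat (- t))+1/2))"
 using rho(2) by (intro mult_strict_left_mono) auto
 also have "... = 1" by (simp only: mult.commute[of "exp (- _)"] exp_minus_inverse)
 finally show "step_radius r A j rho" using j(1) by (simp add: step_radius_def)
 qed
 from laurent_on_shift[OF this,of "- x"] show ?thesis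
 unfolding coef_sym_def[abs_def] gsym_def[abs_def] .
qed

lemma box_kernel_coef:
 assumes t: "- int A<=t" "- int A<=t'"
 shows "box_kernel r d A t h t' h' =
 (if t'<=t then (\<Sum>\<^sub>\<infinity>n\<in>{..0}. coef_inv r A d t (tile_pos t h) n * coef_sym r A d t' (tile_pos t' h') (- n))
 else-(\<Sum>\<^sub>\<infinity>n\<in>{0<..}. coef_inv r A d t (tile_pos t h) n * coef_sym r A d t' (tile_pos t' h') (- n)))"
proof -
 have "nat (t'+int A)<=nat (t+int A) \<longleftrightarrow> t'<=t" using t by auto
 thus ?thesis
 unfolding box_kernel_def corr_kernel_def kernel_term_def coef_inv_def coef_sym_def by (simp add: algebra_simps)
qed

text \<open>Coefficients at \<open>n\<close> and at \<open>- n\<close> pick up inverse factors, so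
  the pairing may be computed from the series on any circle, normalised by any constant.\<close>

lemma coef_rescale:
 assumes "rho ~= 0" "kappa ~= 0" and s: "(%n. a n * b (- n)) summable_on X"
 shows "(of_real (\<Sum>\<^sub>\<infinity>n\<in>X. a n * b (- n)) :: complex) =
 (\<Sum>\<^sub>\<infinity>n\<in>X. (kappa * of_real (a n * rho powi n))*(of_real (b (- n) * rho powi (- n)) / kappa))"
proof -
 have "(kappa * of_real (a n * rho powi n))*(of_real (b (- n) * rho powi (- n)) / kappa) = of_real (a n * b (- n))" for n
 using assms(1,2) by (simp add: power_int_minus)
 thus ?thesis by (simp only:) (rule infsumI[symmetric,OF has_sum_of_real[OF has_sum_infsum[OF s]]])
qed

lemma fourier_coeff_unique:
 assumes "(%n. norm (d n)) summable_on UNIV" "\<And>th. ((%n. d n * cis (of_int n * th)) has_sum H th) UNIV"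
 shows "fourier_coeff (- pi) pi H n=d n"
proof -
 have e: "fourier_coeff (- pi) pi (%th. cis (- (of_int n * th))) (- k)=(if k=n then 1 else 0)" for k
 proof -
 have "(%th. cis (- (of_int n * th)) * cis (- (of_int (- k) * th)))=(%th. cis (of_int (k-n) * th))"
 by (simp add: cis_mult algebra_simps)
 thus ?thesis
 unfolding fourier_coeff_def by (simp only: integral_cis_period) simp
 qed
 have "((%k. d k*(if k=n then 1 else 0)) has_sum
 1/(2 * pi) * integral {- pi..pi} (%th. cis (- (of_int n * th)) * H th)) UNIV"
 proof -
 have "continuous_on {- pi..pi} (%th. cis (- (of_int n * th)))" by (intro continuous_intros)
 from fourier_pairing[OF assms this] show ?thesis unfolding e by simp
 qed
 moreover have "((%k. d k*(if k=n then 1 else 0)) has_sum d n) (UNIV :: int set)"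
 by (rule has_sum_finite_neutralI[of "{n}"]) auto
 ultimately show ?thesis
 unfolding fourier_coeff_def by (simp only: mult.commute[of _ "cis _"]) (rule has_sum_unique)
qed

lemma tendsto_integral_uniform:
 fixes f :: "real => real => complex"
 assumes u: "uniform_limit {a..b} f g (at_right 0)" and c: "\<forall>\<^sub>F r in at_right 0. continuous_on {a..b} (f r)"
 and g: "continuous_on {a..b} g"
 shows "((%r. integral {a..b} (f r)) \<longlongrightarrow> integral {a..b} g) (at_right 0)"
proof -
 define f' where "f'=(%r. if continuous_on {a..b} (f r) then f r else g)"
 have ev: "\<forall>\<^sub>F r in at_right 0. f' r=f r" using c by eventually_elim (simp add: f'_def)
 have "\<forall>\<^sub>F r in at_right 0. \<forall>x\<in>{a..b}. f' r x=f r x" using ev by eventually_elim simp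
 hence "uniform_limit {a..b} f' g (at_right 0)"
 using u by (subst uniform_limit_cong[where g=f and i=g]) auto
 moreover have "continuous_on {a..b} (f' r)" for r using g by (simp add: f'_def)
 ultimately obtain I J where IJ: "\<And>r. (f' r has_integral I r) {a..b}" "(g has_integral J) {a..b}" "(I \<longlongrightarrow> J) (at_right 0)"
 by (rule uniform_limit_integral) auto
 have "((%r. integral {a..b} (f' r)) \<longlongrightarrow> integral {a..b} g) (at_right 0)"
 using IJ(3) unfolding integral_unique[OF IJ(1)] integral_unique[OF IJ(2)] .
 moreover have "\<forall>\<^sub>F r in at_right 0. integral {a..b} (f' r)=integral {a..b} (f r)" using ev by eventually_elim simp
 ultimately show ?thesis by (rule Lim_transform_eventually)
qed

lemma half_pairing_add:
 assumes "continuous_on (side sg a b) f" "continuous_on (side sg a b) g" "(%n. norm (d n)) summable_on UNIV"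
 shows "half_pairing sg a b (%th. f th+g th) d X=half_pairing sg a b f d X+half_pairing sg a b g d X"
proof -
 let ?l = "side_lo sg a b" and ?h = "side_hi sg a b"
 have "fourier_coeff ?l ?h (%th. f th+g th) n=fourier_coeff ?l ?h f n+fourier_coeff ?l ?h g n" for n
 proof -
 have i: "(%th. h th * cis (- (of_int n * th))) integrable_on {?l..?h}" if "continuous_on {?l..?h} h" for h :: "real => complex"
 by (intro integrable_continuous_interval continuous_intros that)
 show ?thesis unfolding fourier_coeff_def distrib_right integral_add[OF i[OF assms(1)] i[OF assms(2)]] by (simp only: distrib_left)
 qed
 thus ?thesis unfolding half_pairing_def
 by (simp only: distrib_right) (intro infsum_add summable_fourier_pairing assms)
qed

lemma half_pairing_bound:
 assumes f: "continuous_on (side sg a b) f" "\<And>th. th \<in> side sg a b ==> norm (f th) <= \<delta>"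
 and ab: "0<=a" "a<=b" "b<=pi" and d: "(%n. norm (d n)) summable_on UNIV"
 and Q: "\<And>F. finite F ==> (\<Sum>n\<in>F. (norm (d n))\<^sup>2)<=Q\<^sup>2" "0<=Q" and \<delta>: "0 <= \<delta>"
 shows "norm (half_pairing sg a b f d X) <= \<delta> * Q"
proof -
 have pw: "- pi<=side_lo sg a b" "side_hi sg a b<=pi" "side_lo sg a b<=side_hi sg a b" "side_hi sg a b-side_lo sg a b<=pi"
 using ab by (auto simp: side_lo_def side_hi_def)
 have "norm (half_pairing sg a b f d X)<=sqrt (\<delta>\<^sup>2) * sqrt (Q\<^sup>2)"
 unfolding half_pairing_def
 proof (rule norm_infsum_mult_le[OF summable_fourier_pairing[OF f(1) d]])
 fix F :: "int set" assume F: "finite F"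
 have "(\<Sum>n\<in>F. (norm (fourier_coeff (side_lo sg a b) (side_hi sg a b) f n))\<^sup>2) \<le>
 1/(2 * pi) * integral (side sg a b) (%th. (norm (f th))\<^sup>2)"
 by (intro bessel_finite f(1) pw F)
 also have "... <= 1/(2 * pi)*(\<delta>\<^sup>2*(side_hi sg a b-side_lo sg a b))"
 proof (intro mult_left_mono)
 have "norm (integral (side sg a b) (%th. (norm (f th))\<^sup>2)) <= \<delta>\<^sup>2*(side_hi sg a b-side_lo sg a b)"
 proof (rule integral_bound[OF pw(3)])
 show "continuous_on (side sg a b) (%th. (norm (f th))\<^sup>2)" by (intro continuous_intros f(1))
 fix th assume "th \<in> side sg a b"
 from power_mono[OF f(2)[OF this] norm_ge_zero,of 2]
 show "norm ((norm (f th))\<^sup>2) <= \<delta>\<^sup>2" by (simp only: real_norm_def abs_power2)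
 qed
 thus "integral (side sg a b) (%th. (norm (f th))\<^sup>2) <= \<delta>\<^sup>2*(side_hi sg a b-side_lo sg a b)" by simp
 qed simp
 also have "... <= 1/(2 * pi)*(\<delta>\<^sup>2*(2 * pi))"
 using pw(4) pi_gt_zero by (intro mult_left_mono) (linarith | simp)+
 finally show "(\<Sum>n\<in>F. (norm (fourier_coeff (side_lo sg a b) (side_hi sg a b) f n))\<^sup>2) <= \<delta>\<^sup>2" by simp
 have "(\<Sum>n\<in>F. (norm (d (- n)))\<^sup>2)=(\<Sum>n\<in>uminus ` F. (norm (d n))\<^sup>2)" by (simp add: sum.reindex inj_on_def)
 also have "... <= Q\<^sup>2" using F by (intro Q(1)) auto
 finally show "(\<Sum>n\<in>F. (norm (d (- n)))\<^sup>2)<=Q\<^sup>2" .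
 qed
 thus ?thesis using \<delta> Q(2) by simp
qed

text \<open>Three additions to \<open>half_pairing_limit\<close>: the amplitude may depend on
  \<open>r\<close> and converge uniformly; the coefficients belong to the same phase times a factor
  tending to 1, so that the phases cancel in the full integral; the positive half follows as the
  full pairing minus the nonpositive one.\<close>

lemma half_pairing_limit_uniform:
 fixes G :: "real => bool" and as :: "real => real list" and x :: "real => int" and d :: "real => int => complex"
 and E psi :: "real => real => complex" and phi phi' :: "real => complex"
 assumes evp: "\<forall>\<^sub>F r in at_right 0. G r" and Gpos: "\<And>r. G r ==> r > 0"
 and as: "\<And>r a. G r ==> a \<in> set (as r) ==> 0<=a & a < 1"
 and ths: "0<=ths" "ths<=pi"
 and inside: "\<And>th. 0 < th ==> th < ths ==> \<exists>e>0. \<forall>\<^sub>F r in at_right 0. e/r <= osc_rate (as r) (x r) th"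
 and outside: "\<And>th. ths < th ==> th<=pi ==> \<exists>e>0. \<forall>\<^sub>F r in at_right 0. osc_rate (as r) (x r) th <= - e/r"
 and d: "\<And>r. G r ==> (%n. norm (d r n)) summable_on UNIV"
 "\<And>r th. G r ==> ((%n. d r n * cis (of_int n * th)) has_sum osc (as r) (x r) th * E r th) UNIV"
 and E: "uniform_limit {- pi..pi} E (%_. 1) (at_right 0)" "\<And>r. G r ==> continuous_on {- pi..pi} (E r)"
 and eta: "0 <= eta" "eta <= pi"
 and phi: "\<And>th. th \<in> side sg eta pi ==> (phi has_vector_derivative phi' th) (at th within side sg eta pi)"
 and phi'c: "continuous_on (side sg eta pi) phi'"
 and psi: "uniform_limit (side sg eta pi) psi phi (at_right 0)" "\<And>r. G r ==> continuous_on (side sg eta pi) (psi r)"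
 shows "((%r. half_pairing sg eta pi (%th. cnj (osc (as r) (x r) th) * psi r th) (d r) {..0}) \<longlongrightarrow>
 1/(2 * pi) * integral (side sg eta (max eta ths)) phi) (at_right 0)" (is ?neg)
 and "((%r. half_pairing sg eta pi (%th. cnj (osc (as r) (x r) th) * psi r th) (d r) {0<..}) \<longlongrightarrow>
 1/(2 * pi) * integral (side sg (max eta ths) pi) phi) (at_right 0)" (is ?pos)
proof -
 let ?o = "%r th. osc (as r) (x r) th" and ?c = "max eta ths"
 let ?T = "%r f X. half_pairing sg eta pi (%th. cnj (?o r th) * f th) (d r) X"
 have c: "eta <= ?c" "?c<=pi" using eta ths by auto
 have oc: "continuous_on S (?o r)" if "G r" for r S by (rule continuous_osc[OF as[OF that]])
 have oo: "cnj (?o r th) * ?o r th=1" if "G r" for r th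
 proof -
 have "cmod (?o r th)=1" by (rule norm_osc[OF as[OF that]])
 thus ?thesis using complex_norm_square[of "?o r th"] by (simp add: mult.commute)
 qed
 have phic: "continuous_on (side sg eta pi) phi" using phi by (rule continuous_on_vector_derivative)
 have subpi: "side sg eta pi \<subseteq> {- pi..pi}" using eta by (auto simp: side_lo_def side_hi_def)
 have bd: "bounded (phi ` S)" if "S \<subseteq> side sg eta pi" for S
 using bounded_subset[OF compact_imp_bounded[OF compact_continuous_image[OF phic compact_Icc]]] that by blast
 have b1: "bounded ((%_. 1 :: complex) ` side sg eta pi)" by (rule bounded_subset[of "{1}"]) auto
 have uphi: "uniform_limit (side sg eta pi) (%r th. psi r th * E r th) phi (at_right 0)"
 proof -
 have "uniform_limit (side sg eta pi) (%r th. psi r th * E r th) (%th. phi th*1) (at_right 0)"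
 by (rule uniform_lim_mult[OF psi(1) uniform_limit_on_subset[OF E(1) subpi] bd[OF order_refl] b1])
 thus ?thesis by simp
 qed
 have uphi': "uniform_limit (side sg eta pi) (%r th. phi th * E r th) phi (at_right 0)"
 proof -
 have "uniform_limit (side sg eta pi) (%r th. phi th * E r th) (%th. phi th*1) (at_right 0)"
 by (rule uniform_lim_mult[OF uniform_limit_const uniform_limit_on_subset[OF E(1) subpi] bd[OF order_refl] b1])
 thus ?thesis by simp
 qed
 have Ec: "continuous_on (side sg eta pi) (E r)" if "G r" for r using continuous_on_subset[OF E(2)[OF that] subpi] .
 have Hm: "\<forall>\<^sub>F r in at_right 0. (\<forall>th\<in>{- pi..pi}. norm (?o r th * E r th)<=2) & (\<forall>F. finite F --> (\<Sum>n\<in>F. (norm (d r n))\<^sup>2)<=2\<^sup>2)"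
 using uniform_limitD[OF E(1),of 1,simplified] evp
 proof eventually_elim
 case (elim r)
 have n: "norm (?o r th * E r th)<=2" if "th \<in> {- pi..pi}" for th
 proof -
 have "dist (E r th) 1 < 1" using elim(1) that by auto
 hence "norm (E r th)<=2" using norm_triangle_ineq2[of "E r th" 1] by (simp add: dist_norm)
 thus ?thesis using norm_osc[OF as[OF elim(2)]] by (simp add: norm_mult)
 qed
 have "(\<Sum>n\<in>F. (norm (d r n))\<^sup>2)<=2\<^sup>2" if F: "finite F" for F
 proof -
 have Hc: "continuous_on {- pi..pi} (%th. ?o r th * E r th)" by (intro continuous_on_mult oc[OF elim(2)] E(2)[OF elim(2)])
 have "(\<Sum>n\<in>F. (norm (d r n))\<^sup>2)=(\<Sum>n\<in>F. (norm (fourier_coeff (- pi) pi (%th. ?o r th * E r th) n))\<^sup>2)"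
 by (simp only: fourier_coeff_unique[OF d(1)[OF elim(2)] d(2)[OF elim(2)]])
 also have "... <= 1/(2 * pi) * integral {- pi..pi} (%th. (norm (?o r th * E r th))\<^sup>2)"
 by (intro bessel_finite Hc F) auto
 also have "... <= 1/(2 * pi)*(2\<^sup>2*(pi - - pi))"
 proof (intro mult_left_mono)
 have "norm (integral {- pi..pi} (%th. (norm (?o r th * E r th))\<^sup>2))<=2\<^sup>2*(pi - - pi)"
 proof (rule integral_bound)
 show "continuous_on {- pi..pi} (%th. (norm (?o r th * E r th))\<^sup>2)" by (intro continuous_on_power continuous_on_norm Hc)
 fix th assume "th \<in> {- pi..pi}"
 from power_mono[OF n[OF this] norm_ge_zero,of 2]
 show "norm ((norm (?o r th * E r th))\<^sup>2)<=2\<^sup>2" by (simp only: real_norm_def abs_power2)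
 qed simp
 thus "integral {- pi..pi} (%th. (norm (?o r th * E r th))\<^sup>2)<=2\<^sup>2*(pi - - pi)" by simp
 qed simp
 also have "... = 2\<^sup>2" by simp
 finally show ?thesis .
 qed
 thus ?case using n by blast
 qed
 have main: "((%r. ?T r phi {..0}-1/(2 * pi) * integral (side sg eta ?c) (%th. cnj (?o r th) * phi th*(?o r th * E r th))) \<longlongrightarrow> 0) (at_right 0)"
 by (rule half_pairing_limit[where G=G,OF evp Gpos as ths inside outside d _ Hm eta phi phi'c])
 (auto intro!: continuous_on_mult oc E(2))
 have canc: "cnj (?o r th) * f*(?o r th * e)=f * e" if "G r" for r th f e
 proof -
 have "cnj (?o r th) * f*(?o r th * e)=(cnj (?o r th) * ?o r th)*(f * e)" by (simp only: mult_ac)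
 thus ?thesis unfolding oo[OF that] by simp
 qed
 have lim: "((%r. integral (side sg a b) (%th. phi th * E r th)) \<longlongrightarrow> integral (side sg a b) phi) (at_right 0)"
 "((%r. integral (side sg a b) (%th. psi r th * E r th)) \<longlongrightarrow> integral (side sg a b) phi) (at_right 0)"
 if "eta <= a" "b<=pi" for a b
 proof -
 note sub=side_subset[OF that,of sg]
 have "\<forall>\<^sub>F r in at_right 0. continuous_on (side sg a b) (%th. phi th * E r th)"
 using evp by eventually_elim (intro continuous_on_mult continuous_on_subset[OF phic sub] continuous_on_subset[OF Ec sub])
 thus "((%r. integral (side sg a b) (%th. phi th * E r th)) \<longlongrightarrow> integral (side sg a b) phi) (at_right 0)"
 by (rule tendsto_integral_uniform[OF uniform_limit_on_subset[OF uphi' sub] _ continuous_on_subset[OF phic sub]])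
 have "\<forall>\<^sub>F r in at_right 0. continuous_on (side sg a b) (%th. psi r th * E r th)"
 using evp by eventually_elim (intro continuous_on_mult continuous_on_subset[OF psi(2) sub] continuous_on_subset[OF Ec sub])
 thus "((%r. integral (side sg a b) (%th. psi r th * E r th)) \<longlongrightarrow> integral (side sg a b) phi) (at_right 0)"
 by (rule tendsto_integral_uniform[OF uniform_limit_on_subset[OF uphi sub] _ continuous_on_subset[OF phic sub]])
 qed
 have rem: "((%r. ?T r (%th. psi r th - phi th) {..0}) \<longlongrightarrow> 0) (at_right 0)"
 proof (rule tendstoI)
 fix \<epsilon> :: real assume \<epsilon>: "0 < \<epsilon>"
 hence "\<epsilon> / 3 > 0" by simp
 from uniform_limitD[OF psi(1) this] evp Hm
 show "\<forall>\<^sub>F r in at_right 0. dist (?T r (%th. psi r th - phi th) {..0}) 0 < \<epsilon>"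
 proof eventually_elim
 case (elim r)
 have "norm (?T r (%th. psi r th - phi th) {..0}) <= \<epsilon> / 3*2"
 proof (rule half_pairing_bound[OF _ _ eta order_refl d(1)[OF elim(2)]])
 show "continuous_on (side sg eta pi) (%th. cnj (?o r th)*(psi r th - phi th))"
 by (intro continuous_on_mult continuous_on_cnj continuous_on_diff oc psi(2) phic elim(2))
 show "(\<Sum>n\<in>F. (norm (d r n))\<^sup>2)<=2\<^sup>2" if "finite F" for F using elim(3)[THEN conjunct2] that by blast
 fix th assume "th \<in> side sg eta pi"
 hence "norm (psi r th - phi th) < \<epsilon> / 3" using elim(1) unfolding dist_norm by blast
 thus "norm (cnj (?o r th)*(psi r th - phi th)) <= \<epsilon> / 3" using norm_osc[OF as[OF elim(2)]] by (simp add: norm_mult)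
 qed (use \<epsilon> in auto)
 thus ?case using \<epsilon> by (simp add: dist_norm)
 qed
 qed
 have neg: ?neg
 proof -
 have "((%r. (?T r phi {..0}-1/(2 * pi) * integral (side sg eta ?c) (%th. cnj (?o r th) * phi th*(?o r th * E r th))) +
 ?T r (%th. psi r th - phi th) {..0}+1/(2 * pi) * integral (side sg eta ?c) (%th. phi th * E r th)) \<longlongrightarrow>
 0+0+1/(2 * pi) * integral (side sg eta ?c) phi) (at_right 0)"
 by (intro tendsto_add main rem tendsto_mult_left lim(1) order_refl c)
 moreover have "\<forall>\<^sub>F r in at_right 0. (?T r phi {..0}-1/(2 * pi) * integral (side sg eta ?c) (%th. cnj (?o r th) * phi th*(?o r th * E r th))) +
 ?T r (%th. psi r th - phi th) {..0}+1/(2 * pi) * integral (side sg eta ?c) (%th. phi th * E r th) = ?T r (psi r) {..0}"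
 using evp
 proof eventually_elim
 case (elim r)
 have "?T r (psi r) {..0}=half_pairing sg eta pi (%th. cnj (?o r th) * phi th+cnj (?o r th)*(psi r th - phi th)) (d r) {..0}"
 by (simp only: distrib_left[symmetric] add_diff_cancel_left' diff_add_cancel add_diff_eq)
 also have "... = ?T r phi {..0} + ?T r (%th. psi r th - phi th) {..0}"
 by (intro half_pairing_add continuous_on_mult continuous_on_cnj continuous_on_diff oc psi(2) phic elim d(1))
 finally show ?case unfolding canc[OF elim] by simp
 qed
 ultimately show ?thesis by (auto elim: Lim_transform_eventually)
 qed
 show ?neg by (rule neg)
 show ?pos
 proof -
 have "integral (side sg eta pi) phi = integral (side sg eta ?c) phi + integral (side sg ?c pi) phi"
 by (rule integral_side_combine[OF c]) (intro integrable_continuous_interval phic)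
 hence "((%r. 1/(2 * pi) * integral (side sg eta pi) (%th. psi r th * E r th) - ?T r (psi r) {..0}) \<longlongrightarrow> 1/(2 * pi) * integral (side sg ?c pi) phi) (at_right 0)"
 using tendsto_diff[OF tendsto_mult_left[OF lim(2)[OF order_refl order_refl],of "1/(2 * pi)"] neg] by (simp add: distrib_left)
 moreover have "\<forall>\<^sub>F r in at_right 0. 1/(2 * pi) * integral (side sg eta pi) (%th. psi r th * E r th) - ?T r (psi r) {..0} = ?T r (psi r) {0<..}"
 using evp
 proof eventually_elim
 case (elim r)
 have "?T r (psi r) {..0} + ?T r (psi r) {0<..}=1/(2 * pi) * integral (side sg eta pi) (%th. cnj (?o r th) * psi r th*(?o r th * E r th))"
 by (intro half_pairing_total continuous_on_mult continuous_on_cnj oc psi(2) elim d)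
 thus ?case unfolding canc[OF elim] by (simp add: algebra_simps)
 qed
 ultimately show ?thesis by (rule Lim_transform_eventually)
 qed
qed

text \<open>At most \<open>D\<close> factors remain, and their nodes are at most
  \<open>exp (- (r * N))\<close>, which is tiny for a large base.\<close>

lemma tailp_near_1:
 assumes "r > 0" "s >= 0" "0 < b" "b<=cmod z" "N'<=N+D"
 shows "cmod (tailp r s N N' z-1)<=(1+exp (- (r * real N))/b)^D-1"
proof -
 let ?a = "%i. complex_of_real (exp (- (s+r*(real i+1/2))))/z"
 have "cmod (tailp r s N N' z-1)=cmod ((\<Prod>i\<in>{N..<N'}. 1 + - ?a i)-1)" by (simp add: tailp_def)
 also have "... <= (\<Prod>i\<in>{N..<N'}. 1+cmod (- ?a i))-1" by (rule norm_prod_minus1_le_prod_minus1)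
 also have "(\<Prod>i\<in>{N..<N'}. 1+cmod (- ?a i))<=(\<Prod>i\<in>{N..<N'}. 1+exp (- (r * real N))/b)"
 proof (rule prod_mono,intro conjI)
 fix i assume i: "i \<in> {N..<N'}"
 have "r * real N<=r*(real i+1/2)" using i assms(1) by (intro mult_left_mono) auto
 hence "r * real N<=s+r*(real i+1/2)" using assms(2) by linarith
 hence "exp (- (s+r*(real i+1/2)))<=exp (- (r * real N))" by (simp only: exp_le_cancel_iff neg_le_iff_le)
 hence "exp (- (s+r*(real i+1/2)))/cmod z<=exp (- (r * real N))/b"
 using assms(3,4) by (intro frac_le) auto
 thus "1+cmod (- ?a i)<=1+exp (- (r * real N))/b"
 by (simp only: norm_minus_cancel norm_divide norm_of_real abs_exp_cancel add_le_cancel_left)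
 show "0<=1+cmod (- ?a i)" using norm_ge_zero[of "- ?a i"] by linarith
 qed
 also have "... = (1+exp (- (r * real N))/b)^(N'-N)" by simp
 also have "... <= (1+exp (- (r * real N))/b)^D" using assms by (intro power_increasing) auto
 finally show ?thesis by simp
qed

text \<open>Provides the derivative data that integration by parts requires of a holomorphic
  amplitude.\<close>

lemma circle_C1:
 assumes "open U" "F holomorphic_on U" "cis ` S \<subseteq> U"
 shows "th \<in> S ==> ((%th. F (cis th)) has_vector_derivative deriv F (cis th)*(\<i> * cis th)) (at th within S)"
 and "continuous_on S (%th. deriv F (cis th)*(\<i> * cis th))"
proof -
 assume "th \<in> S"
 hence "cis th \<in> U" using assms(3) by auto
 hence "(F has_field_derivative deriv F (cis th)) (at (cis th))" by (rule holomorphic_derivI[OF assms(2,1)])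
 moreover have "(cis has_vector_derivative \<i> * cis th) (at th within S)"
 unfolding cis_conv_exp by (auto intro!: derivative_eq_intros has_vector_derivative_real_field)
 ultimately show "((%th. F (cis th)) has_vector_derivative deriv F (cis th)*(\<i> * cis th)) (at th within S)"
 using field_vector_diff_chain_within[of cis "\<i> * cis th" th S F "deriv F (cis th)"]
 by (simp add: o_def has_field_derivative_at_within mult.commute)
next
 have "continuous_on U (deriv F)"
 using holomorphic_on_imp_continuous_on[OF holomorphic_deriv[OF assms(2,1)]] .
 hence "continuous_on S (%th. deriv F (cis th))"
 by (rule continuous_on_compose2) (use assms(3) in \<open>auto intro!: continuous_intros\<close>)
 thus "continuous_on S (%th. deriv F (cis th)*(\<i> * cis th))" by (intro continuous_intros)
qed

lemma quotp_ref:
 "quotp r t (t+int k) (of_real (exp (- (r * of_int t/2))) * z) =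
 (\<Prod>i<k. 1-of_real (exp (- (r * of_int t/2+r*(real i+1/2))))/z)"
proof -
 have "exp (- (r*(of_int (t+int i)+1/2)))/exp (- (r * of_int t/2))=exp (- (r * of_int t/2+r*(real i+1/2)))" for i
 proof -
 have "exp (- (r*(of_int (t+int i)+1/2)))/exp (- (r * of_int t/2))=exp (- (r*(of_int (t+int i)+1/2)) - - (r * of_int t/2))"
 by (rule exp_diff[symmetric])
 also have "- (r*(of_int (t+int i)+1/2)) - - (r * of_int t/2) = - (r * of_int t/2+r*(real i+1/2))"
 by (simp add: algebra_simps)
 finally show ?thesis .
 qed
 hence *: "complex_of_real (exp (- (r*(of_int (t+int i)+1/2))))/(of_real (exp (- (r * of_int t/2))) * z) =
 of_real (exp (- (r * of_int t/2+r*(real i+1/2))))/z" for i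
 by (simp only: divide_divide_eq_left[symmetric] of_real_divide[symmetric])
 have "quotp r t (t+int k) w=(\<Prod>i<k. 1-of_real (exp (- (r*(of_int (t+int i)+1/2))))/w)" for w
 unfolding quotp_def
 by (rule prod.reindex_bij_witness[where i = "%i. t+int i" and j = "%T. nat (T-t)"]) auto
 thus ?thesis by (simp only: *)
qed

lemma uniform_limit_quot:
 fixes a :: "real => nat => real"
 assumes "\<And>i. ((%r. a r i) \<longlongrightarrow> c) (at_right 0)"
 shows "uniform_limit S (%r th. \<Prod>i<k. 1-of_real (a r i)/cis th) (%th. (1-of_real c/cis th)^k) (at_right 0)"
proof (induction k)
 case 0
 thus ?case by (simp add: uniform_limit_const)
next
 case (Suc k)
 have b: "bounded ((%th. (1-of_real c/cis th)^m) ` S)" for m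
 proof (rule boundedI)
 fix w assume "w \<in> (%th. (1-of_real c/cis th)^m) ` S"
 then obtain th where w: "w=(1-of_real c/cis th)^m" by auto
 have "cmod (1-of_real c/cis th)<=1 + \<bar>c\<bar>" using norm_triangle_ineq4[of 1 "of_real c/cis th"] by (simp add: norm_divide)
 thus "norm w<=(1 + \<bar>c\<bar>)^m" unfolding w norm_power by (rule power_mono) simp
 qed
 have f: "uniform_limit S (%r th. 1-of_real (a r k)/cis th) (%th. 1-of_real c/cis th) (at_right 0)"
 proof (rule uniform_limitI)
 fix e :: real assume e: "0 < e"
 show "\<forall>\<^sub>F r in at_right 0. \<forall>th\<in>S. dist (1-complex_of_real (a r k)/cis th) (1-of_real c/cis th) < e"
 using tendstoD[OF assms e,of k]
 proof eventually_elim
 case (elim r)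
 have "dist (1-complex_of_real (a r k)/cis th) (1-of_real c/cis th)=dist (a r k) c" for th
 proof -
 have "(1-complex_of_real (a r k)/cis th)-(1-of_real c/cis th) = of_real (c-a r k)/cis th"
 by (simp add: diff_divide_distrib)
 thus ?thesis unfolding dist_norm by (simp only: norm_divide norm_of_real norm_cis) (simp add: abs_minus_commute)
 qed
 thus ?case using elim by simp
 qed
 qed
 show ?case using uniform_lim_mult[OF Suc.IH f b b[of 1,simplified]] by (simp add: mult.commute)
qed

section \<open>Asymptotics relative to one reference slice\<close>

text \<open>All data belong to one slice \<open>t r\<close>; in the application \<open>y r\<close>
  is \<open>h + t/2 + 1/2\<close>. \<open>dD\<close> says that the base is balanced up to
  \<open>D\<close> factors. \<open>below\<close> and \<open>above\<close> say that
  \<open>ths\<close> separates the angles where the limiting rate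
  \<open>- ln (poisson_den c th) - mu\<close> is positive from those where it is negative.\<close>

locale reference =
 fixes A :: "real => nat" and d t y :: "real => int" and \<tau> mu ths :: real and D :: nat
 assumes \<tau>: "0 <= \<tau>" and rt: "((%r. r * of_int (t r)) \<longlongrightarrow> \<tau>) (at_right 0)"
 and ry: "((%r. r * of_int (y r)) \<longlongrightarrow> mu) (at_right 0)"
 and rA: "filterlim (%r. r * real (A r)) at_top (at_right 0)"
 and dD: "\<And>r. r > 0 ==> t r<=d r & d r<=t r+int D"
 and ths: "0<=ths" "ths<=pi"
 and below: "\<And>th. 0 < th ==> th < ths ==> poisson_den (exp (- \<tau> / 2)) th < exp (- mu)"
 and above: "\<And>th. ths < th ==> th<=pi ==> exp (- mu) < poisson_den (exp (- \<tau> / 2)) th"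
begin

definition c :: real where "c=exp (- \<tau> / 2)"
definition s :: "real => real" where "s r=r * of_int \<bar>t r\<bar> / 2"
definition N :: "real => nat" where "N r=A r-nat (- t r)"
definition N' :: "real => nat" where "N' r=nat (int (A r)+d r)-nat (t r)"
definition x :: "real => int" where "x r=y r+int (nat (- t r))"
definition as :: "real => real list" where "as r=nodes r (s r) (N r)"
definition rho :: "real => real" where "rho r=exp (- (r * of_int (t r)/2))"
definition E :: "real => complex => complex" where "E r z=tailp r (s r) (N r) (N' r) z"
definition Q :: "nat => real => complex => complex" where
 "Q k r z=(\<Prod>i<k. 1-of_real (exp (- (r * of_int (t r)/2+r*(real i+1/2))))/z)"
text \<open>The base contains the slices from \<open>t r\<close> to \<open>t r + M\<close>, and the
  tail factor stays away from 0 so that it can be inverted. By \<open>good_ev\<close> this holds for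
  all small \<open>r\<close>.\<close>

definition good :: "nat => real => bool" where
 "good M r \<longleftrightarrow> 0 < r & \<bar>t r\<bar> + int M<=int (A r) & (\<forall>th. 1/2 < cmod (E r (cis th)))"

lemma evp: "\<forall>\<^sub>F r :: real in at_right 0. r > 0" by (rule eventually_at_right_less)

lemma c01: "0 < c" "c<=1" using \<tau> by (auto simp: c_def)

text \<open>As \<open>\<tau>\<close> is nonnegative, negative slices occur only at distance o(1/r)
  from the main diagonal, so the shift of positions by \<open>nat (- t)\<close> is macroscopically
  negligible.\<close>

lemma rneg: "((%r. r * real (nat (- t r))) \<longlongrightarrow> 0) (at_right 0)"
proof -
 have "((%r. max 0 (- (r * of_int (t r)))) \<longlongrightarrow> max 0 (- \<tau>)) (at_right 0)" by (intro tendsto_intros rt)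
 moreover have "max 0 (- \<tau>)=0" using \<tau> by simp
 ultimately have "((%r. max 0 (- (r * of_int (t r)))) \<longlongrightarrow> 0) (at_right 0)" by (simp only:)
 moreover have "\<forall>\<^sub>F r in at_right 0. max 0 (- (r * of_int (t r)))=r * real (nat (- t r))"
 using evp
 proof eventually_elim
 case (elim r)
 show ?case
 proof (cases "0<=t r")
 case True
 hence "0<=r * of_int (t r)" using elim by simp
 thus ?thesis using True by simp
 next
 case False
 hence "r * of_int (t r)<=0" using elim by (simp add: mult_le_0_iff)
 thus ?thesis using False by simp
 qed
 qed
 ultimately show ?thesis by (rule Lim_transform_eventually)
qed

lemma s_lim: "(s \<longlongrightarrow> \<tau> / 2) (at_right 0)"
proof -
 have "((%r. \<bar>r * of_int (t r)\<bar> / 2) \<longlongrightarrow> \<bar>\<tau>\<bar> / 2) (at_right 0)" by (intro tendsto_intros rt) simp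
 moreover have "\<forall>\<^sub>F r in at_right 0. \<bar>r * of_int (t r)\<bar> / 2=s r"
 using evp by eventually_elim (simp add: s_def abs_mult)
 ultimately show ?thesis using \<tau> by (auto dest: Lim_transform_eventually)
qed

lemma s_nonneg: "r > 0 ==> 0<=s r" by (simp add: s_def)

lemma rx: "((%r. r * of_int (x r)) \<longlongrightarrow> mu) (at_right 0)"
 using tendsto_add[OF ry rneg] by (simp only: x_def of_int_add of_int_of_nat_eq distrib_left add_0_right)

lemma rho_lim: "(rho \<longlongrightarrow> c) (at_right 0)"
proof -
 have "((%r. exp (- (r * of_int (t r)/2))) \<longlongrightarrow> exp (- (\<tau> / 2))) (at_right 0)" by (intro tendsto_intros rt) simp
 thus ?thesis by (simp add: rho_def[abs_def] c_def)
qed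

lemma rho_pos: "0 < rho r" by (simp add: rho_def)

lemma rN: "filterlim (%r. r * real (N r)) at_top (at_right 0)"
proof -
 have "filterlim (%r. - (r * real (nat (- t r)))+r * real (A r)) at_top (at_right 0)"
 by (rule filterlim_tendsto_add_at_top[OF tendsto_minus[OF rneg] rA])
 thus ?thesis
 proof (rule filterlim_at_top_mono)
 show "\<forall>\<^sub>F r in at_right 0. - (r * real (nat (- t r)))+r * real (A r)<=r * real (N r)"
 using evp
 proof eventually_elim
 case (elim r)
 have "real (A r)-real (nat (- t r))<=real (N r)" by (simp add: N_def)
 from mult_left_mono[OF this,of r] elim show ?case by (simp add: algebra_simps)
 qed
 qed
qed

lemma N'_le:
 assumes "r > 0" "\<bar>t r\<bar> <= int (A r)"
 shows "N' r<=N r+D"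
 using dD[OF assms(1)] assms(2) unfolding N'_def N_def by linarith

lemma size_ev: "\<forall>\<^sub>F r in at_right 0. 0 < r & \<bar>t r\<bar> + int M<=int (A r)"
proof -
 have "((%r. \<bar>r * of_int (t r)\<bar> + r * real M) \<longlongrightarrow> \<bar>\<tau>\<bar> + 0 * real M) (at_right 0)" by (intro tendsto_intros rt)
 hence "\<forall>\<^sub>F r in at_right 0. \<bar>r * of_int (t r)\<bar> + r * real M < \<bar>\<tau>\<bar> + 1" by (rule order_tendstoD) simp
 moreover have "\<forall>\<^sub>F r in at_right 0. \<bar>\<tau>\<bar> + 1<=r * real (A r)" using rA by (simp add: filterlim_at_top)
 ultimately show ?thesis using evp
 proof eventually_elim
 case (elim r)
 hence "r*(\<bar>of_int (t r)\<bar> + real M) < r * real (A r)" by (simp add: abs_mult distrib_left)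
 hence "\<bar>real_of_int (t r)\<bar> + real M < real (A r)" using elim(3) by simp
 thus ?case using elim(3) by linarith
 qed
qed

text \<open>Uniformity outside a disc, and not on the circle alone, serves the contour that will run
  inside the unit disc.\<close>

lemma E_unif:
 assumes "0 < b"
 shows "uniform_limit {z. b<=cmod z} E (%_. 1) (at_right 0)"
proof (rule uniform_limitI)
 fix e :: real assume e: "0 < e"
 have "((%r. exp (- (r * real (N r)))) \<longlongrightarrow> 0) (at_right 0)"
 by (rule filterlim_compose[OF exp_at_bot]) (rule filterlim_compose[OF filterlim_uminus_at_bot_at_top rN])
 hence "((%r. (1+exp (- (r * real (N r)))/b)^D-1) \<longlongrightarrow> (1+0/b)^D-1) (at_right 0)"
 by (intro tendsto_intros) (use assms in auto)
 hence "\<forall>\<^sub>F r in at_right 0. (1+exp (- (r * real (N r)))/b)^D-1 < e"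
 by (rule order_tendstoD) (use e in simp)
 thus "\<forall>\<^sub>F r in at_right 0. \<forall>z\<in>{z. b<=cmod z}. dist (E r z) 1 < e" using size_ev[of 0]
 proof eventually_elim
 case (elim r)
 show ?case
 proof
 fix z assume "z \<in> {z. b<=cmod z}"
 hence "cmod (E r z-1)<=(1+exp (- (r * real (N r)))/b)^D-1"
 unfolding E_def using elim(2) by (intro tailp_near_1 s_nonneg assms N'_le) auto
 thus "dist (E r z) 1 < e" using elim(1) by (simp add: dist_norm)
 qed
 qed
qed

lemma E_circle: "uniform_limit S (%r th. E r (cis th)) (%_. 1) (at_right 0)"
proof (rule uniform_limitI)
 fix e :: real assume "0 < e"
 from uniform_limitD[OF E_unif[of 1] this]
 show "\<forall>\<^sub>F r in at_right 0. \<forall>th\<in>S. dist (E r (cis th)) 1 < e" by (auto elim!: eventually_mono)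
qed

lemma E_circle_inverse: "uniform_limit S (%r th. inverse (E r (cis th))) (%_. 1) (at_right 0)"
 using uniform_lim_inverse[OF E_circle[of S],of 1] by simp

lemma E_cont: "continuous_on S (%th. E r (cis th))"
 unfolding E_def tailp_def by (intro continuous_intros) auto

lemma good_ev: "\<forall>\<^sub>F r in at_right 0. good M r"
 using size_ev[of M] uniform_limitD[OF E_circle[of UNIV],of "1/2",simplified]
proof eventually_elim
 case (elim r)
 have "1/2 < cmod (E r (cis th))" for th
 using elim(2)[rule_format,of th] norm_triangle_ineq2[of 1 "E r (cis th)"] by (simp add: dist_norm norm_minus_commute)
 thus ?case using elim(1) by (simp add: good_def)
qed

lemma as_bounds: "r > 0 ==> a \<in> set (as r) ==> 0<=a & a < 1"
 unfolding as_def by (rule nodes_bounds[OF _ s_nonneg])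

text \<open>Completing the square gives the lower bound \<open>(sin th)^2\<close>, valid up to
  \<open>a = 1\<close>, where the nodes accumulate if \<open>\<tau> = 0\<close>. At
  \<open>th = pi\<close> the value is \<open>(1 + a)^2\<close>.\<close>

lemma poisson_den_lower:
 assumes "0 < th" "th<=pi"
 shows "\<exists>kappa>0. \<forall>a. 0<=a --> a<=1 --> kappa <= poisson_den a th"
proof (cases "th=pi")
 case True
 thus ?thesis by (intro exI[of _ 1]) (auto simp: poisson_den_def)
next
 case False
 hence "0 < sin th" using assms by (intro sin_gt_zero) auto
 moreover have "(sin th)\<^sup>2<=poisson_den a th" for a
 proof -
 have "poisson_den a th=(a-cos th)\<^sup>2+(sin th)\<^sup>2"
 using sin_cos_squared_add[of th] by (simp add: poisson_den_def power2_diff algebra_simps)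
 thus ?thesis by simp
 qed
 ultimately show ?thesis by (intro exI[of _ "(sin th)\<^sup>2"]) auto
qed

lemma rate_lim:
 assumes "0 < th" "th<=pi" and "((%r. r * of_int (x' r)) \<longlongrightarrow> m) (at_right 0)"
 shows "((%r. r * osc_rate (as r) (x' r) th) \<longlongrightarrow> - ln (poisson_den c th)-m) (at_right 0)" "0 < poisson_den c th"
proof -
 obtain kappa where k: "0 < kappa" "\<And>a. 0<=a ==> a<=1 ==> kappa <= poisson_den a th" using poisson_den_lower[OF assms(1,2)] by blast
 from osc_rate_limit[OF s_nonneg s_lim rN assms(3) k] show "((%r. r * osc_rate (as r) (x' r) th) \<longlongrightarrow> - ln (poisson_den c th)-m) (at_right 0)"
 by (simp add: as_def c_def)
 show "0 < poisson_den c th" using k(1) k(2)[of c] c01 by simp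
qed

lemma rate_inside:
 assumes "0 < th" "th<=pi" and x': "((%r. r * of_int (x' r)) \<longlongrightarrow> m) (at_right 0)" and lt: "poisson_den c th < exp (- m)"
 shows "\<exists>e>0. \<forall>\<^sub>F r in at_right 0. e/r <= osc_rate (as r) (x' r) th"
proof -
 note L=rate_lim[OF assms(1-3)]
 define e where "e=(- ln (poisson_den c th)-m)/2"
 have "ln (poisson_den c th) < - m" using lt L(2) ln_less_cancel_iff[of "poisson_den c th" "exp (- m)"] by simp
 hence e: "0 < e" "e < - ln (poisson_den c th)-m" by (auto simp: e_def)
 have "\<forall>\<^sub>F r in at_right 0. e/r <= osc_rate (as r) (x' r) th"
 using order_tendstoD(1)[OF L(1) e(2)] evp by eventually_elim (simp add: field_simps)
 thus ?thesis using e(1) by blast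
qed

lemma inside: "0 < th ==> th < ths ==> \<exists>e>0. \<forall>\<^sub>F r in at_right 0. e/r <= osc_rate (as r) (x r) th"
 using below[of th] ths by (intro rate_inside[OF _ _ rx]) (auto simp: c_def)

lemma outside:
 assumes "ths < th" "th<=pi"
 shows "\<exists>e>0. \<forall>\<^sub>F r in at_right 0. osc_rate (as r) (x r) th <= - e/r"
proof -
 have "0 < th" using assms ths by auto
 note L=rate_lim[OF this assms(2) rx]
 define e where "e=(ln (poisson_den c th) + mu)/2"
 have "- mu < ln (poisson_den c th)" using above[OF assms] L(2) ln_less_cancel_iff[of "exp (- mu)" "poisson_den c th"] by (simp add: c_def)
 moreover have "ln (poisson_den c th) + mu = 2 * e" by (simp add: e_def)
 ultimately have e: "0 < e" "- ln (poisson_den c th) - mu < - e" by simp_all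
 have "\<forall>\<^sub>F r in at_right 0. osc_rate (as r) (x r) th <= - e/r"
 using order_tendstoD(2)[OF L(1) e(2)] evp by eventually_elim (simp add: field_simps)
 thus ?thesis using e(1) by blast
qed

lemma Q_lim: "uniform_limit S (%r th. Q k r (cis th)) (%th. (1-of_real c/cis th)^k) (at_right 0)"
 unfolding Q_def
proof (rule uniform_limit_quot)
 fix i
 have "((%r. exp (- (r * of_int (t r)/2+r*(real i+1/2)))) \<longlongrightarrow> exp (- (\<tau> / 2+0*(real i+1/2)))) (at_right 0)"
 by (intro tendsto_intros rt) simp
 thus "((%r. exp (- (r * of_int (t r)/2+r*(real i+1/2)))) \<longlongrightarrow> c) (at_right 0)" by (simp add: c_def)
qed

lemma gsym_eq:
 assumes "good M r" "z ~= 0"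
 shows "gsym r (A r) (d r) (t r) (x r) (of_real (rho r) * z) = of_real (rho r) powi (- x r)*(oscz (as r) (x r) z * E r z)"
 using assms dD[of r] unfolding good_def rho_def as_def E_def s_def N_def N'_def by (intro gsym_ref) auto

lemma rho_radius:
 assumes "good M r"
 shows "exp (- (r*(of_int (nat (t r))+1/2))) < rho r" "rho r < exp (r*(of_int (nat (- t r))+1/2))"
proof -
 have r: "r > 0" using assms by (simp add: good_def)
 have "of_int (t r)/2 < real_of_int (nat (t r))+1/2" "- of_int (t r)/2 < real_of_int (nat (- t r))+1/2" by auto
 from mult_strict_left_mono[OF this(1) r] mult_strict_left_mono[OF this(2) r]
 show "exp (- (r*(of_int (nat (t r))+1/2))) < rho r" "rho r < exp (r*(of_int (nat (- t r))+1/2))"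
 unfolding rho_def exp_less_cancel_iff by simp_all
qed

end

lemma laurent_on_fourier:
 assumes "laurent_on b rho f"
 shows "(%n. norm (complex_of_real (b n * rho powi n))) summable_on UNIV"
 and "((%n. of_real (b n * rho powi n) * cis (of_int n * th)) has_sum f (of_real rho * cis th)) UNIV"
proof -
 have rho: "rho > 0" using assms by (simp add: laurent_on_def)
 show "(%n. norm (complex_of_real (b n * rho powi n))) summable_on UNIV"
 using assms rho unfolding norm_of_real laurent_on_def by (simp add: abs_mult)
 have "((%n. of_real (b n)*(of_real rho * cis th) powi n) has_sum f (of_real rho * cis th)) UNIV"
 using assms rho by (simp add: laurent_on_def norm_mult)
 thus "((%n. of_real (b n * rho powi n) * cis (of_int n * th)) has_sum f (of_real rho * cis th)) UNIV"
 by (simp add: power_int_mult_distrib cis_power_int of_real_power_int mult_ac)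
qed

lemma coef_summable:
 assumes "r > 0"
 shows "(%n. coef_inv r A d t x n * coef_sym r A d t' x' (- n)) summable_on X"
proof -
 let ?K = "A+nat (int A+d)"
 have e: "- n-(- x')=x'-n" for n by simp
 have eq: "(%n. \<bar>coef_inv r A d t x n * coef_sym r A d t' x' (- n)\<bar>) =
 (%n. \<bar>kernel_term r A ?K (nat (t+int A)) x (nat (t'+int A)) x' n\<bar>)"
 unfolding kernel_term_def coef_inv_def coef_sym_def e by (rule refl)
 have "(%n. \<bar>coef_inv r A d t x n * coef_sym r A d t' x' (- n)\<bar>) summable_on X"
 unfolding eq by (rule kernel_term_abs_summable[OF assms])
 thus ?thesis unfolding real_norm_def[symmetric] by (rule abs_summable_summable)
qed

lemma fourier_coeff_halves:
 assumes "continuous_on {- pi..pi} f"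
 shows "fourier_coeff (- pi) pi f n=fourier_coeff (side_lo False 0 pi) (side_hi False 0 pi) f n+fourier_coeff (side_lo True 0 pi) (side_hi True 0 pi) f n"
proof -
 have "(%th. f th * cis (- (of_int n * th))) integrable_on {- pi..pi}"
 by (intro integrable_continuous_interval continuous_intros assms)
 from Henstock_Kurzweil_Integration.integral_combine[OF _ _ this,of 0] show ?thesis
 by (simp add: fourier_coeff_def side_lo_def side_hi_def add_divide_distrib[symmetric])
qed

lemma fourier_coeff_cmult: "fourier_coeff a b (%th. k * f th) n=k * fourier_coeff a b f n"
 by (simp add: fourier_coeff_def mult.assoc)

lemma integral_sides:
 fixes f :: "real => complex"
 assumes "continuous_on {- b..b} f" "0<=b"
 shows "integral (side False 0 b) f+integral (side True 0 b) f=integral {- b..b} f"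
 using Henstock_Kurzweil_Integration.integral_combine[OF _ _ integrable_continuous_interval[OF assms(1)],of 0] assms(2)
 by (simp add: side_lo_def side_hi_def)

lemma quotient_nz:
 fixes a :: "nat => real"
 assumes "th \<in> {- pi..pi}" "th ~= 0" "\<And>i. 0 < a i"
 shows "(\<Prod>i<k. 1-of_real (a i)/cis th) ~= 0"
proof -
 have "1-complex_of_real (a i)/cis th ~= 0" for i
 proof
 assume "1-complex_of_real (a i)/cis th=0"
 hence "cis th = of_real (a i)" by (simp add: field_simps)
 hence "cos th=a i" "sin th=0" by (auto simp: complex_eq_iff)
 hence c: "cos th=1" using assms(3)[of i] sin_cos_squared_add[of th] by (auto simp: power2_eq_1_iff)
 have "th=0" using cos_inj_pi[of "\<bar>th\<bar>" 0] assms(1) c by auto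
 thus False using assms(2) by simp
 qed
 thus ?thesis by simp
qed

section \<open>Entries with nonnegative time difference\<close>

context reference
begin

lemma Q_nz: "th \<in> {- pi..pi} ==> th ~= 0 ==> Q k r (cis th) ~= 0"
 unfolding Q_def by (rule quotient_nz) auto

lemma Q_cont: "continuous_on S (%th. Q k r (cis th))"
 unfolding Q_def by (intro continuous_intros) auto

lemma monomial_lim: "uniform_limit S (%r th. (of_real (rho r) * cis th) powi l) (%th. (of_real c * cis th) powi l) (at_right 0)"
proof (rule uniform_limitI)
 fix e :: real assume e: "0 < e"
 have "((%r. rho r powi l) \<longlongrightarrow> c powi l) (at_right 0)" by (intro tendsto_intros rho_lim) (use c01 in auto)
 from tendstoD[OF this e]
 show "\<forall>\<^sub>F r in at_right 0. \<forall>th\<in>S. dist ((complex_of_real (rho r) * cis th) powi l) ((of_real c * cis th) powi l) < e"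
 proof eventually_elim
 case (elim r)
 have "(complex_of_real (rho r) * cis th) powi l-(of_real c * cis th) powi l = of_real (rho r powi l-c powi l) * cis (of_int l * th)" for th
 by (simp add: power_int_mult_distrib cis_power_int of_real_power_int algebra_simps)
 thus ?case using elim by (simp add: dist_norm norm_mult del: of_real_diff)
 qed
qed

lemma monomial_bounded: "bounded ((%th. (of_real c * cis th) powi l) ` S)"
 by (rule boundedI[of _ "c powi l"]) (use c01 in \<open>auto simp: norm_power_int norm_mult\<close>)

lemma Qlim_bounded: "bounded ((%th. (1-of_real c/cis th)^k) ` S)"
proof (rule boundedI)
 fix w assume "w \<in> (%th. (1-of_real c/cis th)^k) ` S"
 then obtain th where w: "w=(1-of_real c/cis th)^k" by auto
 have "cmod (1-of_real c/cis th)<=2" using norm_triangle_ineq4[of 1 "of_real c/cis th"] c01 by (simp add: norm_divide)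
 thus "norm w<=2^k" unfolding w norm_power by (rule power_mono) simp
qed

lemma osc_cnj:
 assumes "r > 0"
 shows "inverse (osc (as r) (x r) th)=cnj (osc (as r) (x r) th)"
proof -
 have "cmod (osc (as r) (x r) th)=1" by (rule norm_osc[OF as_bounds[OF assms]])
 hence "osc (as r) (x r) th * cnj (osc (as r) (x r) th)=1" using complex_norm_square[of "osc (as r) (x r) th"] by simp
 thus ?thesis by (rule inverse_unique)
qed

text \<open>The amplitude of \<open>1/J\<close> at the later slice, seen on the reference circle of
  the earlier one, after the oscillating factor is split off. The quotient \<open>Q\<close> is a
  numerator here and causes no pole.\<close>

definition psi :: "nat => int => real => real => complex" where
 "psi k l r th=(of_real (rho r) * cis th) powi l * Q k r (cis th) * inverse (E r (cis th))"

definition dcoef :: "real => int => complex" where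
 "dcoef r n = of_real (coef_sym r (A r) (d r) (t r) (x r) n * rho r powi n)/of_real (rho r) powi (- x r)"

lemma dcoef:
 assumes "good M r"
 shows "(%n. norm (dcoef r n)) summable_on UNIV"
 and "((%n. dcoef r n * cis (of_int n * th)) has_sum osc (as r) (x r) th * E r (cis th)) UNIV"
proof -
 have r: "r > 0" "- int (A r)<=t r" using assms by (auto simp: good_def)
 note L=laurent_on_fourier[OF laurent_on_coef_sym[OF r(1) rho_pos rho_radius(2)[OF assms] r(2),of "d r" "x r"]]
 have nz: "complex_of_real (rho r) powi (- x r) ~= 0" using rho_pos[of r] by simp
 show "(%n. norm (dcoef r n)) summable_on UNIV"
 unfolding dcoef_def divide_inverse norm_mult[of _ "inverse _"] by (rule summable_on_cmult_left[OF L(1)])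
 have "((%n. dcoef r n * cis (of_int n * th)) has_sum inverse (of_real (rho r) powi (- x r)) * gsym r (A r) (d r) (t r) (x r) (of_real (rho r) * cis th)) UNIV"
 using has_sum_cmult_right[OF L(2)[of th],of "inverse (of_real (rho r) powi (- x r))"] by (simp only: dcoef_def divide_inverse mult_ac)
 thus "((%n. dcoef r n * cis (of_int n * th)) has_sum osc (as r) (x r) th * E r (cis th)) UNIV"
 unfolding gsym_eq[OF assms cis_neq_zero] osc_eq_oscz using nz by (simp add: mult.assoc[symmetric])
qed

text \<open>Both series are read off on the reference circle of the earlier slice, where the
  constants \<open>rho\<close> and \<open>gam\<close> separate from phase and amplitude.\<close>

lemma plus_pairing:
 fixes k :: nat and l :: int
 assumes g: "good k r"
 defines "t' \<equiv> t r+int k" and "x' \<equiv> y r+l+int (nat (- (t r+int k)))"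
 shows "of_real (\<Sum>\<^sub>\<infinity>n\<in>{..0}. coef_inv r (A r) (d r) t' x' n * coef_sym r (A r) (d r) (t r) (x r) (- n)) * gam r (t r)/gam r t' =
 half_pairing False 0 pi (%th. cnj (osc (as r) (x r) th) * psi k l r th) (dcoef r) {..0} +
 half_pairing True 0 pi (%th. cnj (osc (as r) (x r) th) * psi k l r th) (dcoef r) {..0}"
proof -
 let ?o = "osc (as r) (x r)" and ?f = "%th. cnj (osc (as r) (x r) th) * psi k l r th"
 let ?kappa = "complex_of_real (rho r) powi (- x r)"
 have r: "r > 0" "\<bar>t r\<bar> + int k<=int (A r)" using g by (auto simp: good_def)
 have E0: "E r (cis th) ~= 0" for th
 proof -
 have "1/2 < cmod (E r (cis th))" using g by (simp add: good_def)
 thus ?thesis by auto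
 qed
 have nz: "?kappa ~= 0" using rho_pos[of r] by simp
 have fc: "continuous_on S ?f" for S
 unfolding psi_def using rho_pos[of r] E0
 by (intro continuous_intros continuous_osc[OF as_bounds[OF r(1)]] Q_cont E_cont) auto
 have rad: "exp (- (r*(of_int (nat t')+1/2))) < rho r"
 proof -
 have "r*(of_int (nat (t r))+1/2)<=r*(of_int (nat t')+1/2)" using r(1) by (intro mult_left_mono) (auto simp: t'_def)
 hence "exp (- (r*(of_int (nat t')+1/2)))<=exp (- (r*(of_int (nat (t r))+1/2)))" by (simp only: exp_le_cancel_iff neg_le_iff_le)
 thus ?thesis using rho_radius(1)[OF g] by linarith
 qed
 have co: "?kappa * of_real (coef_inv r (A r) (d r) t' x' n * rho r powi n)=gam r t'/gam r (t r) * fourier_coeff (- pi) pi ?f n" for n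
 proof -
 have inv: "inverse (gsym r (A r) (d r) t' x' (of_real (rho r) * cis th))=inverse ?kappa * (gam r t'/gam r (t r)) * ?f th"
 if th: "th \<in> {- pi..pi}" "th ~= 0" for th
 proof -
 define w where "w=complex_of_real (rho r) * cis th"
 have w0: "w ~= 0" using rho_pos[of r] by (simp add: w_def)
 have q: "quotp r (t r) t' w=Q k r (cis th)" unfolding w_def t'_def rho_def Q_def by (rule quotp_ref)
 have yl: "y r-(y r+l) = - l" by simp
 have "gsym r (A r) (d r) t' x' w=gsym r (A r) (d r) t' x' w * gam r t'/gam r t'" using gam_nz[of r t'] by simp
 also have "gsym r (A r) (d r) t' x' w * gam r t'=gsym r (A r) (d r) (t r) (x r) w * gam r (t r) * w powi (y r-(y r+l))/quotp r (t r) t' w"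
 by (rule gsym_step) (use r dD[OF r(1)] w0 q Q_nz[OF th,of k r] in \<open>auto simp: t'_def x'_def x_def\<close>)
 also have "gsym r (A r) (d r) (t r) (x r) w = ?kappa * (?o th * E r (cis th))"
 unfolding w_def osc_eq_oscz by (rule gsym_eq[OF g]) simp
 finally have "gsym r (A r) (d r) t' x' w = ?kappa * (?o th * E r (cis th)) * gam r (t r) * w powi (- l)/Q k r (cis th)/gam r t'"
 unfolding q yl .
 hence "inverse (gsym r (A r) (d r) t' x' w)=inverse ?kappa * (gam r t'/gam r (t r))*(inverse (?o th)*(w powi l * Q k r (cis th) * inverse (E r (cis th))))"
 by (simp only: power_int_minus divide_inverse inverse_mult_distrib inverse_inverse_eq mult_ac)
 thus ?thesis unfolding osc_cnj[OF r(1)] psi_def w_def .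
 qed
 \<comment> \<open>The formula \<open>inv\<close> excludes the angle 0, where \<open>Q\<close> may
   vanish; one point does not affect the integral.\<close>
 have "integral {- pi..pi} (%th. inverse (gsym r (A r) (d r) t' x' (of_real (rho r) * cis th)) * cis (- (of_int n * th))) =
 integral {- pi..pi} (%th. inverse ?kappa * (gam r t'/gam r (t r)) * ?f th * cis (- (of_int n * th)))"
 by (rule integral_spike[of "{0}"]) (simp_all only: negligible_sing Diff_iff singleton_iff inv simp_thms)
 hence "fourier_coeff (- pi) pi (%th. inverse (gsym r (A r) (d r) t' x' (of_real (rho r) * cis th))) n =
 fourier_coeff (- pi) pi (%th. inverse ?kappa * (gam r t'/gam r (t r)) * ?f th) n"
 unfolding fourier_coeff_def by (simp only:)
 also have "... = inverse ?kappa * (gam r t'/gam r (t r)) * fourier_coeff (- pi) pi ?f n" by (rule fourier_coeff_cmult)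
 finally have "of_real (coef_inv r (A r) (d r) t' x' n * rho r powi n)=inverse ?kappa * (gam r t'/gam r (t r)) * fourier_coeff (- pi) pi ?f n"
 unfolding laurent_on_fourier_coeff[OF laurent_on_coef_inv[OF r(1) rad]] .
 thus ?thesis using nz by simp
 qed
 have s: "(%n. fourier_coeff (side_lo sg 0 pi) (side_hi sg 0 pi) ?f n * dcoef r (- n)) summable_on {..0}" for sg
 by (intro summable_fourier_pairing fc dcoef(1)[OF g])
 have "complex_of_real (\<Sum>\<^sub>\<infinity>n\<in>{..0}. coef_inv r (A r) (d r) t' x' n * coef_sym r (A r) (d r) (t r) (x r) (- n)) =
 (\<Sum>\<^sub>\<infinity>n\<in>{..0}. (?kappa * of_real (coef_inv r (A r) (d r) t' x' n * rho r powi n))*(of_real (coef_sym r (A r) (d r) (t r) (x r) (- n) * rho r powi (- n)) / ?kappa))"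
 by (rule coef_rescale[OF _ nz coef_summable[OF r(1)]]) (use rho_pos[of r] in simp)
 also have "... = (\<Sum>\<^sub>\<infinity>n\<in>{..0}. gam r t'/gam r (t r)*(fourier_coeff (- pi) pi ?f n * dcoef r (- n)))"
 unfolding co dcoef_def by (simp only: mult.assoc)
 also have "... = gam r t'/gam r (t r)*(\<Sum>\<^sub>\<infinity>n\<in>{..0}. fourier_coeff (- pi) pi ?f n * dcoef r (- n))"
 by (rule infsum_cmult_right')
 also have "(\<Sum>\<^sub>\<infinity>n\<in>{..0}. fourier_coeff (- pi) pi ?f n * dcoef r (- n))=half_pairing False 0 pi ?f (dcoef r) {..0}+half_pairing True 0 pi ?f (dcoef r) {..0}"
 unfolding half_pairing_def fourier_coeff_halves[OF fc] distrib_right by (rule infsum_add[OF s s])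
 finally show ?thesis using gam_nz[of r t'] gam_nz[of r "t r"] by simp
qed

text \<open>Each half circle keeps the arc up to \<open>ths\<close>, and the two arcs join to a
  symmetric one.\<close>

lemma plus_limit:
 "((%r. of_real (\<Sum>\<^sub>\<infinity>n\<in>{..0}. coef_inv r (A r) (d r) (t r+int k) (y r+l+int (nat (- (t r+int k)))) n *
 coef_sym r (A r) (d r) (t r) (x r) (- n)) * gam r (t r)/gam r (t r+int k)) \<longlongrightarrow>
 1/(2 * pi) * integral {- ths..ths} (%th. (of_real c * cis th) powi l*(1-of_real c/cis th)^k)) (at_right 0)"
proof -
 let ?F = "%z. (of_real c * z) powi l*(1-of_real c/z)^k"
 have hol: "?F holomorphic_on - {0}" using c01 by (intro holomorphic_intros) auto
 have U: "open (- {0 :: complex})" "cis ` S \<subseteq> - {0}" for S by auto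
 note C1=circle_C1[OF U(1) hol U(2)]
 have lim: "((%r. half_pairing sg 0 pi (%th. cnj (osc (as r) (x r) th) * psi k l r th) (dcoef r) {..0}) \<longlongrightarrow>
 1/(2 * pi) * integral (side sg 0 (max 0 ths)) (%th. ?F (cis th))) (at_right 0)" for sg
 proof (rule half_pairing_limit_uniform(1)[where G = "good k" and E = "%r th. E r (cis th)",OF good_ev _ _ ths inside outside])
 show "uniform_limit (side sg 0 pi) (psi k l) (%th. ?F (cis th)) (at_right 0)"
 proof -
 have b: "bounded ((%th. ?F (cis th)) ` side sg 0 pi)"
 by (intro compact_imp_bounded compact_continuous_image compact_Icc continuous_on_vector_derivative[OF C1(1)])
 have b1: "bounded ((%_. 1 :: complex) ` side sg 0 pi)" by (rule bounded_subset[of "{1}"]) auto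
 have "uniform_limit (side sg 0 pi) (%r th. (of_real (rho r) * cis th) powi l * Q k r (cis th) * inverse (E r (cis th))) (%th. ?F (cis th)*1) (at_right 0)"
 by (intro uniform_lim_mult monomial_lim Q_lim E_circle_inverse monomial_bounded Qlim_bounded b b1)
 thus ?thesis unfolding psi_def[abs_def] by simp
 qed
 fix r assume g: "good k r"
 thus "0 < r" by (simp add: good_def)
 thus "\<And>a. a \<in> set (as r) ==> 0<=a & a < 1" by (rule as_bounds)
 show "(%n. norm (dcoef r n)) summable_on UNIV" "\<And>th. ((%n. dcoef r n * cis (of_int n * th)) has_sum osc (as r) (x r) th * E r (cis th)) UNIV"
 by (rule dcoef[OF g])+
 have "E r (cis th) ~= 0" for th
 proof -
 have "1/2 < cmod (E r (cis th))" using g by (simp add: good_def)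
 thus ?thesis by auto
 qed
 thus "continuous_on (side sg 0 pi) (psi k l r)"
 unfolding psi_def[abs_def] using rho_pos[of r] by (intro continuous_intros Q_cont E_cont) auto
 next
 show "uniform_limit {- pi..pi} (%r th. E r (cis th)) (%_. 1) (at_right 0)" by (rule E_circle)
 show "continuous_on {- pi..pi} (%th. E r (cis th))" for r by (rule E_cont)
 show "((%th. ?F (cis th)) has_vector_derivative deriv ?F (cis th)*(\<i> * cis th)) (at th within side sg 0 pi)" if "th \<in> side sg 0 pi" for th
 using that by (rule C1(1))
 show "continuous_on (side sg 0 pi) (%th. deriv ?F (cis th)*(\<i> * cis th))" by (rule C1(2))
 qed simp_all
 have "integral (side False 0 (max 0 ths)) (%th. ?F (cis th))+integral (side True 0 (max 0 ths)) (%th. ?F (cis th))=integral {- ths..ths} (%th. ?F (cis th))"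
 using integral_sides[OF continuous_on_vector_derivative[OF C1(1)] ths(1)] ths(1) by (simp add: max_def)
 hence "((%r. half_pairing False 0 pi (%th. cnj (osc (as r) (x r) th) * psi k l r th) (dcoef r) {..0} +
 half_pairing True 0 pi (%th. cnj (osc (as r) (x r) th) * psi k l r th) (dcoef r) {..0}) \<longlongrightarrow> 1/(2 * pi) * integral {- ths..ths} (%th. ?F (cis th))) (at_right 0)"
 using tendsto_add[OF lim[of False] lim[of True]] by (simp only: distrib_left[symmetric])
 thus ?thesis
 by (rule Lim_transform_eventually) (rule eventually_mono[OF good_ev[of k]],rule plus_pairing[symmetric])
qed

end

section \<open>A chord that separates the point 1 from the origin\<close>

text \<open>The vertical segment from \<open>cis (- eta)\<close> to \<open>cis eta\<close>, run
  through with a cosine. For \<open>0 <= t <= 1\<close> and \<open>sin eta > 0\<close> the speed is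
  then \<open>pi * sqrt (1 - |z|^2)\<close>, which later cancels the growth of a geometric sum near
  the endpoints.\<close>

definition chord :: "real => real => complex" where
 "chord eta t=Complex (cos eta) (- (sin eta * cos (pi * t)))"

definition chord' :: "real => real => complex" where
 "chord' eta t=Complex 0 (sin eta * (sin (pi * t) * pi))"

lemma chord_derivative: "(chord eta has_vector_derivative chord' eta t) (at t within S)"
 unfolding has_vector_derivative_complex_iff chord_def chord'_def o_def
 by (auto intro!: derivative_eq_intros)

lemma chord_ends: "chord eta 0=cis (- eta)" "chord eta 1=cis eta"
 by (simp_all add: chord_def cis.ctr complex_eq_iff)

lemma chord_norm: "1-(cmod (chord eta t))\<^sup>2=(sin eta * sin (pi * t))\<^sup>2"
proof -
 have "(cmod (chord eta t))\<^sup>2=(cos eta)\<^sup>2+(sin eta)\<^sup>2*(cos (pi * t))\<^sup>2" by (simp add: cmod_power2 chord_def power_mult_distrib)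
 also have "... = 1-(sin eta)\<^sup>2*(sin (pi * t))\<^sup>2"
 using sin_cos_squared_add3[of eta] by (simp add: cos_squared_eq algebra_simps)
 finally show ?thesis by (simp add: power_mult_distrib)
qed

lemma continuous_chord: "continuous_on S (chord eta)" "continuous_on S (chord' eta)"
proof -
 show "continuous_on S (chord eta)" by (rule continuous_on_vector_derivative) (rule chord_derivative)
 have "chord' eta = (%t. \<i> * of_real (sin eta * (sin (pi * t) * pi)))" by (auto simp: chord'_def complex_eq_iff fun_eq_iff)
 thus "continuous_on S (chord' eta)" by (auto intro!: continuous_intros)
qed

lemma valid_path_chord: "valid_path (chord eta)"
 unfolding valid_path_def
 by (intro C1_differentiable_imp_piecewise)
 (auto simp: C1_differentiable_on_def intro!: exI[of _ "chord' eta"] chord_derivative continuous_chord)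

lemma contour_integral_chord: "contour_integral (chord eta) f=integral {0..1} (%t. f (chord eta t) * chord' eta t)"
proof -
 have "vector_derivative (chord eta) (at t)=chord' eta t" for t
 by (rule vector_derivative_at) (rule chord_derivative)
 thus ?thesis unfolding contour_integral_integral by simp
qed

text \<open>The arc \<open>\<bar>th\<bar> \<le> \<eta>\<close> of the unit circle is replaced by its chord.\<close>

lemma keyhole_integral:
 assumes eta: "0 < eta" "eta < pi/2" and R: "0 < R" "R < cos eta" and R2: "cos eta < R2"
 and hol: "f holomorphic_on {z. Re z < R2} - {0}"
 shows "integral {- pi..pi} (%th. f (of_real R * cis th) * of_real R * \<i> * cis th) =
 integral {- pi..- eta} (%th. f (cis th) * \<i> * cis th)+integral {eta..pi} (%th. f (cis th) * \<i> * cis th) +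
 integral {0..1} (%t. f (chord eta t) * chord' eta t)"
proof -
 let ?S = "{z. Re z < R2}"
 define g0 where "g0=part_circlepath 0 R (- pi) pi"
 define g1 where "g1=part_circlepath 0 1 (- pi) (- eta)"
 define g2 where "g2=part_circlepath 0 1 eta pi"
 define \<Gamma> where "\<Gamma> = g1 +++ (chord eta +++ g2)"
 have S: "open ?S" "connected ?S" "convex ?S" by (auto simp: open_halfspace_Re_lt convex_halfspace_Re_lt convex_connected)
 have v: "valid_path g0" "valid_path g1" "valid_path g2" by (simp_all add: g0_def g1_def g2_def)
 note v = v valid_path_chord[of eta]
 have pc: "pathstart (chord eta)=cis (- eta)" "pathfinish (chord eta)=cis eta" by (simp_all add: pathstart_def pathfinish_def chord_ends)
 have cp: "cis (- pi) = - 1" by (simp add: complex_eq_iff)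
 hence ep: "exp (- (\<i> * of_real pi)) = - 1" by (simp add: cis_conv_exp)
 have p1: "pathstart g1 = - 1" "pathfinish g1=cis (- eta)" by (simp_all add: g1_def cis_conv_exp ep)
 have p2: "pathstart g2=cis eta" "pathfinish g2 = - 1" by (simp_all add: g2_def cis_conv_exp)
 have p0: "pathstart g0=pathfinish g0"
 by (simp add: g0_def ep)
 have v\<Gamma>: "valid_path (chord eta +++ g2)" "valid_path \<Gamma>" unfolding \<Gamma>_def using v pc p1 p2 by (auto intro!: valid_path_join)
 have cl: "pathfinish \<Gamma> = pathstart \<Gamma>" by (simp add: \<Gamma>_def p1 p2)
 have cosle: "cos th<=cos eta" if "th \<in> {- pi..- eta} \<or> th \<in> {eta..pi}" for th
 proof -
 have "cos \<bar>th\<bar> <= cos eta" using that eta by (intro cos_monotone_0_pi_le) auto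
 thus ?thesis by simp
 qed
 have im0: "path_image g0 \<subseteq> ?S - {0}"
 proof
 fix z assume "z \<in> path_image g0"
 then obtain th where z: "z = of_real R * cis th" by (auto simp: g0_def path_image_part_circlepath' cis_conv_exp)
 have "R * cos th<=R*1" using R by (intro mult_left_mono) auto
 moreover have "Re z=R * cos th" by (simp add: z)
 ultimately have "Re z < R2" using R R2 by linarith
 thus "z \<in> ?S - {0}" using z R by auto
 qed
 have im1: "path_image g1 \<subseteq> ?S - {0}"
 using cosle R2 eta by (fastforce simp: g1_def path_image_part_circlepath' cis_conv_exp[symmetric] Re_exp Im_exp closed_segment_eq_real_ivl)
 have im2: "path_image g2 \<subseteq> ?S - {0}"
 using cosle R2 eta by (fastforce simp: g2_def path_image_part_circlepath' cis_conv_exp[symmetric] Re_exp Im_exp closed_segment_eq_real_ivl)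
 have imc: "path_image (chord eta) \<subseteq> ?S - {0}" using R R2 by (auto simp: path_image_def chord_def complex_eq_iff)
 have im: "path_image \<Gamma> \<subseteq> ?S - {0}"
 unfolding \<Gamma>_def using im1 im2 imc pc p1 p2 by (simp add: path_image_join)
 have i0: "h contour_integrable_on p" if "h holomorphic_on ?S - {0}" "valid_path p" "path_image p \<subseteq> ?S - {0}" for h p
 by (rule contour_integrable_holomorphic_simple[OF that(1) _ that(2,3)]) (use S in auto)
 have split: "contour_integral \<Gamma> h=contour_integral g1 h+(contour_integral (chord eta) h+contour_integral g2 h)" if "h holomorphic_on ?S - {0}" for h
 unfolding \<Gamma>_def using v v\<Gamma> pc p1 p2 i0[OF that] im1 im2 imc by (simp add: contour_integral_join contour_integrable_join)
 have arc1: "contour_integral g1 h=integral {- pi..- eta} (%th. h (cis th) * \<i> * cis th)" for h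
 unfolding g1_def using eta by (subst contour_integral_part_circlepath_eq) auto
 have arc2: "contour_integral g2 h=integral {eta..pi} (%th. h (cis th) * \<i> * cis th)" for h
 unfolding g2_def using eta by (subst contour_integral_part_circlepath_eq) auto
 have arc0: "contour_integral g0 h=integral {- pi..pi} (%th. h (of_real R * cis th) * of_real R * \<i> * cis th)" for h
 unfolding g0_def by (subst contour_integral_part_circlepath_eq) auto
 have hinv: "(%w. 1/(w-0)) holomorphic_on ?S - {0}" by (intro holomorphic_intros) auto
 have w0: "winding_number g0 0=1"
 proof -
 have "winding_number g0 0=1/(2 * of_real pi * \<i>) * contour_integral g0 (%w. 1/(w-0))"
 by (subst winding_number_valid_path[OF v(1)]) (use im0 in auto)
 also have "contour_integral g0 (%w. 1/(w-0))=integral {- pi..pi} (%th. \<i>)"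
 unfolding arc0 using R by (intro integral_cong) (auto simp: field_simps)
 finally show ?thesis by (simp add: scaleR_conv_of_real)
 qed
 \<comment> \<open>By the principal logarithm the chord contributes \<open>2 * \<i> * eta\<close>,
   exactly what the omitted arc would.\<close>
 have w1: "winding_number \<Gamma> 0=1"
 proof -
 have c: "contour_integral (chord eta) (%w. 1/(w-0))=2 * \<i> * of_real eta"
 proof -
 have "((%w. 1/(w-0)) has_contour_integral (Ln (pathfinish (chord eta))-Ln (pathstart (chord eta)))) (chord eta)"
 proof (rule contour_integral_primitive[where S = "{z. 0 < Re z}"])
 show "(Ln has_field_derivative 1/(w-0)) (at w within {z. 0 < Re z})" if "w \<in> {z. 0 < Re z}" for w
 using that by (auto intro!: derivative_eq_intros simp: complex_nonpos_Reals_iff inverse_eq_divide)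
 show "valid_path (chord eta)" by (rule valid_path_chord)
 qed (use R in \<open>auto simp: path_image_def chord_def\<close>)
 moreover have "Ln (cis eta) = \<i> * of_real eta" "Ln (cis (- eta)) = \<i> * of_real (- eta)"
 unfolding cis_conv_exp using eta by (auto intro!: Ln_exp)
 ultimately show ?thesis by (simp add: pc contour_integral_unique)
 qed
 have "winding_number \<Gamma> 0=1/(2 * of_real pi * \<i>) * contour_integral \<Gamma> (%w. 1/(w-0))"
 by (subst winding_number_valid_path[OF v\<Gamma>(2)]) (use im in auto)
 also have "contour_integral \<Gamma> (%w. 1/(w-0))=integral {- pi..- eta} (%th. \<i>)+(2 * \<i> * of_real eta + integral {eta..pi} (%th. \<i>))"
 unfolding split[OF hinv] c arc1 arc2 by (intro arg_cong2[where f = "(+)"] refl integral_cong) (auto simp: field_simps)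
 also have "... = 2 * of_real pi * \<i>" using eta by (simp add: scaleR_conv_of_real algebra_simps)
 finally show ?thesis by simp
 qed
 have wo: "winding_number p z=0" if "valid_path p" "pathfinish p=pathstart p" "path_image p \<subseteq> ?S - {0}" "z \<notin> ?S" for p z
 by (rule winding_number_zero_outside[OF valid_path_imp_path[OF that(1)] S(3) that(2)[symmetric,THEN sym]]) (use that in auto)
 \<comment> \<open>Both closed curves wind once around 0, the only possible singularity in the
   half-plane, so the residue theorem equates the integrals.\<close>
 have "contour_integral g0 f=2 * pi * \<i> * (\<Sum>p\<in>{0}. winding_number g0 p * residue f p)"
 by (rule Residue_theorem[OF S(1,2) _ hol v(1) p0[symmetric] im0]) (use wo[OF v(1) p0[symmetric] im0] in auto)
 moreover have "contour_integral \<Gamma> f=2 * pi * \<i> * (\<Sum>p\<in>{0}. winding_number \<Gamma> p * residue f p)"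
 by (rule Residue_theorem[OF S(1,2) _ hol v\<Gamma>(2) cl im]) (use wo[OF v\<Gamma>(2) cl im] in auto)
 ultimately have "contour_integral g0 f=contour_integral \<Gamma> f" by (simp add: w0 w1)
 thus ?thesis unfolding split[OF hol] arc0 arc1 arc2 contour_integral_chord by (simp only: add_ac)
qed

text \<open>The integrand decays pointwise except at the two endpoints, where the sine vanishes; it
  is dominated by 1.\<close>

lemma chord_integral_decay:
 "((%X. integral {0..1} (%t. exp (- (\<bar>X\<bar> * (sin (pi * t))\<^sup>2)))) \<longlongrightarrow> 0) at_top"
proof (rule tendsto_at_topI_sequentially)
 fix X :: "nat => real" assume X: "filterlim X at_top sequentially"
 define g :: "real => real" where "g=(%t. if t \<in> {0,1} then 1 else 0)"
 have "(%n. integral {0..1} (%t. exp (- (\<bar>X n\<bar> * (sin (pi * t))\<^sup>2)))) \<longlonglongrightarrow> integral {0..1} g"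
 proof (rule dominated_convergence(2)[where h = "%_. 1"])
 fix t :: real assume t: "t \<in> {0..1}"
 show "(%n. exp (- (\<bar>X n\<bar> * (sin (pi * t))\<^sup>2))) \<longlonglongrightarrow> g t"
 proof (cases "t \<in> {0,1}")
 case True
 thus ?thesis by (auto simp: g_def)
 next
 case False
 hence "0 < t" "t < 1" using t by auto
 hence "0 < sin (pi * t)" by (intro sin_gt_zero) auto
 hence s: "0 < (sin (pi * t))\<^sup>2" by simp
 have "filterlim (%n. \<bar>X n\<bar>) at_top sequentially" by (rule filterlim_at_top_mono[OF X]) (intro always_eventually allI abs_ge_self)
 hence "filterlim (%n. (sin (pi * t))\<^sup>2 * \<bar>X n\<bar>) at_top sequentially" by (rule filterlim_tendsto_pos_mult_at_top[OF tendsto_const s])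
 hence "(%n. exp (- ((sin (pi * t))\<^sup>2 * \<bar>X n\<bar>))) \<longlonglongrightarrow> 0"
 by (intro filterlim_compose[OF exp_at_bot] filterlim_compose[OF filterlim_uminus_at_bot_at_top])
 thus ?thesis using False by (simp add: g_def mult.commute)
 qed
 qed (auto intro!: integrable_continuous_interval continuous_intros)
 moreover have "(g has_integral 0) {0..1}" by (rule has_integral_spike_finite[of "{0,1}" _ _ "%_. 0"]) (auto simp: g_def)
 hence "integral {0..1} g=0" by (rule integral_unique)
 ultimately show "(%n. integral {0..1} (%t. exp (- (\<bar>X n\<bar> * (sin (pi * t))\<^sup>2)))) \<longlonglongrightarrow> 0" by simp
qed

text \<open>With \<open>v\<close> the squared modulus of \<open>z\<close>, the left side equals
  \<open>1 - (1-v)/v * ((1-a^2)/dd - 1)\<close>, where \<open>dd\<close> is the squared modulus of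
  \<open>1 - a * z\<close>. Since \<open>dd\<close> is at most \<open>poisson_den a eta\<close>, the
  bracket is at least the phase rate at the end of the chord, and \<open>1 - u <= exp (- u)\<close>
  makes the bound multiplicative.\<close>

lemma blaschke_chord_le:
 fixes z :: complex
 assumes a: "0<=a" "a < 1" and z: "Re z=cos eta" "0 < cos eta" "cmod z<=1"
 shows "(cmod ((1-of_real a/z)/(1-of_real a * z)))\<^sup>2<=exp (- ((1-(cmod z)\<^sup>2)/(cmod z)\<^sup>2 * phase_rate a eta))"
proof -
 define v where "v = (cmod z)\<^sup>2"
 define P where "P=poisson_den a eta"
 define dd where "dd=1-2 * a * cos eta + a\<^sup>2 * v"
 have z0: "z ~= 0" using z by auto
 have v: "0 < v" "v <= 1" using z z0 by (auto simp: v_def power_le_one)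
 have v3: "v = (cos eta)\<^sup>2+(Im z)\<^sup>2" by (simp add: v_def cmod_power2 z(1))
 have d: "(cmod (1-of_real a * z))\<^sup>2=dd" by (simp add: cmod_power2 z(1) dd_def v3) (simp add: power2_eq_square algebra_simps)
 have n: "(cmod (1-of_real a/z))\<^sup>2=(v - 2 * a * cos eta + a\<^sup>2)/v"
 proof -
 have "1-of_real a/z=(z-of_real a)/z" using z0 by (simp add: field_simps)
 hence "(cmod (1-of_real a/z))\<^sup>2=(cmod (z-of_real a))\<^sup>2/v" by (simp add: norm_divide power_divide v_def)
 also have "(cmod (z-of_real a))\<^sup>2=v - 2 * a * cos eta + a\<^sup>2" by (simp add: cmod_power2 z(1) v3) (simp add: power2_eq_square algebra_simps)
 finally show ?thesis .
 qed
 have "1-of_real a * z ~= 0"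
 proof
 assume "1-of_real a * z=0"
 hence "of_real a * z=1" by simp
 hence "cmod (of_real a * z)=1" by simp
 hence "a * cmod z=1" using a by (simp add: norm_mult)
 moreover have "a * cmod z<=a*1" using a z by (intro mult_left_mono) auto
 ultimately show False using a by simp
 qed
 hence d0: "0 < dd" unfolding d[symmetric] by simp
 have dP: "dd<=P" using v a unfolding dd_def P_def poisson_den_def by (simp add: mult_left_le)
 have "phase_rate a eta = (1-a\<^sup>2)/P-1"
 using d0 dP unfolding phase_rate_def P_def poisson_den_def by (simp add: field_simps)
 also have "... <= (1-a\<^sup>2)/dd-1"
 using dP d0 a by (intro diff_right_mono divide_left_mono) (auto simp: power_le_one)
 finally have ph: "phase_rate a eta <= (1-a\<^sup>2)/dd-1" .
 have "(cmod ((1-of_real a/z)/(1-of_real a * z)))\<^sup>2=(v - 2 * a * cos eta + a\<^sup>2)/v / dd"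
 by (simp add: norm_divide power_divide d n)
 also have "... = 1 + - ((1-v)/v * ((1-a\<^sup>2)/dd-1))"
 proof -
 have "(1-v)/v * ((1-a\<^sup>2)/dd-1)*(v * dd)=(1-v)*(1-a\<^sup>2-dd)" using v d0 by (simp add: field_simps)
 also have "... = v * dd-(v - 2 * a * cos eta + a\<^sup>2)" by (simp add: dd_def power2_eq_square algebra_simps)
 finally have "(1 + - ((1-v)/v * ((1-a\<^sup>2)/dd-1)))*(v * dd)=v - 2 * a * cos eta + a\<^sup>2" by (simp only: distrib_right mult_1 mult_minus_left)
 thus ?thesis using v d0 by (simp add: divide_divide_eq_left nonzero_divide_eq_eq)
 qed
 also have "... <= 1 + - ((1-v)/v * phase_rate a eta)" using ph v by (simp add: mult_left_mono divide_right_mono)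
 also have "... <= exp (- ((1-v)/v * phase_rate a eta))" by (rule exp_ge_add_one_self)
 finally show ?thesis unfolding v_def .
qed

text \<open>The phase rate at the end of the chord governs the decay inside the disc. Two rates are
  assumed because of the power \<open>z powi (- x)\<close>: for \<open>x > 0\<close> it grows, which
  the rate with \<open>x\<close> compensates, and for \<open>x < 0\<close> it is at most 1 in
  modulus and the rate without it suffices.\<close>

lemma oscz_chord_le:
 assumes as: "\<And>a. a \<in> set as ==> 0<=a & a < 1" and z: "Re z=cos eta" "0 < cos eta" "cmod z<=1"
 and e: "e <= osc_rate as 0 eta" "e <= osc_rate as x eta" "0<=e"
 shows "cmod (oscz as x z)<=exp (- (e/2*(1-(cmod z)\<^sup>2)))"
proof -
 define v where "v = (cmod z)\<^sup>2"
 define S where "S=(\<Sum>a\<leftarrow>as. phase_rate a eta)"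
 have z0: "z ~= 0" using z by auto
 have v: "0 < v" "v <= 1" using z z0 by (auto simp: v_def power_le_one)
 have S: "e<=S" "e<=S-of_int x" using e by (auto simp: osc_rate_def S_def)
 have 1: "(cmod (\<Prod>a\<leftarrow>as. (1-of_real a/z)/(1-of_real a * z)))\<^sup>2<=exp (- ((1-v)/v * S))"
 unfolding S_def using as
 proof (induction as)
 case (Cons b bs)
 have "(cmod ((1-of_real b/z)/(1-of_real b * z)))\<^sup>2*(cmod (\<Prod>a\<leftarrow>bs. (1-of_real a/z)/(1-of_real a * z)))\<^sup>2 \<le>
 exp (- ((1-v)/v * phase_rate b eta)) * exp (- ((1-v)/v * (\<Sum>a\<leftarrow>bs. phase_rate a eta)))"
 unfolding v_def by (intro mult_mono blaschke_chord_le Cons.IH[unfolded v_def] z) (use Cons.prems in auto)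
 thus ?case by (simp only: list.map prod_list.Cons sum_list.Cons norm_mult power_mult_distrib exp_add[symmetric] distrib_left minus_add_distrib)
 qed simp
 have 2: "(cmod (z powi (- x)))\<^sup>2=exp (- of_int x * ln v)"
 proof -
 have "(cmod (z powi (- x)))\<^sup>2=v powi (- x)" unfolding v_def norm_power_int power_int_power' by (simp add: power_int_power' power_int_power mult.commute)
 also have "... = v powr of_int (- x)" by (rule powr_real_of_int'[symmetric]) (use v in auto)
 finally show ?thesis using v by (simp add: powr_def)
 qed
 have le: "- ((1-v)/v * S) + - of_int x * ln v <= - (e*(1-v))"
 proof (cases "0<=x")
 case True
 have "ln (1/v)<=1/v - 1" using v by (intro ln_le_minus_one) auto
 hence "- ln v <= (1-v)/v" using v by (simp add: ln_div diff_divide_distrib)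
 hence "of_int x * - ln v <= of_int x*((1-v)/v)" using True by (intro mult_left_mono) auto
 moreover have "of_int x * - ln v = - of_int x * ln v" by simp
 moreover have "(1-v)/v * (S-of_int x)=(1-v)/v * S-of_int x*((1-v)/v)" by (simp only: right_diff_distrib mult.commute[of "real_of_int x"])
 ultimately have "- ((1-v)/v * S) + - of_int x * ln v <= - ((1-v)/v * (S-of_int x))" by linarith
 also have "... <= - ((1-v) * e)"
 proof -
 have "(1-v) * v <= (1-v)*1" using v by (intro mult_left_mono) auto
 hence "1-v <= (1-v)/v" using v(1) by (simp only: pos_le_divide_eq mult_1_right)
 hence "(1-v) * e<=(1-v)/v * (S-of_int x)" using S e v by (intro mult_mono) auto
 thus ?thesis by simp
 qed
 finally show ?thesis by (simp add: mult.commute)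
 next
 case False
 have "ln v <= 0" using v by simp
 hence "- of_int x * ln v <= 0" using False by (intro mult_nonneg_nonpos) auto
 moreover have "(1-v) * e<=(1-v)/v * S"
 proof -
 have "(1-v) * v <= (1-v)*1" using v by (intro mult_left_mono) auto
 hence "1-v <= (1-v)/v" using v(1) by (simp only: pos_le_divide_eq mult_1_right)
 thus ?thesis using S e v by (intro mult_mono) auto
 qed
 ultimately show ?thesis by (simp add: mult.commute)
 qed
 have "(cmod (oscz as x z))\<^sup>2<=exp (- ((1-v)/v * S)) * exp (- of_int x * ln v)"
 unfolding oscz_def norm_mult power_mult_distrib 2 using 1 by (intro mult_right_mono) auto
 also have "... <= exp (- (e*(1-v)))" unfolding exp_add[symmetric] exp_le_cancel_iff by (rule le)
 also have "... = (exp (- (e/2*(1-v))))\<^sup>2" by (simp add: power2_eq_square exp_add[symmetric])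
 finally show ?thesis unfolding v_def by (rule power2_le_imp_le) simp
qed

lemma norm_infsum_le_finite:
 fixes f :: "'a => complex"
 assumes s: "f summable_on X" and b: "\<And>F. finite F ==> F \<subseteq> X ==> norm (sum f F)<=B"
 shows "norm (infsum f X)<=B"
proof -
 have "((%F. norm (sum f F)) \<longlongrightarrow> norm (infsum f X)) (finite_subsets_at_top X)"
 using has_sum_infsum[OF s] unfolding has_sum_def by (rule tendsto_norm)
 thus ?thesis
 using b by (intro tendsto_upperbound[of _ _ "finite_subsets_at_top X"]) (auto intro!: eventually_finite_subsets_at_top_weakI)
qed

lemma fourier_coeff_cnj: "cnj (fourier_coeff a b (%th. cnj (g th)) n)=fourier_coeff a b g (- n)"
proof -
 have "cnj (fourier_coeff a b (%th. cnj (g th)) n)=1/(2 * pi) * integral {a..b} (%th. cnj (cnj (g th) * cis (- (of_int n * th))))"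
 unfolding fourier_coeff_def by (simp add: Henstock_Kurzweil_Integration.integral_cnj)
 thus ?thesis by (simp add: fourier_coeff_def cis_cnj)
qed

text \<open>The limit lemmas expect the conjugate phase in the function and the phase itself in the
  coefficients; conjugation covers the case in which the two are exchanged.\<close>

lemma cnj_half_pairing:
 assumes "\<And>n. cnj (dd n)=dd n"
 shows "cnj (half_pairing sg a b (%th. cnj (g th)) dd X) =
 (\<Sum>\<^sub>\<infinity>n\<in>X. fourier_coeff (side_lo sg a b) (side_hi sg a b) g (- n) * dd (- n))"
 unfolding half_pairing_def infsum_cnj[symmetric] by (simp only: complex_cnj_mult fourier_coeff_cnj assms)

text \<open>Besides 0 the only poles are the points \<open>1/a\<close>, which lie to the right of
  1.\<close>

lemma holomorphic_on_oscz:
 assumes "\<And>a. a \<in> set as ==> 0<=a & a < 1" "\<And>z. z \<in> S ==> z ~= 0 & Re z < 1"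
 shows "oscz as x holomorphic_on S"
proof -
 have "(%z. \<Prod>a\<leftarrow>as. (1-of_real a/z)/(1-of_real a * z)) holomorphic_on S"
 using assms(1)
 proof (induction as)
 case (Cons b bs)
 have nz: "1-of_real b * z ~= 0" if "z \<in> S" for z
 proof
 assume "1-of_real b * z=0"
 hence "of_real b * z=1" by simp
 hence "Re (of_real b * z)=1" by (simp only: one_complex.sel)
 hence e: "b * Re z=1" by simp
 have b: "0<=b" "b < 1" "Re z < 1" using Cons.prems assms(2)[OF that] by auto
 have "b * Re z < 1"
 proof (cases "0<=Re z")
 case True
 hence "b * Re z<=1 * Re z" using b by (intro mult_right_mono) auto
 thus ?thesis using b by simp
 next
 case False
 hence "b * Re z<=0" using b by (intro mult_nonneg_nonpos) auto
 thus ?thesis by simp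
 qed
 thus False using e by simp
 qed
 have h: "(%z. (1-of_real b/z)/(1-of_real b * z)) holomorphic_on S"
 using assms(2) nz by (intro holomorphic_intros) auto
 have "(%z. ((1-of_real b/z)/(1-of_real b * z))*(\<Prod>a\<leftarrow>bs. (1-of_real a/z)/(1-of_real a * z))) holomorphic_on S"
 by (rule holomorphic_on_mult[OF h Cons.IH]) (use Cons.prems in auto)
 thus ?case by simp
 qed simp
 thus ?thesis unfolding oscz_def[abs_def] using assms(2) by (intro holomorphic_intros) auto
qed

section \<open>Entries with negative time difference\<close>

context reference
begin

text \<open>The normalised symbol \<open>J\<close> of the later slice in the scale of the earlier
  one, defined in the plane because the contour will leave the circle. Here \<open>Q\<close> is a
  denominator.\<close>

definition gv :: "nat => int => real => complex => complex" where
 "gv k l r z = oscz (as r) (x r) z*(E r z*(of_real (rho r) * z) powi l * inverse (Q k r z))"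

definition dinv :: "real => int => complex" where
 "dinv r n = of_real (coef_inv r (A r) (d r) (t r) (x r) n * rho r powi n)/of_real (rho r) powi x r"

text \<open>The coefficients are real, so conjugating the series reverses the index; this is how the
  third claim obtains the phase \<open>osc\<close> instead of its conjugate.\<close>

lemma dinv:
 assumes "good M r"
 shows "(%n. norm (dinv r n)) summable_on UNIV" "(%n. norm (dinv r (- n))) summable_on UNIV"
 and "((%n. dinv r (- n) * cis (of_int n * th)) has_sum osc (as r) (x r) th * cnj (inverse (E r (cis th)))) UNIV"
 and "cnj (dinv r n)=dinv r n"
proof -
 have r: "r > 0" using assms by (auto simp: good_def)
 note L=laurent_on_fourier[OF laurent_on_coef_inv[OF r rho_radius(1)[OF assms],of "A r" "d r" "x r"]]
 let ?kappa = "complex_of_real (rho r) powi x r"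
 have nz: "?kappa ~= 0" using rho_pos[of r] by simp
 show s: "(%n. norm (dinv r n)) summable_on UNIV"
 unfolding dinv_def divide_inverse norm_mult[of _ "inverse _"] by (rule summable_on_cmult_left[OF L(1)])
 have "(%n. norm (dinv r n)) summable_on UNIV \<longleftrightarrow> (%n. norm (dinv r (- n))) summable_on UNIV"
 by (rule summable_on_reindex_bij_witness[where i=uminus and j=uminus]) auto
 with s show "(%n. norm (dinv r (- n))) summable_on UNIV" by blast
 show cd: "cnj (dinv r n)=dinv r n" for n by (simp add: dinv_def)
 have 1: "((%n. dinv r n * cis (of_int n * th)) has_sum cnj (osc (as r) (x r) th) * inverse (E r (cis th))) UNIV"
 proof -
 have "((%n. dinv r n * cis (of_int n * th)) has_sum inverse ?kappa * inverse (gsym r (A r) (d r) (t r) (x r) (of_real (rho r) * cis th))) UNIV"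
 using has_sum_cmult_right[OF L(2)[of th],of "inverse ?kappa"] by (simp only: dinv_def divide_inverse mult_ac)
 also have "inverse ?kappa * inverse (gsym r (A r) (d r) (t r) (x r) (of_real (rho r) * cis th))=cnj (osc (as r) (x r) th) * inverse (E r (cis th))"
 unfolding gsym_eq[OF assms cis_neq_zero] osc_eq_oscz[symmetric] osc_cnj[OF r,symmetric] using nz by (simp add: power_int_minus)
 finally show ?thesis .
 qed
 hence "((%n. cnj (dinv r n * cis (of_int n * th))) has_sum cnj (cnj (osc (as r) (x r) th) * inverse (E r (cis th)))) UNIV"
 by (simp only: has_sum_cnj_iff)
 moreover have "((%n. cnj (dinv r n * cis (of_int n * th))) has_sum cnj (cnj (osc (as r) (x r) th) * inverse (E r (cis th)))) UNIV \<longleftrightarrow>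
 ((%n. dinv r (- n) * cis (of_int n * th)) has_sum cnj (cnj (osc (as r) (x r) th) * inverse (E r (cis th)))) UNIV"
 by (rule has_sum_reindex_bij_witness[where i=uminus and j=uminus]) (auto simp: cd cis_cnj)
 ultimately show "((%n. dinv r (- n) * cis (of_int n * th)) has_sum osc (as r) (x r) th * cnj (inverse (E r (cis th)))) UNIV"
 by (simp only: complex_cnj_mult complex_cnj_cnj)
qed

text \<open>The common part of the cases \<tau> > 0 and \<tau> = 0. Only the arcs
  \<open>eta <= |th|\<close>, on which the limit of \<open>Q\<close> is bounded away from 0, are
  integrated over the circle; \<open>ch\<close> collects what a modified contour contributes in
  place of the remaining arc.\<close>

lemma minus_core:
 fixes k :: nat and l :: int and phi :: "real => complex" and \<delta> ch :: "real => int => complex"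
 assumes eta: "0 <= eta" "eta <= pi" and b: "0 < b" "\<And>th. th \<in> {- pi..pi} ==> eta <= \<bar>th\<bar> ==> b<=cmod (1-of_real c/cis th)"
 and Qnz: "\<forall>\<^sub>F r in at_right 0. \<forall>th\<in>{- pi..pi}. eta <= \<bar>th\<bar> --> Q k r (cis th) ~= 0"
 and \<delta>: "\<forall>\<^sub>F r in at_right 0. \<forall>n>0. \<delta> r n=fourier_coeff (side_lo False eta pi) (side_hi False eta pi) (%th. gv k l r (cis th)) (- n) +
 fourier_coeff (side_lo True eta pi) (side_hi True eta pi) (%th. gv k l r (cis th)) (- n)+ch r n"
 and chs: "\<forall>\<^sub>F r in at_right 0. (%n. dinv r n * ch r n) summable_on {0<..}"
 and chl: "((%r. \<Sum>\<^sub>\<infinity>n\<in>{0<..}. dinv r n * ch r n) \<longlongrightarrow> 0) (at_right 0)"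
 defines "phi \<equiv> %th. (of_real c * cis th) powi l * inverse ((1-of_real c/cis th)^k)"
 shows "((%r. \<Sum>\<^sub>\<infinity>n\<in>{0<..}. dinv r n * \<delta> r n) \<longlongrightarrow>
 1/(2 * pi)*(integral (side False (max eta ths) pi) phi + integral (side True (max eta ths) pi) phi)) (at_right 0)"
proof -
 define G where "G=(%r. good k r & (\<forall>th\<in>{- pi..pi}. eta <= \<bar>th\<bar> --> Q k r (cis th) ~= 0))"
 define psi' where "psi'=(%r th. cnj (E r (cis th)*(of_real (rho r) * cis th) powi l * inverse (Q k r (cis th))))"
 let ?o = "%r. osc (as r) (x r)"
 let ?F = "%z. (of_real c * z) powi l * inverse ((1-of_real c/z)^k)"
 have sd: "th \<in> {- pi..pi} & eta <= \<bar>th\<bar>" if "th \<in> side sg eta pi" for sg th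
 using that eta by (auto simp: side_lo_def side_hi_def split: if_splits)
 have evG: "\<forall>\<^sub>F r in at_right 0. G r" using good_ev[of k] Qnz unfolding G_def by eventually_elim blast
 have Gg: "good k r" "r > 0" if "G r" for r using that by (auto simp: G_def good_def)
 have E0: "E r (cis th) ~= 0" if "G r" for r th
 proof -
 have "1/2 < cmod (E r (cis th))" using Gg(1)[OF that] by (simp add: good_def)
 thus ?thesis by auto
 qed
 have gveq: "cnj (gv k l r (cis th))=cnj (?o r th) * psi' r th" for r th
 unfolding gv_def psi'_def osc_eq_oscz by (simp only: complex_cnj_mult)
 have psi'c: "continuous_on (side sg eta pi) (psi' r)" if "G r" for sg r
 unfolding psi'_def using rho_pos[of r] that sd[of _ sg] by (intro continuous_intros E_cont Q_cont) (auto simp: G_def)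
 have hol: "?F holomorphic_on - {0,of_real c}"
 using c01 by (intro holomorphic_intros) (auto simp: field_simps)
 have U: "open (- {0 :: complex,of_real c})" by (intro open_Compl finite_imp_closed) auto
 have cU: "cis ` side sg eta pi \<subseteq> - {0,of_real c}" for sg
 proof
 fix z assume "z \<in> cis ` side sg eta pi"
 then obtain th where th: "z=cis th" "th \<in> side sg eta pi" by auto
 have "b<=cmod (1-of_real c/cis th)" using sd[OF th(2)] by (intro b(2)) auto
 hence "cis th ~= of_real c" using b(1) c01 by (auto simp: divide_self_if)
 thus "z \<in> - {0,of_real c}" using th by simp
 qed
 note C1=circle_C1[OF U hol cU]
 have C1': "((%th. cnj (phi th)) has_vector_derivative cnj (deriv ?F (cis th)*(\<i> * cis th))) (at th within side sg eta pi)" if "th \<in> side sg eta pi" for sg th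
 unfolding phi_def by (rule bounded_linear.has_vector_derivative[OF bounded_linear_cnj C1(1)[OF that]])
 have bd1: "bounded ((%_. 1 :: complex) ` S)" for S :: "real set" by (rule bounded_subset[of "{1}"]) auto
 have ulim: "uniform_limit (side sg eta pi) psi' (%th. cnj (phi th)) (at_right 0)" for sg
 proof -
 have low: "b^k<=norm ((1-of_real c/cis th)^k)" if "th \<in> side sg eta pi" for th
 unfolding norm_power using b sd[OF that] by (intro power_mono) auto
 have bk: "0 < b^k" using b by simp
 have qi: "uniform_limit (side sg eta pi) (%r th. inverse (Q k r (cis th))) (%th. inverse ((1-of_real c/cis th)^k)) (at_right 0)"
 using uniform_lim_inverse[OF Q_lim[where S = "side sg eta pi"] low bk] by (simp add: o_def)
 have qb: "bounded ((%th. inverse ((1-of_real c/cis th)^k)) ` side sg eta pi)"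
 proof (rule boundedI)
 fix w assume "w \<in> (%th. inverse ((1-of_real c/cis th)^k)) ` side sg eta pi"
 then obtain th where w: "w=inverse ((1-of_real c/cis th)^k)" "th \<in> side sg eta pi" by auto
 show "norm w<=inverse (b^k)" unfolding w(1) norm_inverse by (rule le_imp_inverse_le[OF low[OF w(2)] bk])
 qed
 have eb: "bounded ((%th. 1*(of_real c * cis th) powi l) ` side sg eta pi)" using monomial_bounded[of l "side sg eta pi"] by simp
 have "uniform_limit (side sg eta pi) (%r th. E r (cis th)*(of_real (rho r) * cis th) powi l * inverse (Q k r (cis th)))
 (%th. 1*(of_real c * cis th) powi l * inverse ((1-of_real c/cis th)^k)) (at_right 0)"
 by (intro uniform_lim_mult E_circle monomial_lim qi qb eb bd1 monomial_bounded)
 from bounded_linear.uniform_limit[OF bounded_linear_cnj this] show ?thesis unfolding psi'_def phi_def by simp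
 qed
 have lim: "((%r. half_pairing sg eta pi (%th. cnj (?o r th) * psi' r th) (%n. dinv r (- n)) {0<..}) \<longlongrightarrow>
 1/(2 * pi) * integral (side sg (max eta ths) pi) (%th. cnj (phi th))) (at_right 0)" for sg
 proof (rule half_pairing_limit_uniform(2)[where G=G and E = "%r th. cnj (inverse (E r (cis th)))",OF evG Gg(2) _ ths inside outside _ _ _ _ eta])
 show "uniform_limit (side sg eta pi) psi' (%th. cnj (phi th)) (at_right 0)" by (rule ulim)
 have "uniform_limit {- pi..pi} (%r th. cnj (inverse (E r (cis th)))) (%_. cnj 1) (at_right 0)"
 by (rule bounded_linear.uniform_limit[OF bounded_linear_cnj E_circle_inverse])
 thus "uniform_limit {- pi..pi} (%r th. cnj (inverse (E r (cis th)))) (%_. 1) (at_right 0)" by simp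
 show "((%th. cnj (phi th)) has_vector_derivative cnj (deriv ?F (cis th)*(\<i> * cis th))) (at th within side sg eta pi)" if "th \<in> side sg eta pi" for th
 by (rule C1'[OF that])
 show "continuous_on (side sg eta pi) (%th. cnj (deriv ?F (cis th)*(\<i> * cis th)))" by (intro continuous_on_cnj C1(2))
 fix r assume G: "G r"
 show "0<=a & a < 1" if "a \<in> set (as r)" for a by (rule as_bounds[OF Gg(2)[OF G] that])
 show "(%n. norm (dinv r (- n))) summable_on UNIV" by (rule dinv(2)[OF Gg(1)[OF G]])
 show "((%n. dinv r (- n) * cis (of_int n * th)) has_sum osc (as r) (x r) th * cnj (inverse (E r (cis th)))) UNIV" for th
 by (rule dinv(3)[OF Gg(1)[OF G]])
 show "continuous_on {- pi..pi} (%th. cnj (inverse (E r (cis th))))"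
 using E0[OF G] by (intro continuous_intros E_cont) auto
 show "continuous_on (side sg eta pi) (psi' r)" by (rule psi'c[OF G])
 qed
 let ?fc = "%sg r n. fourier_coeff (side_lo sg eta pi) (side_hi sg eta pi) (%th. gv k l r (cis th)) (- n)"
 have lim2: "((%r. \<Sum>\<^sub>\<infinity>n\<in>{0<..}. ?fc sg r n * dinv r n) \<longlongrightarrow> 1/(2 * pi) * integral (side sg (max eta ths) pi) phi) (at_right 0)" for sg
 proof -
 have "((%r. cnj (half_pairing sg eta pi (%th. cnj (gv k l r (cis th))) (%n. dinv r (- n)) {0<..})) \<longlongrightarrow>
 cnj (1/(2 * pi) * integral (side sg (max eta ths) pi) (%th. cnj (phi th)))) (at_right 0)"
 unfolding gveq by (rule tendsto_cnj[OF lim])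
 also have "cnj (1/(2 * pi) * integral (side sg (max eta ths) pi) (%th. cnj (phi th)))=1/(2 * pi) * integral (side sg (max eta ths) pi) phi"
 by (simp add: Henstock_Kurzweil_Integration.integral_cnj)
 finally show ?thesis
 proof (rule Lim_transform_eventually)
 show "\<forall>\<^sub>F r in at_right 0. cnj (half_pairing sg eta pi (%th. cnj (gv k l r (cis th))) (%n. dinv r (- n)) {0<..})=(\<Sum>\<^sub>\<infinity>n\<in>{0<..}. ?fc sg r n * dinv r n)"
 using evG
 proof eventually_elim
 case (elim r)
 show ?case using cnj_half_pairing[of "%n. dinv r (- n)"] dinv(4)[OF Gg(1)[OF elim]] by simp
 qed
 qed
 qed
 have "((%r. (\<Sum>\<^sub>\<infinity>n\<in>{0<..}. ?fc False r n * dinv r n)+(\<Sum>\<^sub>\<infinity>n\<in>{0<..}. ?fc True r n * dinv r n)+(\<Sum>\<^sub>\<infinity>n\<in>{0<..}. dinv r n * ch r n)) \<longlongrightarrow>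
 1/(2 * pi) * integral (side False (max eta ths) pi) phi + 1/(2 * pi) * integral (side True (max eta ths) pi) phi + 0) (at_right 0)"
 by (intro tendsto_add lim2 chl)
 hence "((%r. (\<Sum>\<^sub>\<infinity>n\<in>{0<..}. ?fc False r n * dinv r n)+(\<Sum>\<^sub>\<infinity>n\<in>{0<..}. ?fc True r n * dinv r n)+(\<Sum>\<^sub>\<infinity>n\<in>{0<..}. dinv r n * ch r n)) \<longlongrightarrow>
 1/(2 * pi)*(integral (side False (max eta ths) pi) phi + integral (side True (max eta ths) pi) phi)) (at_right 0)"
 by (simp only: distrib_left add_0_right)
 thus ?thesis
 proof (rule Lim_transform_eventually)
 show "\<forall>\<^sub>F r in at_right 0. (\<Sum>\<^sub>\<infinity>n\<in>{0<..}. ?fc False r n * dinv r n)+(\<Sum>\<^sub>\<infinity>n\<in>{0<..}. ?fc True r n * dinv r n)+(\<Sum>\<^sub>\<infinity>n\<in>{0<..}. dinv r n * ch r n) =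
 (\<Sum>\<^sub>\<infinity>n\<in>{0<..}. dinv r n * \<delta> r n)"
 using evG \<delta> chs
 proof eventually_elim
 case (elim r)
 have gc: "continuous_on (side sg eta pi) (%th. gv k l r (cis th))" for sg
 proof -
 have "continuous_on (side sg eta pi) (%th. cnj (cnj (?o r th) * psi' r th))"
 by (intro continuous_intros continuous_osc[OF as_bounds[OF Gg(2)[OF elim(1)]]] psi'c[OF elim(1)])
 thus ?thesis unfolding gveq[symmetric] by simp
 qed
 have s: "(%n. ?fc sg r n * dinv r n) summable_on {0<..}" for sg
 proof -
 have "(%n. cnj (fourier_coeff (side_lo sg eta pi) (side_hi sg eta pi) (%th. cnj (gv k l r (cis th))) n * dinv r (- (- n)))) summable_on {0<..}"
 unfolding summable_on_cnj_iff
 by (rule summable_fourier_pairing[where d = "%n. dinv r (- n)"]) (intro continuous_on_cnj gc,rule dinv(2)[OF Gg(1)[OF elim(1)]])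
 thus ?thesis by (simp only: complex_cnj_mult fourier_coeff_cnj dinv(4)[OF Gg(1)[OF elim(1)]] minus_minus)
 qed
 have "(\<Sum>\<^sub>\<infinity>n\<in>{0<..}. dinv r n * \<delta> r n)=(\<Sum>\<^sub>\<infinity>n\<in>{0<..}. ?fc False r n * dinv r n + ?fc True r n * dinv r n+dinv r n * ch r n)"
 proof (rule infsum_cong)
 fix n :: int assume "n \<in> {0<..}"
 hence "\<delta> r n = ?fc False r n + ?fc True r n+ch r n" using elim(2) by simp
 thus "dinv r n * \<delta> r n = ?fc False r n * dinv r n + ?fc True r n * dinv r n+dinv r n * ch r n" by (simp only: distrib_left mult.commute)
 qed
 also have "... = (\<Sum>\<^sub>\<infinity>n\<in>{0<..}. ?fc False r n * dinv r n + ?fc True r n * dinv r n)+(\<Sum>\<^sub>\<infinity>n\<in>{0<..}. dinv r n * ch r n)"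
 by (rule infsum_add[OF summable_on_add[OF s s] elim(3)])
 also have "(\<Sum>\<^sub>\<infinity>n\<in>{0<..}. ?fc False r n * dinv r n + ?fc True r n * dinv r n)=(\<Sum>\<^sub>\<infinity>n\<in>{0<..}. ?fc False r n * dinv r n)+(\<Sum>\<^sub>\<infinity>n\<in>{0<..}. ?fc True r n * dinv r n)"
 by (rule infsum_add[OF s s])
 finally show ?case by simp
 qed
 qed
qed

end

context reference
begin

text \<open>The constant factor normalises \<open>J\<close> of the later slice to \<open>gv\<close>
  and undoes the normalisation of \<open>dinv\<close>.\<close>

definition \<delta>v :: "nat => int => real => int => complex" where
 "\<delta>v k l r n = of_real (coef_sym r (A r) (d r) (t r+int k) (y r-l+int (nat (- (t r+int k)))) (- n) * rho r powi (- n)) *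
 (of_real (rho r) powi x r*(gam r (t r+int k)/gam r (t r)))"

lemma minus_pairing:
 assumes "r > 0"
 shows "of_real (\<Sum>\<^sub>\<infinity>n\<in>{0<..}. coef_inv r (A r) (d r) (t r) (x r) n *
 coef_sym r (A r) (d r) (t r+int k) (y r-l+int (nat (- (t r+int k)))) (- n)) * gam r (t r+int k)/gam r (t r) =
 (\<Sum>\<^sub>\<infinity>n\<in>{0<..}. dinv r n * \<delta>v k l r n)"
proof -
 let ?kappa = "inverse (complex_of_real (rho r) powi x r)" and ?g = "gam r (t r+int k)/gam r (t r)"
 let ?a = "coef_inv r (A r) (d r) (t r) (x r)" and ?b = "coef_sym r (A r) (d r) (t r+int k) (y r-l+int (nat (- (t r+int k))))"
 have nz: "?kappa ~= 0" "rho r ~= 0" using rho_pos[of r] by auto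
 have "of_real (\<Sum>\<^sub>\<infinity>n\<in>{0<..}. ?a n * ?b (- n)) * gam r (t r+int k)/gam r (t r) = of_real (\<Sum>\<^sub>\<infinity>n\<in>{0<..}. ?a n * ?b (- n)) * ?g" by simp
 also have "... = (\<Sum>\<^sub>\<infinity>n\<in>{0<..}. (?kappa * of_real (?a n * rho r powi n))*(of_real (?b (- n) * rho r powi (- n)) / ?kappa)) * ?g"
 by (simp only: coef_rescale[OF nz(2,1) coef_summable[OF assms]])
 also have "... = (\<Sum>\<^sub>\<infinity>n\<in>{0<..}. (?kappa * of_real (?a n * rho r powi n))*(of_real (?b (- n) * rho r powi (- n)) / ?kappa) * ?g)"
 by (rule infsum_cmult_left'[symmetric])
 also have "... = (\<Sum>\<^sub>\<infinity>n\<in>{0<..}. dinv r n * \<delta>v k l r n)"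
 unfolding dinv_def \<delta>v_def by (simp only: divide_inverse inverse_inverse_eq mult_ac)
 finally show ?thesis .
qed

lemma gsym_gv:
 assumes g: "good k r" and z: "z ~= 0" "Q k r z ~= 0"
 shows "gsym r (A r) (d r) (t r+int k) (y r-l+int (nat (- (t r+int k)))) (of_real (rho r) * z) *
 (of_real (rho r) powi x r*(gam r (t r+int k)/gam r (t r)))=gv k l r z"
proof -
 define w where "w=complex_of_real (rho r) * z"
 have r: "r > 0" "\<bar>t r\<bar> + int k<=int (A r)" using g by (auto simp: good_def)
 have w0: "w ~= 0" using rho_pos[of r] z by (simp add: w_def)
 have q: "quotp r (t r) (t r+int k) w=Q k r z" unfolding w_def rho_def Q_def by (rule quotp_ref)
 have nz: "complex_of_real (rho r) ~= 0" using rho_pos[of r] by simp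
 let ?G = "gsym r (A r) (d r) (t r+int k) (y r-l+int (nat (- (t r+int k)))) w"
 have yl: "y r-(y r-l)=l" by simp
 have "?G * gam r (t r+int k)=gsym r (A r) (d r) (t r) (x r) w * gam r (t r) * w powi (y r-(y r-l))/quotp r (t r) (t r+int k) w"
 by (rule gsym_step) (use r dD[OF r(1)] w0 q z in \<open>auto simp: x_def\<close>)
 also have "gsym r (A r) (d r) (t r) (x r) w = of_real (rho r) powi (- x r)*(oscz (as r) (x r) z * E r z)"
 unfolding w_def by (rule gsym_eq[OF g z(1)])
 finally have "?G * gam r (t r+int k) = of_real (rho r) powi (- x r)*(oscz (as r) (x r) z * E r z) * gam r (t r) * w powi l/Q k r z"
 unfolding q yl .
 hence "?G * gam r (t r+int k)*(of_real (rho r) powi x r/gam r (t r)) =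
 (of_real (rho r) powi (- x r) * of_real (rho r) powi x r)*(gam r (t r)/gam r (t r)) * gv k l r z"
 unfolding gv_def w_def by (simp only: divide_inverse mult_ac)
 moreover have "complex_of_real (rho r) powi (- x r) * of_real (rho r) powi x r=1" using nz by (simp add: power_int_minus)
 moreover have "gam r (t r)/gam r (t r)=1" using gam_nz[of r "t r"] by simp
 ultimately have "?G * gam r (t r+int k)*(of_real (rho r) powi x r/gam r (t r))=gv k l r z" by (simp only: mult_1)
 moreover have "?G*(of_real (rho r) powi x r*(gam r (t r+int k)/gam r (t r))) = ?G * gam r (t r+int k)*(of_real (rho r) powi x r/gam r (t r))"
 by (simp only: divide_inverse mult_ac)
 ultimately show ?thesis unfolding w_def by (simp only:)
qed

text \<open>The zeros of \<open>Q\<close> tend to \<open>c < 1\<close>, strictly inside the unit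
  circle, so the whole circle can be used with \<open>eta = 0\<close> and no correction.\<close>

lemma minus_limit_pos:
 fixes k :: nat and l :: int and phi :: "real => complex"
 assumes \<tau>0: "0 < \<tau>"
 defines "phi \<equiv> %th :: real. (of_real c * cis th) powi l * inverse ((1-of_real c/cis th)^k) :: complex"
 shows "((%r. \<Sum>\<^sub>\<infinity>n\<in>{0<..}. dinv r n * \<delta>v k l r n) \<longlongrightarrow>
 1/(2 * pi)*(integral (side False ths pi) phi + integral (side True ths pi) phi)) (at_right 0)"
proof -
 have c1: "c < 1" using \<tau>0 by (simp add: c_def)
 have tp: "\<forall>\<^sub>F r in at_right 0. 0 < t r"
 using order_tendstoD(1)[OF rt \<tau>0] evp by eventually_elim (simp add: zero_less_mult_iff)
 have Q0: "Q k r (cis th) ~= 0" if "0 < r" "0 < t r" for r th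
 proof -
 have "1-complex_of_real (exp (- (r * of_int (t r)/2+r*(real i+1/2))))/cis th ~= 0" for i
 proof
 assume "1-complex_of_real (exp (- (r * of_int (t r)/2+r*(real i+1/2))))/cis th=0"
 hence "cis th = of_real (exp (- (r * of_int (t r)/2+r*(real i+1/2))))" by (simp add: field_simps)
 hence "cmod (cis th)=cmod (of_real (exp (- (r * of_int (t r)/2+r*(real i+1/2)))))" by (simp only:)
 hence "exp (- (r * of_int (t r)/2+r*(real i+1/2)))=1" by (simp only: norm_cis norm_of_real abs_exp_cancel)
 hence "r * of_int (t r)/2+r*(real i+1/2)=0" by simp
 moreover have "0 < r * of_int (t r)/2" "0 < r*(real i+1/2)" using that by (auto intro!: mult_pos_pos)
 ultimately show False by linarith
 qed
 thus ?thesis unfolding Q_def by simp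
 qed
 have mx: "max 0 ths=ths" using ths by simp
 have "((%r. \<Sum>\<^sub>\<infinity>n\<in>{0<..}. dinv r n * \<delta>v k l r n) \<longlongrightarrow>
 1/(2 * pi)*(integral (side False (max 0 ths) pi) phi + integral (side True (max 0 ths) pi) phi)) (at_right 0)"
 unfolding phi_def
 proof (rule minus_core[where b = "1-c" and ch = "%_ _. 0"])
 fix th :: real
 show "1-c<=cmod (1-of_real c/cis th)"
 using norm_triangle_ineq2[of 1 "of_real c/cis th"] c01 by (simp add: norm_divide)
 next
 show "\<forall>\<^sub>F r in at_right 0. \<forall>th\<in>{- pi..pi}. 0 <= \<bar>th\<bar> --> Q k r (cis th) ~= 0" using tp evp by eventually_elim (simp add: Q0)
 show "\<forall>\<^sub>F r in at_right 0. \<forall>n>0. \<delta>v k l r n=fourier_coeff (side_lo False 0 pi) (side_hi False 0 pi) (%th. gv k l r (cis th)) (- n) +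
 fourier_coeff (side_lo True 0 pi) (side_hi True 0 pi) (%th. gv k l r (cis th)) (- n)+0"
 using tp good_ev[of k]
 proof eventually_elim
 case (elim r)
 have r: "r > 0" "- int (A r)<=t r+int k" using elim(2) by (auto simp: good_def)
 have "rho r < 1" using elim(1) r(1) by (simp add: rho_def)
 moreover have "1<=exp (r*(real_of_int (nat (- (t r+int k)))+1/2))" using r(1) by simp
 ultimately have rad: "rho r < exp (r*(real_of_int (nat (- (t r+int k)))+1/2))" by linarith
 let ?C = "of_real (rho r) powi x r*(gam r (t r+int k)/gam r (t r))"
 let ?G = "gsym r (A r) (d r) (t r+int k) (y r-l+int (nat (- (t r+int k))))"
 have eq: "?C * ?G (of_real (rho r) * cis th)=gv k l r (cis th)" for th
 using gsym_gv[OF elim(2) cis_neq_zero Q0[OF r(1) elim(1)],where l=l] by (simp only: mult.commute)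
 have cont: "continuous_on {- pi..pi} (%th. gv k l r (cis th))"
 unfolding gv_def osc_eq_oscz[symmetric] using rho_pos[of r] Q0[OF r(1) elim(1)]
 by (intro continuous_intros continuous_osc[OF as_bounds[OF r(1)]] E_cont Q_cont) auto
 have "\<delta>v k l r n=fourier_coeff (- pi) pi (%th. gv k l r (cis th)) (- n)" for n
 proof -
 have "\<delta>v k l r n = ?C * fourier_coeff (- pi) pi (%th. ?G (of_real (rho r) * cis th)) (- n)"
 unfolding laurent_on_fourier_coeff[OF laurent_on_coef_sym[OF r(1) rho_pos rad r(2)]] \<delta>v_def by (rule mult.commute)
 thus ?thesis unfolding fourier_coeff_cmult[symmetric] eq .
 qed
 thus ?case by (simp only: fourier_coeff_halves[OF cont] add_0_right) simp
 qed
 qed (use c1 in auto)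
 thus ?thesis unfolding mx .
qed

definition nd :: "real => nat => real" where
 "nd r i=exp (- (r * of_int (t r)/2+r*(real i+1/2)))"

lemma nd_lim: "((%r. nd r i) \<longlongrightarrow> c) (at_right 0)"
proof -
 have "((%r. exp (- (r * of_int (t r)/2+r*(real i+1/2)))) \<longlongrightarrow> exp (- (\<tau> / 2+0*(real i+1/2)))) (at_right 0)"
 by (intro tendsto_intros rt) simp
 thus ?thesis by (simp add: c_def nd_def)
qed

lemma Q_nd: "Q k r z=(\<Prod>i<k. 1-of_real (nd r i)/z)"
 by (simp only: Q_def nd_def)

text \<open>To the left of \<open>R2\<close> the origin is the only singularity: the zeros of
  \<open>Q\<close> are the points \<open>nd r i\<close>, and the other poles of \<open>oscz\<close>
  lie beyond 1.\<close>

lemma gv_holomorphic: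
 assumes r: "r > 0" and nd: "\<And>i. i < k ==> R2 < nd r i" and R2: "R2<=1"
 shows "gv k l r holomorphic_on {z. Re z < R2} - {0}" "\<And>z. z ~= 0 ==> Re z < R2 ==> Q k r z ~= 0"
proof -
 show q: "Q k r z ~= 0" if z: "z ~= 0" "Re z < R2" for z
 proof -
 have "1-of_real (nd r i)/z ~= 0" if "i < k" for i
 proof
 assume "1-of_real (nd r i)/z=0"
 hence "z = of_real (nd r i)" using z(1) by (simp add: field_simps)
 thus False using nd[OF that] z(2) by simp
 qed
 thus ?thesis using z(1) by (auto simp: Q_nd)
 qed
 have o: "oscz (as r) (x r) holomorphic_on {z. Re z < R2} - {0}"
 by (rule holomorphic_on_oscz[OF as_bounds[OF r]]) (use R2 in auto)
 have Eh: "E r holomorphic_on {z. Re z < R2} - {0}" unfolding E_def[abs_def] tailp_def by (intro holomorphic_intros) auto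
 have Qh: "Q k r holomorphic_on {z. Re z < R2} - {0}" unfolding Q_def[abs_def] by (intro holomorphic_intros) auto
 show "gv k l r holomorphic_on {z. Re z < R2} - {0}"
 unfolding gv_def[abs_def] by (intro holomorphic_on_mult o Eh holomorphic_on_inverse Qh holomorphic_intros) (use rho_pos[of r] q in auto)
qed

end

lemma norm_powi_le:
 fixes w :: complex
 assumes "1<=M" "1/M<=cmod w" "cmod w<=M"
 shows "cmod (w powi l)<=M^nat \<bar>l\<bar>"
proof (cases "0<=l")
 case True
 hence "w powi l=w^nat \<bar>l\<bar>" by (simp add: power_int_def)
 thus ?thesis using assms by (simp add: norm_power power_mono)
next
 case False
 hence e: "w powi l=inverse w^nat \<bar>l\<bar>" by (simp add: power_int_def)
 have "0 < M" using assms(1) by linarith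
 hence "inverse (cmod w)<=inverse (1/M)" using assms(2) by (intro le_imp_inverse_le) auto
 thus ?thesis unfolding e by (simp add: norm_power norm_inverse power_mono)
qed

lemma sum_geometric_le:
 fixes v :: real
 assumes v: "0<=v" "v < 1" and F: "finite F" "F \<subseteq> {0 :: int<..}"
 shows "(\<Sum>n\<in>F. v ^ nat (n-1))<=1/(1-v)"
proof -
 have inj: "inj_on (%n :: int. nat (n-1)) F"
 proof (rule inj_onI)
 fix a b assume ab: "a \<in> F" "b \<in> F" "nat (a-1)=nat (b-1)"
 hence "0 < a" "0 < b" using F(2) by auto
 thus "a=b" using ab(3) by linarith
 qed
 have "(\<Sum>n\<in>F. v ^ nat (n-1))=(\<Sum>m\<in>(%n. nat (n-1)) ` F. v ^ m)" by (simp add: sum.reindex[OF inj])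
 also have "... <= (\<Sum>m. v ^ m)" using v F by (intro sum_le_suminf summable_geometric) auto
 also have "... = 1/(1-v)" using v by (intro suminf_geometric) auto
 finally show ?thesis .
qed

context reference
begin

text \<open>Bessel's inequality for a function of modulus at most 2, since \<open>E\<close> has
  modulus at least 1/2 on the circle.\<close>

lemma dinv_l2:
 assumes g: "good M r" and F: "finite F"
 shows "(\<Sum>n\<in>F. (norm (dinv r n))\<^sup>2)<=2\<^sup>2"
proof -
 have r: "r > 0" using g by (simp add: good_def)
 let ?H = "%th. osc (as r) (x r) th * cnj (inverse (E r (cis th)))"
 have E1: "1/2 < cmod (E r (cis th))" for th using g by (simp add: good_def)
 have E0: "E r (cis th) ~= 0" for th
 proof
 assume "E r (cis th)=0"
 thus False using E1[of th] by simp
 qed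
 have Hc: "continuous_on {- pi..pi} ?H" using E0 by (intro continuous_intros continuous_osc[OF as_bounds[OF r]] E_cont) auto
 have n: "norm (?H th)<=2" for th
 proof -
 have "inverse (cmod (E r (cis th)))<=inverse (1/2)" using E1[of th] by (intro le_imp_inverse_le) auto
 thus ?thesis using norm_osc[OF as_bounds[OF r]] by (simp add: norm_mult norm_inverse)
 qed
 have "(\<Sum>n\<in>F. (norm (dinv r n))\<^sup>2)=(\<Sum>n\<in>uminus ` F. (norm (dinv r (- n)))\<^sup>2)" by (simp add: sum.reindex inj_on_def)
 also have "... = (\<Sum>n\<in>uminus ` F. (norm (fourier_coeff (- pi) pi ?H n))\<^sup>2)"
 by (simp only: fourier_coeff_unique[OF dinv(2)[OF g] dinv(3)[OF g]])
 also have "... <= 1/(2 * pi) * integral {- pi..pi} (%th. (norm (?H th))\<^sup>2)"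
 by (intro bessel_finite Hc finite_imageI F) auto
 also have "... <= 1/(2 * pi)*(2\<^sup>2*(pi - - pi))"
 proof (intro mult_left_mono)
 have "norm (integral {- pi..pi} (%th. (norm (?H th))\<^sup>2))<=2\<^sup>2*(pi - - pi)"
 proof (rule integral_bound)
 show "continuous_on {- pi..pi} (%th. (norm (?H th))\<^sup>2)" by (intro continuous_on_power continuous_on_norm Hc)
 show "norm ((norm (?H th))\<^sup>2)<=2\<^sup>2" for th using power_mono[OF n norm_ge_zero,of th 2] by (simp only: real_norm_def abs_power2)
 qed simp
 thus "integral {- pi..pi} (%th. (norm (?H th))\<^sup>2)<=2\<^sup>2*(pi - - pi)" by simp
 qed simp
 also have "... = 2\<^sup>2" by simp
 finally show ?thesis .
qed

text \<open>For \<open>\<tau> = 0\<close> the limit \<open>(1 - 1/z)^(-k)\<close> of the quotient is singular at \<open>z = 1\<close>, so the part of the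
  contour near \<open>z = 1\<close> is moved into the disc, where \<open>oscz\<close> is exponentially small.\<close>

lemma minus_limit_zero:
 fixes k :: nat and l :: int and phi :: "real => complex"
 assumes \<tau>0: "\<tau> = 0" and ths0: "0 < ths"
 defines "phi \<equiv> %th. (of_real c * cis th) powi l * inverse ((1-of_real c/cis th)^k)"
 shows "((%r. \<Sum>\<^sub>\<infinity>n\<in>{0<..}. dinv r n * \<delta>v k l r n) \<longlongrightarrow>
 1/(2 * pi)*(integral (side False ths pi) phi + integral (side True ths pi) phi)) (at_right 0)"
proof -
 have "c=exp (- \<tau> / 2)" by (rule c_def)
 also have "... = 1" using \<tau>0 by simp
 finally have c1: "c=1" .
 \<comment> \<open>Below \<open>ths\<close> the rate with position \<open>x\<close> is positive.
   Below \<open>pi/3\<close> the rate with position 0 is positive too, because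
   \<open>2 - 2 * cos eta < 1\<close>. Both are required by \<open>oscz_chord_le\<close>.\<close>
 define eta where "eta = min (ths/2) (pi/4)"
 have eta: "0 < eta" "eta < ths" "eta <= pi/4" "eta < pi/2" "eta <= pi" "max eta ths=ths"
 using ths0 pi_gt_zero by (auto simp: eta_def min_def)
 define C0 where "C0=cos eta"
 have "cos (pi/3) < cos eta" using eta by (intro cos_monotone_0_pi) auto
 hence C0h: "1/2 < C0" by (simp add: C0_def cos_60)
 have C01: "C0 < 1"
 proof -
 have "cos eta < cos 0" using eta pi_gt_zero by (intro cos_monotone_0_pi) auto
 thus ?thesis by (simp add: C0_def)
 qed
 have S0: "0 < sin eta" using eta by (intro sin_gt_zero) auto
 \<comment> \<open>A vertical line strictly between the chord and 1: the zeros of \<open>Q\<close>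
   tend to 1 and are eventually to its right.\<close>
 define R2 where "R2=(1+C0)/2"
 have R2: "C0 < R2" "R2 < 1" using C01 by (auto simp: R2_def)
 \<comment> \<open>A circle inside the chord with radius below 1/2. As \<open>rho r < 2\<close>, the
   radius \<open>rho r * R\<close> stays below 1, within the domain of convergence, even if
   \<open>rho r\<close> exceeds 1.\<close>
 define R where "R=C0/2"
 have R: "0 < R" "R < C0" "R < 1/2" using C0h C01 by (auto simp: R_def)
 have "poisson_den c eta < exp (- mu)" using below[OF eta(1,2)] by (simp add: c_def)
 from rate_inside[OF eta(1,5) rx this] obtain e1 where e1: "0 < e1" "\<forall>\<^sub>F r in at_right 0. e1/r <= osc_rate (as r) (x r) eta" by blast
 have "poisson_den c eta < exp (- 0)" using C0h by (simp add: poisson_den_def c1 C0_def)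
 moreover have "((%r. r * of_int 0) \<longlongrightarrow> 0) (at_right 0)" by simp
 ultimately obtain e2 where e2: "0 < e2" "\<forall>\<^sub>F r in at_right 0. e2/r <= osc_rate (as r) 0 eta"
 using rate_inside[OF eta(1,5),of "%_. 0" 0] by blast
 define e where "e=min e1 e2"
 have e: "0 < e" "e<=e1" "e<=e2" using e1 e2 by (auto simp: e_def)
 have Eb: "\<forall>\<^sub>F r in at_right 0. \<forall>z\<in>{z. C0<=cmod z}. dist (E r z) 1 < 1"
 using uniform_limitD[OF E_unif[of C0],of 1] C0h by simp
 have ndev: "\<forall>\<^sub>F r in at_right 0. \<forall>i\<in>{..<k}. R2 < nd r i"
 using R2 c1 by (intro eventually_ball_finite ballI order_tendstoD(1)[OF nd_lim]) auto
 have rhoev: "\<forall>\<^sub>F r in at_right 0. 1/2 < rho r & rho r < 2"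
 using order_tendstoD(1)[OF rho_lim,of "1/2"] order_tendstoD(2)[OF rho_lim,of 2] c1 by (simp add: eventually_conj_iff)
 define Z where "Z=(%r. good k r & (\<forall>i<k. R2 < nd r i) & 1/2 < rho r & rho r < 2 & (\<forall>z. C0<=cmod z --> cmod (E r z)<=2) \<and>
 e/r <= osc_rate (as r) 0 eta & e/r <= osc_rate (as r) (x r) eta)"
 have evZ: "\<forall>\<^sub>F r in at_right 0. Z r"
 using good_ev[of k] ndev rhoev Eb e1(2) e2(2) evp
 proof eventually_elim
 case (elim r)
 have "cmod (E r z)<=2" if "C0<=cmod z" for z
 proof -
 have "dist (E r z) 1 < 1" using elim(4) that by blast
 thus ?thesis using norm_triangle_ineq2[of "E r z" 1] by (simp add: dist_norm)
 qed
 note E2=this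
 have er: "e/r<=e1/r" "e/r<=e2/r" using e elim(7) by (auto intro!: divide_right_mono)
 show ?case unfolding Z_def
 proof (intro conjI allI impI)
 show "good k r" by (rule elim(1))
 show "R2 < nd r i" if "i < k" for i using elim(2) that by simp
 show "1/2 < rho r" "rho r < 2" using elim(3) by simp_all
 show "cmod (E r z)<=2" if "C0<=cmod z" for z by (rule E2[OF that])
 show "e/r <= osc_rate (as r) 0 eta" using er(2) elim(6) by (rule order_trans)
 show "e/r <= osc_rate (as r) (x r) eta" using er(1) elim(5) by (rule order_trans)
 qed
 qed
 define ch where "ch=(%r n. 1/(2 * of_real pi * \<i>) * integral {0..1} (%t. gv k l r (chord eta t) * chord eta t powi (n-1) * chord' eta t))"
 \<comment> \<open>Bounds for the factors of \<open>gv\<close> besides \<open>oscz\<close>: 2 for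
   \<open>E\<close>, a power of 4 for the monomial, whose base has modulus between 1/4 and 4, and
   the distance \<open>(1 - C0)/2\<close> from the chord to the zeros of \<open>Q\<close>.\<close>
 define B where "B=2*(4^nat \<bar>l\<bar> * (2/(1-C0))^k)"
 have B0: "0 < B" using C01 by (simp add: B_def)
 have chn: "C0<=cmod (chord eta t)" "cmod (chord eta t)<=1" "Re (chord eta t)=C0" "chord eta t ~= 0" for t
 proof -
 show re: "Re (chord eta t)=C0" by (simp add: chord_def C0_def)
 thus "C0<=cmod (chord eta t)" using complex_Re_le_cmod[of "chord eta t"] by simp
 have "(cmod (chord eta t))\<^sup>2<=1" using chord_norm[of eta t] zero_le_power2[of "sin eta * sin (pi * t)"] by linarith
 hence "(cmod (chord eta t))\<^sup>2<=1\<^sup>2" by simp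
 thus "cmod (chord eta t)<=1" by (rule power2_le_imp_le) simp
 show "chord eta t ~= 0" using re C0h by auto
 qed
 have gvb: "cmod (gv k l r (chord eta t))<=B * exp (- (e/r/2*(sin eta * sin (pi * t))\<^sup>2))" if Z: "Z r" for r t
 proof -
 let ?z = "chord eta t"
 have r: "r > 0" using Z by (simp add: Z_def good_def)
 have 1: "cmod (oscz (as r) (x r) ?z)<=exp (- (e/r/2*(sin eta * sin (pi * t))\<^sup>2))"
 unfolding chord_norm[symmetric]
 by (rule oscz_chord_le[OF as_bounds[OF r]]) (use Z chn[of t] C0h e r in \<open>auto simp: Z_def C0_def\<close>)
 have 2: "cmod (E r ?z)<=2" using Z chn(1)[of t] by (simp add: Z_def)
 have 3: "cmod ((of_real (rho r) * ?z) powi l)<=4^nat \<bar>l\<bar>"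
 proof (rule norm_powi_le)
 have rho: "1/2 < rho r" "rho r < 2" using Z by (auto simp: Z_def)
 have "1/2*(1/2) <= rho r * cmod ?z" using rho chn(1)[of t] C0h by (intro mult_mono) auto
 thus "1/4<=cmod (of_real (rho r) * ?z)" using rho by (simp add: norm_mult)
 have "rho r * cmod ?z<=2*1" using rho chn(2)[of t] by (intro mult_mono) auto
 thus "cmod (of_real (rho r) * ?z)<=4" using rho by (simp add: norm_mult)
 qed simp
 have 4: "cmod (inverse (Q k r ?z))<=(2/(1-C0))^k"
 proof -
 have "(1-C0)/2<=cmod (1-of_real (nd r i) / ?z)" if "i < k" for i
 proof -
 have "R2 < nd r i" using Z that by (simp add: Z_def)
 hence "(1-C0)/2<=nd r i-C0" by (simp add: R2_def field_simps)
 also have "... <= \<bar>Re (?z-of_real (nd r i))\<bar>" using chn(3)[of t] by simp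
 also have "... <= cmod (?z-of_real (nd r i))" by (rule abs_Re_le_cmod)
 also have "... <= cmod (?z-of_real (nd r i))/cmod ?z"
 using chn(2,4)[of t] by (simp add: le_divide_eq mult_left_le)
 also have "... = cmod (1-of_real (nd r i) / ?z)" using chn(4)[of t] by (simp add: norm_divide[symmetric] diff_divide_distrib)
 finally show ?thesis .
 qed
 hence "(\<Prod>i<k. (1-C0)/2)<=(\<Prod>i<k. cmod (1-of_real (nd r i) / ?z))" using C01 by (intro prod_mono) auto
 hence "((1-C0)/2)^k<=cmod (Q k r ?z)" by (simp add: Q_nd prod_norm)
 hence "inverse (cmod (Q k r ?z))<=inverse (((1-C0)/2)^k)" using C01 by (intro le_imp_inverse_le) auto
 thus ?thesis by (simp add: norm_inverse power_inverse[symmetric])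
 qed
 have "cmod (gv k l r ?z)=cmod (oscz (as r) (x r) ?z)*(cmod (E r ?z) * cmod ((of_real (rho r) * ?z) powi l) * cmod (inverse (Q k r ?z)))"
 by (simp only: gv_def norm_mult)
 also have "... <= exp (- (e/r/2*(sin eta * sin (pi * t))\<^sup>2))*(2*4^nat \<bar>l\<bar> * (2/(1-C0))^k)"
 using C01 by (intro mult_mono 1 2 3 4) auto
 also have "... = B * exp (- (e/r/2*(sin eta * sin (pi * t))\<^sup>2))" by (simp only: B_def mult_ac)
 finally show ?thesis .
 qed
 have gvc: "continuous_on {0..1} (%t. gv k l r (chord eta t))" if Z: "Z r" for r
 proof -
 have "continuous_on ({z. Re z < R2} - {0}) (gv k l r)"
 by (rule holomorphic_on_imp_continuous_on[OF gv_holomorphic(1)]) (use Z R2 in \<open>auto simp: Z_def good_def\<close>)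
 thus ?thesis by (rule continuous_on_compose2[OF _ continuous_chord(1)]) (use chn R2 in auto)
 qed
 have powc: "continuous_on S (%t. chord eta t powi m)" for S m
 by (intro continuous_intros continuous_chord) (use chn(4) in auto)
 \<comment> \<open>Finite sums are estimated under the integral. Cauchy-Schwarz, square summability
   of \<open>dinv\<close> and a geometric series give \<open>2 / sqrt (1 - v)\<close>, which the
   speed of the chord cancels up to a constant; the decay of \<open>gv\<close> remains.\<close>
 have fin: "norm (\<Sum>n\<in>F. dinv r n * ch r n)<=B * integral {0..1} (%t. exp (- (\<bar>e/r/2*(sin eta)\<^sup>2\<bar> * (sin (pi * t))\<^sup>2)))"
 if Z: "Z r" and F: "finite F" "F \<subseteq> {0<..}" for r F
 proof -
 have r: "r > 0" and g: "good k r" using Z by (auto simp: Z_def good_def)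
 let ?P = "%t. \<Sum>n\<in>F. dinv r n * chord eta t powi (n-1)"
 have Pb: "cmod (?P t) * cmod (chord' eta t)<=2 * pi" if t: "t \<in> {0..1}" for t
 proof (cases "sin (pi * t)=0")
 case True
 hence "chord' eta t=0" by (simp add: chord'_def complex_eq_iff)
 thus ?thesis by simp
 next
 case False
 have st: "0<=sin (pi * t)" using t by (intro sin_ge_zero) (auto simp: mult_left_le)
 define v where "v = (cmod (chord eta t))\<^sup>2"
 have v1: "1-v = (sin eta * sin (pi * t))\<^sup>2" unfolding v_def by (rule chord_norm)
 have "0 < (sin eta * sin (pi * t))\<^sup>2" using False S0 by simp
 hence v: "0<=v" "v < 1" unfolding v1[symmetric] by (simp_all add: v_def)
 have nr: "cmod (chord' eta t)=pi * sqrt (1-v)"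
 using S0 st by (simp add: chord'_def cmod_def v1 abs_mult)
 have "cmod (?P t)<=(\<Sum>n\<in>F. cmod (dinv r n) * cmod (chord eta t powi (n-1)))"
 by (rule order_trans[OF norm_sum]) (simp add: norm_mult)
 also have "... = sqrt ((\<Sum>n\<in>F. cmod (dinv r n) * cmod (chord eta t powi (n-1)))\<^sup>2)" by (simp add: sum_nonneg)
 also have "... <= sqrt ((\<Sum>n\<in>F. (cmod (dinv r n))\<^sup>2)*(\<Sum>n\<in>F. (cmod (chord eta t powi (n-1)))\<^sup>2))"
 by (intro real_sqrt_le_mono Cauchy_Schwarz_ineq_sum)
 also have "... <= sqrt (2\<^sup>2*(1/(1-v)))"
 proof (intro real_sqrt_le_mono mult_mono dinv_l2[OF g F(1)] sum_nonneg)
 have "(\<Sum>n\<in>F. (cmod (chord eta t powi (n-1)))\<^sup>2)=(\<Sum>n\<in>F. v ^ nat (n-1))"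
 proof (rule sum.cong[OF refl])
 fix n assume "n \<in> F"
 hence "0<=n-1" using F(2) by auto
 hence "chord eta t powi (n-1)=chord eta t^nat (n-1)" by (simp add: power_int_def)
 thus "(cmod (chord eta t powi (n-1)))\<^sup>2=v ^ nat (n-1)" by (simp add: norm_power v_def power_even_eq[symmetric] power_mult[symmetric] mult.commute)
 qed
 thus "(\<Sum>n\<in>F. (cmod (chord eta t powi (n-1)))\<^sup>2)<=1/(1-v)" using sum_geometric_le[OF v F] by simp
 qed auto
 also have "... = 2/sqrt (1-v)" by (simp add: real_sqrt_mult real_sqrt_divide)
 finally have "cmod (?P t) * cmod (chord' eta t)<=2/sqrt (1-v)*(pi * sqrt (1-v))" unfolding nr by (rule mult_right_mono) (use v in simp)
 also have "... = 2 * pi" using v by simp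
 finally show ?thesis .
 qed
 have int: "(%t. gv k l r (chord eta t) * chord eta t powi (n-1) * chord' eta t) integrable_on {0..1}" for n
 by (intro integrable_continuous_interval continuous_on_mult gvc[OF Z] powc continuous_chord)
 have "(\<Sum>n\<in>F. dinv r n * ch r n)=1/(2 * of_real pi * \<i>)*(\<Sum>n\<in>F. dinv r n * integral {0..1} (%t. gv k l r (chord eta t) * chord eta t powi (n-1) * chord' eta t))"
 unfolding ch_def sum_distrib_left by (intro sum.cong refl) (simp only: mult_ac)
 also have "(\<Sum>n\<in>F. dinv r n * integral {0..1} (%t. gv k l r (chord eta t) * chord eta t powi (n-1) * chord' eta t)) =
 integral {0..1} (%t. \<Sum>n\<in>F. dinv r n*(gv k l r (chord eta t) * chord eta t powi (n-1) * chord' eta t))"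
 unfolding integral_mult_right[symmetric] by (rule integral_sum[symmetric,OF F(1)]) (intro integrable_on_mult_right int)
 also have "(%t. \<Sum>n\<in>F. dinv r n*(gv k l r (chord eta t) * chord eta t powi (n-1) * chord' eta t))=(%t. gv k l r (chord eta t)*(?P t * chord' eta t))"
 unfolding sum_distrib_left sum_distrib_right by (intro ext sum.cong refl) (simp only: mult_ac)
 finally have "norm (\<Sum>n\<in>F. dinv r n * ch r n)=1/(2 * pi) * norm (integral {0..1} (%t. gv k l r (chord eta t)*(?P t * chord' eta t)))"
 by (simp add: norm_mult norm_divide)
 also have "... <= 1/(2 * pi) * integral {0..1} (%t. (2 * pi)*(B * exp (- (\<bar>e/r/2*(sin eta)\<^sup>2\<bar> * (sin (pi * t))\<^sup>2))))"
 proof (intro mult_left_mono integral_norm_bound_integral)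
 show "(%t. gv k l r (chord eta t)*(?P t * chord' eta t)) integrable_on {0..1}"
 by (intro integrable_continuous_interval continuous_on_mult gvc[OF Z] continuous_on_sum powc continuous_chord continuous_on_const)
 show "(%t. (2 * pi)*(B * exp (- (\<bar>e/r/2*(sin eta)\<^sup>2\<bar> * (sin (pi * t))\<^sup>2)))) integrable_on {0..1}"
 by (intro integrable_continuous_interval continuous_intros)
 fix t :: real assume t: "t \<in> {0..1}"
 have "0<=e/r/2*(sin eta)\<^sup>2" using e r by simp
 hence ab: "\<bar>e/r/2*(sin eta)\<^sup>2\<bar> * (sin (pi * t))\<^sup>2=e/r/2*(sin eta * sin (pi * t))\<^sup>2"
 by (simp only: abs_of_nonneg power_mult_distrib mult.assoc)
 have "norm (gv k l r (chord eta t)*(?P t * chord' eta t))=cmod (gv k l r (chord eta t))*(cmod (?P t) * cmod (chord' eta t))" by (simp only: norm_mult)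
 also have "... <= (B * exp (- (e/r/2*(sin eta * sin (pi * t))\<^sup>2)))*(2 * pi)"
 by (rule mult_mono[OF gvb[OF Z] Pb[OF t]]) (use B0 in \<open>auto\<close>)
 finally show "norm (gv k l r (chord eta t)*(?P t * chord' eta t))<=(2 * pi)*(B * exp (- (\<bar>e/r/2*(sin eta)\<^sup>2\<bar> * (sin (pi * t))\<^sup>2)))"
 unfolding ab by (simp only: mult_ac)
 qed simp
 also have "... = B * integral {0..1} (%t. exp (- (\<bar>e/r/2*(sin eta)\<^sup>2\<bar> * (sin (pi * t))\<^sup>2)))" by simp
 finally show ?thesis .
 qed
 have chs: "(%n. dinv r n * ch r n) summable_on {0<..}" if Z: "Z r" for r
 proof (rule abs_summable_summable)
 have g: "good k r" using Z by (auto simp: Z_def)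
 obtain M where M: "\<And>t. t \<in> {0..1} ==> norm (gv k l r (chord eta t) * chord' eta t)<=M"
 using compact_imp_bounded[OF compact_continuous_image[OF continuous_on_mult[OF gvc[OF Z] continuous_chord(2)] compact_Icc]] unfolding bounded_iff by blast
 have "norm (ch r n)<=1/(2 * pi) * M" if "n \<in> {0<..}" for n
 proof -
 have "norm (integral {0..1} (%t. gv k l r (chord eta t) * chord eta t powi (n-1) * chord' eta t))<=M*(1-0)"
 proof (rule integral_bound)
 show "continuous_on {0..1} (%t. gv k l r (chord eta t) * chord eta t powi (n-1) * chord' eta t)"
 by (intro continuous_on_mult gvc[OF Z] powc continuous_chord)
 fix t :: real assume t: "t \<in> {0..1}"
 have "chord eta t powi (n-1)=chord eta t^nat (n-1)" using that by (simp add: power_int_def)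
 hence "cmod (chord eta t powi (n-1))<=1" using chn(2)[of t] by (simp add: norm_power power_le_one)
 hence "norm (gv k l r (chord eta t) * chord' eta t) * cmod (chord eta t powi (n-1))<=norm (gv k l r (chord eta t) * chord' eta t)*1"
 by (intro mult_left_mono) auto
 moreover have "norm (gv k l r (chord eta t) * chord eta t powi (n-1) * chord' eta t)=norm (gv k l r (chord eta t) * chord' eta t) * cmod (chord eta t powi (n-1))"
 by (simp only: norm_mult mult_ac)
 ultimately show "norm (gv k l r (chord eta t) * chord eta t powi (n-1) * chord' eta t)<=M" using M[OF t] by linarith
 qed simp
 hence "1/(2 * pi) * norm (integral {0..1} (%t. gv k l r (chord eta t) * chord eta t powi (n-1) * chord' eta t))<=1/(2 * pi) * M"
 by (intro mult_left_mono) auto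
 thus ?thesis by (simp add: ch_def norm_mult norm_divide)
 qed
 hence b1: "norm (dinv r n * ch r n)<=norm (dinv r n)*(1/(2 * pi) * M)" if "n \<in> {0<..}" for n
 unfolding norm_mult using that by (intro mult_left_mono) auto
 have s1: "(%n. norm (dinv r n)*(1/(2 * pi) * M)) summable_on {0<..}"
 by (rule summable_on_cmult_left[OF summable_on_subset_banach[OF dinv(1)[OF g]]]) simp
 show "(%n. norm (dinv r n * ch r n)) summable_on {0<..}"
 by (rule Infinite_Sum.abs_summable_on_comparison_test'[OF s1 b1])
 qed
 have "((%r. \<Sum>\<^sub>\<infinity>n\<in>{0<..}. dinv r n * \<delta>v k l r n) \<longlongrightarrow>
 1/(2 * pi)*(integral (side False (max eta ths) pi) phi + integral (side True (max eta ths) pi) phi)) (at_right 0)"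
 unfolding phi_def
 proof (rule minus_core[where b = "1-C0" and ch=ch])
 show "0 <= eta" "eta <= pi" "0 < 1-C0" using eta C01 by auto
 show "1-C0<=cmod (1-of_real c/cis th)" if "th \<in> {- pi..pi}" "eta <= \<bar>th\<bar>" for th
 proof -
 have "cos \<bar>th\<bar> <= cos eta" using that eta by (intro cos_monotone_0_pi_le) auto
 hence "1-C0<=Re (1-of_real c/cis th)" by (simp add: c1 C0_def divide_inverse)
 thus ?thesis using complex_Re_le_cmod order_trans by blast
 qed
 show "\<forall>\<^sub>F r in at_right 0. \<forall>th\<in>{- pi..pi}. eta <= \<bar>th\<bar> --> Q k r (cis th) ~= 0"
 by (intro always_eventually allI ballI impI Q_nz) (use eta in auto)
 show "\<forall>\<^sub>F r in at_right 0. (%n. dinv r n * ch r n) summable_on {0<..}" using evZ by (rule eventually_mono) (rule chs)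
 show "((%r. \<Sum>\<^sub>\<infinity>n\<in>{0<..}. dinv r n * ch r n) \<longlongrightarrow> 0) (at_right 0)"
 proof (rule Lim_null_comparison)
 show "\<forall>\<^sub>F r in at_right 0. norm (\<Sum>\<^sub>\<infinity>n\<in>{0<..}. dinv r n * ch r n)<=B * integral {0..1} (%t. exp (- (\<bar>e/r/2*(sin eta)\<^sup>2\<bar> * (sin (pi * t))\<^sup>2)))"
 using evZ by (rule eventually_mono) (intro norm_infsum_le_finite chs fin)
 have "filterlim (%r. (e/2*(sin eta)\<^sup>2) * inverse r) at_top (at_right 0)"
 by (rule filterlim_tendsto_pos_mult_at_top[OF tendsto_const _ filterlim_inverse_at_top_right]) (use e S0 in simp)
 moreover have "(%r. (e/2*(sin eta)\<^sup>2) * inverse r)=(%r. e/r/2*(sin eta)\<^sup>2)" by (simp only: divide_inverse mult_ac)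
 ultimately have "filterlim (%r. e/r/2*(sin eta)\<^sup>2) at_top (at_right 0)" by (simp only:)
 from tendsto_mult_left[OF filterlim_compose[OF chord_integral_decay this],of B]
 show "((%r. B * integral {0..1} (%t. exp (- (\<bar>e/r/2*(sin eta)\<^sup>2\<bar> * (sin (pi * t))\<^sup>2)))) \<longlongrightarrow> 0) (at_right 0)" by simp
 qed
 show "\<forall>\<^sub>F r in at_right 0. \<forall>n>0. \<delta>v k l r n=fourier_coeff (side_lo False eta pi) (side_hi False eta pi) (%th. gv k l r (cis th)) (- n) +
 fourier_coeff (side_lo True eta pi) (side_hi True eta pi) (%th. gv k l r (cis th)) (- n)+ch r n"
 using evZ
 proof (eventually_elim,intro allI impI)
 fix r and n :: int assume Z: "Z r"
 have g: "good k r" and r: "r > 0" "- int (A r)<=t r+int k" and nd: "\<And>i. i < k ==> R2 < nd r i" using Z by (auto simp: Z_def good_def)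
 have hol1: "gv k l r holomorphic_on {z. Re z < R2} - {0}"
 by (rule gv_holomorphic(1)[where ?R2.0=R2,OF r(1)]) (use nd R2 in auto)
 have hol2: "Q k r z ~= 0" if "z ~= 0" "Re z < R2" for z
 by (rule gv_holomorphic(2)[where ?R2.0=R2,OF r(1) _ _ that]) (use nd R2 in auto)
 let ?C = "of_real (rho r) powi x r*(gam r (t r+int k)/gam r (t r))"
 let ?G = "gsym r (A r) (d r) (t r+int k) (y r-l+int (nat (- (t r+int k))))"
 let ?b = "coef_sym r (A r) (d r) (t r+int k) (y r-l+int (nat (- (t r+int k))))"
 have rhoR: "0 < rho r * R" using rho_pos R by simp
 have "rho r * R < 2*(1/2)" using Z R rho_pos[of r] by (intro mult_strict_mono) (auto simp: Z_def)
 moreover have "1<=exp (r*(real_of_int (nat (- (t r+int k)))+1/2))" using r(1) by simp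
 ultimately have rad: "rho r * R < exp (r*(real_of_int (nat (- (t r+int k)))+1/2))" by linarith
 have zr: "of_real R * cis th ~= 0" "Re (of_real R * cis th) < R2" for th
 proof -
 show "of_real R * cis th ~= 0" using R by simp
 have "R * cos th<=R*1" using R by (intro mult_left_mono) auto
 moreover have "Re (of_real R * cis th)=R * cos th" by simp
 ultimately show "Re (of_real R * cis th) < R2" using R R2 by linarith
 qed
 have eq: "?C * ?G (of_real (rho r * R) * cis th)=gv k l r (of_real R * cis th)" for th
 proof -
 have "of_real (rho r * R) * cis th = of_real (rho r)*(of_real R * cis th)" by (simp only: of_real_mult mult.assoc)
 hence "?G (of_real (rho r * R) * cis th) * ?C=gv k l r (of_real R * cis th)"
 using gsym_gv[OF g zr(1) hol2[OF zr],where l=l] by (simp only:)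
 thus ?thesis by (simp only: mult.commute)
 qed
 have "of_real (?b (- n) * rho r powi (- n)) = of_real R powi n*(of_real (?b (- n)*(rho r * R) powi (- n)) :: complex)"
 using R by (simp add: power_int_mult_distrib power_int_minus)
 also have "(of_real (?b (- n)*(rho r * R) powi (- n)) :: complex)=fourier_coeff (- pi) pi (%th. ?G (of_real (rho r * R) * cis th)) (- n)"
 by (rule laurent_on_fourier_coeff[OF laurent_on_coef_sym[OF r(1) rhoR rad r(2)],symmetric])
 finally have "\<delta>v k l r n = of_real R powi n*(?C * fourier_coeff (- pi) pi (%th. ?G (of_real (rho r * R) * cis th)) (- n))"
 unfolding \<delta>v_def by (simp only: mult_ac)
 also have "?C * fourier_coeff (- pi) pi (%th. ?G (of_real (rho r * R) * cis th)) (- n)=fourier_coeff (- pi) pi (%th. gv k l r (of_real R * cis th)) (- n)"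
 unfolding fourier_coeff_cmult[symmetric] eq ..
 finally have dv: "\<delta>v k l r n = of_real R powi n * fourier_coeff (- pi) pi (%th. gv k l r (of_real R * cis th)) (- n)" .
 \<comment> \<open>The exponent \<open>n - 1\<close> turns the contour integrals of
   \<open>keyhole_integral\<close> into Fourier coefficients, because the measure contributes
   \<open>\<i> * z\<close>.\<close>
 have fh: "(%z. gv k l r z * z powi (n-1)) holomorphic_on {z. Re z < R2} - {0}"
 by (intro holomorphic_intros hol1) auto
 have p1: "z powi (n-1) * z=z powi n" if "z ~= 0" for z :: complex
 using power_int_add_1[of z "n-1"] that by simp
 have a: "gv k l r z * z powi (n-1) * \<i> * z = \<i> * (gv k l r z * z powi n)" if "z ~= 0" for z
 unfolding p1[OF that,symmetric] by (simp only: mult_ac)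
 have a0: "gv k l r (of_real R * cis th)*(of_real R * cis th) powi (n-1) * of_real R * \<i> * cis th =
 \<i> * (of_real R powi n*(gv k l r (of_real R * cis th) * cis (- (of_int (- n) * th))))" for th
 proof -
 have "(of_real R * cis th) powi n = of_real R powi n * cis (- (of_int (- n) * th))" by (simp add: power_int_mult_distrib cis_power_int)
 moreover have "gv k l r (of_real R * cis th)*(of_real R * cis th) powi (n-1) * of_real R * \<i> * cis th =
 gv k l r (of_real R * cis th)*(of_real R * cis th) powi (n-1) * \<i> * (of_real R * cis th)" by (simp only: mult_ac)
 ultimately show ?thesis unfolding a[OF zr(1)] by (simp only: mult_ac)
 qed
 have a1: "gv k l r (cis th) * cis th powi (n-1) * \<i> * cis th = \<i> * (gv k l r (cis th) * cis (- (of_int (- n) * th)))" for th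
 unfolding a[OF cis_neq_zero] by (simp add: cis_power_int)
 have key: "\<i> * (of_real R powi n * integral {- pi..pi} (%th. gv k l r (of_real R * cis th) * cis (- (of_int (- n) * th)))) =
 \<i> * integral {- pi..- eta} (%th. gv k l r (cis th) * cis (- (of_int (- n) * th))) +
 \<i> * integral {eta..pi} (%th. gv k l r (cis th) * cis (- (of_int (- n) * th))) +
 integral {0..1} (%t. gv k l r (chord eta t) * chord eta t powi (n-1) * chord' eta t)"
 using keyhole_integral[OF eta(1,4) R(1) R(2)[unfolded C0_def] R2(1)[unfolded C0_def] fh] unfolding a0 a1 integral_mult_right .
 have nzi: "2 * complex_of_real pi * \<i> ~= 0" by simp
 have "\<delta>v k l r n=1/(2 * of_real pi * \<i>)*(\<i> * (of_real R powi n * integral {- pi..pi} (%th. gv k l r (of_real R * cis th) * cis (- (of_int (- n) * th)))))"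
 unfolding dv fourier_coeff_def by simp
 also have "... = fourier_coeff (side_lo False eta pi) (side_hi False eta pi) (%th. gv k l r (cis th)) (- n) +
 fourier_coeff (side_lo True eta pi) (side_hi True eta pi) (%th. gv k l r (cis th)) (- n)+ch r n"
 unfolding key distrib_left ch_def fourier_coeff_def side_lo_def side_hi_def by simp
 finally show "\<delta>v k l r n=fourier_coeff (side_lo False eta pi) (side_hi False eta pi) (%th. gv k l r (cis th)) (- n) +
 fourier_coeff (side_lo True eta pi) (side_hi True eta pi) (%th. gv k l r (cis th)) (- n)+ch r n" .
 qed
 qed
 thus ?thesis unfolding eta(6) .
qed

lemma minus_limit:
 fixes k :: nat and l :: int and phi :: "real => complex"
 assumes "\<tau> = 0 ==> 0 < ths"
 defines "phi \<equiv> %th. (of_real c * cis th) powi l * inverse ((1-of_real c/cis th)^k)"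
 shows "((%r. of_real (\<Sum>\<^sub>\<infinity>n\<in>{0<..}. coef_inv r (A r) (d r) (t r) (x r) n *
 coef_sym r (A r) (d r) (t r+int k) (y r-l+int (nat (- (t r+int k)))) (- n)) * gam r (t r+int k)/gam r (t r)) \<longlongrightarrow>
 1/(2 * pi)*(integral (side False ths pi) phi + integral (side True ths pi) phi)) (at_right 0)"
proof -
 have "((%r. \<Sum>\<^sub>\<infinity>n\<in>{0<..}. dinv r n * \<delta>v k l r n) \<longlongrightarrow>
 1/(2 * pi)*(integral (side False ths pi) phi + integral (side True ths pi) phi)) (at_right 0)"
 unfolding phi_def using minus_limit_zero[OF _ assms(1)] minus_limit_pos \<tau> by (cases "\<tau> = 0") auto
 thus ?thesis
 by (rule Lim_transform_eventually) (rule eventually_mono[OF evp],rule minus_pairing[symmetric])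
qed

end

section \<open>The incomplete beta kernel as an integral over arcs\<close>

lemma point_neq_1:
 assumes "0 < c" "c<=1" "th \<in> {- pi..pi}" "th=0 ==> c < 1"
 shows "of_real c * cis th ~= 1"
proof
 assume e: "of_real c * cis th=1"
 hence "cmod (of_real c * cis th)=1" by simp
 hence c: "c=1" using assms(1) by (simp add: norm_mult)
 hence "cos \<bar>th\<bar> = cos 0" using e by (simp add: complex_eq_iff)
 hence "\<bar>th\<bar> = 0" using cos_inj_pi[of "\<bar>th\<bar>" 0] assms(3) by auto
 thus False using assms(4) c by simp
qed

text \<open>For real \<open>z\<close> an admissible path is a closed loop. A clockwise circle
  starting at its rightmost point runs through the lower half-plane first, and its integral vanishes
  when no singularity is enclosed.\<close>

lemma small_loop_integral:
 fixes a \<epsilon> :: real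
 assumes "0 < \<epsilon>" "f holomorphic_on S" "convex S" "path_image (part_circlepath (of_real a) \<epsilon> 0 (- 2 * pi)) \<subseteq> S" "open S"
 and I: "a - \<epsilon> \<in> I"
 shows "crossing_path I (of_real (a + \<epsilon>)) (part_circlepath (of_real a) \<epsilon> 0 (- 2 * pi))"
 "contour_integral (part_circlepath (of_real a) \<epsilon> 0 (- 2 * pi)) f=0"
proof -
 let ?g = "part_circlepath (of_real a) \<epsilon> 0 (- 2 * pi)"
 have g: "?g u = of_real a + of_real \<epsilon> * cis (- (2 * pi * u))" for u
 by (simp add: part_circlepath_def linepath_def cis_conv_exp mult_ac)
 have im: "Im (?g u) = - (\<epsilon> * sin (2 * pi * u))" for u unfolding g by simp
 have ends: "?g 0 = of_real (a + \<epsilon>)" "?g 1 = of_real (a + \<epsilon>)" unfolding g by (simp_all add: complex_eq_iff)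
 have half: "?g (1/2) = of_real (a - \<epsilon>)" unfolding g by (simp add: complex_eq_iff)
 show "crossing_path I (of_real (a + \<epsilon>)) ?g"
 unfolding crossing_path_def
 proof (intro conjI bexI[of _ "1/2"] ballI)
 show "?g (1/2) \<in> complex_of_real ` I" unfolding half by (rule imageI[OF I])
 show "pathstart ?g=cnj (of_real (a + \<epsilon>))" "pathfinish ?g = of_real (a + \<epsilon>)"
 using ends by (simp_all only: pathstart_def pathfinish_def complex_cnj_complex_of_real)
 show "Im (?g u) < 0" if "u \<in> {0<..<1/2}" for u
 proof -
 have "0 < sin (2 * pi * u)" using that by (intro sin_gt_zero) auto
 thus ?thesis unfolding im using assms(1) by simp
 qed
 show "0 < Im (?g u)" if "u \<in> {1/2<..<1}" for u
 proof -
 have "sin (2 * pi * u) < 0" using that by (intro sin_lt_zero) auto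
 thus ?thesis unfolding im using assms(1) by (simp add: mult_pos_neg)
 qed
 qed auto
 have "(f has_contour_integral 0) ?g"
 by (rule Cauchy_theorem_convex_simple[OF assms(2,3) _ assms(4)])
 (use ends in \<open>simp_all only: pathstart_def pathfinish_def valid_path_part_circlepath\<close>)
 thus "contour_integral ?g f=0" by (rule contour_integral_unique)
qed

lemma beta_plus_arc:
 assumes c: "0 < c" "c<=1" and ths: "0<=ths" "ths<=pi" "ths=0 ==> c < 1"
 shows "beta_plus (int k) l (of_real c * cis ths) =
 1/(2 * pi) * integral {- ths..ths} (%th. (1-of_real c * cis th)^k*(of_real c * cis th) powi (- l))"
proof -
 let ?z = "complex_of_real c * cis ths"
 let ?f = "%w :: complex. (1-w) powi int k * w powi (- l-1)"
 have z: "Im ?z >= 0" "?z ~= 0" "?z ~= 1"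
 using c ths sin_ge_zero[of ths] point_neq_1[of c ths] by auto
 have hol: "?f holomorphic_on - {0}" by (simp add: power_int_of_nat) (intro holomorphic_intros,auto)
 have I: "{0<..<1 :: real} = {0<..<1} \<or> {0<..<1 :: real} = {..<0}" by simp
 show ?thesis
 proof (cases "ths=0")
 case True
 have c1: "c < 1" using ths True by simp
 \<comment> \<open>The loop through \<open>c\<close> and \<open>c/2\<close> lies in the right
   half-plane and so avoids the pole at 0.\<close>
 let ?g = "part_circlepath (of_real (3/4 * c)) (c/4) 0 (- 2 * pi)"
 have im: "path_image ?g \<subseteq> {w. 0 < Re w}"
 proof
 fix w assume "w \<in> path_image ?g"
 hence "cmod (w-of_real (3/4 * c))=c/4" using c by (auto simp: path_image_part_circlepath' norm_mult)
 hence "\<bar>Re (w-of_real (3/4 * c))\<bar> <= c/4" using abs_Re_le_cmod[of "w-of_real (3/4 * c)"] by simp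
 moreover have "Re (w-of_real (3/4 * c))=Re w-3/4 * c" by simp
 ultimately have "0 < Re w" using c by linarith
 thus "w \<in> {w. 0 < Re w}" by simp
 qed
 have h: "?f holomorphic_on {w. 0 < Re w}" by (rule holomorphic_on_subset[OF hol]) auto
 have "3/4 * c-c/4 \<in> {0<..<1}" using c c1 by auto
 note L=small_loop_integral[OF _ h convex_halfspace_Re_gt im open_halfspace_Re_gt this]
 have e: "3/4 * c+c/4=c" by simp
 have "crossing_path {0<..<1} ?z ?g" using L(1) c True unfolding e by simp
 from inc_beta_eq[OF I z this,of "int k" l] show ?thesis
 unfolding beta_plus_def using L(2) c True by simp
 next
 case False
 hence t0: "0 < ths" using ths by simp
 \<comment> \<open>The arc of radius \<open>c\<close> crosses the real axis at \<open>c\<close>,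
   which is not in the open interval if \<open>c = 1\<close>. Dipping to radius \<open>c/2\<close>
   repairs this and is a homotopy in the punctured plane, where the integrand is holomorphic as the
   exponent of \<open>1 - w\<close> is nonnegative.\<close>
 define m where "m=(%t. c-c/2 * sin (pi * t))"
 define g where "g=(%t. of_real (m t) * cis (ths*(2 * t-1)))"
 let ?h = "part_circlepath 0 c (- ths) ths"
 have h: "?h t = of_real c * cis (ths*(2 * t-1))" for t
 by (simp add: part_circlepath_def linepath_def cis_conv_exp algebra_simps)
 have m0: "c/2<=m t" "m t<=c" if "t \<in> {0..1}" for t
 proof -
 have "0<=sin (pi * t)" using that by (intro sin_ge_zero) (auto simp: mult_left_le)
 moreover have "c/2 * sin (pi * t)<=c/2*1" using c by (intro mult_left_mono) auto
 ultimately show "c/2<=m t" "m t<=c" using c by (auto simp: m_def)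
 qed
 define g' where "g'=(%t. of_real (- (c/2*(cos (pi * t) * pi))) * cis (ths*(2 * t-1)) + of_real (m t)*(of_real (ths*2)*(\<i> * cis (ths*(2 * t-1)))))"
 have gd: "(g has_vector_derivative g' t) (at t)" for t
 proof -
 have 1: "((%t. complex_of_real (m t)) has_vector_derivative of_real (- (c/2*(cos (pi * t) * pi)))) (at t)"
 unfolding m_def by (intro has_vector_derivative_of_real) (auto intro!: derivative_eq_intros)
 have 2: "((%t. cis (ths*(2 * t-1))) has_vector_derivative of_real (ths*2)*(\<i> * cis (ths*(2 * t-1)))) (at t)"
 unfolding has_vector_derivative_complex_iff o_def by (auto intro!: derivative_eq_intros)
 show ?thesis unfolding g_def g'_def
 using has_vector_derivative_mult[OF 1 2] by (simp add: add.commute)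
 qed
 have gc: "continuous_on {0..1} g'" unfolding g'_def m_def by (intro continuous_intros)
 have vg: "valid_path g" unfolding valid_path_def
 by (intro C1_differentiable_imp_piecewise) (auto simp: C1_differentiable_on_def intro!: exI[of _ g'] gd gc)
 have ends: "pathstart g=cnj ?z" "pathfinish g = ?z" by (simp_all add: pathstart_def pathfinish_def g_def m_def cis_cnj)
 have hends: "pathstart ?h=cnj ?z" "pathfinish ?h = ?z" unfolding pathstart_def pathfinish_def h by (simp_all add: cis_cnj)
 have cp: "crossing_path {0<..<1} ?z g"
 unfolding crossing_path_def
 proof (intro conjI bexI[of _ "1/2"] ballI vg ends)
 have "g (1/2) = of_real (c/2)" by (simp add: g_def m_def)
 moreover have "c/2 \<in> {0<..<1}" using c by auto
 ultimately show "g (1/2) \<in> complex_of_real ` {0<..<1}" by (rule image_eqI)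
 fix u :: real
 have Im: "Im (g u)=m u * sin (ths*(2 * u-1))" by (simp add: g_def)
 show "Im (g u) < 0" if u: "u \<in> {0<..<1/2}"
 proof -
 have "ths*(1-2 * u) < ths*1" "0 < ths*(1-2 * u)" using u t0 by (auto intro!: mult_strict_left_mono)
 hence "0 < sin (ths*(1-2 * u))" using ths by (intro sin_gt_zero) auto
 moreover have "sin (ths*(2 * u-1)) = - sin (ths*(1-2 * u))" by (simp add: sin_minus[symmetric] algebra_simps)
 moreover have "0 < m u" using m0(1)[of u] u c by auto
 ultimately show ?thesis unfolding Im by (simp add: mult_pos_neg)
 qed
 show "0 < Im (g u)" if u: "u \<in> {1/2<..<1}"
 proof -
 have "ths*(2 * u-1) < ths*1" "0 < ths*(2 * u-1)" using u t0 by (auto intro!: mult_strict_left_mono)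
 hence "0 < sin (ths*(2 * u-1))" using ths by (intro sin_gt_zero) auto
 moreover have "0 < m u" using m0(1)[of u] u c by auto
 ultimately show ?thesis unfolding Im by simp
 qed
 qed auto
 have "homotopic_paths (- {0}) g ?h"
 proof (rule homotopic_paths_linear)
 show "closed_segment (g t) (?h t) \<subseteq> - {0}" if t: "t \<in> {0..1}" for t
 proof
 fix w assume "w \<in> closed_segment (g t) (?h t)"
 then obtain u where u: "0<=u" "u<=1" "w=(1-u) *\<^sub>R g t+u *\<^sub>R ?h t" by (auto simp: closed_segment_def)
 have "w = of_real ((1-u) * m t+u * c) * cis (ths*(2 * t-1))"
 unfolding u(3) h by (simp add: g_def scaleR_conv_of_real algebra_simps)
 moreover have "0 < (1-u) * m t+u * c"
 proof -
 have "(1-u)*(c/2)+u*(c/2)<=(1-u) * m t+u * c" using u m0[OF t] c by (intro add_mono mult_left_mono) auto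
 moreover have "(1-u)*(c/2)+u*(c/2)=c/2" by (simp only: distrib_right[symmetric]) simp
 ultimately show ?thesis using c by linarith
 qed
 ultimately show "w \<in> - {0}" by (simp add: less_imp_neq[symmetric] del: of_real_add of_real_mult)
 qed
 qed (use vg ends hends in \<open>simp_all only: valid_path_imp_path valid_path_part_circlepath\<close>)
 hence "contour_integral g ?f=contour_integral ?h ?f"
 by (rule Cauchy_theorem_homotopic_paths) (use hol vg in \<open>auto simp: valid_path_part_circlepath\<close>)
 also have "... = integral {- ths..ths} (%t. ?f (0 + of_real c * cis t) * of_real c * \<i> * cis t)"
 by (rule contour_integral_part_circlepath_eq) (use t0 in simp)
 also have "... = integral {- ths..ths} (%th. \<i> * ((1-of_real c * cis th)^k*(of_real c * cis th) powi (- l)))"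
 proof (rule integral_cong)
 fix th
 have "(of_real c * cis th) powi (- l-1)*(of_real c * cis th)=(of_real c * cis th) powi (- l)"
 using power_int_add_1[of "of_real c * cis th" "- l-1"] c by simp
 note 1=this
 have "?f (0 + of_real c * cis th) * of_real c * \<i> * cis th = \<i> * ((1-of_real c * cis th) powi int k*((of_real c * cis th) powi (- l-1)*(of_real c * cis th)))"
 by (simp only: add_0 mult_ac)
 thus "?f (0 + of_real c * cis th) * of_real c * \<i> * cis th = \<i> * ((1-of_real c * cis th)^k*(of_real c * cis th) powi (- l))"
 unfolding 1 power_int_of_nat .
 qed
 finally have ci: "contour_integral g ?f = \<i> * integral {- ths..ths} (%th. (1-of_real c * cis th)^k*(of_real c * cis th) powi (- l))" by simp
 show ?thesis unfolding beta_plus_def inc_beta_eq[OF I z cp] ci by simp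
 qed
qed

text \<open>The path runs clockwise from the conjugate of \<open>z\<close> to \<open>- c\<close> and
  on to \<open>z\<close>, against the orientation of the arcs; this causes the sign. It avoids the
  pole at 1, because \<open>ths = 0\<close> forces \<open>c < 1\<close>.\<close>

lemma beta_minus_arc:
 assumes c: "0 < c" "c<=1" and ths: "0<=ths" "ths<=pi" "ths=0 ==> c < 1"
 shows "beta_minus (- int k) l (of_real c * cis ths) =
 - (1/(2 * pi)*(integral {- pi..- ths} (%th. inverse ((1-of_real c * cis th)^k)*(of_real c * cis th) powi (- l)) +
 integral {ths..pi} (%th. inverse ((1-of_real c * cis th)^k)*(of_real c * cis th) powi (- l))))"
proof -
 let ?z = "complex_of_real c * cis ths"
 let ?f = "%w :: complex. (1-w) powi (- int k) * w powi (- l-1)"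
 let ?F = "%th. inverse ((1-of_real c * cis th)^k)*(of_real c * cis th) powi (- l)"
 have z: "Im ?z >= 0" "?z ~= 0" "?z ~= 1"
 using c ths sin_ge_zero[of ths] point_neq_1[of c ths] by auto
 have hol: "?f holomorphic_on - {0,1}" by (intro holomorphic_intros) auto
 have op: "open (- {0,1 :: complex})" by (intro open_Compl finite_imp_closed) auto
 have I: "{..<0 :: real} = {0<..<1} \<or> {..<0 :: real} = {..<0}" by simp
 show ?thesis
 proof (cases "ths=pi")
 case True
 \<comment> \<open>The loop through \<open>- c\<close> and \<open>- 3 * c\<close> lies in the left
   half-plane, away from both singularities.\<close>
 let ?g = "part_circlepath (of_real (- 2 * c)) c 0 (- 2 * pi)"
 have im: "path_image ?g \<subseteq> {w. Re w < 0}"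
 proof
 fix w assume "w \<in> path_image ?g"
 hence "cmod (w-of_real (- 2 * c))=c" using c by (auto simp: path_image_part_circlepath' norm_mult)
 hence "\<bar>Re (w-of_real (- 2 * c))\<bar> <= c" using abs_Re_le_cmod[of "w-of_real (- 2 * c)"] by simp
 thus "w \<in> {w. Re w < 0}" using c by simp
 qed
 have h: "?f holomorphic_on {w. Re w < 0}" by (rule holomorphic_on_subset[OF hol]) auto
 have "- 2 * c-c \<in> {..<0}" using c by auto
 note L=small_loop_integral[OF c(1) h convex_halfspace_Re_lt im open_halfspace_Re_lt this]
 have e: "- 2 * c+c = - c" by simp
 have "crossing_path {..<0} ?z ?g" using L(1) True unfolding e by simp
 from inc_beta_eq[OF I z this,of "- int k" l] show ?thesis
 unfolding beta_minus_def using L(2) True by simp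
 next
 case False
 hence t0: "ths < pi" using ths by simp
 let ?g1 = "part_circlepath 0 c (- ths) (- pi)" and ?g2 = "part_circlepath 0 c pi ths"
 let ?h1 = "part_circlepath 0 c (- pi) (- ths)" and ?h2 = "part_circlepath 0 c ths pi"
 have g1: "?g1 t = of_real c * cis (- (ths+t*(pi-ths)))" for t
 by (simp add: part_circlepath_def linepath_def cis_conv_exp algebra_simps)
 have g2: "?g2 t = of_real c * cis (pi-t*(pi-ths))" for t
 by (simp add: part_circlepath_def linepath_def cis_conv_exp algebra_simps)
 have ends: "pathstart ?g1=cnj ?z" "pathfinish ?g1 = of_real (- c)" "pathstart ?g2 = of_real (- c)" "pathfinish ?g2 = ?z"
 unfolding pathstart_def pathfinish_def g1 g2 by (simp_all add: cis_cnj complex_eq_iff)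
 have cp: "crossing_path {..<0} ?z (?g1 +++ ?g2)"
 unfolding crossing_path_def
 proof (intro conjI bexI[of _ "1/2"] ballI)
 show "valid_path (?g1 +++ ?g2)" using ends by (intro valid_path_join valid_path_part_circlepath) simp
 show "pathstart (?g1 +++ ?g2)=cnj ?z" "pathfinish (?g1 +++ ?g2) = ?z" using ends by simp_all
 have "(?g1 +++ ?g2) (1/2) = of_real (- c)" using ends(2) by (simp add: joinpaths_def pathfinish_def)
 moreover have "- c \<in> {..<0}" using c by simp
 ultimately show "(?g1 +++ ?g2) (1/2) \<in> complex_of_real ` {..<0}" by (rule image_eqI)
 fix u :: real
 show "Im ((?g1 +++ ?g2) u) < 0" if u: "u \<in> {0<..<1/2}"
 proof -
 have "(2 * u)*(pi-ths) < 1*(pi-ths)" "0 < (2 * u)*(pi-ths)" using u t0 by (auto intro!: mult_strict_right_mono)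
 hence "0 < sin (ths+(2 * u)*(pi-ths))" using ths by (intro sin_gt_zero) auto
 moreover have "(?g1 +++ ?g2) u = of_real c * cis (- (ths+(2 * u)*(pi-ths)))" using u by (simp add: joinpaths_def g1)
 moreover have "Im (of_real c * cis (- X)) = - (c * sin X)" for X by simp
 ultimately show ?thesis using c(1) by (simp only: neg_less_0_iff_less mult_pos_pos)
 qed
 show "0 < Im ((?g1 +++ ?g2) u)" if u: "u \<in> {1/2<..<1}"
 proof -
 have "(2 * u-1)*(pi-ths) < 1*(pi-ths)" "0 < (2 * u-1)*(pi-ths)" using u t0 by (auto intro!: mult_strict_right_mono)
 hence "0 < sin (pi-(2 * u-1)*(pi-ths))" using ths by (intro sin_gt_zero) auto
 moreover have "(?g1 +++ ?g2) u = of_real c * cis (pi-(2 * u-1)*(pi-ths))" using u by (simp add: joinpaths_def g2)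
 ultimately show ?thesis using c by (simp del: sin_pi_minus)
 qed
 qed auto
 have avoid: "path_image (part_circlepath 0 c a b) \<subseteq> - {0,1}" if ab: "a<=b" "{a..b} \<subseteq> {- pi..- ths} \<or> {a..b} \<subseteq> {ths..pi}" for a b
 proof
 fix w assume "w \<in> path_image (part_circlepath 0 c a b)"
 hence "w \<in> (%x. 0 + of_real c * cis x) ` {a..b}"
 using ab(1) by (simp only: path_image_part_circlepath' closed_segment_eq_real_ivl if_True)
 then obtain th where "w=0 + of_real c * cis th" "th \<in> {a..b}" by (rule imageE)
 hence w: "w = of_real c * cis th" "th \<in> {a..b}" by simp_all
 have "w ~= 1" unfolding w(1) by (rule point_neq_1[OF c]) (use w(2) ab ths in auto)
 thus "w \<in> - {0,1}" using w c by auto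
 qed
 have i: "?f contour_integrable_on ?h1" "?f contour_integrable_on ?h2"
 by (rule contour_integrable_holomorphic_simple[OF hol op valid_path_part_circlepath avoid],use ths in auto)+
 have rv: "?g1=reversepath ?h1" "?g2=reversepath ?h2" by (simp_all add: reversepath_part_circlepath)
 have ci: "contour_integral (part_circlepath 0 c a b) ?f = \<i> * integral {a..b} ?F" if "a < b" for a b
 proof -
 have "contour_integral (part_circlepath 0 c a b) ?f=integral {a..b} (%t. ?f (0 + of_real c * cis t) * of_real c * \<i> * cis t)"
 by (rule contour_integral_part_circlepath_eq[OF that])
 also have "... = integral {a..b} (%th. \<i> * ?F th)"
 proof (rule integral_cong)
 fix th
 have 1: "(of_real c * cis th) powi (- l-1)*(of_real c * cis th)=(of_real c * cis th) powi (- l)"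
 using power_int_add_1[of "of_real c * cis th" "- l-1"] c by simp
 have 2: "(1-of_real c * cis th) powi (- int k)=inverse ((1-of_real c * cis th)^k)" by (simp only: power_int_minus power_int_of_nat)
 have "?f (0 + of_real c * cis th) * of_real c * \<i> * cis th = \<i> * ((1-of_real c * cis th) powi (- int k)*((of_real c * cis th) powi (- l-1)*(of_real c * cis th)))"
 by (simp only: add_0 mult_ac)
 thus "?f (0 + of_real c * cis th) * of_real c * \<i> * cis th = \<i> * ?F th" unfolding 1 2 .
 qed
 finally show ?thesis by simp
 qed
 have "contour_integral (?g1 +++ ?g2) ?f=contour_integral ?g1 ?f+contour_integral ?g2 ?f"
 unfolding rv using i by (intro contour_integral_join contour_integrable_reversepath valid_path_imp_reverse valid_path_part_circlepath)
 also have "... = - (\<i> * integral {- pi..- ths} ?F) + - (\<i> * integral {ths..pi} ?F)"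
 unfolding rv contour_integral_reversepath[OF valid_path_part_circlepath] using t0 by (simp add: ci)
 finally have "contour_integral (?g1 +++ ?g2) ?f = - \<i> * (integral {- pi..- ths} ?F+integral {ths..pi} ?F)" by (simp add: algebra_simps)
 thus ?thesis unfolding beta_minus_def inc_beta_eq[OF I z cp] by simp
 qed
qed

section \<open>The critical angle\<close>

text \<open>The angle of \<open>z_star\<close>; clipping to \<open>[-1, 1]\<close> covers the case of disjoint circles.\<close>

definition star_cos :: "real => real => real" where
 "star_cos \<tau> chi=(1+(exp (- \<tau> / 2))\<^sup>2-(exp (- \<tau> / 4-chi/2))\<^sup>2)/(2 * exp (- \<tau> / 2))"

definition star_angle :: "real => real => real" where
 "star_angle \<tau> chi=arccos (max (- 1) (min 1 (star_cos \<tau> chi)))"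

lemma star_angle:
 shows "0<=star_angle \<tau> chi" "star_angle \<tau> chi<=pi" "cos (star_angle \<tau> chi)=max (- 1) (min 1 (star_cos \<tau> chi))"
 unfolding star_angle_def by (auto intro!: arccos_lbound arccos_ubound cos_arccos)

text \<open>\<open>star_cos\<close> is the value of \<open>cos th\<close> at which both sides would
  agree, and \<open>poisson_den\<close> decreases as \<open>cos th\<close> grows.\<close>

lemma star_angle_below:
 assumes "0 < th" "th < star_angle \<tau> chi"
 shows "poisson_den (exp (- \<tau> / 2)) th < exp (- (chi + \<tau> / 2))"
proof -
 have "cos (star_angle \<tau> chi) < cos th" using assms star_angle[of \<tau> chi] by (intro cos_monotone_0_pi) auto
 hence lt: "max (- 1) (min 1 (star_cos \<tau> chi)) < cos th" unfolding star_angle(3) .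
 have "star_cos \<tau> chi < cos th"
 proof (rule ccontr)
 assume "~ star_cos \<tau> chi < cos th"
 hence "cos th<=min 1 (star_cos \<tau> chi)" by (intro min.boundedI) auto
 hence "cos th<=max (- 1) (min 1 (star_cos \<tau> chi))" by (rule max.coboundedI2)
 thus False using lt by linarith
 qed
 hence "2 * exp (- \<tau> / 2) * star_cos \<tau> chi < 2 * exp (- \<tau> / 2) * cos th" by (intro mult_strict_left_mono) auto
 moreover have "2 * exp (- \<tau> / 2) * star_cos \<tau> chi=1+(exp (- \<tau> / 2))\<^sup>2-(exp (- \<tau> / 4-chi/2))\<^sup>2" by (simp add: star_cos_def)
 moreover have "(exp (- \<tau> / 4-chi/2))\<^sup>2=exp (- (chi + \<tau> / 2))" by (simp add: power2_eq_square exp_add[symmetric])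
 ultimately show ?thesis unfolding poisson_den_def by linarith
qed

lemma star_angle_above:
 assumes "star_angle \<tau> chi < th" "th<=pi"
 shows "exp (- (chi + \<tau> / 2)) < poisson_den (exp (- \<tau> / 2)) th"
proof -
 have "cos th < cos (star_angle \<tau> chi)" using assms star_angle[of \<tau> chi] by (intro cos_monotone_0_pi) auto
 hence lt: "cos th < max (- 1) (min 1 (star_cos \<tau> chi))" unfolding star_angle(3) .
 have "cos th < star_cos \<tau> chi"
 proof (rule ccontr)
 assume "~ cos th < star_cos \<tau> chi"
 hence "min 1 (star_cos \<tau> chi)<=cos th" by (intro min.coboundedI2) auto
 hence "max (- 1) (min 1 (star_cos \<tau> chi))<=cos th" by (intro max.boundedI) auto
 thus False using lt by linarith
 qed
 hence "2 * exp (- \<tau> / 2) * cos th < 2 * exp (- \<tau> / 2) * star_cos \<tau> chi" by (intro mult_strict_left_mono) auto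
 moreover have "2 * exp (- \<tau> / 2) * star_cos \<tau> chi=1+(exp (- \<tau> / 2))\<^sup>2-(exp (- \<tau> / 4-chi/2))\<^sup>2" by (simp add: star_cos_def)
 moreover have "(exp (- \<tau> / 4-chi/2))\<^sup>2=exp (- (chi + \<tau> / 2))" by (simp add: power2_eq_square exp_add[symmetric])
 ultimately show ?thesis unfolding poisson_den_def by linarith
qed

text \<open>For \<tau> = 0 the second circle is centred at the point 1 of the first and has positive
  radius, so the critical point differs from 1. This leaves room for the chord.\<close>

lemma star_angle_0: "0 < star_angle 0 chi"
proof -
 have "star_cos 0 chi < 1" by (simp add: star_cos_def)
 hence "cos (star_angle 0 chi) ~= 1" unfolding star_angle(3) by (auto simp: max_def min_def)
 hence "star_angle 0 chi ~= 0" by auto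
 thus ?thesis using star_angle(1)[of 0 chi] by simp
qed

text \<open>If the circles meet, the law of cosines gives the real part \<open>c * star_cos\<close>.
  Otherwise \<open>star_cos\<close> lies beyond 1 or -1, and the clipped angle 0 or pi gives the
  corresponding real value.\<close>

lemma z_star_eq:
 assumes "0 <= \<tau>"
 shows "z_star \<tau> chi = of_real (exp (- \<tau> / 2)) * cis (star_angle \<tau> chi)"
proof -
 define c where "c=exp (- \<tau> / 2)"
 define D where "D=exp (- \<tau> / 4-chi/2)"
 define kappa where "kappa = star_cos \<tau> chi"
 define C where "C=sphere (0 :: complex) c \<inter> sphere 1 D"
 have c: "0 < c" "c<=1" using assms by (auto simp: c_def)
 have D: "0 < D" by (simp add: D_def)
 have k: "2 * c * kappa = 1+c\<^sup>2-D\<^sup>2" by (simp add: kappa_def star_cos_def c_def D_def)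
 have mem: "z \<in> C \<longleftrightarrow> cmod z=c & Re z=c * kappa" for z
 proof -
 have "cmod (1-z)=D \<longleftrightarrow> (cmod (1-z))\<^sup>2=D\<^sup>2" using D by (simp add: power2_eq_iff_nonneg)
 moreover have "(cmod (1-z))\<^sup>2=1-2 * Re z+(cmod z)\<^sup>2" unfolding cmod_power2 by (simp add: power2_eq_square algebra_simps)
 ultimately show ?thesis using k by (auto simp: C_def dist_norm)
 qed
 have z: "z_star \<tau> chi=(if C ~= {} then (THE z. C = {z,cnj z} & Im z >= 0)
 else if exp (- chi/2) < exp (\<tau> / 4)-exp (- \<tau> / 4) then of_real c
 else if exp (- chi/2) > exp (\<tau> / 4)+exp (- \<tau> / 4) then-of_real c else undefined)"
 unfolding z_star_def C_def c_def D_def Let_def by simp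
 have De: "exp (\<tau> / 4) * D=exp (- chi/2)" "exp (\<tau> / 4) * c=exp (- \<tau> / 4)"
 unfolding D_def c_def by (simp_all add: exp_add[symmetric])
 have lt: "exp (- chi/2) < exp (\<tau> / 4)-exp (- \<tau> / 4) \<longleftrightarrow> D < 1-c"
 proof -
 have "exp (\<tau> / 4) * D < exp (\<tau> / 4)*(1-c) \<longleftrightarrow> D < 1-c" by simp
 thus ?thesis unfolding right_diff_distrib De by simp
 qed
 have gt: "exp (- chi/2) > exp (\<tau> / 4)+exp (- \<tau> / 4) \<longleftrightarrow> D > 1+c"
 proof -
 have "exp (\<tau> / 4)*(1+c) < exp (\<tau> / 4) * D \<longleftrightarrow> 1+c < D" by simp
 thus ?thesis unfolding distrib_left De by simp
 qed
 have ab: "\<bar>kappa\<bar> <= 1" if ne: "C ~= {}"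
 proof -
 obtain w where "w \<in> C" using ne by blast
 hence "\<bar>c * kappa\<bar> <= c" using mem abs_Re_le_cmod[of w] by metis
 thus ?thesis using c by (simp add: abs_mult)
 qed
 consider "\<bar>kappa\<bar> <= 1" | "1 < kappa" | "kappa < - 1" by linarith
 thus ?thesis
 proof cases
 case 1
 let ?w = "of_real c * cis (star_angle \<tau> chi)"
 have cos: "cos (star_angle \<tau> chi) = kappa" using 1 unfolding star_angle(3) kappa_def[symmetric] by auto
 have sn: "0<=sin (star_angle \<tau> chi)" using star_angle[of \<tau> chi] by (intro sin_ge_zero)
 have w: "?w \<in> C" using c by (simp add: mem norm_mult cos)
 have two: "w = ?w \<or> w=cnj ?w" if "w \<in> C" for w
 proof -
 have "(cmod w)\<^sup>2=(cmod ?w)\<^sup>2" "Re w=Re ?w" using that[unfolded mem] w[unfolded mem] by (simp_all only:)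
 hence "(Im w)\<^sup>2=(Im ?w)\<^sup>2" unfolding cmod_power2 by simp
 hence "Im w=Im ?w \<or> Im w = - Im ?w" by (simp only: power2_eq_iff)
 thus ?thesis using \<open>Re w=Re ?w\<close> by (auto simp: complex_eq_iff)
 qed
 have "cnj ?w \<in> C" using w unfolding mem by (simp only: complex_mod_cnj cnj.sel)
 hence C: "C = {?w,cnj ?w}" using w two by blast
 have "(THE z. C = {z,cnj z} & Im z >= 0) = ?w"
 proof (rule the_equality)
 show "C = {?w,cnj ?w} & 0<=Im ?w" using C c sn by simp
 fix v assume v: "C = {v,cnj v} & 0<=Im v"
 hence "v = ?w \<or> v = cnj ?w" using two[of v] by blast
 thus "v = ?w"
 proof
 \<comment> \<open>The conjugate has nonnegative imaginary part only if both points are real, that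
   is for tangent circles.\<close>
 assume e: "v = cnj ?w"
 hence "Im v = - (c * sin (star_angle \<tau> chi))" by simp
 moreover have "0<=c * sin (star_angle \<tau> chi)" using c(1) sn by simp
 moreover have "0<=Im v" using v by blast
 ultimately have "c * sin (star_angle \<tau> chi)=0" by linarith
 hence "Im ?w=0" by simp
 thus ?thesis using e by (simp add: complex_eq_iff)
 qed
 qed
 thus ?thesis unfolding z c_def[symmetric] using w by auto
 next
 case 2
 hence "C = {}" using ab by fastforce
 moreover have "D < 1-c"
 proof -
 have "2 * c*1 < 2 * c * kappa" using 2 c by (intro mult_strict_left_mono) auto
 hence "D\<^sup>2 < (1-c)\<^sup>2" using k by (simp add: power2_diff)
 thus ?thesis using c by (simp add: power2_less_imp_less)
 qed
 moreover have "star_angle \<tau> chi=0" using 2 by (simp add: star_angle_def kappa_def[symmetric])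
 ultimately show ?thesis unfolding z lt c_def[symmetric] by simp
 next
 case 3
 hence "C = {}" using ab by fastforce
 moreover have D: "1+c < D"
 proof -
 have "2 * c * kappa < 2 * c*(- 1)" using 3 c by (intro mult_strict_left_mono) auto
 hence "(1+c)\<^sup>2 < D\<^sup>2" using k by (simp add: power2_sum)
 thus ?thesis using D by (simp add: power2_less_imp_less)
 qed
 moreover have "~ D < 1-c" using D c by linarith
 moreover have "star_angle \<tau> chi=pi" using 3 by (simp add: star_angle_def kappa_def[symmetric])
 ultimately show ?thesis unfolding z lt gt c_def[symmetric] by simp
 qed
qed

section \<open>Gauge factors and the final limit\<close>

text \<open>In the product belonging to a permutation the factors \<open>g i / g (p i)\<close>
  multiply to 1.\<close>

lemma det_gauge:
 fixes g :: "'n::finite => complex"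
 assumes "\<And>i. g i ~= 0"
 shows "det (\<chi> i j. g i/g j * M i j)=det (\<chi> i j. M i j)"
 unfolding Determinants.det_def
proof (rule sum.cong[OF refl])
 fix p :: "'n => 'n" assume "p \<in> {p. p permutes UNIV}"
 hence "(\<Prod>i\<in>UNIV. g (p i))=(\<Prod>i\<in>UNIV. g i)" by (intro prod.permute[symmetric,unfolded o_def]) simp
 hence "(\<Prod>i\<in>UNIV. g i/g (p i))=1" using assms by (simp add: prod_dividef)
 thus "of_int (sign p)*(\<Prod>i\<in>UNIV. (\<chi> i j. g i/g j * M i j) $ i $ p i) = of_int (sign p)*(\<Prod>i\<in>UNIV. (\<chi> i j. M i j) $ i $ p i)"
 by (simp only: vec_lambda_beta prod.distrib mult_1)
qed

lemma of_real_det: "complex_of_real (det (\<chi> i j. (M i j :: real)))=det (\<chi> i j :: 'n::finite. complex_of_real (M i j))"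
 by (simp add: Determinants.det_def)

lemma tendsto_det:
 fixes M :: "'b => 'n::finite => 'n => complex"
 assumes "\<And>i j. ((%r. M r i j) \<longlongrightarrow> L i j) F"
 shows "((%r. det (\<chi> i j. M r i j)) \<longlongrightarrow> det (\<chi> i j. L i j)) F"
 unfolding Determinants.det_def by (simp,intro tendsto_intros assms)

lemma integral_reflect_symmetric:
 fixes f :: "real => complex"
 shows "integral {- a..a} (%th. f (- th))=integral {- a..a} f"
 using Henstock_Kurzweil_Integration.integral_reflect_real[of a "- a" f] by simp

text \<open>On the circle of radius \<open>c\<close> the inversion \<open>w\<close> to
  \<open>c^2 / w\<close> is complex conjugation. It turns the integrand found in the limit into that
  of the beta kernel, up to a power of \<open>c^2\<close>.\<close>

lemma arc_reflect:
 assumes "0 < c"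
 shows "(of_real c * cis th) powi l * G (1-of_real c/cis th) =
 of_real (c\<^sup>2) powi l*(G (1-of_real c * cis (- th))*(of_real c * cis (- th)) powi (- l))"
proof -
 have e: "of_real c * cis th = of_real (c\<^sup>2) * inverse (of_real c * cis (- th))" using assms by (simp add: power2_eq_square)
 have "(of_real c * cis th) powi l = of_real (c\<^sup>2) powi l * inverse (of_real c * cis (- th)) powi l"
 unfolding e by (rule power_int_mult_distrib)
 also have "inverse (of_real c * cis (- th)) powi l=(of_real c * cis (- th)) powi (- l)" by (simp only: power_int_inverse power_int_minus)
 finally have "(of_real c * cis th) powi l = of_real (c\<^sup>2) powi l*(of_real c * cis (- th)) powi (- l)" .
 moreover have "of_real c/cis th = of_real c * cis (- th)" by (simp add: divide_inverse)
 ultimately show ?thesis by (simp only: mult_ac)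
qed

theorem theorem2:
  fixes t :: "real \<Rightarrow> 'n::finite \<Rightarrow> int" and h :: "real \<Rightarrow> 'n \<Rightarrow> real"
    and \<Delta>t :: "'n \<Rightarrow> 'n \<Rightarrow> int" and \<Delta>h :: "'n \<Rightarrow> 'n \<Rightarrow> real"
    and \<tau> chi :: real
  assumes "\<And>r i. r > 0 \<Longrightarrow> (t r i, h r i) \<in> tile_lattice"
    and "\<And>r. r > 0 \<Longrightarrow> inj (\<lambda>i. (t r i, h r i))"
    and "\<And>r i j. r > 0 \<Longrightarrow> t r i - t r j = \<Delta>t i j"
    and "\<And>r i j. r > 0 \<Longrightarrow> h r i - h r j = \<Delta>h i j"
    and "\<And>i. ((\<lambda>r. r * of_int (t r i)) \<longlongrightarrow> \<tau>) (at_right 0)"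
    and "\<And>i. ((\<lambda>r. r * h r i) \<longlongrightarrow> chi) (at_right 0)"
    and "\<tau> \<ge> 0"
  shows "((\<lambda>r. complex_of_real
              (pp_prob (exp (- r)) (\<lambda>p. range (\<lambda>i. (t r i, h r i)) \<subseteq> tile_centers p)))
          \<longlongrightarrow>
          det (\<chi> i j.
            let l = \<lfloor>\<Delta>h i j + of_int (\<Delta>t i j) / 2\<rfloor> in
            if \<Delta>t i j \<ge> 0 then beta_plus (\<Delta>t i j) l (z_star \<tau> chi)
            else beta_minus (\<Delta>t i j) l (z_star \<tau> chi))) (at_right 0)"
proof -
 note lat=assms(1) and injt=assms(2) and \<Delta>t=assms(3) and \<Delta>h=assms(4) and rt=assms(5) and rh=assms(6) and \<tau> = assms(7)
 have evp: "\<forall>\<^sub>F r :: real in at_right 0. r > 0" by (rule eventually_at_right_less)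
 define mu where "mu = chi + \<tau> / 2"
 define ths where "ths=star_angle \<tau> chi"
 define c where "c=exp (- \<tau> / 2)"
 define y where "y=(%r i. \<lfloor>h r i + of_int (t r i)/2+1/2\<rfloor>)"
 define l where "l=(%i j. \<lfloor>\<Delta>h i j + of_int (\<Delta>t i j)/2\<rfloor>)"
 \<comment> \<open>An arbitrary point that anchors all differences.\<close>
 define i0 where "i0=(undefined :: 'n)"
 define D where "D=nat (\<Sum>i\<in>UNIV. \<bar>\<Delta>t i i0\<bar>)"
 \<comment> \<open>This lies between \<open>t r i\<close> and \<open>t r i + 2 * D\<close> for every
   point \<open>i\<close>, so one base is balanced for all slices at once.\<close>
 define d where "d=(%r. t r i0+int D)"
 have y: "of_int (y r i)=h r i + of_int (t r i)/2+1/2" if "r > 0" for r i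
 proof -
 have "h r i + of_int (t r i)/2+1/2 \<in> \<int>" using lat[OF that,of i] by (simp add: tile_lattice_def)
 then obtain z where "h r i + of_int (t r i)/2+1/2 = of_int z" by (rule Ints_cases)
 thus ?thesis unfolding y_def by (simp only: floor_of_int)
 qed
 have l: "l i j=y r i-y r j" if "r > 0" for r i j
 proof -
 have "\<Delta>h i j + of_int (\<Delta>t i j)/2 = of_int (y r i-y r j)"
 unfolding \<Delta>h[OF that,symmetric] \<Delta>t[OF that,symmetric] of_int_diff y[OF that] by (simp add: field_simps)
 thus ?thesis unfolding l_def by (simp only: floor_of_int)
 qed
 have pos: "tile_pos (t r i) (h r i)=y r i+int (nat (- t r i))" if "r > 0" for r i
 proof -
 have "real_of_int (tile_pos (t r i) (h r i)) = of_int (y r i+int (nat (- t r i)))"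
 unfolding tile_pos[OF lat[OF that,of i]] of_int_add y[OF that] by (cases "0<=t r i") (auto simp: field_simps)
 thus ?thesis by (simp only: of_int_eq_iff)
 qed
 have dD: "t r i<=d r & d r<=t r i+int (2 * D)" if "r > 0" for r i
 proof -
 have "\<bar>\<Delta>t i i0\<bar> <= (\<Sum>i\<in>UNIV. \<bar>\<Delta>t i i0\<bar>)" by (rule member_le_sum) auto
 hence "\<bar>t r i-t r i0\<bar> <= int D" unfolding \<Delta>t[OF that] D_def by simp
 thus ?thesis unfolding d_def by linarith
 qed
 define m where "m=CARD('n)"
 obtain e where e: "bij_betw e {0..<m} (UNIV :: 'n set)" unfolding m_def using ex_bij_betw_nat_finite[of "UNIV :: 'n set"] by auto
 let ?P = "%r. pp_prob (exp (- r)) (%p. range (%i. (t r i,h r i)) \<subseteq> tile_centers p)"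
 let ?K = "%r A i j. box_kernel r (d r) A (t r i) (h r i) (t r j) (h r j)"
 \<comment> \<open>A diagonal choice: for each \<open>r\<close> the base is so large that the finite
   determinant is within \<open>r\<close> of the probability, while \<open>r * A\<close> is at least
   \<open>1/r\<close>, which extends the Riemann sums to infinity.\<close>
 have "\<exists>A. 1/r<=r * real A & \<bar>det (\<chi> i j. ?K r A i j) - ?P r\<bar> < r" if r: "r > 0" for r
 proof -
 have im: "(%u. (t r (e u),h r (e u))) ` {..<m}=range (%i. (t r i,h r i))"
 proof -
 have "(%u. (t r (e u),h r (e u))) ` {..<m}=(%i. (t r i,h r i)) ` (e ` {0..<m})" by (simp only: image_image lessThan_atLeast0)
 also have "e ` {0..<m}=UNIV" using e by (simp add: bij_betw_def)
 finally show ?thesis .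
 qed
 have inj: "inj_on (%u. (t r (e u),h r (e u))) {..<m}"
 proof -
 have "inj_on ((%i. (t r i,h r i)) \<circ> e) {..<m}"
 by (rule comp_inj_on) (use e injt[OF r] in \<open>auto simp: bij_betw_def lessThan_atLeast0 intro: inj_on_subset\<close>)
 thus ?thesis by (simp add: o_def)
 qed
 have dt: "detn m (%u v. ?K r A (e u) (e v))=det (\<chi> i j. ?K r A i j)" for A by (rule detn_eq_det[OF e])
 from pp_prob_limit[where t = "%u. t r (e u)" and h = "%u. h r (e u)" and d = "d r",OF r lat[OF r] inj]
 have "(%A. detn m (%u v. ?K r A (e u) (e v))) \<longlonglongrightarrow> ?P r" unfolding im .
 hence "(%A. det (\<chi> i j. ?K r A i j)) \<longlonglongrightarrow> ?P r" by (simp only: dt)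
 from tendstoD[OF this r] have 1: "\<forall>\<^sub>F A in sequentially. \<bar>det (\<chi> i j. ?K r A i j) - ?P r\<bar> < r" by (simp add: dist_real_def)
 have "filterlim (%A. r * real A) at_top sequentially"
 by (rule filterlim_tendsto_pos_mult_at_top[OF tendsto_const r filterlim_real_sequentially])
 hence 2: "\<forall>\<^sub>F A in sequentially. 1/r<=r * real A" by (simp add: filterlim_at_top)
 from eventually_happens'[OF sequentially_bot eventually_conj[OF 2 1]] show ?thesis by blast
 qed
 hence "\<forall>r. \<exists>A. r > 0 --> 1/r<=r * real A & \<bar>det (\<chi> i j. ?K r A i j) - ?P r\<bar> < r" by blast
 then obtain A where "\<forall>r. r > 0 --> 1/r<=r * real (A r) & \<bar>det (\<chi> i j. ?K r (A r) i j) - ?P r\<bar> < r" by (rule choice[THEN exE])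
 hence A: "1/r<=r * real (A r)" "\<bar>det (\<chi> i j. ?K r (A r) i j) - ?P r\<bar> < r" if "r > 0" for r using that by auto
 have rA: "filterlim (%r. r * real (A r)) at_top (at_right 0)"
 by (rule filterlim_at_top_mono[OF filterlim_inverse_at_top_right]) (rule eventually_mono[OF evp],simp only: inverse_eq_divide A(1))
 have ry: "((%r. r * of_int (y r i)) \<longlongrightarrow> mu) (at_right 0)" for i
 proof -
 have "((%r. r * h r i+r * of_int (t r i)/2+r*(1/2)) \<longlongrightarrow> chi + \<tau> / 2+0*(1/2)) (at_right 0)"
 by (intro tendsto_intros rh rt) simp
 hence "((%r. r * h r i+r * of_int (t r i)/2+r*(1/2)) \<longlongrightarrow> mu) (at_right 0)" by (simp add: mu_def)
 moreover have "\<forall>\<^sub>F r in at_right 0. r * h r i+r * of_int (t r i)/2+r*(1/2)=r * of_int (y r i)"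
 using evp by eventually_elim (simp add: y algebra_simps)
 ultimately show ?thesis by (rule Lim_transform_eventually)
 qed
 have ref: "reference A d (%r. t r i) (%r. y r i) \<tau> mu ths (2 * D)" for i
 proof (rule reference.intro[OF \<tau> rt ry rA dD])
 show "0<=ths" "ths<=pi" unfolding ths_def by (rule star_angle)+
 show "poisson_den (exp (- \<tau> / 2)) th < exp (- mu)" if "0 < th" "th < ths" for th
 using that unfolding ths_def mu_def by (rule star_angle_below)
 show "exp (- mu) < poisson_den (exp (- \<tau> / 2)) th" if "ths < th" "th<=pi" for th
 using that unfolding ths_def mu_def by (rule star_angle_above)
 qed
 interpret R: reference A d "%r. t r i" "%r. y r i" \<tau> mu ths "2 * D" for i by (rule ref)
 have cR: "R.c=c" unfolding R.c_def c_def ..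
 have c: "0 < c" "c<=1" using R.c01 unfolding cR by auto
 have ths: "0<=ths" "ths<=pi" unfolding ths_def by (rule star_angle)+
 have \<tau>0: "\<tau> = 0 ==> 0 < ths" using star_angle_0 by (auto simp: ths_def)
 have th0: "c < 1" if z: "ths=0"
 proof -
 have "\<tau> ~= 0" using \<tau>0 z by auto
 thus ?thesis using \<tau> by (simp add: c_def)
 qed
 define B where "B=(%i j. if \<Delta>t i j >= 0 then beta_plus (\<Delta>t i j) (l i j) (z_star \<tau> chi) else beta_minus (\<Delta>t i j) (l i j) (z_star \<tau> chi))"
 have zs: "z_star \<tau> chi = of_real c * cis ths" unfolding c_def ths_def by (rule z_star_eq[OF \<tau>])
 \<comment> \<open>The reference slice is the earlier of the two, that of \<open>j\<close> in the
   first case and that of \<open>i\<close> in the second.\<close>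
 have entry: "((%r. gam r (t r j)/gam r (t r i) * of_real (?K r (A r) i j)) \<longlongrightarrow> of_real (c\<^sup>2) powi l i j * B i j) (at_right 0)" for i j
 proof (cases "\<Delta>t i j >= 0")
 case True
 define k where "k=nat (\<Delta>t i j)"
 have k: "\<Delta>t i j=int k" using True by (simp add: k_def)
 have "1/(2 * pi) * integral {- ths..ths} (%th. (of_real c * cis th) powi l i j*(1-of_real c/cis th)^k) = of_real (c\<^sup>2) powi l i j * B i j"
 proof -
 have "integral {- ths..ths} (%th. (of_real c * cis th) powi l i j*(1-of_real c/cis th)^k) =
 integral {- ths..ths} (%th. of_real (c\<^sup>2) powi l i j*((1-of_real c * cis (- th))^k*(of_real c * cis (- th)) powi (- l i j)))"
 by (simp only: arc_reflect[OF c(1),where G = "%z. z^k"])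
 also have "... = of_real (c\<^sup>2) powi l i j * integral {- ths..ths} (%th. (1-of_real c * cis (- th))^k*(of_real c * cis (- th)) powi (- l i j))"
 by (rule integral_mult_right)
 also have "integral {- ths..ths} (%th. (1-of_real c * cis (- th))^k*(of_real c * cis (- th)) powi (- l i j)) =
 integral {- ths..ths} (%th. (1-of_real c * cis th)^k*(of_real c * cis th) powi (- l i j))"
 by (rule integral_reflect_symmetric)
 finally show ?thesis unfolding B_def zs k using beta_plus_arc[OF c ths th0,of k "l i j"] by (simp add: mult.left_commute)
 qed
 with R.plus_limit[of j k "l i j",unfolded cR]
 have "((%r. of_real (\<Sum>\<^sub>\<infinity>n\<in>{..0}. coef_inv r (A r) (d r) (t r j+int k) (y r j+l i j+int (nat (- (t r j+int k)))) n *
 coef_sym r (A r) (d r) (t r j) (R.x j r) (- n)) * gam r (t r j)/gam r (t r j+int k)) \<longlongrightarrow> of_real (c\<^sup>2) powi l i j * B i j) (at_right 0)"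
 by (simp only:)
 thus ?thesis
 proof (rule Lim_transform_eventually)
 show "\<forall>\<^sub>F r in at_right 0. of_real (\<Sum>\<^sub>\<infinity>n\<in>{..0}. coef_inv r (A r) (d r) (t r j+int k) (y r j+l i j+int (nat (- (t r j+int k)))) n *
 coef_sym r (A r) (d r) (t r j) (R.x j r) (- n)) * gam r (t r j)/gam r (t r j+int k)=gam r (t r j)/gam r (t r i) * of_real (?K r (A r) i j)"
 using R.good_ev[of i 0] R.good_ev[of j 0]
 proof eventually_elim
 case (elim r)
 have r: "r > 0" and s: "- int (A r)<=t r i" "- int (A r)<=t r j" using elim by (auto simp: R.good_def)
 have ti: "t r j+int k=t r i" using \<Delta>t[OF r,of i j] k by simp
 have yi: "y r j+l i j=y r i" using l[OF r,of i j] by simp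
 have "t r j<=t r i" using ti by simp
 hence "?K r (A r) i j=(\<Sum>\<^sub>\<infinity>n\<in>{..0}. coef_inv r (A r) (d r) (t r i) (y r i+int (nat (- t r i))) n * coef_sym r (A r) (d r) (t r j) (R.x j r) (- n))"
 unfolding box_kernel_coef[OF s] R.x_def pos[OF r] by simp
 thus ?case unfolding ti yi by (simp only: divide_inverse mult_ac)
 qed
 qed
 next
 case False
 define k where "k=nat (- \<Delta>t i j)"
 have k: "\<Delta>t i j = - int k" using False by (simp add: k_def)
 let ?F = "%th. inverse ((1-of_real c * cis th)^k)*(of_real c * cis th) powi (- l i j)"
 let ?G = "%th. (of_real c * cis th) powi l i j * inverse ((1-of_real c/cis th)^k)"
 have "- (1/(2 * pi)*(integral (side False ths pi) ?G+integral (side True ths pi) ?G)) = of_real (c\<^sup>2) powi l i j * B i j"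
 proof -
 have G: "integral {a..b} ?G = of_real (c\<^sup>2) powi l i j * integral {- b..- a} ?F" for a b
 proof -
 have "integral {a..b} ?G=integral {a..b} (%th. of_real (c\<^sup>2) powi l i j * ?F (- th))"
 by (simp only: arc_reflect[OF c(1),where G = "%z. inverse (z^k)"])
 also have "... = of_real (c\<^sup>2) powi l i j * integral {a..b} (%th. ?F (- th))" by (rule integral_mult_right)
 also have "integral {a..b} (%th. ?F (- th))=integral {- b..- a} ?F"
 using Henstock_Kurzweil_Integration.integral_reflect_real[of "- a" "- b" ?F] by simp
 finally show ?thesis .
 qed
 have "integral (side False ths pi) ?G+integral (side True ths pi) ?G = of_real (c\<^sup>2) powi l i j*(integral {- pi..- ths} ?F+integral {ths..pi} ?F)"
 unfolding side_lo_def side_hi_def if_True if_False G by (simp add: distrib_left add.commute)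
 thus ?thesis unfolding B_def zs using beta_minus_arc[OF c ths th0,of k "l i j"] False by (simp add: k mult.left_commute)
 qed
 with tendsto_minus[OF R.minus_limit[OF \<tau>0,where i=i and l = "l i j" and k=k,unfolded cR]]
 have "((%r. - (of_real (\<Sum>\<^sub>\<infinity>n\<in>{0<..}. coef_inv r (A r) (d r) (t r i) (R.x i r) n *
 coef_sym r (A r) (d r) (t r i+int k) (y r i-l i j+int (nat (- (t r i+int k)))) (- n)) * gam r (t r i+int k)/gam r (t r i))) \<longlongrightarrow> of_real (c\<^sup>2) powi l i j * B i j) (at_right 0)"
 by (simp only:)
 thus ?thesis
 proof (rule Lim_transform_eventually)
 show "\<forall>\<^sub>F r in at_right 0. - (of_real (\<Sum>\<^sub>\<infinity>n\<in>{0<..}. coef_inv r (A r) (d r) (t r i) (R.x i r) n *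
 coef_sym r (A r) (d r) (t r i+int k) (y r i-l i j+int (nat (- (t r i+int k)))) (- n)) * gam r (t r i+int k)/gam r (t r i))=gam r (t r j)/gam r (t r i) * of_real (?K r (A r) i j)"
 using R.good_ev[of i 0] R.good_ev[of j 0]
 proof eventually_elim
 case (elim r)
 have r: "r > 0" and s: "- int (A r)<=t r i" "- int (A r)<=t r j" using elim by (auto simp: R.good_def)
 have tj: "t r i+int k=t r j" using \<Delta>t[OF r,of i j] k by simp
 have yj: "y r i-l i j=y r j" using l[OF r,of i j] by simp
 have "~ t r j<=t r i" using \<Delta>t[OF r,of i j] False by simp
 hence "?K r (A r) i j = - (\<Sum>\<^sub>\<infinity>n\<in>{0<..}. coef_inv r (A r) (d r) (t r i) (R.x i r) n * coef_sym r (A r) (d r) (t r j) (y r j+int (nat (- t r j))) (- n))"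
 unfolding box_kernel_coef[OF s] R.x_def pos[OF r] by simp
 thus ?case unfolding tj yj by (simp only: of_real_minus divide_inverse mult_minus_right mult_ac)
 qed
 qed
 qed
 have "((%r. det (\<chi> i j. gam r (t r j)/gam r (t r i) * complex_of_real (?K r (A r) i j))) \<longlongrightarrow> det (\<chi> i j. of_real (c\<^sup>2) powi l i j * B i j)) (at_right 0)"
 by (rule tendsto_det[OF entry])
 moreover have "det (\<chi> i j. gam r (t r j)/gam r (t r i) * complex_of_real (?K r (A r) i j))=complex_of_real (det (\<chi> i j. ?K r (A r) i j))" for r
 proof -
 have "inverse (gam r (t r i))/inverse (gam r (t r j))=gam r (t r j)/gam r (t r i)" for i j by (simp add: divide_inverse)
 thus ?thesis
 using det_gauge[of "%i. inverse (gam r (t r i))" "%i j. complex_of_real (?K r (A r) i j)"] gam_nz[of r] by (simp add: of_real_det)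
 qed
 moreover have "det (\<chi> i j. of_real (c\<^sup>2) powi l i j * B i j)=det (\<chi> i j. B i j)"
 proof -
 \<comment> \<open>\<open>l i j\<close> is a difference of integers attached to \<open>i\<close> and
   to \<open>j\<close>, so the powers of \<open>c^2\<close> form another gauge.\<close>
 have q: "of_real (c\<^sup>2) powi l i j = of_real (c\<^sup>2) powi l i i0/complex_of_real (c\<^sup>2) powi l j i0" for i j
 proof -
 have "l i j=l i i0-l j i0" using l[of 1] by simp
 thus ?thesis using c by (simp only: power_int_diff) (simp add: power_int_diff)
 qed
 let ?g = "%i. complex_of_real (c\<^sup>2) powi l i i0"
 have "(%i j. of_real (c\<^sup>2) powi l i j * B i j)=(%i j. ?g i / ?g j * B i j)"
 by (intro ext arg_cong2[where f = "(*)"] q refl)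
 hence "det (\<chi> i j. of_real (c\<^sup>2) powi l i j * B i j)=det (\<chi> i j. ?g i / ?g j * B i j)"
 by (rule arg_cong[of _ _ "%M. det (\<chi> i j. M i j)"])
 also have "... = det (\<chi> i j. B i j)" by (rule det_gauge) (use c in simp)
 finally show ?thesis .
 qed
 ultimately have "((%r. complex_of_real (det (\<chi> i j. ?K r (A r) i j))) \<longlongrightarrow> det (\<chi> i j. B i j)) (at_right 0)" by (simp only:)
 moreover have "((%r. complex_of_real (?P r-det (\<chi> i j. ?K r (A r) i j))) \<longlongrightarrow> 0) (at_right 0)"
 proof (rule Lim_null_comparison)
 show "\<forall>\<^sub>F r in at_right 0. norm (complex_of_real (?P r-det (\<chi> i j. ?K r (A r) i j)))<=r"
 using evp
 proof eventually_elim
 case (elim r)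
 show ?case using A(2)[OF elim] unfolding norm_of_real by linarith
 qed
 show "((%r. r) \<longlongrightarrow> 0) (at_right (0 :: real))" by (rule tendsto_ident_at)
 qed
 ultimately have "((%r. complex_of_real (det (\<chi> i j. ?K r (A r) i j))+complex_of_real (?P r-det (\<chi> i j. ?K r (A r) i j))) \<longlongrightarrow> det (\<chi> i j. B i j)+0) (at_right 0)"
 by (rule tendsto_add)
 hence "((%r. complex_of_real (?P r)) \<longlongrightarrow> det (\<chi> i j. B i j)) (at_right 0)" by simp
 thus ?thesis unfolding B_def l_def Let_def .
qed

end
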